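(* Let $Z\subseteq\mathbb{P}^2\times\mathbb{A}^1$ be a family of plane cubics with smooth total space, whose fibres $Z_t$ are smooth for $t\neq0$ and whose central fibre is the toric boundary $\Delta=D_0\cup D_1\cup D_2$. Let $E$ denote the general fibre. Of the $234$ embedded integral rational cubics maximally tangent to $E$ at a single point, as $E$ degenerates to $\Delta$ exactly $27$ have limiting multi-degree $(1,1,1)$, exactly $162$ have limiting multi-degree $(2,1,0)$, and exactly $45$ have limiting multi-degree $(3,0,0)$.
   Context: Work over an algebraically closed field of characteristic zero. "General fibre" may be taken to be the geometric generic fibre of $Z\to\mathbb{A}^1$. An embedded integral rational cubic maximally tangent to $E$ is an integral rational plane cubic $C\neq E$ such that the preimage of $E$ under the normalisation map $\mathbb{P}^1\to C\subseteq\mathbb{P}^2$ is a single point (so with contact order $9$). The contact point is a $9$-torsion point of $(E,p_0)$, where $p_0\in E$ is a fixed flex point; each of the $9$ points which are $3$-torsion supports $2$ such cubics and each of the remaining $72$ supports $3$, for a total of $234$. An embedded tangent curve to $E$ degenerates uniquely along with the cubic; its limit over $t=0$ is contained in $\Delta$ and, as a cycle, equals $d_0D_0+d_1D_1+d_2D_2$; the triple $(d_0,d_1,d_2)$ up to reordering is the limiting multi-degree. *)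

theory Defs
  imports
    "HOL-Computational_Algebra.Computational_Algebra"
    "HOL-Algebra.Algebraic_Closure_Type"
begin

section \<open>Forms in three variables\<close>

text \<open>
  A polynomial in \<open>x, y, z\<close> over \<open>'a\<close> is an element of \<^typ>\<open>'a poly poly poly\<close>; the variable
  of the outermost \<open>poly\<close> is \<open>x\<close>, that of the innermost one is \<open>z\<close>.
\<close>

definition var_x :: "'a::comm_ring_1 poly poly poly" where "var_x = [:0, 1:]"
definition var_y :: "'a::comm_ring_1 poly poly poly" where "var_y = [:[:0, 1:]:]"
definition var_z :: "'a::comm_ring_1 poly poly poly" where "var_z = [:[:[:0, 1:]:]:]"

definition coeff3 :: "'a::zero poly poly poly \<Rightarrow> nat \<Rightarrow> nat \<Rightarrow> nat \<Rightarrow> 'a" where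
  "coeff3 G i j k = coeff (coeff (coeff G i) j) k"

definition eval3 :: "'a::comm_ring_1 poly poly poly \<Rightarrow> 'a \<times> 'a \<times> 'a \<Rightarrow> 'a" where
  "eval3 G = (\<lambda>(x, y, z). poly (poly (poly G [:[:x:]:]) [:y:]) z)"

definition form3 :: "nat \<Rightarrow> 'a::zero poly poly poly \<Rightarrow> bool" where
  "form3 d G \<longleftrightarrow> (\<forall>i j k. coeff3 G i j k \<noteq> 0 \<longrightarrow> i + j + k = d)"

abbreviation map3 :: "('a::zero \<Rightarrow> 'b::zero) \<Rightarrow> 'a poly poly poly \<Rightarrow> 'b poly poly poly" where
  "map3 h \<equiv> map_poly (map_poly (map_poly h))"

definition diff_x :: "'a::idom poly poly poly \<Rightarrow> 'a poly poly poly" where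
  "diff_x = pderiv"
definition diff_y :: "'a::idom poly poly poly \<Rightarrow> 'a poly poly poly" where
  "diff_y = map_poly pderiv"
definition diff_z :: "'a::idom poly poly poly \<Rightarrow> 'a poly poly poly" where
  "diff_z = map_poly (map_poly pderiv)"

section \<open>Plane curves\<close>

text \<open>
  Points of the projective plane (line) are represented by their nonzero vectors of homogeneous
  coordinates.  A plane curve (effective divisor) is the class of a nonzero form up to nonzero
  scalars, so equality of curves includes multiplicities: the divisor of
  \<open>x\<^sup>a y\<^sup>b z\<^sup>c\<close> is the cycle \<open>a D\<^sub>0 + b D\<^sub>1 + c D\<^sub>2\<close>, where the \<open>D\<^sub>i\<close> are the coordinate lines.
\<close>

definition curve :: "'a::field poly poly poly \<Rightarrow> 'a poly poly poly set" where
  "curve G = {smult [:[:c:]:] G | c. c \<noteq> 0}"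

definition toric_cycle :: "nat \<Rightarrow> nat \<Rightarrow> nat \<Rightarrow> 'a::field poly poly poly set" where
  "toric_cycle a b c = curve (var_x ^ a * var_y ^ b * var_z ^ c)"

definition singular_at :: "'a::field poly poly poly \<Rightarrow> 'a \<times> 'a \<times> 'a \<Rightarrow> bool" where
  "singular_at G v \<longleftrightarrow> eval3 G v = 0 \<and>
     eval3 (diff_x G) v = 0 \<and> eval3 (diff_y G) v = 0 \<and> eval3 (diff_z G) v = 0"

definition smooth_curve :: "'a::field poly poly poly \<Rightarrow> bool" where
  "smooth_curve G \<longleftrightarrow> (\<forall>v. v \<noteq> (0, 0, 0) \<longrightarrow> \<not> singular_at G v)"

section \<open>Maximally tangent rational cubics\<close>

text \<open>Polynomials in two variables \<open>s, u\<close>; the variable of the outer \<open>poly\<close> is \<open>s\<close>.\<close>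

definition eval2 :: "'a::comm_ring_1 poly poly \<Rightarrow> 'a \<times> 'a \<Rightarrow> 'a" where
  "eval2 f = (\<lambda>(s, u). poly (poly f [:s:]) u)"

definition form2 :: "nat \<Rightarrow> 'a::zero poly poly \<Rightarrow> bool" where
  "form2 d f \<longleftrightarrow> (\<forall>i j. coeff (coeff f i) j \<noteq> 0 \<longrightarrow> i + j = d)"

type_synonym 'a param = "'a poly poly \<times> 'a poly poly \<times> 'a poly poly"

definition eval_param :: "'a::comm_ring_1 param \<Rightarrow> 'a \<times> 'a \<Rightarrow> 'a \<times> 'a \<times> 'a" where
  "eval_param = (\<lambda>(f, g, h) p. (eval2 f p, eval2 g p, eval2 h p))"

definition line_to_plane :: "'a::field param \<Rightarrow> bool" where
  "line_to_plane = (\<lambda>(f, g, h). \<exists>n. form2 n f \<and> form2 n g \<and> form2 n h \<and>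
     (\<forall>p. p \<noteq> (0, 0) \<longrightarrow> eval_param (f, g, h) p \<noteq> (0, 0, 0)))"

definition image_is :: "'a::field param \<Rightarrow> 'a poly poly poly \<Rightarrow> bool" where
  "image_is \<phi> G \<longleftrightarrow> (\<forall>v. v \<noteq> (0, 0, 0) \<longrightarrow>
     (eval3 G v = 0 \<longleftrightarrow>
        (\<exists>p c. p \<noteq> (0, 0) \<and> c \<noteq> 0 \<and>
           v = (case eval_param \<phi> p of (x, y, z) \<Rightarrow> (c * x, c * y, c * z)))))"

text \<open>
  A morphism from the projective line is birational onto its image iff it has a rational inverse
  \<open>(a : b)\<close>, given by two forms of the same degree that do not both vanish on the image.
\<close>

definition birational_onto_image :: "'a::field param \<Rightarrow> bool" where
  "birational_onto_image \<phi> \<longleftrightarrow> (\<exists>m a b. form3 m a \<and> form3 m b \<and>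
     (\<exists>p. eval3 a (eval_param \<phi> p) \<noteq> 0 \<or> eval3 b (eval_param \<phi> p) \<noteq> 0) \<and>
     (\<forall>s u. s * eval3 b (eval_param \<phi> (s, u)) = u * eval3 a (eval_param \<phi> (s, u))))"

text \<open>
  The normalisation of an integral curve is its finite birational cover by a normal curve.  A
  morphism from the projective line onto a curve is automatically finite.
\<close>

definition normalisation :: "'a::field param \<Rightarrow> 'a poly poly poly \<Rightarrow> bool" where
  "normalisation \<phi> G \<longleftrightarrow> line_to_plane \<phi> \<and> image_is \<phi> G \<and> birational_onto_image \<phi>"

definition preimage_single_point :: "'a::field param \<Rightarrow> 'a poly poly poly \<Rightarrow> bool" where
  "preimage_single_point \<phi> E \<longleftrightarrow> (\<exists>s\<^sub>0 u\<^sub>0. (s\<^sub>0, u\<^sub>0) \<noteq> (0, 0) \<and>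
     (\<forall>s u. (s, u) \<noteq> (0, 0) \<longrightarrow>
        (eval3 E (eval_param \<phi> (s, u)) = 0 \<longleftrightarrow> (\<exists>c. c \<noteq> 0 \<and> (s, u) = (c * s\<^sub>0, c * u\<^sub>0)))))"

text \<open>The base field is meant to be algebraically closed, so \<^const>\<open>irreducible\<close> forms define
  the integral curves.\<close>

definition max_tangent_cubics :: "'a::alg_closed_field poly poly poly \<Rightarrow> 'a poly poly poly set set"
  where
  "max_tangent_cubics E = {curve G | G. form3 3 G \<and> irreducible G \<and> curve G \<noteq> curve E \<and>
     (\<exists>\<phi>. normalisation \<phi> G \<and> preimage_single_point \<phi> E)}"

section \<open>Families of plane cubics over the affine line\<close>

text \<open>
  A family is given by a form in \<open>x, y, z\<close> with coefficients in \<open>k[t]\<close>, that is, an element of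
  \<^typ>\<open>'k poly poly poly poly\<close> whose innermost variable is \<open>t\<close>.
\<close>

definition fibre :: "'k::field poly poly poly poly \<Rightarrow> 'k \<Rightarrow> 'k poly poly poly" where
  "fibre F s = map3 (\<lambda>p. poly p s) F"

definition diff_t :: "'k::field poly poly poly poly \<Rightarrow> 'k poly poly poly poly" where
  "diff_t F = map3 pderiv F"

text \<open>Jacobian criterion for the part of the total space that lies over \<open>U\<close>.\<close>

definition smooth_total_space :: "'k::field poly poly poly poly \<Rightarrow> 'k set \<Rightarrow> bool" where
  "smooth_total_space F U \<longleftrightarrow> (\<forall>s\<in>U. \<forall>v. v \<noteq> (0, 0, 0) \<longrightarrow>
     \<not> (singular_at (fibre F s) v \<and> eval3 (fibre (diff_t F) s) v = 0))"

text \<open>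
  The base is an open neighbourhood \<open>U\<close> of \<open>0\<close> in the affine line, \<^term>\<open>UNIV\<close> being one
  possibility.  The restriction to a neighbourhood is essential: no family with singular fibre
  the triangle over \<open>0\<close> and smooth total space has smooth fibres over all of \<open>t \<noteq> 0\<close>,
  because its discriminant would be \<open>c t\<^sup>3\<close> and Mason-Stothers excludes
  \<open>c\<^sub>4\<^sup>3 - c\<^sub>6\<^sup>2 = c t\<^sup>3\<close> with \<open>c\<^sub>4, c\<^sub>6\<close> coprime.
\<close>

definition toric_degeneration :: "'k::field poly poly poly poly \<Rightarrow> 'k set \<Rightarrow> bool" where
  "toric_degeneration F U \<longleftrightarrow> form3 3 F \<and> finite (- U) \<and> 0 \<in> U \<and>
     (\<forall>s\<in>U. s \<noteq> 0 \<longrightarrow> smooth_curve (fibre F s)) \<and>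
     smooth_total_space F U \<and>
     curve (fibre F 0) = toric_cycle 1 1 1"

section \<open>Geometric generic fibre and limits over t = 0\<close>

type_synonym 'k geom = "'k poly fract alg_closure"

definition embed :: "'k::field poly \<Rightarrow> 'k geom" where
  "embed p = to_ac (Fract p 1)"

definition generic_fibre :: "'k::field poly poly poly poly \<Rightarrow> 'k geom poly poly poly" where
  "generic_fibre F = map3 embed F"

text \<open>
  To take limits over \<open>t = 0\<close> of curves defined over finite extensions of \<open>k(t)\<close> one has to choose,
  compatibly, a point over \<open>0\<close> on each finite cover of the affine line; this amounts to a valuation
  ring \<open>V\<close> of the algebraic closure of \<open>k(t)\<close> that dominates the local ring at \<open>0\<close>.  The map
  \<open>\<rho> : V \<rightarrow> k\<close> is the residue map, i.e. the value at the chosen points (its values outside \<open>V\<close>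
  are irrelevant).
\<close>

definition place_over_0 :: "'k::field geom set \<Rightarrow> ('k geom \<Rightarrow> 'k) \<Rightarrow> bool" where
  "place_over_0 V \<rho> \<longleftrightarrow>
     (\<forall>a\<in>V. \<forall>b\<in>V. a - b \<in> V \<and> a * b \<in> V) \<and>
     (\<forall>a. a \<in> V \<or> inverse a \<in> V) \<and>
     (\<forall>a\<in>V. \<forall>b\<in>V. \<rho> (a + b) = \<rho> a + \<rho> b \<and> \<rho> (a * b) = \<rho> a * \<rho> b) \<and>
     (\<forall>p. embed p \<in> V \<and> \<rho> (embed p) = poly p 0)"

text \<open>The flat limit of a plane curve: normalise its equation so that it has coefficients in \<open>V\<close>
  and nonzero reduction, and reduce.\<close>

definition limit_curve ::
  "'k::field geom set \<Rightarrow> ('k geom \<Rightarrow> 'k) \<Rightarrow> 'k geom poly poly poly set \<Rightarrow> 'k poly poly poly set \<Rightarrow> bool"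
  where
  "limit_curve V \<rho> C C\<^sub>0 \<longleftrightarrow>
     (\<exists>G\<in>C. (\<forall>i j k. coeff3 G i j k \<in> V) \<and> map3 \<rho> G \<noteq> 0 \<and> C\<^sub>0 = curve (map3 \<rho> G))"

text \<open>A multi-degree up to reordering is a multiset.\<close>

definition limiting_multidegree ::
  "'k::field geom set \<Rightarrow> ('k geom \<Rightarrow> 'k) \<Rightarrow> 'k geom poly poly poly set \<Rightarrow> nat multiset \<Rightarrow> bool"
  where
  "limiting_multidegree V \<rho> C M \<longleftrightarrow>
     (\<exists>d\<^sub>0 d\<^sub>1 d\<^sub>2. limit_curve V \<rho> C (toric_cycle d\<^sub>0 d\<^sub>1 d\<^sub>2) \<and> M = {#d\<^sub>0, d\<^sub>1, d\<^sub>2#})"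

end

theory Submission
  imports Defs
begin

text \<open>
  A smooth cubic in Hesse form \<open>s (x\<^sup>3 + y\<^sup>3 + z\<^sup>3) + x y z = 0\<close> has nine flexes, each of which supports
  two maximally tangent rational cubics, and 72 further contact points, which are grouped by the
  translations of order three into eight classes of nine and support three cubics each.  Up to
  linear changes of coordinates these cubics are explicit combinations of the equation of the
  elliptic curve and one other form, so that for \<open>s\<close> in the maximal ideal of the place one can read
  off their limits: \<open>(1,1,1)\<close> and \<open>(3,0,0)\<close> at a flex; once \<open>(1,1,1)\<close> and twice \<open>(3,0,0)\<close> on the two
  classes that belong to the diagonal translations; and three times \<open>(2,1,0)\<close> on the other six.

  The general fibre \<open>F\<close> is brought to this form by a substitution that is integral at the place and
  monomial modulo its maximal ideal.  Smoothness of the total space forces every flex tangent of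
  \<open>F\<close> to reduce to a side of the triangle and the flexes on one side to have distinct reductions,
  which are determined by cube roots; so there are exactly three on each side.  A Hesse form of \<open>F\<close>
  in which the line \<open>x = 0\<close> contains two flexes of one side then has \<open>x\<close>, \<open>y\<close> and \<open>z\<close> reducing to
  the three sides.
\<close>

text \<open>The group law enters only through tangents. With a flex as origin the tangent at
  \<open>p\<close> meets the curve again in -2p, so three successive tangents leading from
  \<open>p\<close> back to \<open>p\<close> express -8p = p. This closing-up is read off from the
  coefficients of a parametrised contact of order nine, and on the Hesse pencil its equation factors
  into eight classes, one for each nonzero value of 3p. The three points of such a chain, taken as
  vertices of the coordinate triangle, give the form x^2 y + y^2 z + z^2 x + al x y z, for which the
  tangent cubics can be solved explicitly. The tangent cubics at a point lie in the pencil of cubics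
  with contact nine there. It is spanned by the curve and the cube of the tangent at a flex,
  otherwise by the curve and the member singular at the point. The limit depends on which spanning
  form dominates at the place. The obstacle for a general family is that a Hesse form exists over
  the algebraic closure, but its coordinates need not be integral at the place; the reductions of
  the flexes control them.\<close>

instance fract :: ("{idom,ring_char_0}") field_char_0
proof
  show "inj (of_nat :: nat \<Rightarrow> 'a fract)"
    by (rule injI) (simp add: of_nat_fract eq_fract)
qed

section \<open>Algebra of ternary forms, linear substitutions and cubics on lines\<close>

section \<open>Evaluation and substitution\<close>

definition const3 :: "'a::zero \<Rightarrow> 'a poly poly poly" where
  "const3 c = [:[:[:c:]:]:]"

lemma const3_simps [simp]:
  fixes c d :: "'a::comm_ring_1"
  shows const3_0: "const3 (0 :: 'a) = 0" and const3_1: "const3 (1 :: 'a) = 1"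
  by (simp_all add: const3_def one_pCons)

lemma const3_add: "const3 (c + d) = const3 c + const3 d"
  and const3_mult: "const3 (c * d) = const3 c * const3 (d :: 'a::comm_ring_1)"
  by (simp_all add: const3_def)

lemma const3_eq_0 [simp]: "const3 c = 0 \<longleftrightarrow> c = 0"
  by (simp add: const3_def)

text \<open>The coefficient map \<open>h\<close> is left free: the identity gives values,
  \<open>const3\<close> substitutes forms into a form, and the embedding of constants into
  polynomials pulls a form back along a curve with one parameter.\<close>

definition ev3 :: "('a \<Rightarrow> 'b::comm_ring_1) \<Rightarrow> 'a::zero poly poly poly \<Rightarrow> 'b \<Rightarrow> 'b \<Rightarrow> 'b \<Rightarrow> 'b" where
  "ev3 h G p q r = (\<Sum>i\<le>degree G. \<Sum>j\<le>degree (coeff G i). \<Sum>k\<le>degree (coeff (coeff G i) j).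
     h (coeff3 G i j k) * p ^ i * q ^ j * r ^ k)"

lemma eval3_add [simp]: "eval3 (A + B) v = eval3 A v + eval3 B v"
  and eval3_diff [simp]: "eval3 (A - B) v = eval3 A v - eval3 B v"
  and eval3_uminus [simp]: "eval3 (- A) v = - eval3 A v"
  and eval3_mult [simp]: "eval3 (A * B) v = eval3 A v * eval3 B v"
  and eval3_0 [simp]: "eval3 0 v = 0"
  and eval3_1 [simp]: "eval3 1 v = 1"
  and eval3_const3 [simp]: "eval3 (const3 c) v = c"
  and eval3_power [simp]: "eval3 (A ^ n) v = eval3 A v ^ n"
  by (cases v; simp add: eval3_def const3_def)+

lemma eval3_var [simp]:
  "eval3 var_x (x, y, z) = x" "eval3 var_y (x, y, z) = y" "eval3 var_z (x, y, z) = z"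
  by (simp_all add: eval3_def var_x_def var_y_def var_z_def)

lemma eval3_sum [simp]: "eval3 (sum f A) v = (\<Sum>a\<in>A. eval3 (f a) v)"
  by (induction A rule: infinite_finite_induct) auto

lemma eval3_eq_ev3: "eval3 G (x, y, z) = ev3 (\<lambda>c. c) G x y z"
proof -
  have "poly G [:[:x:]:] = (\<Sum>i\<le>degree G. coeff G i * [:[:x ^ i:]:])"
    by (simp add: poly_altdef poly_const_pow)
  then have "eval3 G (x, y, z) = (\<Sum>i\<le>degree G. poly (poly (coeff G i) [:y:]) z * x ^ i)"
    by (simp add: eval3_def poly_sum mult_ac)
  also have "\<dots> = (\<Sum>i\<le>degree G. (\<Sum>j\<le>degree (coeff G i). poly (coeff (coeff G i) j) z * y ^ j) * x ^ i)"
    by (simp add: poly_altdef[of "coeff G _"] poly_sum poly_const_pow mult.commute[of "poly _ z"])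
  also have "\<dots> = ev3 (\<lambda>c. c) G x y z"
    by (simp add: ev3_def poly_altdef[of "coeff (coeff G _) _"] coeff3_def sum_distrib_left sum_distrib_right mult_ac)
  finally show ?thesis .
qed

lemma eval3_comp:
  "eval3 (ev3 const3 G p q r) v = eval3 G (eval3 p v, eval3 q v, eval3 r v)"
  by (simp add: eval3_eq_ev3 ev3_def)

lemma poly_comp: "poly (ev3 (\<lambda>c. [:c:]) G p q r) t = eval3 G (poly p t, poly q t, poly r t)"
  by (simp add: eval3_eq_ev3 ev3_def poly_sum mult_ac)

text \<open>Characteristic zero supplies infinitely many constants inside the coefficient domain
  \<open>'a poly\<close>, while a nonzero polynomial over a domain has finitely many roots.\<close>

lemma poly_const_all_0:
  fixes P :: "'a::{idom,ring_char_0} poly poly"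
  assumes "\<And>y. poly P [:y:] = 0" shows "P = 0"
proof (rule ccontr)
  assume "P \<noteq> 0"
  then have "finite {y. poly P y = 0}" by (rule poly_roots_finite)
  moreover have "range (\<lambda>y. [:y:]) \<subseteq> {y. poly P y = 0}" using assms by auto
  ultimately have "finite (range (\<lambda>y::'a. [:y:]))" by (rule finite_subset[rotated])
  moreover have "inj (\<lambda>y::'a. [:y:])" by (auto intro: injI)
  ultimately show False using finite_imageD infinite_UNIV_char_0 by blast
qed

lemma eval3_all_0:
  fixes G :: "'a::{idom,ring_char_0} poly poly poly"
  assumes "\<And>v. eval3 G v = 0" shows "G = 0"
proof -
  have 1: "poly (poly G [:[:x:]:]) [:y:] = 0" for x y
  proof -
    have "poly (poly (poly G [:[:x:]:]) [:y:]) z = 0" for z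
      using assms[of "(x, y, z)"] by (simp add: eval3_def)
    then show ?thesis using poly_all_0_iff_0 by blast
  qed
  have 2: "poly G [:[:x:]:] = 0" for x using 1 poly_const_all_0 by blast
  show ?thesis
  proof (rule ccontr)
    assume "G \<noteq> 0"
    then have "finite {y. poly G y = 0}" by (rule poly_roots_finite)
    moreover have "range (\<lambda>y. [:[:y:]:]) \<subseteq> {y. poly G y = 0}" using 2 by auto
    ultimately have "finite (range (\<lambda>y::'a. [:[:y:]:]))" by (rule finite_subset[rotated])
    moreover have "inj (\<lambda>y::'a. [:[:y:]:])" by (auto intro: injI)
    ultimately show False using finite_imageD infinite_UNIV_char_0 by blast
  qed
qed

text \<open>Identities between forms are proved on values throughout: there substitution is function
  application, and the claim becomes a polynomial identity between ring elements.\<close>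

lemma eval3_eqI:
  fixes G :: "'a::{idom,ring_char_0} poly poly poly"
  assumes "\<And>x y z. eval3 G (x, y, z) = eval3 H (x, y, z)" shows "G = H"
proof -
  have "eval3 (G - H) v = 0" for v by (cases v) (simp add: assms)
  then show ?thesis using eval3_all_0 by fastforce
qed

lemma coeff3_eqI: "(\<And>i j k. coeff3 A i j k = coeff3 B i j k) \<Longrightarrow> A = B"
  by (simp add: coeff3_def poly_eq_iff)

lemma coeff3_add [simp]: "coeff3 (A + B) i j k = coeff3 A i j k + coeff3 B i j k"
  and coeff3_0 [simp]: "coeff3 0 i j k = 0"
  by (simp_all add: coeff3_def)

lemma form3_0 [simp]: "form3 d 0" by (simp add: form3_def)

lemma form3_add [simp]: "form3 d A \<Longrightarrow> form3 d B \<Longrightarrow> form3 d (A + B)"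
  unfolding form3_def coeff3_add by (metis add_0)

lemma form3_sum: "(\<And>a. a \<in> S \<Longrightarrow> form3 d (f a)) \<Longrightarrow> form3 d (sum f S)"
  by (induction S rule: infinite_finite_induct) auto

lemma coeff3_mult:
  "coeff3 (A * B) i j k =
    (\<Sum>i'\<le>i. \<Sum>j'\<le>j. \<Sum>k'\<le>k. coeff3 A i' j' k' * coeff3 B (i - i') (j - j') (k - k'))"
  by (simp add: coeff3_def coeff_mult coeff_sum)

lemma form3_mult:
  fixes A B :: "'a::comm_ring_1 poly poly poly"
  assumes "form3 d A" "form3 e B" shows "form3 (d + e) (A * B)"
  unfolding form3_def
proof (intro allI impI)
  fix i j k assume "coeff3 (A * B) i j k \<noteq> 0"
  then obtain i' where i: "i' \<le> i"
    and "(\<Sum>j'\<le>j. \<Sum>k'\<le>k. coeff3 A i' j' k' * coeff3 B (i - i') (j - j') (k - k')) \<noteq> 0"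
    unfolding coeff3_mult by (meson atMost_iff sum.not_neutral_contains_not_neutral)
  then obtain j' where j: "j' \<le> j"
    and "(\<Sum>k'\<le>k. coeff3 A i' j' k' * coeff3 B (i - i') (j - j') (k - k')) \<noteq> 0"
    by (meson atMost_iff sum.not_neutral_contains_not_neutral)
  then obtain k' where k: "k' \<le> k"
    and "coeff3 A i' j' k' * coeff3 B (i - i') (j - j') (k - k') \<noteq> 0"
    by (meson atMost_iff sum.not_neutral_contains_not_neutral)
  then have "coeff3 A i' j' k' \<noteq> 0" "coeff3 B (i - i') (j - j') (k - k') \<noteq> 0" by auto
  then have "i' + j' + k' = d" "i - i' + (j - j') + (k - k') = e"
    using assms by (auto simp: form3_def)
  with i j k show "i + j + k = d + e" by linarith
qed

lemma form3_const3: "form3 0 (const3 c)"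
  by (auto simp: form3_def const3_def coeff3_def coeff_pCons split: nat.splits)

lemma form3_1: "form3 0 (1 :: 'a::comm_ring_1 poly poly poly)"
  using form3_const3[of "1::'a"] by simp

lemma form3_var: "form3 1 var_x" "form3 1 var_y" "form3 1 var_z"
  by (auto simp: form3_def coeff3_def var_x_def var_y_def var_z_def coeff_pCons split: nat.splits)

lemma form3_power: "form3 d (A :: 'a::comm_ring_1 poly poly poly) \<Longrightarrow> form3 (d * n) (A ^ n)"
  by (induction n) (auto intro: form3_mult simp: form3_1)

lemma form3_const3_mult:
  "form3 d (A :: 'a::comm_ring_1 poly poly poly) \<Longrightarrow> form3 d (const3 c * A)"
  using form3_mult[OF form3_const3, of d A c] by simp

lemma form3_comp:
  fixes G :: "'a::comm_ring_1 poly poly poly"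
  assumes "form3 d G" "form3 (Suc 0) p" "form3 (Suc 0) q" "form3 (Suc 0) r"
  shows "form3 d (ev3 const3 G p q r)"
  unfolding ev3_def
proof (intro form3_sum)
  fix i j k
  show "form3 d (const3 (coeff3 G i j k) * p ^ i * q ^ j * r ^ k)"
  proof (cases "coeff3 G i j k = 0")
    case False
    then have d: "d = 0 + Suc 0 * i + Suc 0 * j + Suc 0 * k" using assms(1) by (auto simp: form3_def)
    show ?thesis unfolding d
      by (intro form3_mult form3_power form3_const3 assms)
  qed simp
qed

fun scal :: "'a::times \<Rightarrow> 'a \<times> 'a \<times> 'a \<Rightarrow> 'a \<times> 'a \<times> 'a" where
  "scal c (x, y, z) = (c * x, c * y, c * z)"

lemma eval3_scal:
  assumes "form3 d G" shows "eval3 G (scal c v) = c ^ d * eval3 G v"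
proof -
  obtain x y z where v: "v = (x, y, z)" by (cases v)
  have "coeff3 G i j k * (c * x) ^ i * (c * y) ^ j * (c * z) ^ k
      = c ^ d * (coeff3 G i j k * x ^ i * y ^ j * z ^ k)" for i j k
  proof (cases "coeff3 G i j k = 0")
    case False
    then have d: "d = i + j + k" using assms by (auto simp: form3_def)
    show ?thesis by (simp add: d power_mult_distrib power_add)
  qed simp
  then show ?thesis by (simp add: v eval3_eq_ev3 ev3_def sum_distrib_left)
qed

section \<open>Linear changes of coordinates\<close>

type_synonym 'a vec = "'a \<times> 'a \<times> 'a"
type_synonym 'a mat = "'a vec \<times> 'a vec \<times> 'a vec"

fun dot :: "'a::comm_ring_1 vec \<Rightarrow> 'a vec \<Rightarrow> 'a" where
  "dot (a, b, c) (x, y, z) = a * x + b * y + c * z"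

fun app :: "'a::comm_ring_1 mat \<Rightarrow> 'a vec \<Rightarrow> 'a vec" where
  "app (r1, r2, r3) v = (dot r1 v, dot r2 v, dot r3 v)"

fun lin :: "'a::comm_ring_1 vec \<Rightarrow> 'a poly poly poly" where
  "lin (a, b, c) = const3 a * var_x + const3 b * var_y + const3 c * var_z"

fun subst3 :: "'a::comm_ring_1 mat \<Rightarrow> 'a poly poly poly \<Rightarrow> 'a poly poly poly" where
  "subst3 (r1, r2, r3) G = ev3 const3 G (lin r1) (lin r2) (lin r3)"

text \<open>Inverse matrices are carried as a pair acting on vectors: one of them pulls back
  equations, the other moves points. Determinants mainly serve to produce such pairs.\<close>

definition lininv :: "'a::comm_ring_1 mat \<Rightarrow> 'a mat \<Rightarrow> bool" where
  "lininv M M' \<longleftrightarrow> (\<forall>v. app M (app M' v) = v) \<and> (\<forall>v. app M' (app M v) = v)"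

lemma lininv_sym: "lininv M M' \<Longrightarrow> lininv M' M" by (simp add: lininv_def)

lemma eval3_lin: "eval3 (lin r) v = dot r v"
  by (cases r; cases v) simp

lemma eval3_subst [simp]: "eval3 (subst3 M G) v = eval3 G (app M v)"
  by (cases M) (simp add: eval3_comp eval3_lin del: lin.simps)

lemma form3_lin: "form3 (Suc 0) (lin r)"
  by (cases r) (auto intro!: form3_add form3_const3_mult form3_var[simplified])

lemma form3_subst: "form3 d G \<Longrightarrow> form3 d (subst3 M G)"
  by (cases M) (auto intro!: form3_comp form3_lin simp del: lin.simps)

lemma mat_cases:
  obtains a b c d e f g h i where "M = ((a, b, c), (d, e, f), (g, h, i))"
  by (metis prod_cases3)

lemma dot_scal: "dot r (scal c v) = c * dot r v"
  by (cases r; cases v) (simp add: algebra_simps)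

lemma app_scal: "app M (scal c v) = scal c (app M v)"
  by (cases M) (simp add: dot_scal)

lemma app_0 [simp]: "app M (0, 0, 0) = (0, 0, 0)"
  using app_scal[of M 0 "(0, 0, 0)"] by (cases "app M (0,0,0)") simp

lemma lininv_nz: "lininv M M' \<Longrightarrow> app M v = (0, 0, 0) \<longleftrightarrow> v = (0, 0, 0)"
  by (metis app_0 lininv_def)

lemma scal_scal [simp]: "scal c (scal d v) = scal (c * d) (v :: 'a::comm_ring_1 vec)"
  by (cases v) simp

lemma scal_1 [simp]: "scal 1 v = (v :: 'a::comm_ring_1 vec)"
  by (cases v) simp

lemma scal_nz: "scal c v = (0, 0, 0) \<longleftrightarrow> c = 0 \<or> v = (0, 0, 0 :: 'a::field)"
  by (cases v) auto

lemma subst_subst: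
  fixes G :: "'a::{idom,ring_char_0} poly poly poly"
  assumes "lininv M M'" shows "subst3 M (subst3 M' G) = G"
  using assms by (intro eval3_eqI) (auto simp: lininv_def)

lemma subst_mult:
  fixes G :: "'a::{idom,ring_char_0} poly poly poly"
  shows "subst3 M (G * H) = subst3 M G * subst3 M H"
  by (rule eval3_eqI) simp

lemma subst_add:
  fixes G :: "'a::{idom,ring_char_0} poly poly poly"
  shows "subst3 M (G + H) = subst3 M G + subst3 M H"
  by (rule eval3_eqI) simp

lemma subst_const3:
  "subst3 M (const3 (c :: 'a::{idom,ring_char_0})) = const3 c"
  by (rule eval3_eqI) simp

lemma subst_1: "subst3 M (1 :: 'a::{idom,ring_char_0} poly poly poly) = 1"
  by (rule eval3_eqI) simp

lemma subst_0: "subst3 M (0 :: 'a::{idom,ring_char_0} poly poly poly) = 0"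
  by (rule eval3_eqI) simp

lemma subst_unit:
  fixes G :: "'a::{idom,ring_char_0} poly poly poly"
  assumes "G dvd 1" shows "subst3 M G dvd 1"
  using assms by (metis dvdE dvdI subst_1 subst_mult)

lemma irreducible_subst:
  fixes G :: "'a::{idom,ring_char_0} poly poly poly"
  assumes "lininv M M'" "irreducible G" shows "irreducible (subst3 M G)"
proof (rule irreducibleI)
  note inv = subst_subst[OF assms(1)] subst_subst[OF lininv_sym[OF assms(1)]]
  show "subst3 M G \<noteq> 0" using assms(2) inv subst_0 by (metis not_irreducible_zero)
  show "\<not> subst3 M G dvd 1"
    using assms(2) inv subst_unit by (metis irreducible_not_unit)
  fix a b assume "subst3 M G = a * b"
  then have "G = subst3 M' a * subst3 M' b" using inv by (metis subst_mult)
  then have "subst3 M' a dvd 1 \<or> subst3 M' b dvd 1" using assms(2) irreducibleD by blast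
  then show "a dvd 1 \<or> b dvd 1" using inv subst_unit by metis
qed

fun det3 :: "'a::comm_ring_1 mat \<Rightarrow> 'a" where
  "det3 ((a, b, c), (d, e, f), (g, h, i)) = a*(e*i - f*h) - b*(d*i - f*g) + c*(d*h - e*g)"

fun minv :: "'a::field mat \<Rightarrow> 'a mat" where
  "minv ((a, b, c), (d, e, f), (g, h, i)) = (let r = inverse (det3 ((a, b, c), (d, e, f), (g, h, i))) in
    (((e*i - f*h)*r, (c*h - b*i)*r, (b*f - c*e)*r),
     ((f*g - d*i)*r, (a*i - c*g)*r, (c*d - a*f)*r),
     ((d*h - e*g)*r, (b*g - a*h)*r, (a*e - b*d)*r)))"

lemma lininv_minv: 
  assumes "det3 M \<noteq> 0" shows "lininv M (minv M)"
proof -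
  obtain a b c d e f g h i where M: "M = ((a, b, c), (d, e, f), (g, h, i))"
    by (rule mat_cases)
  define r where "r = inverse (det3 M)"
  have r: "r * (a*(e*i - f*h) - b*(d*i - f*g) + c*(d*h - e*g)) = 1"
    using assms by (simp add: r_def M)
  have r': "inverse (det3 ((a, b, c), (d, e, f), (g, h, i))) = r" by (simp add: r_def M)
  show ?thesis
    unfolding lininv_def M minv.simps r' Let_def using r
    by (simp; intro conjI allI; Groebner_Basis.algebra)
qed

section \<open>Coordinate changes and maximally tangent cubics\<close>

lemma smult_const3: "smult [:[:c:]:] G = const3 c * G"
  by (simp add: const3_def)

lemma curve_alt: "curve G = {const3 c * G | c. c \<noteq> 0}"
  by (simp add: curve_def smult_const3)

lemma curve_self: "G \<in> curve G"
  unfolding curve_alt by (auto intro!: exI[of _ 1])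

lemma curve_scale: "c \<noteq> 0 \<Longrightarrow> curve (const3 c * G) = curve G"
proof -
  assume c: "c \<noteq> 0"
  have 1: "const3 d * (const3 c * G) = const3 (d * c) * G" for d by (simp add: const3_mult mult_ac)
  have 2: "const3 d * G = const3 (d / c) * (const3 c * G)" for d unfolding 1 using c by simp
  show ?thesis unfolding curve_alt
  proof (rule equalityI; rule subsetI)
    fix x assume "x \<in> {const3 d * (const3 c * G) |d. d \<noteq> 0}"
    then obtain d where "x = const3 d * (const3 c * G)" "d \<noteq> 0" by blast
    then show "x \<in> {const3 d * G |d. d \<noteq> 0}" using c unfolding 1 by (auto intro!: exI[of _ "d * c"])
  next
    fix x assume "x \<in> {const3 d * G |d. d \<noteq> 0}"
    then obtain d where "x = const3 d * G" "d \<noteq> 0" by blast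
    then show "x \<in> {const3 d * (const3 c * G) |d. d \<noteq> 0}" using 2[of d] c by (auto intro!: exI[of _ "d / c"])
  qed
qed

lemma curve_eq_iff: "curve G = curve H \<longleftrightarrow> (\<exists>c. c \<noteq> 0 \<and> G = const3 c * H)"
proof
  assume "curve G = curve H"
  then have "G \<in> curve H" using curve_self by blast
  then show "\<exists>c. c \<noteq> 0 \<and> G = const3 c * H" unfolding curve_alt by blast
qed (auto simp: curve_scale)

lemma curve_memD: "H \<in> curve G \<Longrightarrow> curve H = curve G"
  using curve_eq_iff unfolding curve_alt by blast

lemma subst_curve:
  fixes G :: "'a::field_char_0 poly poly poly"
  shows "subst3 M ` curve G = curve (subst3 M G)"
  unfolding curve_alt by (auto simp: subst_mult subst_const3 image_iff) (metis subst_const3 subst_mult)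

definition papp :: "'a::comm_ring_1 mat \<Rightarrow> 'a param \<Rightarrow> 'a param" where
  "papp = (\<lambda>((a, b, c), (d, e, f), (g, h, i)) (p, q, r).
    (smult [:a:] p + smult [:b:] q + smult [:c:] r, smult [:d:] p + smult [:e:] q + smult [:f:] r,
     smult [:g:] p + smult [:h:] q + smult [:i:] r))"

lemma eval_papp: "eval_param (papp M \<phi>) p = app M (eval_param \<phi> p)"
  by (cases M rule: mat_cases; cases \<phi>; cases p) (simp add: papp_def eval_param_def eval2_def)

lemma form2_lin:
  fixes p :: "'a::idom poly poly"
  shows "form2 n p \<Longrightarrow> form2 n q \<Longrightarrow> form2 n r \<Longrightarrow> form2 n (smult [:a:] p + smult [:b:] q + smult [:c:] r)"
  by (auto simp: form2_def) (metis add_0 mult_zero_right)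

lemma papp_form2:
  fixes M :: "'a::idom mat"
  assumes "\<phi> = (f, g, h)" "form2 n f" "form2 n g" "form2 n h" "papp M \<phi> = (f', g', h')"
  shows "form2 n f' \<and> form2 n g' \<and> form2 n h'"
  using assms by (cases M rule: mat_cases) (auto simp: papp_def intro!: form2_lin)

lemma image_is_alt: "image_is \<phi> G \<longleftrightarrow> (\<forall>v. v \<noteq> (0, 0, 0) \<longrightarrow>
     (eval3 G v = 0 \<longleftrightarrow> (\<exists>p c. p \<noteq> (0, 0) \<and> c \<noteq> 0 \<and> v = scal c (eval_param \<phi> p))))"
proof -
  have "(case w of (x, y, z) \<Rightarrow> (c * x, c * y, c * z)) = scal c w" for c :: 'a and w by (cases w) simp
  then show ?thesis by (simp add: image_is_def)
qed

text \<open>Points move by \<open>M'\<close> when equations are pulled back by \<open>M\<close>. The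
  forms of the rational inverse are pulled back by \<open>M\<close> too, so they recover the same
  parameter.\<close>

lemma normalisation_subst:
  fixes G :: "'a::field_char_0 poly poly poly"
  assumes "lininv M M'" "normalisation \<phi> G" shows "normalisation (papp M' \<phi>) (subst3 M G)"
proof -
  obtain f g h where f: "\<phi> = (f, g, h)" by (cases \<phi>)
  obtain f' g' h' where f': "papp M' \<phi> = (f', g', h')" by (cases "papp M' \<phi>")
  have 1: "line_to_plane (papp M' \<phi>)"
  proof -
    obtain n where n: "form2 n f" "form2 n g" "form2 n h" 
      "\<And>p. p \<noteq> (0, 0) \<Longrightarrow> eval_param \<phi> p \<noteq> (0, 0, 0)"
      using assms(2) unfolding normalisation_def line_to_plane_def f by auto
    have "eval_param (f', g', h') p \<noteq> (0, 0, 0)" if "p \<noteq> (0, 0)" for p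
      unfolding f'[symmetric] eval_papp using n(4)[OF that] lininv_nz[OF lininv_sym[OF assms(1)]] by blast
    with papp_form2[OF f n(1-3) f'] show ?thesis unfolding line_to_plane_def f' by auto
  qed
  have 2: "image_is (papp M' \<phi>) (subst3 M G)"
    unfolding image_is_alt
  proof (intro allI impI)
    fix v :: "'a vec" assume "v \<noteq> (0, 0, 0)"
    then have "app M v \<noteq> (0, 0, 0)" using assms(1) lininv_nz by blast
    then have "eval3 G (app M v) = 0 \<longleftrightarrow> (\<exists>p c. p \<noteq> (0, 0) \<and> c \<noteq> 0 \<and> app M v = scal c (eval_param \<phi> p))"
      using assms(2) unfolding normalisation_def image_is_alt by blast
    moreover have "app M v = scal c (eval_param \<phi> p) \<longleftrightarrow> v = scal c (eval_param (papp M' \<phi>) p)" for c p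
      using assms(1) unfolding lininv_def eval_papp by (metis app_scal)
    ultimately show "eval3 (subst3 M G) v = 0 \<longleftrightarrow>
      (\<exists>p c. p \<noteq> (0, 0) \<and> c \<noteq> 0 \<and> v = scal c (eval_param (papp M' \<phi>) p))" by simp
  qed
  obtain m a b where ab: "form3 m a" "form3 m b"
    "\<exists>p. eval3 a (eval_param \<phi> p) \<noteq> 0 \<or> eval3 b (eval_param \<phi> p) \<noteq> 0"
    "\<forall>s u. s * eval3 b (eval_param \<phi> (s, u)) = u * eval3 a (eval_param \<phi> (s, u))"
    using assms(2) unfolding normalisation_def birational_onto_image_def by blast
  have 3: "app M (eval_param (papp M' \<phi>) p) = eval_param \<phi> p" for p
    using assms(1) unfolding eval_papp lininv_def by blast
  have "birational_onto_image (papp M' \<phi>)"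
    unfolding birational_onto_image_def
    by (rule exI[of _ m], rule exI[of _ "subst3 M a"], rule exI[of _ "subst3 M b"])
      (use ab in \<open>simp add: form3_subst 3\<close>)
  with 1 2 show ?thesis by (simp add: normalisation_def)
qed

lemma max_tangent_subst:
  fixes E :: "'a::{alg_closed_field,field_char_0} poly poly poly"
  assumes "lininv M M'" "C \<in> max_tangent_cubics E"
  shows "subst3 M ` C \<in> max_tangent_cubics (subst3 M E)"
proof -
  obtain G \<phi> where G: "C = curve G" "form3 3 G" "irreducible G" "curve G \<noteq> curve E"
    "normalisation \<phi> G" "preimage_single_point \<phi> E"
    using assms(2) unfolding max_tangent_cubics_def by blast
  have 3: "app M (eval_param (papp M' \<phi>) p) = eval_param \<phi> p" for p
    using assms(1) unfolding eval_papp lininv_def by blast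
  have 1: "preimage_single_point (papp M' \<phi>) (subst3 M E)"
    using G(6) by (simp add: preimage_single_point_def 3)
  have 2: "curve (subst3 M G) \<noteq> curve (subst3 M E)"
  proof
    assume "curve (subst3 M G) = curve (subst3 M E)"
    then have "subst3 M ` curve G = subst3 M ` curve E" by (simp only: subst_curve)
    then have "subst3 M' ` subst3 M ` curve G = subst3 M' ` subst3 M ` curve E" by simp
    then show False using G(4) by (simp add: image_image subst_subst[OF lininv_sym[OF assms(1)]])
  qed
  show ?thesis
    unfolding G(1) subst_curve max_tangent_cubics_def
    using 1 2 G(2,3,5) normalisation_subst[OF assms(1)] irreducible_subst[OF assms(1)] form3_subst
    by blast
qed

section \<open>Cubic forms\<close>

definition mono3 :: "'a::zero \<Rightarrow> nat \<Rightarrow> nat \<Rightarrow> nat \<Rightarrow> 'a poly poly poly" where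
  "mono3 c i j k = monom (monom (monom c k) j) i"

lemma coeff3_mono3 [simp]:
  "coeff3 (mono3 c i j k) i' j' k' = (if i = i' \<and> j = j' \<and> k = k' then c else 0)"
  by (simp add: coeff3_def mono3_def)

lemma eval3_mono3 [simp]: "eval3 (mono3 c i j k) (x, y, z) = c * x ^ i * y ^ j * z ^ k"
  by (simp add: eval3_def mono3_def poly_monom poly_const_pow mult_ac)

text \<open>The monomials are listed in lexicographic order
  \<open>x\<^sup>3, x\<^sup>2y, x\<^sup>2z, xy\<^sup>2, xyz, xz\<^sup>2, y\<^sup>3, y\<^sup>2z, yz\<^sup>2, z\<^sup>3\<close>.\<close>

definition cub :: "'a::comm_ring_1 \<Rightarrow> 'a \<Rightarrow> 'a \<Rightarrow> 'a \<Rightarrow> 'a \<Rightarrow> 'a \<Rightarrow> 'a \<Rightarrow> 'a \<Rightarrow> 'a \<Rightarrow> 'a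
    \<Rightarrow> 'a poly poly poly" where
  "cub a b c d e f g h i j = mono3 a 3 0 0 + mono3 b 2 1 0 + mono3 c 2 0 1 + mono3 d 1 2 0
    + mono3 e 1 1 1 + mono3 f 1 0 2 + mono3 g 0 3 0 + mono3 h 0 2 1 + mono3 i 0 1 2 + mono3 j 0 0 3"

lemma eval3_cub [simp]:
  "eval3 (cub a b c d e f g h i j) (x, y, z) = a * x^3 + b * x^2 * y + c * x^2 * z + d * x * y^2
    + e * x * y * z + f * x * z^2 + g * y^3 + h * y^2 * z + i * y * z^2 + j * z^3"
  by (simp add: cub_def)

lemma form3_cub [simp]: "form3 3 (cub a b c d e f g h i j)"
  by (auto simp: form3_def cub_def split: if_splits)

lemma coeff3_cub [simp]:
  "coeff3 (cub a b c d e f g h i j) 3 0 0 = a" "coeff3 (cub a b c d e f g h i j) 2 (Suc 0) 0 = b"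
  "coeff3 (cub a b c d e f g h i j) 2 0 (Suc 0) = c" "coeff3 (cub a b c d e f g h i j) (Suc 0) 2 0 = d"
  "coeff3 (cub a b c d e f g h i j) (Suc 0) (Suc 0) (Suc 0) = e"
  "coeff3 (cub a b c d e f g h i j) (Suc 0) 0 2 = f" "coeff3 (cub a b c d e f g h i j) 0 3 0 = g"
  "coeff3 (cub a b c d e f g h i j) 0 2 (Suc 0) = h" "coeff3 (cub a b c d e f g h i j) 0 (Suc 0) 2 = i"
  "coeff3 (cub a b c d e f g h i j) 0 0 3 = j"
  by (auto simp: cub_def)

lemma form3_3_eq_cub:
  assumes "form3 3 G"
  shows "G = cub (coeff3 G 3 0 0) (coeff3 G 2 1 0) (coeff3 G 2 0 1) (coeff3 G 1 2 0) (coeff3 G 1 1 1)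
    (coeff3 G 1 0 2) (coeff3 G 0 3 0) (coeff3 G 0 2 1) (coeff3 G 0 1 2) (coeff3 G 0 0 3)"
    (is "_ = ?C")
proof (rule coeff3_eqI)
  fix i j k
  show "coeff3 G i j k = coeff3 ?C i j k"
  proof (cases "i + j + k = 3")
    case False
    then have "coeff3 G i j k = 0" "coeff3 ?C i j k = 0"
      using assms form3_cub unfolding form3_def by blast+
    then show ?thesis by simp
  next
    case True
    then have i: "i = 0 \<or> i = 1 \<or> i = 2 \<or> i = 3" and j: "j = 0 \<or> j = 1 \<or> j = 2 \<or> j = 3"
      and k: "k = 3 - i - j" by linarith+
    show ?thesis using i j True unfolding k by (elim disjE) simp_all
  qed
qed

lemma form3_3E:
  assumes "form3 3 G" obtains a b c d e f g h i j where "G = cub a b c d e f g h i j"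
  using form3_3_eq_cub[OF assms] by blast

fun vadd :: "'a::plus vec \<Rightarrow> 'a vec \<Rightarrow> 'a vec" where
  "vadd (x, y, z) (x', y', z') = (x + x', y + y', z + z')"

text \<open>The derivative of a cubic form \<open>G\<close> at \<open>v\<close> in direction \<open>w\<close>, as a finite difference.\<close>

definition polar :: "'a::field poly poly poly \<Rightarrow> 'a vec \<Rightarrow> 'a vec \<Rightarrow> 'a" where
  "polar G v w = (eval3 G (vadd v w) - eval3 G (vadd v (scal (-1) w))) / 2 - eval3 G w"

text \<open>The part of the cubic at \<open>v + w\<close> that is odd in \<open>w\<close> consists
  of the derivative and the value at \<open>w\<close>; subtracting the latter from half the
  difference leaves the derivative.\<close>

lemma polar_cub:
  fixes a :: "'a::field_char_0"
  shows "polar (cub a b c d e f g h i j) (x, y, z) (p, q, r) =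
    (3*a*x^2 + 2*b*x*y + 2*c*x*z + d*y^2 + e*y*z + f*z^2) * p
    + (b*x^2 + 2*d*x*y + e*x*z + 3*g*y^2 + 2*h*y*z + i*z^2) * q
    + (c*x^2 + e*x*y + 2*f*x*z + h*y^2 + 2*i*y*z + 3*j*z^2) * r"
proof -
  have *: "u - v = 2 * (w + s) \<Longrightarrow> (u - v) / 2 - s = w" for u v w s :: 'a by (simp add: field_simps)
  show ?thesis unfolding polar_def
    by (rule *) (simp, Groebner_Basis.algebra)
qed

text \<open>The four coefficients of a cubic on the line through \<open>v\<close> and
  \<open>w\<close>. For \<open>v\<close> on the curve, tangency at \<open>v\<close> is
  \<open>polar G v w = 0\<close>; a flex tangent has \<open>polar G w v = 0\<close> as well.\<close>

lemma eval3_line: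
  fixes G :: "'a::field_char_0 poly poly poly"
  assumes "form3 3 G"
  shows "eval3 G (vadd (scal s v) (scal t w)) =
    s^3 * eval3 G v + s^2 * t * polar G v w + s * t^2 * polar G w v + t^3 * eval3 G w"
proof -
  obtain a b c d e f g h i j where G: "G = cub a b c d e f g h i j" using form3_3E[OF assms] .
  obtain v1 v2 v3 w1 w2 w3 where v: "v = (v1, v2, v3)" "w = (w1, w2, w3)" by (cases v; cases w)
  show ?thesis unfolding G v vadd.simps scal.simps eval3_cub polar_cub
    by Groebner_Basis.algebra
qed

text \<open>Immediate from the form of the definition as a finite difference, because a linear map
  commutes with sums of vectors.\<close>

lemma polar_subst: 
  fixes G :: "'a::field_char_0 poly poly poly"
  shows "polar (subst3 M G) v w = polar G (app M v) (app M w)"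
proof -
  have "dot r (vadd v w) = dot r v + dot r w" for r and v w :: "'a vec"
    by (cases r; cases v; cases w) (simp add: algebra_simps)
  then have "app M (vadd v w) = vadd (app M v) (app M w)" for v w by (cases M) simp
  then show ?thesis by (simp add: polar_def app_scal)
qed

lemma polar_lin:
  fixes G :: "'a::field_char_0 poly poly poly"
  assumes "form3 3 G"
  shows "polar G v (vadd (scal s w) (scal t w')) = s * polar G v w + t * polar G v w'"
    and "polar G (scal s v) w = s^2 * polar G v w" and "polar G v (scal t w) = t * polar G v w"
    and "polar G v v = 3 * eval3 G v"
proof -
  obtain a b c d e f g h i j where G: "G = cub a b c d e f g h i j" using form3_3E[OF assms] .
  obtain v1 v2 v3 w1 w2 w3 u1 u2 u3 where v: "v = (v1, v2, v3)" "w = (w1, w2, w3)" "w' = (u1, u2, u3)"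
    by (cases v; cases w; cases w')
  show "polar G v (vadd (scal s w) (scal t w')) = s * polar G v w + t * polar G v w'"
    unfolding G v vadd.simps scal.simps eval3_cub polar_cub by (simp add: algebra_simps)
  show "polar G (scal s v) w = s^2 * polar G v w" "polar G v (scal t w) = t * polar G v w"
    "polar G v v = 3 * eval3 G v" 
    unfolding G v vadd.simps scal.simps eval3_cub polar_cub
    by (simp_all add: algebra_simps power2_eq_square power3_eq_cube)
qed

section \<open>Linear algebra in dimension three\<close>

lemma ex_row:
  fixes r :: "'a::field vec"
  assumes "r \<noteq> (0, 0, 0)"
  obtains M M' where "lininv M M'" "\<And>v. fst (app M' v) = dot r v"
proof -
  obtain a b c where r: "r = (a, b, c)" by (cases r)
  have "\<exists>r2 r3. det3 (r, r2, r3) \<noteq> 0"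
  proof (cases "a = 0")
    case False
    then have "det3 (r, (0, 1, 0), (0, 0, 1)) \<noteq> 0" by (simp add: r)
    then show ?thesis by blast
  next
    case a: True
    show ?thesis
    proof (cases "b = 0")
      case False
      then have "det3 (r, (1, 0, 0), (0, 0, 1)) \<noteq> 0" by (simp add: r)
      then show ?thesis by blast
    next
      case True
      then have "det3 (r, (1, 0, 0), (0, 1, 0)) \<noteq> 0" using a assms by (simp add: r)
      then show ?thesis by blast
    qed
  qed
  then obtain r2 r3 where "det3 (r, r2, r3) \<noteq> 0" by blast
  from lininv_sym[OF lininv_minv[OF this]] show ?thesis by (rule that) simp
qed

text \<open>A nonzero cross product of two of the vectors is orthogonal to all three, as the
  determinant vanishes. If all cross products are zero the vectors are parallel, and any vector
  orthogonal to a nonzero one of them will do.\<close>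

lemma orth3:
  fixes p q r :: "'a::field vec"
  assumes "det3 (p, q, r) = 0"
  obtains n where "n \<noteq> (0, 0, 0)" "dot n p = 0" "dot n q = 0" "dot n r = 0"
proof -
  obtain p1 p2 p3 q1 q2 q3 r1 r2 r3 where v: "p = (p1, p2, p3)" "q = (q1, q2, q3)" "r = (r1, r2, r3)"
    by (cases p; cases q; cases r)
  have "\<exists>n. n \<noteq> (0, 0, 0) \<and> dot n p = 0 \<and> dot n q = 0 \<and> dot n r = 0" 
  proof (cases "(p2*q3 - p3*q2, p3*q1 - p1*q3, p1*q2 - p2*q1) = (0, 0, 0)
      \<and> (p2*r3 - p3*r2, p3*r1 - p1*r3, p1*r2 - p2*r1) = (0, 0, 0)
      \<and> (q2*r3 - q3*r2, q3*r1 - q1*r3, q1*r2 - q2*r1) = (0, 0, 0)")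
    case False
    then consider "(p2*q3 - p3*q2, p3*q1 - p1*q3, p1*q2 - p2*q1) \<noteq> (0, 0, 0)"
      | "(p2*r3 - p3*r2, p3*r1 - p1*r3, p1*r2 - p2*r1) \<noteq> (0, 0, 0)"
      | "(q2*r3 - q3*r2, q3*r1 - q1*r3, q1*r2 - q2*r1) \<noteq> (0, 0, 0)" by blast
    then show ?thesis
      by cases (intro exI conjI, assumption; (use assms in \<open>simp add: v algebra_simps\<close>))+
  next
    case True
    have *: "\<exists>n. n \<noteq> (0, 0, 0) \<and> (\<forall>x. (\<exists>y z. x = (y, z)) \<longrightarrow> True) \<and> dot n (a, b, c) = 0" 
      for a b c :: 'a
    proof (cases "a = 0")
      case True then show ?thesis by (intro exI[of _ "(1, 0, 0)"]) simp
    next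
      case False then show ?thesis by (intro exI[of _ "(b, -a, 0)"]) simp
    qed
    have par: "dot n (a', b', c') = 0" 
      if "dot n (a, b, c) = 0" "(a, b, c) \<noteq> (0, 0, 0)" "b * c' = c * b'" "c * a' = a * c'" "a * b' = b * a'"
      for n and a b c a' b' c' :: 'a
    proof -
      obtain n1 n2 n3 where n: "n = (n1, n2, n3)" by (cases n)
      have "a * dot n (a', b', c') = a' * dot n (a, b, c)" 
        "b * dot n (a', b', c') = b' * dot n (a, b, c)" "c * dot n (a', b', c') = c' * dot n (a, b, c)"
        unfolding n dot.simps using that(3-5) by Groebner_Basis.algebra+
      then show ?thesis using that(1,2) by auto
    qed
    consider "p \<noteq> (0, 0, 0)" | "q \<noteq> (0, 0, 0)" | "r \<noteq> (0, 0, 0)" 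
      | "p = (0, 0, 0)" "q = (0, 0, 0)" "r = (0, 0, 0)" by blast
    then show ?thesis
    proof cases
      case 1
      obtain n where "n \<noteq> (0, 0, 0)" "dot n p = 0" using * v by metis
      then show ?thesis using 1 True par[of n p1 p2 p3 q3 q2 q1] par[of n p1 p2 p3 r3 r2 r1]
        unfolding v by (intro exI[of _ n]) (simp add: mult.commute)
    next
      case 2
      obtain n where "n \<noteq> (0, 0, 0)" "dot n q = 0" using * v by metis
      then show ?thesis using 2 True par[of n q1 q2 q3 p3 p2 p1] par[of n q1 q2 q3 r3 r2 r1]
        unfolding v by (intro exI[of _ n]) (simp add: mult.commute)
    next
      case 3
      obtain n where "n \<noteq> (0, 0, 0)" "dot n r = 0" using * v by metis
      then show ?thesis using 3 True par[of n r1 r2 r3 p3 p2 p1] par[of n r1 r2 r3 q3 q2 q1]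
        unfolding v by (intro exI[of _ n]) (simp add: mult.commute)
    next
      case 4
      then show ?thesis by (intro exI[of _ "(1, 0, 0)"]) simp
    qed
  qed
  then show ?thesis using that by blast
qed

section \<open>Normalisations of integral cubics as triples of binary cubics\<close>

section \<open>Parametrisations of integral cubics have degree three\<close>

lemma not_unit3:
  assumes "eval3 A (0, 0, 0) = (0 :: 'a::field)" shows "\<not> A dvd 1"
proof
  assume "A dvd 1"
  then obtain B where "1 = A * B" by (auto elim: dvdE)
  then have "eval3 A (0, 0, 0) * eval3 B (0, 0, 0) = 1" by (metis eval3_1 eval3_mult)
  then show False using assms by simp
qed

text \<open>If the line lay on the curve, coordinates with the line as x = 0 would give G = x Q. A
  cubic form has no linear term, so Q vanishes at the origin and neither factor is a unit.\<close>

lemma irreducible_no_line: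
  fixes G :: "'a::field_char_0 poly poly poly"
  assumes "irreducible G" "form3 3 G" "r \<noteq> (0, 0, 0)"
  obtains v where "dot r v = 0" "eval3 G v \<noteq> 0"
proof -
  have "\<exists>v. dot r v = 0 \<and> eval3 G v \<noteq> 0"
  proof (rule ccontr)
    assume none: "\<not> ?thesis"
    obtain M M' where M: "lininv M M'" "\<And>v. fst (app M' v) = dot r v" using ex_row[OF assms(3)] by blast
    let ?G = "subst3 M G"
    have z: "eval3 ?G (0, y, z) = 0" for y z
    proof -
      have "dot r (app M (0, y, z)) = 0" using M by (metis fst_conv lininv_def)
      then show ?thesis using none by (metis eval3_subst)
    qed
    have "poly ?G 0 = 0"
    proof (rule poly_const_all_0)
      fix y
      have "poly (poly (poly ?G 0) [:y:]) z = 0" for z using z[of y z] by (simp add: eval3_def)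
      then show "poly (poly ?G 0) [:y:] = 0" using poly_all_0_iff_0 by blast
    qed
    then obtain Q where Q: "?G = [:0, 1:] * Q" using poly_eq_0_iff_dvd[of ?G 0] by (metis dvdE minus_zero)
    have irr: "irreducible ?G" using irreducible_subst[OF M(1) assms(1)] .
    have "\<not> [:0, 1::'a poly poly:] dvd 1" by (rule not_unit3) (simp add: eval3_def)
    moreover have "\<not> Q dvd 1"
    proof (rule not_unit3)
      have "coeff3 ?G 1 0 0 = coeff3 Q 0 0 0" by (simp add: Q coeff3_def)
      moreover have "coeff3 ?G 1 0 0 = 0" using form3_subst[OF assms(2)] unfolding form3_def
        by (metis add.right_neutral numeral_eq_one_iff semiring_norm(86))
      ultimately show "eval3 Q (0, 0, 0) = 0" by (simp add: eval3_def coeff3_def poly_0_coeff_0)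
    qed
    ultimately show False using irreducibleD[OF irr Q] by blast
  qed
  then show ?thesis using that by blast
qed

text \<open>A curve inside the line \<open>r\<close> is impossible: join a point \<open>v\<close> of
  that line off the curve to a point \<open>q\<close> off both. The joining line still meets the
  cubic, but it meets \<open>r\<close> only in \<open>v\<close>.\<close>

lemma irreducible_dependent:
  fixes G :: "'a::{alg_closed_field,field_char_0} poly poly poly"
  assumes "irreducible G" "form3 3 G" "r \<noteq> (0, 0, 0)"
    and "\<And>v. v \<noteq> (0, 0, 0) \<Longrightarrow> eval3 G v = 0 \<Longrightarrow> dot r v = 0"
  shows False
proof -
  obtain v where v: "dot r v = 0" "eval3 G v \<noteq> 0" using irreducible_no_line[OF assms(1-3)] .
  have "lin r \<noteq> 0"
  proof
    assume "lin r = 0"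
    then have "dot r v = 0" for v by (metis eval3_lin eval3_0)
    from this[of "(1,0,0)"] this[of "(0,1,0)"] this[of "(0,0,1)"] show False using assms(3) by (cases r) auto
  qed
  then have "lin r * G \<noteq> 0" using assms(1) by auto
  then obtain q where q: "dot r q \<noteq> 0" "eval3 G q \<noteq> 0"
    using eval3_all_0[of "lin r * G"] by (auto simp: eval3_lin)
  let ?p = "[:eval3 G v, polar G v q, polar G q v, eval3 G q:]"
  obtain t where t: "poly ?p t = 0" using alg_closed_imp_poly_has_root[of ?p] q(2) by auto
  have "eval3 G (vadd (scal 1 v) (scal t q)) = 0"
    using t unfolding eval3_line[OF assms(2)] by (simp add: algebra_simps power2_eq_square power3_eq_cube)
  moreover have "dot r (vadd (scal 1 v) (scal t q)) = t * dot r q"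
    using v(1) by (cases r; cases v; cases q) (simp add: algebra_simps)
  moreover have "vadd (scal 1 v) (scal t q) \<noteq> (0, 0, 0)"
  proof
    assume "vadd (scal 1 v) (scal t q) = (0, 0, 0)"
    then have "t * dot r q = 0" using \<open>dot r _ = t * dot r q\<close> by (cases r) simp
    then have "v = (0, 0, 0)" using \<open>vadd _ _ = (0, 0, 0)\<close> q(1) by (cases v; cases q) auto
    then show False using v(2) eval3_scal[OF assms(2), of 0 v] by simp
  qed
  ultimately have "t = 0" using assms(4) q(1) by (metis mult_eq_0_iff)
  then show False using \<open>eval3 G (vadd _ _) = 0\<close> v(2) by (cases v; cases q) simp
qed

text \<open>The chart u = 1. The degree \<open>n\<close> is kept as an argument because the
  coefficient at \<open>n\<close>, possibly zero, is the value at the point (1 : 0) outside the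
  chart.\<close>

definition dehom :: "nat \<Rightarrow> 'a::comm_ring_1 poly poly \<Rightarrow> 'a poly" where
  "dehom n f = (\<Sum>i\<le>n. monom (coeff (coeff f i) (n - i)) i)"

lemma eval2_form2:
  assumes "form2 n f" 
  shows "eval2 f (s, u) = (\<Sum>i\<le>n. coeff (coeff f i) (n - i) * s ^ i * u ^ (n - i))"
proof -
  have c: "coeff f i = (if i \<le> n then monom (coeff (coeff f i) (n - i)) (n - i) else 0)" for i
    using assms unfolding form2_def by (auto simp: poly_eq_iff) (metis add_diff_cancel_left', metis le_add1)
  have "degree f \<le> n" using c by (intro degree_le) (metis not_le)
  then have "poly f [:s:] = (\<Sum>i\<le>n. coeff f i * [:s:] ^ i)"
    unfolding poly_altdef by (auto intro!: sum.mono_neutral_left intro: le_degree)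
  then have "eval2 f (s, u) = (\<Sum>i\<le>n. poly (coeff f i) u * s ^ i)"
    by (simp add: eval2_def poly_sum poly_const_pow mult.commute)
  also have "\<dots> = (\<Sum>i\<le>n. coeff (coeff f i) (n - i) * s ^ i * u ^ (n - i))"
    by (rule sum.cong[OF refl], subst c) (simp add: poly_monom mult_ac)
  finally show ?thesis .
qed

lemma dehom:
  assumes "form2 n f"
  shows "poly (dehom n f) s = eval2 f (s, 1)" "degree (dehom n f) \<le> n" "coeff (dehom n f) n = eval2 f (1, 0)"
proof -
  show "poly (dehom n f) s = eval2 f (s, 1)" 
    by (simp add: eval2_form2[OF assms] dehom_def poly_sum poly_monom)
  show "degree (dehom n f) \<le> n" unfolding dehom_def by (intro degree_sum_le) (auto intro: order_trans[OF degree_monom_le])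
  have "coeff (dehom n f) n = coeff (coeff f n) 0" by (simp add: dehom_def coeff_sum if_distrib cong: if_cong)
  also have "\<dots> = eval2 f (1, 0)" 
    unfolding eval2_form2[OF assms] by (subst sum.remove[of _ n]) (auto simp: power_0_left intro!: sum.neutral)
  finally show "coeff (dehom n f) n = eval2 f (1, 0)" .
qed

lemma eval2_scal:
  assumes "form2 n f" shows "eval2 f (c * s, c * u) = c ^ n * eval2 f (s, u)"
  unfolding eval2_form2[OF assms] sum_distrib_left
proof (rule sum.cong)
  fix i assume "i \<in> {..n}"
  then have "c ^ n = c ^ i * c ^ (n - i)" by (simp flip: power_add)
  then show "coeff (coeff f i) (n - i) * (c * s) ^ i * (c * u) ^ (n - i)
    = c ^ n * (coeff (coeff f i) (n - i) * s ^ i * u ^ (n - i))" by (simp add: power_mult_distrib mult_ac)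
qed simp

lemma card_simple_roots:
  fixes p :: "'a::alg_closed_field poly"
  assumes "p \<noteq> 0" "\<And>r. poly p r = 0 \<Longrightarrow> poly (pderiv p) r \<noteq> 0"
  shows "card {r. poly p r = 0} = degree p"
  using assms
proof (induction "degree p" arbitrary: p)
  case 0
  obtain c where c: "p = [:c:]" using 0(1) by (metis degree_eq_zeroE)
  then have "{r. poly p r = 0} = {}" using 0 by auto
  then show ?case by (simp add: c)
next
  case (Suc n)
  obtain r where r: "poly p r = 0" using alg_closed_imp_poly_has_root[of p] Suc(2) by auto
  then obtain q where q: "p = [:-r, 1:] * q" unfolding poly_eq_0_iff_dvd by (rule dvdE)
  have q0: "q \<noteq> 0" using Suc(3) q by auto
  have d: "degree p = Suc (degree q)" unfolding q using q0 by (subst degree_mult_eq) auto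
  have dp: "poly (pderiv p) s = (s - r) * poly (pderiv q) s + poly q s" for s
    unfolding q by (subst pderiv_mult) (simp add: pderiv_pCons algebra_simps)
  have qr: "poly q r \<noteq> 0" using Suc(4)[OF r] dp[of r] by simp
  have "card {s. poly q s = 0} = degree q"
  proof (rule Suc(1))
    show "n = degree q" using d Suc(2) by simp
    fix s assume s: "poly q s = 0"
    then have "poly p s = 0" by (simp add: q)
    from Suc(4)[OF this] show "poly (pderiv q) s \<noteq> 0" using dp[of s] s by auto
  qed (rule q0)
  moreover have "{s. poly p s = 0} = insert r {s. poly q s = 0}" by (auto simp: q)
  moreover have "finite {s. poly q s = 0}" using q0 by (rule poly_roots_finite)
  ultimately show ?case using qr d by simp
qed

text \<open>Differentiation lowers the order of \<open>h\<close> at a root by exactly one. If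
  \<open>g\<close> were nonzero there, the right-hand side would have larger order than the
  left.\<close>

lemma wronskian_root:
  fixes g h :: "'a::field_char_0 poly"
  assumes "g * pderiv h = pderiv g * h" "degree h > 0" "poly h r = 0"
  shows "poly g r = 0"
proof (rule ccontr)
  assume g: "poly g r \<noteq> 0"
  have h: "h \<noteq> 0" "pderiv h \<noteq> 0" using assms(2) by (auto simp: pderiv_eq_0_iff)
  have oh: "order r h = Suc (order r (pderiv h))"
    using order_pderiv[of h r] h assms(3) by (simp add: order_root)
  have "g * pderiv h \<noteq> 0" using g h by auto
  then have "order r g + order r (pderiv h) = order r (pderiv g) + order r h"
    using assms(1) order_mult by metis
  moreover have "order r g = 0" using g by (simp add: order_0I)
  ultimately show False using oh by simp
qed

text \<open>Project from the point (1,0,0), which is off the curve. A general line through it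
  belongs to \<open>n\<close> distinct parameters because the Wronskian is not zero; birationality
  makes their images distinct, and these lie among the at most three points of the cubic on that
  line.\<close>

lemma param_degree_le:
  fixes G :: "'a::{alg_closed_field,field_char_0} poly poly poly"
  assumes G: "form3 3 G" "eval3 G (1, 0, 0) \<noteq> 0"
    and \<phi>: "\<phi> = (f, g, h)" "form2 n f" "form2 n g" "form2 n h"
    and nz: "\<And>p. p \<noteq> (0, 0) \<Longrightarrow> eval_param \<phi> p \<noteq> (0, 0, 0)"
    and van: "\<And>p. p \<noteq> (0, 0) \<Longrightarrow> eval3 G (eval_param \<phi> p) = 0"
    and bir: "birational_onto_image \<phi>"
  shows "n \<le> 3"
proof (cases "n = 0")
  case False
  define f1 g1 h1 where "f1 = dehom n f" and "g1 = dehom n g" and "h1 = dehom n h"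
  have ev: "eval_param \<phi> (s, 1) = (poly f1 s, poly g1 s, poly h1 s)" for s
    by (simp add: \<phi> eval_param_def f1_def g1_def h1_def dehom)
  have ev': "eval_param \<phi> (1, 0) = (coeff f1 n, coeff g1 n, coeff h1 n)"
    by (simp add: \<phi> eval_param_def f1_def g1_def h1_def dehom)
  have x0: "eval3 G (x, 0, 0) = 0 \<Longrightarrow> x = 0" for x
    using eval3_scal[OF G(1), of x "(1, 0, 0)"] G(2) by auto
  have nocz: "poly g1 s \<noteq> 0 \<or> poly h1 s \<noteq> 0" for s
    using nz[of "(s, 1)"] van[of "(s, 1)"] x0[of "poly f1 s"] unfolding ev by auto
  have inf: "coeff g1 n \<noteq> 0 \<or> coeff h1 n \<noteq> 0"
    using nz[of "(1, 0)"] van[of "(1, 0)"] x0[of "coeff f1 n"] unfolding ev' by auto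
  define W where "W = g1 * pderiv h1 - pderiv g1 * h1"
  have W: "W \<noteq> 0"
  proof
    assume "W = 0"
    then have eq: "g1 * pderiv h1 = pderiv g1 * h1" by (simp add: W_def)
    have "degree h1 = 0"
      using wronskian_root[OF eq] nocz alg_closed_imp_poly_has_root[of h1] by fastforce
    moreover have "degree g1 = 0"
      using wronskian_root[of h1 g1] eq nocz alg_closed_imp_poly_has_root[of g1] by (fastforce simp: mult.commute)
    ultimately have "degree g1 = 0" "degree h1 = 0" by auto
    then show False using inf False by (simp add: coeff_eq_0)
  qed
  obtain m a b where ab: "form3 m a" "form3 m b"
    "\<exists>p. eval3 a (eval_param \<phi> p) \<noteq> 0 \<or> eval3 b (eval_param \<phi> p) \<noteq> 0"
    "\<And>s u. s * eval3 b (eval_param \<phi> (s, u)) = u * eval3 a (eval_param \<phi> (s, u))"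
    using bir unfolding birational_onto_image_def by blast
  define bP where "bP = ev3 (\<lambda>c. [:c:]) b f1 g1 h1"
  have bP: "poly bP s = eval3 b (eval_param \<phi> (s, 1))" for s by (simp add: bP_def poly_comp ev)
  have scal: "eval_param \<phi> (c * s, c * u) = scal (c ^ n) (eval_param \<phi> (s, u))" for c s u
    by (simp add: \<phi> eval_param_def eval2_scal)
  \<comment> \<open>If the denominator of the inverse vanished for all (s, 1), so would the
    numerator; homogeneity, and continuation to (1, 0), would then make both vanish
    identically.\<close>
  have "bP \<noteq> 0"
  proof
    assume "bP = 0"
    then have b0: "eval3 b (eval_param \<phi> (s, 1)) = 0" for s using bP by (metis poly_0)
    then have a0: "eval3 a (eval_param \<phi> (s, 1)) = 0" for s using ab(4)[of s 1] by simp
    have ab0: "eval3 a (eval_param \<phi> (s, u)) = 0 \<and> eval3 b (eval_param \<phi> (s, u)) = 0" if "u \<noteq> 0" for s u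
      using scal[of u "s / u" 1] that a0 b0 by (simp add: eval3_scal[OF ab(1)] eval3_scal[OF ab(2)])
    define f2 g2 h2 where "f2 = [:0, 1::'a:]" and "g2 = f2" and "h2 = f2"
    have *: "eval3 q (eval_param \<phi> (1, 0)) = 0" if "\<And>u. u \<noteq> 0 \<Longrightarrow> eval3 q (eval_param \<phi> (1, u)) = 0" for q
    proof -
      define r where "r f = (\<Sum>i\<le>n. monom (coeff (coeff f i) (n - i)) (n - i))" for f :: "'a poly poly"
      have r: "poly (r f) u = eval2 f (1, u)" if "form2 n f" for f u
        by (simp add: r_def eval2_form2[OF that] poly_sum poly_monom)
      define Q where "Q = ev3 (\<lambda>c. [:c:]) q (r f) (r g) (r h)"
      have Q: "poly Q u = eval3 q (eval_param \<phi> (1, u))" for u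
        by (simp add: Q_def poly_comp \<phi> eval_param_def r)
      have "poly ([:0, 1:] * Q) u = 0" for u using that[of u] Q[of u] by auto
      then have "[:0, 1:] * Q = 0" using poly_all_0_iff_0 by blast
      then have "Q = 0" by simp
      then show ?thesis using Q by (metis poly_0)
    qed
    have ab1: "eval3 a (eval_param \<phi> (1, 0)) = 0 \<and> eval3 b (eval_param \<phi> (1, 0)) = 0" using * ab0 by blast
    have "eval3 a (eval_param \<phi> (s, u)) = 0 \<and> eval3 b (eval_param \<phi> (s, u)) = 0" for s u
    proof (cases "u = 0")
      case True
      then show ?thesis using scal[of s 1 0] ab1 by (simp add: eval3_scal[OF ab(1)] eval3_scal[OF ab(2)])
    qed (rule ab0)
    then show False using ab(3) by auto
  qed
  \<comment> \<open>Excluded lines through the centre: the one through the image of (1 : 0), those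
    through ramification points of the projection (zeros of \<open>W\<close>), and those through
    points where both forms of the inverse vanish.\<close>
  define S where "S = {s. poly (W * bP) s = 0}"
  have "finite S" unfolding S_def using W \<open>bP \<noteq> 0\<close> by (intro poly_roots_finite) simp
  then have "finite (insert (coeff g1 n / coeff h1 n) ((\<lambda>s. poly g1 s / poly h1 s) ` S))" by simp
  from ex_new_if_finite[OF infinite_UNIV_char_0 this]
  obtain e where e: "e \<noteq> coeff g1 n / coeff h1 n" "\<And>s. s \<in> S \<Longrightarrow> e \<noteq> poly g1 s / poly h1 s"
    by blast
  define P where "P = g1 - smult e h1"
  have cP: "coeff P n \<noteq> 0" using e(1) inf by (cases "coeff h1 n = 0") (auto simp: P_def field_simps)
  have "degree g1 \<le> n" "degree h1 \<le> n" using \<phi> dehom by (auto simp: g1_def h1_def)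
  then have "degree P \<le> n" unfolding P_def by (meson degree_diff_le degree_smult_le order_trans)
  then have dP: "degree P = n" using cP le_degree by (metis antisym)
  have root: "poly h1 s \<noteq> 0 \<and> poly g1 s = e * poly h1 s \<and> s \<notin> S" if "poly P s = 0" for s
  proof -
    have 1: "poly g1 s = e * poly h1 s" using that by (simp add: P_def)
    then have 2: "poly h1 s \<noteq> 0" using nocz[of s] by auto
    with 1 e(2)[of s] show ?thesis by (auto simp: field_simps)
  qed
  have "card {s. poly P s = 0} = n" unfolding dP[symmetric]
  proof (rule card_simple_roots)
    show "P \<noteq> 0" using cP by auto
    fix s assume s: "poly P s = 0"
    show "poly (pderiv P) s \<noteq> 0"
    proof
      assume "poly (pderiv P) s = 0"
      then have "poly (pderiv g1) s = e * poly (pderiv h1) s" by (simp add: P_def pderiv_diff pderiv_smult)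
      then have "poly W s = 0" using root[OF s] by (simp add: W_def)
      then show False using root[OF s] by (simp add: S_def)
    qed
  qed
  moreover have "card {s. poly P s = 0} \<le> card {x. eval3 G (x, e, 1) = 0}"
  proof (rule card_inj_on_le)
    show "inj_on (\<lambda>s. poly f1 s / poly h1 s) {s. poly P s = 0}"
    proof (rule inj_onI)
      fix s t assume s: "s \<in> {s. poly P s = 0}" and t: "t \<in> {s. poly P s = 0}"
        and eq: "poly f1 s / poly h1 s = poly f1 t / poly h1 t"
      let ?x = "poly f1 s / poly h1 s"
      have 1: "eval_param \<phi> (s, 1) = scal (poly h1 s) (?x, e, 1)" using root[of s] s by (simp add: ev)
      have 2: "eval_param \<phi> (t, 1) = scal (poly h1 t) (?x, e, 1)" using root[of t] t by (simp add: ev eq)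
      have bs: "eval3 b (eval_param \<phi> (s, 1)) \<noteq> 0" and bt: "eval3 b (eval_param \<phi> (t, 1)) \<noteq> 0"
        using root s t by (auto simp: S_def simp flip: bP)
      have "eval3 b (?x, e, 1) \<noteq> 0" using bs unfolding 1 eval3_scal[OF ab(2)] by auto
      moreover have "s * eval3 b (?x, e, 1) = eval3 a (?x, e, 1)"
        using ab(4)[of s 1] bs unfolding 1 eval3_scal[OF ab(2)] eval3_scal[OF ab(1)] by auto
      moreover have "t * eval3 b (?x, e, 1) = eval3 a (?x, e, 1)"
        using ab(4)[of t 1] bt unfolding 2 eval3_scal[OF ab(2)] eval3_scal[OF ab(1)] by auto
      ultimately show "s = t" by (metis mult_right_cancel)
    qed
    show "(\<lambda>s. poly f1 s / poly h1 s) ` {s. poly P s = 0} \<subseteq> {x. eval3 G (x, e, 1) = 0}"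
    proof clarsimp
      fix s assume s: "poly P s = 0"
      have 1: "eval_param \<phi> (s, 1) = scal (poly h1 s) (poly f1 s / poly h1 s, e, 1)" using root[OF s] by (simp add: ev)
      show "eval3 G (poly f1 s / poly h1 s, e, 1) = 0"
        using van[of "(s, 1)"] root[OF s] unfolding 1 eval3_scal[OF G(1)] by auto
    qed
    obtain a b c d e' f g h i j where Gc: "G = cub a b c d e' f g h i j" using form3_3E[OF G(1)] .
    show fin: "finite {x. eval3 G (x, e, 1) = 0}"
      using poly_roots_finite[of "[:g*e^3+h*e^2+i*e+j, d*e^2+e'*e+f, b*e+c, a:]"] G(2)
      by (simp add: Gc algebra_simps power2_eq_square power3_eq_cube)
  qed
  moreover have "card {x. eval3 G (x, e, 1) = 0} \<le> 3"
  proof -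
    obtain a b c d e' f g h i j where Gc: "G = cub a b c d e' f g h i j" using form3_3E[OF G(1)] .
    show ?thesis
      using card_poly_roots_bound[of "[:g*e^3+h*e^2+i*e+j, d*e^2+e'*e+f, b*e+c, a:]"] G(2)
      by (simp add: Gc algebra_simps power2_eq_square power3_eq_cube)
  qed
  ultimately show ?thesis by simp
qed simp

lemma ex_col:
  fixes q :: "'a::field vec"
  assumes "q \<noteq> (0, 0, 0)"
  obtains M M' where "lininv M M'" "app M (1, 0, 0) = q"
proof -
  obtain a b c where q: "q = (a, b, c)" by (cases q)
  have "\<exists>M. det3 M \<noteq> 0 \<and> app M (1, 0, 0) = q"
  proof (cases "a = 0")
    case False
    then have "det3 ((a, 0, 0), (b, 1, 0), (c, 0, 1)) \<noteq> 0" by simp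
    then show ?thesis by (intro exI[of _ "((a, 0, 0), (b, 1, 0), (c, 0, 1))"] conjI) (simp_all add: q)
  next
    case a: True
    show ?thesis
    proof (cases "b = 0")
      case False
      then have "det3 ((a, 1, 0), (b, 0, 0), (c, 0, 1)) \<noteq> 0" by simp
      then show ?thesis by (intro exI[of _ "((a, 1, 0), (b, 0, 0), (c, 0, 1))"] conjI) (simp_all add: q)
    next
      case True
      then have "det3 ((a, 1, 0), (b, 0, 1), (c, 0, 0)) \<noteq> 0" using a assms by (simp add: q)
      then show ?thesis by (intro exI[of _ "((a, 1, 0), (b, 0, 1), (c, 0, 0))"] conjI) (simp_all add: q)
    qed
  qed
  then show ?thesis using that lininv_minv by blast
qed

lemma papp_cases:
  fixes M :: "'a::idom mat"
  assumes "\<phi> = (f, g, h)" "form2 n f" "form2 n g" "form2 n h"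
  obtains f' g' h' where "papp M \<phi> = (f', g', h')" "form2 n f'" "form2 n g'" "form2 n h'"
proof -
  obtain f' g' h' where "papp M \<phi> = (f', g', h')" by (cases "papp M \<phi>")
  with papp_form2[OF assms this] show ?thesis using that by blast
qed

lemma normalisation_zero:
  "normalisation \<phi> G \<Longrightarrow> p \<noteq> (0, 0) \<Longrightarrow> eval3 G (eval_param \<phi> p) = 0"
  unfolding normalisation_def image_is_alt line_to_plane_def
  by (smt (verit, best) case_prodE scal_1 zero_neq_one)

text \<open>Forms of degree at most one parametrise part of a line, and forms of degree two a conic,
  which would split off from the cubic. Together with the bound this leaves degree three.\<close>

lemma normalisation_cubic:
  fixes G :: "'a::{alg_closed_field,field_char_0} poly poly poly"
  assumes G: "form3 3 G" "irreducible G" and nor: "normalisation \<phi> G"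
  obtains f g h where "\<phi> = (f, g, h)" "form2 3 f" "form2 3 g" "form2 3 h"
    "\<And>r. r \<noteq> (0, 0, 0) \<Longrightarrow> \<exists>p. dot r (eval_param \<phi> p) \<noteq> 0"
proof -
  obtain f g h where \<phi>: "\<phi> = (f, g, h)" by (cases \<phi>)
  obtain n where n: "form2 n f" "form2 n g" "form2 n h" 
      "\<And>p. p \<noteq> (0, 0) \<Longrightarrow> eval_param \<phi> p \<noteq> (0, 0, 0)"
    using nor unfolding normalisation_def line_to_plane_def \<phi> by auto
  have van: "eval3 G (eval_param \<phi> (s, u)) = 0" for s u
  proof (cases "(s, u) = (0, 0)")
    case True
    have "eval_param \<phi> (0, 0) = scal (0 ^ n) (eval_param \<phi> (1, 0))"
      using eval2_scal[OF n(1), of 0 1 0] eval2_scal[OF n(2), of 0 1 0] eval2_scal[OF n(3), of 0 1 0]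
      by (simp add: \<phi> eval_param_def)
    then show ?thesis using True normalisation_zero[OF nor, of "(1, 0)"]
      by (simp add: eval3_scal[OF G(1)])
  qed (use normalisation_zero[OF nor] in blast)
  \<comment> \<open>A point off the curve, moved to (1,0,0), is the centre of the projection used in
    the degree bound.\<close>
  obtain q where q: "eval3 G q \<noteq> 0" using G(2) eval3_all_0[of G] by fastforce
  have "q \<noteq> (0, 0, 0)"
    using q eval3_scal[OF G(1), of 0 "(0,0,0)"] by auto
  then obtain M M' where M: "lininv M M'" "app M (1, 0, 0) = q" using ex_col by blast
  have nor': "normalisation (papp M' \<phi>) (subst3 M G)" using normalisation_subst[OF M(1) nor] .
  obtain f' g' h' where \<phi>': "papp M' \<phi> = (f', g', h')" "form2 n f'" "form2 n g'" "form2 n h'"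
    by (rule papp_cases[OF \<phi> n(1-3)])
  have n3: "n \<le> 3"
  proof (rule param_degree_le[of "subst3 M G" "papp M' \<phi>"])
    show "form3 3 (subst3 M G)" using G(1) by (rule form3_subst)
    show "eval3 (subst3 M G) (1, 0, 0) \<noteq> 0" using q M(2) by simp
    show "eval_param (papp M' \<phi>) p \<noteq> (0, 0, 0)" if "p \<noteq> (0, 0)" for p
      unfolding eval_papp using n(4)[OF that] lininv_nz[OF lininv_sym[OF M(1)]] by blast
    show "eval3 (subst3 M G) (eval_param (papp M' \<phi>) p) = 0" if "p \<noteq> (0, 0)" for p
      using normalisation_zero[OF nor' that] .
    show "birational_onto_image (papp M' \<phi>)" using nor' by (simp add: normalisation_def)
  qed (fact \<phi>')+
  have indep: "\<exists>p. dot r (eval_param \<phi> p) \<noteq> 0" if r: "r \<noteq> (0, 0, 0)" for r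
  proof (rule ccontr)
    assume "\<not> ?thesis"
    then have 0: "dot r (eval_param \<phi> p) = 0" for p by blast
    show False
    proof (rule irreducible_dependent[OF G(2,1) r])
      fix v :: "'a vec" assume "v \<noteq> (0, 0, 0)" "eval3 G v = 0"
      then obtain c p where "v = scal c (eval_param \<phi> p)"
        using nor unfolding normalisation_def image_is_alt by blast
      then show "dot r v = 0" using 0 by (simp add: dot_scal)
    qed
  qed
  define P where "P i = (coeff (coeff f i) (n - i), coeff (coeff g i) (n - i), coeff (coeff h i) (n - i))" for i
  have ev: "eval_param \<phi> (s, u) = ((\<Sum>i\<le>n. coeff (coeff f i) (n - i) * s ^ i * u ^ (n - i)),
    (\<Sum>i\<le>n. coeff (coeff g i) (n - i) * s ^ i * u ^ (n - i)), (\<Sum>i\<le>n. coeff (coeff h i) (n - i) * s ^ i * u ^ (n - i)))" for s u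
    by (simp add: \<phi> eval_param_def eval2_form2[OF n(1)] eval2_form2[OF n(2)] eval2_form2[OF n(3)])
  have dotP: "dot r (eval_param \<phi> (s, u)) = (\<Sum>i\<le>n. dot r (P i) * s ^ i * u ^ (n - i))" for r s u
    unfolding ev by (cases r) (simp add: P_def sum_distrib_left sum.distrib[symmetric] algebra_simps)
  have no_orth: "False" if "r \<noteq> (0, 0, 0)" "\<And>i. i \<le> n \<Longrightarrow> dot r (P i) = 0" for r
    using indep[OF that(1)] that(2) by (auto simp: dotP)
  have "n = 3"
  proof (rule ccontr)
    assume "n \<noteq> 3"
    then consider "n \<le> 1" | "n = 2" using n3 by linarith
    then show False
    proof cases
      case 1
      have "det3 (P 0, P 1, (0, 0, 0)) = 0" by (cases "P 0"; cases "P 1") simp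
      then obtain r where r: "r \<noteq> (0, 0, 0)" "dot r (P 0) = 0" "dot r (P 1) = 0" by (rule orth3)
      have "i \<le> n \<Longrightarrow> i = 0 \<or> i = 1" for i using 1 by linarith
      then show False using no_orth[OF r(1)] r by metis
    next
      case 2
      have det: "det3 (P 0, P 1, P 2) \<noteq> 0"
      proof
        assume "det3 (P 0, P 1, P 2) = 0"
        then obtain r where r: "r \<noteq> (0, 0, 0)" "dot r (P 0) = 0" "dot r (P 1) = 0" "dot r (P 2) = 0"
          by (rule orth3)
        have "i \<le> n \<Longrightarrow> i = 0 \<or> i = 1 \<or> i = 2" for i using 2 by linarith
        then show False using no_orth[OF r(1)] r by metis
      qed
      obtain f0 g0 h0 f1 g1 h1 f2 g2 h2 where 
        PP: "P 0 = (f0, g0, h0)" "P 1 = (f1, g1, h1)" "P 2 = (f2, g2, h2)"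
        by (cases "P 0"; cases "P 1"; cases "P 2")
      \<comment> \<open>The columns are \<open>P 2\<close>, \<open>P 1\<close>, \<open>P 0\<close>,
        so in the coordinates of \<open>N\<close> the image is the conic (s^2 : s u : u^2).\<close>
      define N where "N = ((f2, f1, f0), (g2, g1, g0), (h2, h1, h0))"
      have "det3 N = - det3 (P 0, P 1, P 2)" unfolding N_def PP by (simp add: algebra_simps)
      then have "det3 N \<noteq> 0" using det by simp
      then have N: "lininv N (minv N)" by (rule lininv_minv)
      have evN: "eval_param \<phi> (s, u) = app N (s^2, s * u, u^2)" for s u
        using PP unfolding ev by (simp add: 2 N_def P_def numeral_2_eq_2 algebra_simps)
      obtain a b c d e f g h i j where cub: "subst3 N G = cub a b c d e f g h i j" 
        using form3_3E form3_subst[OF G(1)] by blast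
      have "eval3 (subst3 N G) (s^2, s, 1) = 0" for s
        using evN[of s 1] van[of s 1] by simp
      moreover have "eval3 (subst3 N G) (s^2, s, 1) = poly [:j, i, h+f, g+e, d+c, b, a:] s" for s
        unfolding cub eval3_cub by (simp add: algebra_simps power2_eq_square power3_eq_cube)
      ultimately have "poly [:j, i, h+f, g+e, d+c, b, a:] s = 0" for s by metis
      then have "[:j, i, h+f, g+e, d+c, b, a:] = 0" using poly_all_0_iff_0 by blast
      then have co: "j = 0" "i = 0" "h = -f" "g = -e" "d = -c" "b = 0" "a = 0"
        by (simp_all add: add_eq_0_iff2)
      \<comment> \<open>The coefficient equations say that the cubic is a multiple of the equation x
        z - y^2 of the conic.\<close>
      have "subst3 N G = lin (c, e, f) * (var_x * var_z - var_y ^ 2)"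
        unfolding cub by (rule eval3_eqI) (simp add: co algebra_simps power2_eq_square power3_eq_cube)
      moreover have "\<not> lin (c, e, f) dvd 1" by (rule not_unit3) simp
      moreover have "\<not> (var_x * var_z - var_y ^ 2 :: 'a poly poly poly) dvd 1" by (rule not_unit3) simp
      ultimately show False using irreducible_subst[OF N G(2)] irreducibleD by blast
    qed
  qed
  with that[OF \<phi>] n indep show ?thesis by blast
qed

section \<open>Normalised parametrisations\<close>

type_synonym 'a bcub = "'a \<times> 'a \<times> 'a \<times> 'a"

fun bev :: "'a::comm_ring_1 bcub \<Rightarrow> 'a \<Rightarrow> 'a \<Rightarrow> 'a" where
  "bev (a, b, c, d) s u = a * s^3 + b * s^2 * u + c * s * u^2 + d * u^3"

lemma form2_3_bev:
  assumes "form2 3 f" obtains c where "\<And>s u. eval2 f (s, u) = bev c s u"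
  by (rule that[of "(coeff (coeff f 3) 0, coeff (coeff f 2) 1, coeff (coeff f 1) 2, coeff (coeff f 0) 3)"])
    (simp add: eval2_form2[OF assms] numeral_3_eq_3 numeral_2_eq_2 algebra_simps)

lemma bev_subst:
  obtains c' where "\<And>s u. bev c (a * s + b * u) (d * s + e * u) = bev c' s u"
proof -
  obtain c0 c1 c2 c3 where c: "c = (c0, c1, c2, c3)" by (cases c)
  show ?thesis
    by (rule that[of "(c0*a^3 + c1*a^2*d + c2*a*d^2 + c3*d^3,
      3*c0*a^2*b + c1*(a^2*e + 2*a*b*d) + c2*(b*d^2 + 2*a*d*e) + 3*c3*d^2*e,
      3*c0*a*b^2 + c1*(b^2*d + 2*a*b*e) + c2*(a*e^2 + 2*b*d*e) + 3*c3*d*e^2,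
      c0*b^3 + c1*b^2*e + c2*b*e^2 + c3*e^3)"])
      (simp add: c algebra_simps power2_eq_square power3_eq_cube)
qed

lemma bev_scale: obtains c' where "\<And>s u. m * bev c s u = bev c' s u"
proof -
  obtain c0 c1 c2 c3 where c: "c = (c0, c1, c2, c3)" by (cases c)
  show ?thesis by (rule that[of "(m*c0, m*c1, m*c2, m*c3)"]) (simp add: c algebra_simps)
qed

text \<open>The contact point sits at the parameter (1 : 0), so the pullback of \<open>E\<close> is
  a multiple of u^9. Of the normalisation only the incidence with \<open>G\<close> and the fact that
  the image spans the plane are retained; all three properties survive the changes of parameter
  below.\<close>

definition tparam :: "'a::field poly poly poly \<Rightarrow> 'a poly poly poly \<Rightarrow> 'a bcub \<Rightarrow> 'a bcub \<Rightarrow> 'a bcub \<Rightarrow> bool" where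
  "tparam E G f g h \<longleftrightarrow>
    (\<exists>c. c \<noteq> 0 \<and> (\<forall>s u. eval3 E (bev f s u, bev g s u, bev h s u) = c * u^9)) \<and>
    (\<forall>s u. eval3 G (bev f s u, bev g s u, bev h s u) = 0) \<and>
    (\<forall>r. r \<noteq> (0, 0, 0) \<longrightarrow> (\<exists>s u. dot r (bev f s u, bev g s u, bev h s u) \<noteq> 0))"

lemma monom_of_root_0:
  fixes p :: "'a::alg_closed_field poly"
  assumes "p \<noteq> 0" "\<And>r. poly p r = 0 \<Longrightarrow> r = 0"
  obtains c k where "c \<noteq> 0" "p = monom c k"
proof -
  obtain q where q: "p = [:- 0, 1:] ^ order 0 p * q" "\<not> [:- 0, 1:] dvd q"
    using order_decomp[OF assms(1), of 0] by blast
  have q0: "poly q 0 \<noteq> 0" using q(2) poly_eq_0_iff_dvd by blast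
  have "degree q = 0"
  proof (rule ccontr)
    assume "degree q \<noteq> 0"
    then obtain r where r: "poly q r = 0" using alg_closed_imp_poly_has_root by blast
    then have "poly p r = 0" by (subst q(1)) simp
    then show False using assms(2) r q0 by auto
  qed
  then obtain c where c: "q = [:c:]" by (metis degree_eq_zeroE)
  have "p = monom c (order 0 p)" by (subst q(1)) (simp add: c monom_altdef mult.commute)
  moreover have "c \<noteq> 0" using q0 c by auto
  ultimately show ?thesis using that by blast
qed

text \<open>The pullback of \<open>E\<close> is a binary form of degree nine with a single zero,
  hence a multiple of the ninth power of a linear form; a unimodular change of parameters turns that
  linear form into u.\<close>

lemma contact_param:
  fixes E :: "'a::{alg_closed_field,field_char_0} poly poly poly"
  assumes E: "form3 3 E" and C: "C \<in> max_tangent_cubics E"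
    and p: "p \<noteq> (0, 0, 0)" "eval3 E p = 0" "G0 \<in> C" "eval3 G0 p = 0"
  obtains G f g h k where "C = curve G" "form3 3 G" "G \<noteq> 0" "tparam E G f g h"
    "k \<noteq> 0" "p = scal k (bev f 1 0, bev g 1 0, bev h 1 0)"
proof -
  obtain G \<phi> where G: "C = curve G" "form3 3 G" "irreducible G" 
    and nor: "normalisation \<phi> G" and pre: "preimage_single_point \<phi> E"
    using C unfolding max_tangent_cubics_def by blast
  obtain f g h where \<phi>: "\<phi> = (f, g, h)" "form2 3 f" "form2 3 g" "form2 3 h"
    and indep: "\<And>r. r \<noteq> (0, 0, 0) \<Longrightarrow> \<exists>p. dot r (eval_param \<phi> p) \<noteq> 0"
    by (rule normalisation_cubic[OF G(2,3) nor]) blast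
  obtain F0 where F0: "\<And>s u. eval2 f (s, u) = bev F0 s u" by (rule form2_3_bev[OF \<phi>(2)]) blast
  obtain F1 where F1: "\<And>s u. eval2 g (s, u) = bev F1 s u" by (rule form2_3_bev[OF \<phi>(3)]) blast
  obtain F2 where F2: "\<And>s u. eval2 h (s, u) = bev F2 s u" by (rule form2_3_bev[OF \<phi>(4)]) blast
  have ev: "eval_param \<phi> (s, u) = (bev F0 s u, bev F1 s u, bev F2 s u)" for s u
    by (simp add: \<phi>(1) eval_param_def F0 F1 F2)
  obtain s0 u0 where su0: "(s0, u0) \<noteq> (0, 0)"
    and z: "\<And>s u. (s, u) \<noteq> (0, 0) \<Longrightarrow> eval3 E (eval_param \<phi> (s, u)) = 0 \<longleftrightarrow> (\<exists>c. c \<noteq> 0 \<and> (s, u) = (c * s0, c * u0))"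
    using pre unfolding preimage_single_point_def by blast
  obtain s1 u1 where d: "s0 * u1 - s1 * u0 = 1"
  proof (cases "s0 = 0")
    case True
    then show ?thesis using su0 that[of 0 "- 1 / u0"] that[of "-1 / u0" 0] by auto
  next
    case False
    then show ?thesis using that[of "1 / s0" 0] by simp
  qed
  obtain f' where f': "\<And>s u. bev F0 (s0 * s + s1 * u) (u0 * s + u1 * u) = bev f' s u" by (rule bev_subst) blast
  obtain g' where g': "\<And>s u. bev F1 (s0 * s + s1 * u) (u0 * s + u1 * u) = bev g' s u" by (rule bev_subst) blast
  obtain h' where h': "\<And>s u. bev F2 (s0 * s + s1 * u) (u0 * s + u1 * u) = bev h' s u" by (rule bev_subst) blast
  define \<psi> where "\<psi> s u = (bev f' s u, bev g' s u, bev h' s u)" for s u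
  have \<psi>: "\<psi> s u = eval_param \<phi> (s0 * s + s1 * u, u0 * s + u1 * u)" for s u
    by (simp add: \<psi>_def ev f' g' h')
  have inj: "(s0 * s + s1 * u, u0 * s + u1 * u) = (0, 0) \<longleftrightarrow> s = 0 \<and> u = 0" for s u
  proof
    assume "(s0 * s + s1 * u, u0 * s + u1 * u) = (0, 0)"
    then have "s0 * s + s1 * u = 0" "u0 * s + u1 * u = 0" by auto
    then have "(s0 * u1 - s1 * u0) * s = 0" "(s0 * u1 - s1 * u0) * u = 0" by Groebner_Basis.algebra+
    then show "s = 0 \<and> u = 0" using d by simp
  qed simp
  have zero: "eval3 E (\<psi> s u) = 0 \<longleftrightarrow> u = 0" if "\<not> (s = 0 \<and> u = 0)" for s u
  proof -
    have "eval3 E (\<psi> s u) = 0 \<longleftrightarrow> (\<exists>c. c \<noteq> 0 \<and> (s0 * s + s1 * u, u0 * s + u1 * u) = (c * s0, c * u0))"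
      unfolding \<psi> using z inj that by presburger
    also have "\<dots> \<longleftrightarrow> u = 0"
    proof
      assume "\<exists>c. c \<noteq> 0 \<and> (s0 * s + s1 * u, u0 * s + u1 * u) = (c * s0, c * u0)"
      then obtain c where "s0 * s + s1 * u = c * s0" "u0 * s + u1 * u = c * u0" by auto
      then have "(s0 * u1 - s1 * u0) * u = 0" by Groebner_Basis.algebra
      then show "u = 0" using d by simp
    next
      assume "u = 0" then show "\<exists>c. c \<noteq> 0 \<and> (s0 * s + s1 * u, u0 * s + u1 * u) = (c * s0, c * u0)"
        using that by (intro exI[of _ s]) auto
    qed
    finally show ?thesis .
  qed
  have \<psi>scal: "\<psi> (c * s) (c * u) = scal (c ^ 3) (\<psi> s u)" for c s u
    by (cases f'; cases g'; cases h') (simp add: \<psi>_def power_mult_distrib algebra_simps power2_eq_square power3_eq_cube)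
  \<comment> \<open>\<open>Pp\<close> and \<open>Qp\<close> are the pullback in the two charts. The
    first has no root except 0, so it is c w^k; the second does not vanish at 0, and comparing the
    charts forces k = 9.\<close>
  obtain Pp where Pp: "\<And>w. poly Pp w = eval3 E (\<psi> 1 w)"
  proof -
    obtain a0 a1 a2 a3 b0 b1 b2 b3 c0 c1 c2 c3 where 
      fgh: "f' = (a0,a1,a2,a3)" "g' = (b0,b1,b2,b3)" "h' = (c0,c1,c2,c3)" by (cases f'; cases g'; cases h')
    show ?thesis
      by (rule that[of "ev3 (\<lambda>c. [:c:]) E [:a0,a1,a2,a3:] [:b0,b1,b2,b3:] [:c0,c1,c2,c3:]"])
        (simp add: poly_comp \<psi>_def fgh algebra_simps power2_eq_square power3_eq_cube)
  qed
  obtain Qp where Qp: "\<And>w. poly Qp w = eval3 E (\<psi> w 1)"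
  proof -
    obtain a0 a1 a2 a3 b0 b1 b2 b3 c0 c1 c2 c3 where 
      fgh: "f' = (a0,a1,a2,a3)" "g' = (b0,b1,b2,b3)" "h' = (c0,c1,c2,c3)" by (cases f'; cases g'; cases h')
    show ?thesis
      by (rule that[of "ev3 (\<lambda>c. [:c:]) E [:a3,a2,a1,a0:] [:b3,b2,b1,b0:] [:c3,c2,c1,c0:]"])
        (simp add: poly_comp \<psi>_def fgh algebra_simps power2_eq_square power3_eq_cube)
  qed
  have "poly Pp 1 \<noteq> 0" using zero[of 1 1] by (simp add: Pp)
  then have "Pp \<noteq> 0" by auto
  moreover have "poly Pp r = 0 \<Longrightarrow> r = 0" for r using zero[of 1 r] by (simp add: Pp)
  ultimately obtain c k where ck: "c \<noteq> 0" "Pp = monom c k" using monom_of_root_0 by blast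
  have hom: "eval3 E (\<psi> (l * s) (l * u)) = l ^ 9 * eval3 E (\<psi> s u)" for l s u
    unfolding \<psi>scal eval3_scal[OF E] by (simp flip: power_mult)
  have "poly ([:0,1:] * (Qp * monom 1 k - monom c 9)) w = 0" for w
  proof (cases "w = 0")
    case False
    have "eval3 E (\<psi> w 1) = w ^ 9 * eval3 E (\<psi> 1 (1 / w))" using hom[of w 1 "1/w"] False by simp
    also have "\<dots> = w ^ 9 * (c * (1 / w) ^ k)" by (simp flip: Pp add: ck poly_monom)
    finally have "eval3 E (\<psi> w 1) * w ^ k = c * w ^ 9" using False by (simp add: power_divide)
    then show ?thesis by (simp add: Qp poly_monom)
  qed simp
  then have "[:0,1:] * (Qp * monom 1 k - monom c 9) = 0" using poly_all_0_iff_0 by blast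
  then have QQ: "Qp * monom 1 k = monom c 9" by simp
  have "coeff (Qp * monom 1 k) k = coeff Qp 0" by (simp add: coeff_monom_mult mult.commute[of Qp])
  moreover have "coeff Qp 0 \<noteq> 0" using zero[of 0 1] Qp[of 0] by (simp add: poly_0_coeff_0)
  ultimately have k9: "k = 9" unfolding QQ by (auto split: if_splits)
  have E\<psi>: "eval3 E (\<psi> s u) = c * u ^ 9" for s u
  proof (cases "s = 0")
    case False
    have "eval3 E (\<psi> s u) = s ^ 9 * eval3 E (\<psi> 1 (u / s))" using hom[of s 1 "u/s"] False by simp
    also have "\<dots> = s ^ 9 * (c * (u / s) ^ 9)" by (simp flip: Pp add: ck k9 poly_monom)
    finally show ?thesis using False by (simp add: power_divide)
  next
    case True
    have "Qp * monom 1 9 = [:c:] * monom 1 9" using QQ by (simp add: k9 smult_monom)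
    then have "Qp = [:c:]" by (metis monom_eq_0_iff mult_right_cancel zero_neq_one)
    then have "eval3 E (\<psi> 0 1) = c" using Qp[of 0] by simp
    then show ?thesis using hom[of u 0 1] True by simp
  qed
  have G\<psi>: "eval3 G (\<psi> s u) = 0" for s u
  proof (cases "s = 0 \<and> u = 0")
    case True
    have "\<psi> 0 0 = (0, 0, 0)" by (cases f'; cases g'; cases h') (simp add: \<psi>_def)
    then show ?thesis using True eval3_scal[OF G(2), of 0 "(0,0,0)"] by simp
  next
    case False
    then show ?thesis unfolding \<psi> using normalisation_zero[OF nor] inj by blast
  qed
  have ind: "\<exists>s u. dot r (\<psi> s u) \<noteq> 0" if r: "r \<noteq> (0, 0, 0)" for r
  proof -
    obtain s u where su: "dot r (eval_param \<phi> (s, u)) \<noteq> 0" using indep[OF r] by auto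
    have "s0 * (u1 * s - s1 * u) + s1 * (s0 * u - u0 * s) = (s0 * u1 - s1 * u0) * s"
      "u0 * (u1 * s - s1 * u) + u1 * (s0 * u - u0 * s) = (s0 * u1 - s1 * u0) * u"
      by (simp_all add: algebra_simps)
    then have "\<psi> (u1 * s - s1 * u) (s0 * u - u0 * s) = eval_param \<phi> (s, u)" by (simp add: \<psi> d)
    with su show ?thesis by metis
  qed
  have T: "tparam E G f' g' h'"
    using E\<psi> G\<psi> ind ck(1) unfolding tparam_def \<psi>_def by blast
  have "eval3 G p = 0"
    using p(3,4) unfolding G(1) curve_alt by auto
  then obtain p' c' where p': "p' \<noteq> (0, 0)" "c' \<noteq> 0" "p = scal c' (eval_param \<phi> p')"
    using nor p(1) unfolding normalisation_def image_is_alt by blast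
  obtain s u where su: "p' = (s, u)" by (cases p')
  have "eval3 E (eval_param \<phi> (s, u)) = 0" using p(2) p'(2) unfolding p'(3) su eval3_scal[OF E] by auto
  then obtain l where l: "l \<noteq> 0" "(s, u) = (l * s0, l * u0)" using z p'(1) su by blast
  have "eval_param \<phi> (s, u) = \<psi> (l * 1) (l * 0)" using l by (simp add: \<psi> mult.commute)
  then have "p = scal (c' * l ^ 3) (\<psi> 1 0)" unfolding p'(3) su \<psi>scal by simp
  moreover have "c' * l ^ 3 \<noteq> 0" using p' l by simp
  moreover have "G \<noteq> 0" using G(3) by auto
  ultimately show ?thesis using that[OF G(1,2) _ T, of "c' * l ^ 3"] unfolding \<psi>_def by blast
qed

lemma tparam_reparam:
  fixes E :: "'a::field_char_0 poly poly poly"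
  assumes T: "tparam E G f g h" and E: "form3 3 E" "form3 3 G" and nz: "a \<noteq> 0" "d \<noteq> 0" "m \<noteq> 0"
  obtains f' g' h' where "tparam E G f' g' h'"
    "\<And>s u. bev f' s u = m * bev f (a * s + b * u) (d * u)"
    "\<And>s u. bev g' s u = m * bev g (a * s + b * u) (d * u)"
    "\<And>s u. bev h' s u = m * bev h (a * s + b * u) (d * u)"
proof -
  have ex: "\<exists>c'. \<forall>s u. bev c' s u = m * bev c (a * s + b * u) (d * u)" for c
  proof -
    obtain c1 where c1: "\<And>s u. bev c (a * s + b * u) (0 * s + d * u) = bev c1 s u" by (rule bev_subst) blast
    obtain c2 where "\<And>s u. m * bev c1 s u = bev c2 s u" by (rule bev_scale) blast
    with c1 show ?thesis by (metis add_0 mult_zero_left)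
  qed
  obtain f' where f': "\<And>s u. bev f' s u = m * bev f (a * s + b * u) (d * u)" using ex by blast
  obtain g' where g': "\<And>s u. bev g' s u = m * bev g (a * s + b * u) (d * u)" using ex by blast
  obtain h' where h': "\<And>s u. bev h' s u = m * bev h (a * s + b * u) (d * u)" using ex by blast
  have sc: "(bev f' s u, bev g' s u, bev h' s u) = 
      scal m (bev f (a * s + b * u) (d * u), bev g (a * s + b * u) (d * u), bev h (a * s + b * u) (d * u))" for s u
    by (simp add: f' g' h')
  have "tparam E G f' g' h'" unfolding tparam_def
  proof (intro conjI allI impI)
    obtain c where "c \<noteq> 0" "\<And>s u. eval3 E (bev f s u, bev g s u, bev h s u) = c * u^9"
      using T unfolding tparam_def by blast
    then show "\<exists>c. c \<noteq> 0 \<and> (\<forall>s u. eval3 E (bev f' s u, bev g' s u, bev h' s u) = c * u^9)"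
      using nz unfolding sc eval3_scal[OF E(1)]
      by (intro exI[of _ "m^3 * c * d^9"]) (simp add: power_mult_distrib)
    show "eval3 G (bev f' s u, bev g' s u, bev h' s u) = 0" for s u
      using T unfolding sc eval3_scal[OF E(2)] tparam_def by simp
    fix r :: "'a vec" assume "r \<noteq> (0, 0, 0)"
    then obtain s u where su: "dot r (bev f s u, bev g s u, bev h s u) \<noteq> 0" using T unfolding tparam_def by blast
    have "a * ((s - b * (u / d)) / a) + b * (u / d) = s" "d * (u / d) = u" using nz by auto
    then have "dot r (bev f' ((s - b * (u / d)) / a) (u / d), bev g' ((s - b * (u / d)) / a) (u / d),
      bev h' ((s - b * (u / d)) / a) (u / d)) = m * dot r (bev f s u, bev g s u, bev h s u)"
      unfolding sc dot_scal by simp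
    then show "\<exists>s u. dot r (bev f' s u, bev g' s u, bev h' s u) \<noteq> 0" using su nz by (metis mult_eq_0_iff)
  qed
  with f' g' h' show ?thesis using that by blast
qed

section \<open>Local analysis of contact of order nine, and the nodal models of the tangent
  cubics\<close>

section \<open>Contact at a point that is not a flex\<close>

text \<open>Allows a power of the parameter to be cancelled before the leading coefficient is read
  off at 0.\<close>

lemma poly_eq_at_0:
  fixes P Q :: "'a::{idom,ring_char_0} poly"
  assumes "\<And>w. w \<noteq> 0 \<Longrightarrow> poly P w = poly Q w" shows "poly P 0 = poly Q 0"
proof -
  have "poly ([:0, 1:] * (P - Q)) w = 0" for w using assms[of w] by (cases "w = 0") auto
  then have "[:0, 1:] * (P - Q) = 0" using poly_all_0_iff_0 by blast
  then have "P = Q" by simp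
  then show ?thesis by simp
qed

text \<open>The point is (1,0,0); its tangent y = 0 meets the curve again in (0,0,1), whose tangent
  is x = 0, and \<open>R \<noteq> 0\<close> says that (1,0,0) is not a flex. The first coefficients
  of the pullback show that the branch is smooth with simple tangency to y = 0; the remaining
  freedom of parameters then normalises y to s u^2 and z to s^2 u + k1 s u^2 + k2 u^3.\<close>

lemma nonflex_normalise:
  fixes R :: "'a::field_char_0"
  assumes E: "E = cub 0 1 0 be al R ga de 0 0" and R: "R \<noteq> 0"
    and T: "tparam E G f g h" and G: "form3 3 G"
    and p: "bev f 1 0 \<noteq> 0" "bev g 1 0 = 0" "bev h 1 0 = 0"
  obtains f0 f1 f2 f3 k1 k2 where "tparam E G (f0, f1, f2, f3) (0, 0, 1, 0) (0, 1, k1, k2)" "f0 \<noteq> 0"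
proof -
  obtain f0 f1 f2 f3 g1 g2 g3 h1 h2 h3 where f: "f = (f0, f1, f2, f3)" and g: "g = (0, g1, g2, g3)"
    and h: "h = (0, h1, h2, h3)" using p by (cases f; cases g; cases h) auto
  have f0: "f0 \<noteq> 0" using p f by simp
  obtain c where c: "\<And>s u. eval3 E (bev f s u, bev g s u, bev h s u) = c * u^9"
    using T unfolding tparam_def by blast
  define F where "F = [:f0, f1, f2, f3:]"
  have ev: "bev f 1 w = poly F w" "bev g 1 w = w * (g1 + w * g2 + w^2 * g3)" 
    "bev h 1 w = w * (h1 + w * h2 + w^2 * h3)" for w
    by (simp_all add: f g h F_def algebra_simps power2_eq_square power3_eq_cube)
  have F0: "poly F 0 = f0" by (simp add: F_def)
  have id: "(poly F w)^2 * b + be * poly F w * w * b^2 + al * poly F w * w * b * h + R * poly F w * w * h^2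
      + ga * w^2 * b^3 + de * w^2 * b^2 * h = c * w^8"
    if "w \<noteq> 0" "b = g1 + w * g2 + w^2 * g3" "h = h1 + w * h2 + w^2 * h3" for w b h
  proof -
    have "w * ((poly F w)^2 * b + be * poly F w * w * b^2 + al * poly F w * w * b * h + R * poly F w * w * h^2
      + ga * w^2 * b^3 + de * w^2 * b^2 * h) = c * w^9"
      using c[of 1 w] unfolding ev that(2,3)[symmetric] E eval3_cub by (simp add: algebra_simps power2_eq_square power3_eq_cube)
    also have "\<dots> = w * (c * w^8)" by (simp add: eval_nat_numeral)
    finally show ?thesis using that(1) by (metis mult_left_cancel)
  qed
  have "poly (F^2 * [:g1, g2, g3:] + smult be (F * [:0, 1:] * [:g1, g2, g3:]^2) 
      + smult al (F * [:0, 1:] * [:g1, g2, g3:] * [:h1, h2, h3:]) + smult R (F * [:0, 1:] * [:h1, h2, h3:]^2) 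
      + smult ga ([:0, 1:]^2 * [:g1, g2, g3:]^3) + smult de ([:0, 1:]^2 * [:g1, g2, g3:]^2 * [:h1, h2, h3:])) 0
    = poly ([:c:] * [:0, 1:]^8) 0"
  proof (rule poly_eq_at_0)
    fix w :: 'a assume w: "w \<noteq> 0"
    have 1: "poly [:g1, g2, g3:] w = g1 + w * g2 + w^2 * g3" "poly [:h1, h2, h3:] w = h1 + w * h2 + w^2 * h3"
      by (simp_all add: algebra_simps power2_eq_square)
    have 2: "poly [:0, 1:] w = w" "poly [:c:] w = c" by simp_all
    show "poly (F^2 * [:g1, g2, g3:] + smult be (F * [:0, 1:] * [:g1, g2, g3:]^2) 
      + smult al (F * [:0, 1:] * [:g1, g2, g3:] * [:h1, h2, h3:]) + smult R (F * [:0, 1:] * [:h1, h2, h3:]^2) 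
      + smult ga ([:0, 1:]^2 * [:g1, g2, g3:]^3) + smult de ([:0, 1:]^2 * [:g1, g2, g3:]^2 * [:h1, h2, h3:])) w
      = poly ([:c:] * [:0, 1:]^8) w"
      using id[OF w 1] unfolding poly_add poly_mult poly_smult poly_power 2 by (simp add: mult.assoc)
  qed
  then have g1: "g1 = 0" using f0 by (simp add: F0)
  have id2: "(poly F w)^2 * b + be * poly F w * w^2 * b^2 + al * poly F w * w * b * h + R * poly F w * h^2
      + ga * w^4 * b^3 + de * w^3 * b^2 * h = c * w^7"
    if "w \<noteq> 0" "b = g2 + w * g3" "h = h1 + w * h2 + w^2 * h3" for w b h
  proof -
    have b: "w * b = g1 + w * g2 + w^2 * g3" by (simp add: that g1 algebra_simps power2_eq_square)
    have "w * ((poly F w)^2 * b + be * poly F w * w^2 * b^2 + al * poly F w * w * b * h + R * poly F w * h^2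
      + ga * w^4 * b^3 + de * w^3 * b^2 * h) = w * (c * w^7)"
      using id[OF that(1) b that(3)] by (simp add: algebra_simps eval_nat_numeral)
    then show ?thesis using that(1) by (metis mult_left_cancel)
  qed
  have "poly (F^2 * [:g2, g3:] + smult be (F * [:0, 1:]^2 * [:g2, g3:]^2) 
      + smult al (F * [:0, 1:] * [:g2, g3:] * [:h1, h2, h3:]) + smult R (F * [:h1, h2, h3:]^2) 
      + smult ga ([:0, 1:]^4 * [:g2, g3:]^3) + smult de ([:0, 1:]^3 * [:g2, g3:]^2 * [:h1, h2, h3:])) 0
    = poly ([:c:] * [:0, 1:]^7) 0"
  proof (rule poly_eq_at_0)
    fix w :: 'a assume w: "w \<noteq> 0"
    have 1: "poly [:g2, g3:] w = g2 + w * g3" "poly [:h1, h2, h3:] w = h1 + w * h2 + w^2 * h3"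
      by (simp_all add: algebra_simps power2_eq_square)
    have 2: "poly [:0, 1:] w = w" "poly [:c:] w = c" by simp_all
    show "poly (F^2 * [:g2, g3:] + smult be (F * [:0, 1:]^2 * [:g2, g3:]^2) 
      + smult al (F * [:0, 1:] * [:g2, g3:] * [:h1, h2, h3:]) + smult R (F * [:h1, h2, h3:]^2) 
      + smult ga ([:0, 1:]^4 * [:g2, g3:]^3) + smult de ([:0, 1:]^3 * [:g2, g3:]^2 * [:h1, h2, h3:])) w
      = poly ([:c:] * [:0, 1:]^7) w"
      using id2[OF w 1] unfolding poly_add poly_mult poly_smult poly_power 2 by (simp add: mult.assoc)
  qed
  then have "f0 * (f0 * g2 + R * h1^2) = 0" by (simp add: F0 algebra_simps power2_eq_square)
  then have gh: "f0 * g2 = - R * h1^2" using f0 by (simp add: add_eq_0_iff2)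
  \<comment> \<open>For \<open>h1 = 0\<close> the next coefficient gives \<open>g3 = 0\<close>, and
    y would vanish on the whole curve.\<close>
  have h1: "h1 \<noteq> 0"
  proof
    assume h1: "h1 = 0"
    then have g2: "g2 = 0" using gh f0 by simp
    have "poly (F^2 * [:g3:] + smult be (F * [:0, 1:]^3 * [:g3:]^2) 
        + smult al (F * [:0, 1:]^2 * [:g3:] * [:h2, h3:]) + smult R (F * [:0, 1:] * [:h2, h3:]^2) 
        + smult ga ([:0, 1:]^6 * [:g3:]^3) + smult de ([:0, 1:]^5 * [:g3:]^2 * [:h2, h3:])) 0
      = poly ([:c:] * [:0, 1:]^6) 0"
    proof (rule poly_eq_at_0)
      fix w :: 'a assume w: "w \<noteq> 0"
      have "w * poly (F^2 * [:g3:] + smult be (F * [:0, 1:]^3 * [:g3:]^2) 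
        + smult al (F * [:0, 1:]^2 * [:g3:] * [:h2, h3:]) + smult R (F * [:0, 1:] * [:h2, h3:]^2) 
        + smult ga ([:0, 1:]^6 * [:g3:]^3) + smult de ([:0, 1:]^5 * [:g3:]^2 * [:h2, h3:])) w
        = w * poly ([:c:] * [:0, 1:]^6) w"
        using id2[OF w refl refl] by (simp add: g2 h1 algebra_simps eval_nat_numeral)
      then show "poly (F^2 * [:g3:] + smult be (F * [:0, 1:]^3 * [:g3:]^2) 
        + smult al (F * [:0, 1:]^2 * [:g3:] * [:h2, h3:]) + smult R (F * [:0, 1:] * [:h2, h3:]^2) 
        + smult ga ([:0, 1:]^6 * [:g3:]^3) + smult de ([:0, 1:]^5 * [:g3:]^2 * [:h2, h3:])) w
        = poly ([:c:] * [:0, 1:]^6) w" using w by (metis mult_left_cancel)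
    qed
    then have "g3 = 0" using f0 by (simp add: F0)
    then have "dot (0, 1, 0) (bev f s u, bev g s u, bev h s u) = 0" for s u by (simp add: g g1 g2)
    then show False using T unfolding tparam_def by (metis prod.inject zero_neq_one)
  qed
  have g2: "g2 \<noteq> 0" using gh h1 R by auto
  \<comment> \<open>After scaling by 1/d^2, the value of \<open>a\<close> and a shift that absorbs
    \<open>g3\<close> turn y into s u^2; the value \<open>d = h1 * a^2\<close> then makes the
    coefficient of s^2 u in z equal to 1.\<close>
  define a d where "a = 1 / g2" and "d = h1 / g2^2"
  have ad: "a \<noteq> 0" "d \<noteq> 0" "1 / d^2 \<noteq> 0" using g2 h1 by (simp_all add: a_def d_def)
  obtain f' g' h' where T': "tparam E G f' g' h'"
    and f': "\<And>s u. bev f' s u = 1 / d^2 * bev f (a * s + (- g3 * d / g2) * u) (d * u)"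
    and g': "\<And>s u. bev g' s u = 1 / d^2 * bev g (a * s + (- g3 * d / g2) * u) (d * u)"
    and h': "\<And>s u. bev h' s u = 1 / d^2 * bev h (a * s + (- g3 * d / g2) * u) (d * u)"
    using tparam_reparam[OF T _ G ad, of "- g3 * d / g2"] by (simp add: E) blast
  have g'': "bev g' s u = bev (0, 0, 1, 0) s u" for s u
  proof -
    have "g2 * (a * s + (- g3 * d / g2) * u) + g3 * (d * u) = s" using g2 by (simp add: a_def field_simps)
    moreover have "bev g' s u = u^2 * (g2 * (a * s + (- g3 * d / g2) * u) + g3 * (d * u))"
      unfolding g' g g1 bev.simps using ad(2) by (simp add: field_simps power2_eq_square power3_eq_cube)
    ultimately show ?thesis by simp
  qed
  obtain k1 k2 where h'': "h' = (0, 1, k1, k2)"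
  proof -
    obtain x0 x1 x2 x3 where x: "h' = (x0, x1, x2, x3)" by (cases h')
    have "poly [:x0, x1, x2, x3:] w = poly (smult (1 / d^2) (smult (d * h1) ([:0, 1:] * [:a, - g3 * d / g2:]^2)
      + smult (d^2 * h2) ([:0, 1:]^2 * [:a, - g3 * d / g2:]) + smult (d^3 * h3) ([:0, 1:]^3))) w" for w
    proof -
      have "poly [:x0, x1, x2, x3:] w = bev h' 1 w" by (simp add: x algebra_simps power2_eq_square power3_eq_cube)
      also have "\<dots> = 1 / d^2 * bev h (a + (- g3 * d / g2) * w) (d * w)" by (simp add: h')
      also have "\<dots> = 1 / d^2 * (d * h1 * (w * (a + (- g3 * d / g2) * w)^2) + 
          d^2 * h2 * (w^2 * (a + (- g3 * d / g2) * w)) + d^3 * h3 * w^3)"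
        unfolding h bev.simps by (simp add: algebra_simps power_mult_distrib)
      finally show ?thesis by (simp add: algebra_simps)
    qed
    then have eq: "[:x0, x1, x2, x3:] = smult (1 / d^2) (smult (d * h1) ([:0, 1:] * [:a, - g3 * d / g2:]^2)
      + smult (d^2 * h2) ([:0, 1:]^2 * [:a, - g3 * d / g2:]) + smult (d^3 * h3) ([:0, 1:]^3))" 
      using poly_eq_poly_eq_iff by blast
    have "x0 = 0" using arg_cong[OF eq, of "\<lambda>p. coeff p 0"] by (simp add: power2_eq_square power3_eq_cube)
    moreover have "x1 = h1 * a^2 / d" using arg_cong[OF eq, of "\<lambda>p. coeff p 1"] ad(2)
      by (simp add: power2_eq_square power3_eq_cube)
    then have "x1 = 1" using g2 h1 by (simp add: a_def d_def power2_eq_square)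
    ultimately show ?thesis using that x by simp
  qed
  obtain y0 y1 y2 y3 where y: "f' = (y0, y1, y2, y3)" by (cases f')
  have "y0 = bev f' 1 0" by (simp add: y)
  also have "\<dots> = 1 / d^2 * (f0 * a^3)" unfolding f' by (simp add: f)
  finally have "y0 \<noteq> 0" using ad f0 by simp
  moreover have "tparam E G (y0, y1, y2, y3) (0, 0, 1, 0) (0, 1, k1, k2)"
    using T' unfolding tparam_def g'' h'' y .
  ultimately show ?thesis using that by blast
qed

text \<open>These are the coefficients of the pullback of \<open>E\<close> at s = 1. With y = u^2
  and z = u + k1 u^2 + k2 u^3 the quadratic form be y^2 + al y z + R z^2 becomes u^2 (R + q1 u + q2
  u^2 + q3 u^3 + q4 u^4), which explains the four abbreviations.\<close>

lemma nonflex_equations: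
  fixes R :: "'a::field_char_0"
  assumes E: "E = cub 0 1 0 be al R ga de 0 0" and R: "R \<noteq> 0"
    and T: "tparam E G (f0, f1, f2, f3) (0, 0, 1, 0) (0, 1, k1, k2)" and f0: "f0 \<noteq> 0"
  defines "q1 \<equiv> 2*R*k1 + al" and "q2 \<equiv> R*(k1^2 + 2*k2) + al*k1 + be" and "q3 \<equiv> 2*R*k1*k2 + al*k2"
    and "q4 \<equiv> R*k2^2"
  shows "f0 = -R" "f1 = -q1" "f2 = -q2" "R * (f3 + q3) = de" "f3 \<noteq> 0" "k2 \<noteq> 0"
    "f3 * (f3 + q3) = q2 * q4" "q1 * (f3 + q3) + R * q4 = ga + de * k1" "q2 * (f3 + q3) + q1 * q4 = de * k2"
proof -
  obtain c where c: "c \<noteq> 0" "\<And>s u. eval3 E (bev (f0, f1, f2, f3) s u, bev (0, 0, 1, 0) s u, bev (0, 1, k1, k2) s u) = c * u^9"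
    using T unfolding tparam_def by blast
  have "poly [:0, 0, f0^2 + f0*R, 2*f0*f1 + f0*q1 + f1*R, f1^2 + 2*f0*f2 + f0*q2 + f1*q1 + f2*R,
      2*f0*f3 + 2*f1*f2 + f0*q3 + f1*q2 + f2*q1 + f3*R + de,
      f2^2 + 2*f1*f3 + f0*q4 + f1*q3 + f2*q2 + f3*q1 + ga + de*k1,
      2*f2*f3 + f1*q4 + f2*q3 + f3*q2 + de*k2, f3^2 + f2*q4 + f3*q3, f3*q4 - c:] w = 0" for w
    using c(2)[of 1 w] unfolding E eval3_cub bev.simps poly_pCons poly_0 q1_def q2_def q3_def q4_def
    by (simp only: power_one mult_1_right mult_1_left mult_zero_left add_0_left add_0_right mult_zero_right,
      Groebner_Basis.algebra)
  then have "[:0, 0, f0^2 + f0*R, 2*f0*f1 + f0*q1 + f1*R, f1^2 + 2*f0*f2 + f0*q2 + f1*q1 + f2*R,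
      2*f0*f3 + 2*f1*f2 + f0*q3 + f1*q2 + f2*q1 + f3*R + de,
      f2^2 + 2*f1*f3 + f0*q4 + f1*q3 + f2*q2 + f3*q1 + ga + de*k1,
      2*f2*f3 + f1*q4 + f2*q3 + f3*q2 + de*k2, f3^2 + f2*q4 + f3*q3, f3*q4 - c:] = 0"
    using poly_all_0_iff_0 by blast
  then have w: "f0^2 + f0*R = 0" "2*f0*f1 + f0*q1 + f1*R = 0" "f1^2 + 2*f0*f2 + f0*q2 + f1*q1 + f2*R = 0"
      "2*f0*f3 + 2*f1*f2 + f0*q3 + f1*q2 + f2*q1 + f3*R + de = 0"
      "f2^2 + 2*f1*f3 + f0*q4 + f1*q3 + f2*q2 + f3*q1 + ga + de*k1 = 0"
      "2*f2*f3 + f1*q4 + f2*q3 + f3*q2 + de*k2 = 0" "f3^2 + f2*q4 + f3*q3 = 0" "f3*q4 = c"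
    unfolding pCons_eq_0_iff by simp_all
  have "f0 * (f0 + R) = 0" using w(1) by (simp add: algebra_simps power2_eq_square)
  then show f0': "f0 = -R" using f0 by (simp add: add_eq_0_iff2)
  have "R * (f1 + q1) = 0" using w(2) unfolding f0' by Groebner_Basis.algebra
  then show f1: "f1 = -q1" using R by (simp add: add_eq_0_iff2)
  have "R * (f2 + q2) = 0" using w(3) unfolding f0' f1 by Groebner_Basis.algebra
  then show f2: "f2 = -q2" using R by (simp add: add_eq_0_iff2)
  show "R * (f3 + q3) = de" using w(4) unfolding f0' f1 f2 by Groebner_Basis.algebra
  show "f3 \<noteq> 0" using w(8) c(1) by auto
  show "k2 \<noteq> 0" using w(8) c(1) by (auto simp: q4_def)
  show "f3 * (f3 + q3) = q2 * q4" using w(7) unfolding f2 by Groebner_Basis.algebra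
  show "q1 * (f3 + q3) + R * q4 = ga + de * k1" using w(5) unfolding f0' f1 f2 by Groebner_Basis.algebra
  show "q2 * (f3 + q3) + q1 * q4 = de * k2" using w(6) unfolding f0' f1 f2 by Groebner_Basis.algebra
qed

text \<open>The point (0,1,0) lies on the tangent x = 0 at (0,0,1). With \<open>de = 0\<close> this
  tangent would have contact at least three; for \<open>ga = 0\<close>, when (0,1,0) is on the
  curve, \<open>be = 0\<close> says that its own tangent passes through (1,0,0). So three successive
  tangents close up.\<close>

lemma nonflex_tangential:
  fixes R :: "'a::field_char_0"
  assumes E: "E = cub 0 1 0 be al R ga de 0 0" and R: "R \<noteq> 0"
    and T: "tparam E G (f0, f1, f2, f3) (0, 0, 1, 0) (0, 1, k1, k2)" and f0: "f0 \<noteq> 0"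
  shows "de \<noteq> 0" and "ga = 0 \<Longrightarrow> be = 0"
proof -
  define q1 where "q1 = 2*R*k1 + al"
  define q2 where "q2 = R*(k1^2 + 2*k2) + al*k1 + be"
  define q4 where "q4 = R*k2^2"
  define sg where "sg = f3 + k2 * q1"
  note e = nonflex_equations[OF E R T f0]
  have q3: "2*R*k1*k2 + al*k2 = k2 * q1" by (simp add: q1_def algebra_simps)
  have e': "R * sg = de" "f3 \<noteq> 0" "k2 \<noteq> 0" "f3 * sg = q2 * q4" "q1 * sg + R * q4 = ga + de * k1"
    "q2 * sg + q1 * q4 = de * k2"
    using e(4-9) unfolding q3 by (simp_all add: q1_def q2_def q4_def sg_def)
  show de: "de \<noteq> 0"
  proof
    assume "de = 0"
    then have s: "sg = 0" using e'(1) R by simp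
    have q4: "q4 \<noteq> 0" using R e'(3) by (simp add: q4_def)
    then have "q2 = 0" using e'(4) s by simp
    then have "q1 = 0" using e'(6) s \<open>de = 0\<close> q4 by simp
    then have "f3 = 0" using s by (simp add: sg_def)
    then show False using e'(2) by simp
  qed
  assume ga: "ga = 0"
  have s0: "sg \<noteq> 0" using e'(1) de by auto
  have f3: "f3 = sg - k2 * q1" by (simp add: sg_def)
  \<comment> \<open>Eliminating \<open>q2\<close> between its two equations produces a common factor
    \<open>f3\<close>; what remains, sg^2 = R^2 k2^3, is the relation from which
    \<open>be = 0\<close> follows.\<close>
  have "f3 * sg^2 = q4 * (q2 * sg)" using e'(4) by (simp add: power2_eq_square mult_ac)
  also have "q2 * sg = R * sg * k2 - q1 * q4" using e'(6,1) by (simp add: algebra_simps)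
  also have "q4 * (R * sg * k2 - q1 * q4) = R^2 * k2^3 * f3" unfolding q4_def f3 by Groebner_Basis.algebra
  finally have s2: "sg^2 = R^2 * k2^3" using e'(2) by simp
  have a: "q1 * sg = R * sg * k1 - R * q4" using e'(5,1) ga by (simp add: algebra_simps)
  have b: "q2 * sg = R * sg * k2 - q1 * q4" using e'(6,1) by (simp add: algebra_simps)
  have "be * sg^2 = 0"
    using a b s2 unfolding q1_def q2_def q4_def by Groebner_Basis.algebra
  then show "be = 0" using s0 by simp
qed

section \<open>Rational cubics with a distinguished node\<close>

text \<open>If \<open>q\<close> and \<open>c\<close> have no common factor, the cubic \<open>x q(y, z) = c(y, z)\<close> is parametrised by
  \<open>(t : u) \<mapsto> (c(t, u) : t q(t, u) : u q(t, u))\<close>, with inverse \<open>(y : z)\<close>.\<close>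

definition nodal :: "'a::comm_ring_1 \<Rightarrow> 'a \<Rightarrow> 'a bcub \<Rightarrow> 'a poly poly poly" where
  "nodal q1 q2 = (\<lambda>(c0, c1, c2, c3). cub 0 0 0 1 q1 q2 (-c0) (-c1) (-c2) (-c3))"

lemma eval3_nodal: "eval3 (nodal q1 q2 c) (x, y, z) = x * (y^2 + q1*y*z + q2*z^2) - bev c y z"
  by (cases c) (simp add: nodal_def algebra_simps)

text \<open>The cubic is linear in x, so it suffices that its two coefficients have no common
  factor. The hypothesis is a Bezout certificate: a common factor divides z^4, so it does not
  involve y, and as it divides a quadratic monic in y it is a unit.\<close>

lemma irreducible_nodal:
  fixes q1 q2 :: "'a::field_char_0"
  assumes "A * [:[:0, 0, q2:], [:0, q1:], 1:] + B * [:[:0, 0, 0, c3:], [:0, 0, c2:], [:0, c1:], [:c0:]:]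
    = [:[:0, 0, 0, 0, 1:]:]"
  shows "irreducible (nodal q1 q2 (c0, c1, c2, c3))"
proof -
  define Q where "Q = [:[:0, 0, q2:], [:0, q1:], 1:]"
  define D where "D = [:[:0, 0, 0, c3:], [:0, 0, c2:], [:0, c1:], [:c0:]:]"
  have G: "nodal q1 q2 (c0, c1, c2, c3) = [:-D, Q:]"
    by (rule eval3_eqI, subst eval3_nodal) (simp add: eval3_def Q_def D_def algebra_simps power2_eq_square power3_eq_cube)
  have unit: "[:d:] dvd 1" if dQ: "d dvd Q" and dD: "d dvd D" for d
  proof -
    have "d dvd A * Q + B * D" using that by (simp add: dvd_add)
    then obtain e where e: "[:[:0, 0, 0, 0, 1:]:] = d * e" unfolding assms[folded Q_def D_def] by (rule dvdE)
    then have "d \<noteq> 0" "e \<noteq> 0" by auto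
    from degree_mult_eq[OF this] have "degree d + degree e = degree [:[:0, 0, 0, 0, 1 :: 'a:]:]" unfolding e by (rule sym)
    then have "degree d + degree e = 0" by simp
    then obtain d0 where d0: "d = [:d0:]" by (metis add_is_0 degree_eq_zeroE)
    obtain r where "Q = [:d0:] * r" using dQ unfolding d0 by (rule dvdE)
    then have "coeff Q 2 = d0 * coeff r 2" by simp
    then have "1 = d0 * coeff r 2" by (simp add: Q_def numeral_2_eq_2)
    then have "[:[:d0:]:] * [:[:coeff r 2:]:] = 1" by (simp add: one_pCons)
    then show ?thesis unfolding d0 by (rule dvdI[OF sym])
  qed
  have unit_a: "a dvd 1" if a0: "degree a = 0" and ab: "[:-D, Q:] = a * b" for a b :: "'a poly poly poly"
  proof -
    obtain d where d: "a = [:d:]" using a0 by (rule degree_eq_zeroE)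
    have D: "-D = d * coeff b 0"
      using arg_cong[OF ab, of "\<lambda>p. coeff p 0"] unfolding d by simp
    have Q: "Q = d * coeff b 1"
      using arg_cong[OF ab, of "\<lambda>p. coeff p 1"] unfolding d by simp
    have "d dvd -D" unfolding D by (rule dvd_triv_left)
    then have "d dvd D" by simp
    moreover have "d dvd Q" unfolding Q by (rule dvd_triv_left)
    ultimately have "[:d:] dvd 1" using unit by blast
    then show ?thesis unfolding d .
  qed
  show ?thesis unfolding G
  proof (rule irreducibleI)
    show "[:-D, Q:] \<noteq> 0" by (simp add: Q_def)
    show "\<not> [:-D, Q:] dvd 1" by (rule not_unit3) (simp add: eval3_def D_def)
    fix a b assume ab: "[:-D, Q:] = a * b"
    then have "a \<noteq> 0" "b \<noteq> 0" by (auto simp: Q_def)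
    from degree_mult_eq[OF this] have "degree a + degree b = degree [:-D, Q:]" unfolding ab by (rule sym)
    also have "\<dots> = 1" by (simp add: Q_def)
    finally have deg: "degree a + degree b = 1" .
    from deg have "degree a = 0 \<or> degree b = 0" by linarith
    then show "a dvd 1 \<or> b dvd 1" using unit_a[OF _ ab] unit_a[OF _ ab[unfolded mult.commute[of a b]]] by blast
  qed
qed

definition bpoly :: "'a::comm_ring_1 bcub \<Rightarrow> 'a poly poly" where
  "bpoly = (\<lambda>(a, b, c, d). monom (monom a 0) 3 + monom (monom b 1) 2 + monom (monom c 2) 1 + monom (monom d 3) 0)"

lemma eval2_bpoly [simp]: "eval2 (bpoly c) (s, u) = bev c s u"
  by (cases c) (simp add: bpoly_def eval2_def poly_monom poly_const_pow mult_ac)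

lemma form2_bpoly: "form2 3 (bpoly c)"
  by (cases c) (auto simp: form2_def bpoly_def split: if_splits)

text \<open>Reduces everything to one pullback: if it is a nonzero multiple of the ninth power of a
  linear form, the preimage of \<open>E\<close> is one point, and the curve differs from
  \<open>E\<close> because \<open>E\<close> does not vanish on all of it.\<close>

lemma nodal_max_tangent:
  fixes q1 q2 :: "'a::{alg_closed_field,field_char_0}"
  assumes irr: "irreducible (nodal q1 q2 c)"
    and cop: "\<And>t u. t^2 + q1*t*u + q2*u^2 = 0 \<Longrightarrow> bev c t u = 0 \<Longrightarrow> t = 0 \<and> u = 0"
    and l: "l \<noteq> 0" "(s0, u0) \<noteq> (0, 0)"
    and E: "\<And>s u. eval3 E (bev c s u, s * (s^2 + q1*s*u + q2*u^2), u * (s^2 + q1*s*u + q2*u^2)) = l * (u0 * s - s0 * u)^9"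
  shows "curve (nodal q1 q2 c) \<in> max_tangent_cubics E"
proof -
  define q where "q s u = s^2 + q1*s*u + q2*u^2" for s u
  define \<phi> where "\<phi> = (bpoly c, bpoly (1, q1, q2, 0), bpoly (0, 1, q1, q2))"
  have ev: "eval_param \<phi> (s, u) = (bev c s u, s * q s u, u * q s u)" for s u
    by (simp add: \<phi>_def eval_param_def q_def algebra_simps power2_eq_square power3_eq_cube)
  have form: "form3 3 (nodal q1 q2 c)" by (cases c) (simp add: nodal_def)
  have nz: "eval_param \<phi> p \<noteq> (0, 0, 0)" if "p \<noteq> (0, 0)" for p
  proof -
    obtain s u where p: "p = (s, u)" by (cases p)
    show ?thesis using that cop[of s u] unfolding p ev by (auto simp: q_def)
  qed
  have bhom: "bev c (k * y) (k * z) = k^3 * bev c y z" for k y z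
    by (cases c) (simp add: algebra_simps power_mult_distrib power2_eq_square power3_eq_cube)
  have G\<phi>: "eval3 (nodal q1 q2 c) (eval_param \<phi> p) = 0" for p
  proof -
    obtain s u where p: "p = (s, u)" by (cases p)
    have "eval3 (nodal q1 q2 c) (eval_param \<phi> p) = bev c s u * (q s u ^ 2 * q s u) - bev c (q s u * s) (q s u * u)"
      unfolding p ev eval3_nodal by (simp add: q_def algebra_simps power2_eq_square)
    also have "\<dots> = 0" unfolding bhom by (simp add: algebra_simps power2_eq_square power3_eq_cube)
    finally show ?thesis .
  qed
  have "line_to_plane \<phi>"
    using nz unfolding line_to_plane_def \<phi>_def by (auto intro!: exI[of _ 3] form2_bpoly)
  moreover have "image_is \<phi> (nodal q1 q2 c)"
    unfolding image_is_alt
  proof (intro allI impI iffI)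
    fix v :: "'a vec" assume v0: "v \<noteq> (0, 0, 0)" and Gv: "eval3 (nodal q1 q2 c) v = 0"
    obtain x y z where v: "v = (x, y, z)" by (cases v)
    have c: "bev c y z = x * q y z" using Gv by (simp add: v eval3_nodal q_def)
    show "\<exists>p k. p \<noteq> (0, 0) \<and> k \<noteq> 0 \<and> v = scal k (eval_param \<phi> p)"
    proof (cases "q y z = 0")
      case False
      then have "v = scal (1 / q y z) (eval_param \<phi> (y, z))" by (simp add: v ev c)
      moreover have "(y, z) \<noteq> (0, 0)" using False by (auto simp: q_def)
      ultimately show ?thesis using False by (metis divide_eq_0_iff one_neq_zero)
    next
      \<comment> \<open>This is the singular point (1,0,0), reached at a root of the
        quadratic.\<close>
      case True
      then have yz: "y = 0" "z = 0" using cop[of y z] c by (simp_all add: q_def)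
      obtain t where "poly [:q2, q1, 1:] t = 0" using alg_closed_imp_poly_has_root[of "[:q2, q1, 1:]"] by auto
      then have t: "q t 1 = 0" by (simp add: q_def algebra_simps power2_eq_square)
      then have "bev c t 1 \<noteq> 0" using cop[of t 1] by (auto simp: q_def)
      then have "v = scal (x / bev c t 1) (eval_param \<phi> (t, 1))" by (simp add: v yz ev t)
      moreover have "x / bev c t 1 \<noteq> 0" using v0 \<open>bev c t 1 \<noteq> 0\<close> by (simp add: v yz)
      ultimately show ?thesis by (metis prod.inject zero_neq_one)
    qed
  next
    fix v :: "'a vec" assume "\<exists>p k. p \<noteq> (0, 0) \<and> k \<noteq> 0 \<and> v = scal k (eval_param \<phi> p)"
    then show "eval3 (nodal q1 q2 c) v = 0" using G\<phi> by (auto simp: eval3_scal[OF form])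
  qed
  moreover have "birational_onto_image \<phi>"
    unfolding birational_onto_image_def
  proof (rule exI[of _ 1], rule exI[of _ var_y], rule exI[of _ var_z], intro conjI allI)
    show "form3 1 (var_y :: 'a poly poly poly)" "form3 1 (var_z :: 'a poly poly poly)" by (fact form3_var)+
    have "q 1 0 \<noteq> 0" by (simp add: q_def)
    then show "\<exists>p. eval3 var_y (eval_param \<phi> p) \<noteq> 0 \<or> eval3 var_z (eval_param \<phi> p) \<noteq> 0"
      by (intro exI[of _ "(1, 0)"]) (simp add: ev)
    show "s * eval3 var_z (eval_param \<phi> (s, u)) = u * eval3 var_y (eval_param \<phi> (s, u))" for s u
      by (simp add: ev)
  qed
  ultimately have nor: "normalisation \<phi> (nodal q1 q2 c)" by (simp add: normalisation_def)
  have E\<phi>: "eval3 E (eval_param \<phi> (s, u)) = l * (u0 * s - s0 * u)^9" for s u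
    using E[of s u] by (simp add: ev q_def)
  have "preimage_single_point \<phi> E"
    unfolding preimage_single_point_def
  proof (rule exI[of _ s0], rule exI[of _ u0], intro conjI allI impI l(2))
    fix s u :: 'a assume su: "(s, u) \<noteq> (0, 0)"
    show "eval3 E (eval_param \<phi> (s, u)) = 0 \<longleftrightarrow> (\<exists>c. c \<noteq> 0 \<and> (s, u) = (c * s0, c * u0))"
    proof
      assume "eval3 E (eval_param \<phi> (s, u)) = 0"
      then have eq: "u0 * s = s0 * u" using l(1) by (simp add: E\<phi>)
      show "\<exists>c. c \<noteq> 0 \<and> (s, u) = (c * s0, c * u0)"
      proof (cases "s0 = 0")
        case True
        then show ?thesis using l(2) eq su by (intro exI[of _ "u / u0"]) auto
      next
        case False
        then show ?thesis using eq su by (intro exI[of _ "s / s0"]) (auto simp: field_simps)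
      qed
    qed (auto simp: E\<phi>)
  qed
  moreover have "curve (nodal q1 q2 c) \<noteq> curve E"
  proof
    assume "curve (nodal q1 q2 c) = curve E"
    then obtain k where k: "k \<noteq> 0" "nodal q1 q2 c = const3 k * E" using curve_eq_iff by blast
    obtain s u where su: "u0 * s - s0 * u \<noteq> 0"
    proof (cases "u0 = 0")
      case True then show ?thesis using l(2) that[of 0 1] by auto
    next
      case False then show ?thesis using that[of 1 0] by auto
    qed
    have "eval3 (nodal q1 q2 c) (eval_param \<phi> (s, u)) = k * (l * (u0 * s - s0 * u)^9)"
      unfolding k(2) by (simp add: E\<phi>)
    then show False using su k l G\<phi> by simp
  qed
  ultimately show ?thesis
    unfolding max_tangent_cubics_def using nor irr form by blast
qed

section \<open>Contact sets\<close>

definition contact :: "'a::alg_closed_field poly poly poly \<Rightarrow> 'a vec \<Rightarrow> 'a poly poly poly set set" where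
  "contact E p = {C \<in> max_tangent_cubics E. eval3 E p = 0 \<and> (\<exists>G\<in>C. eval3 G p = 0)}"

lemma contact_subst1:
  fixes E :: "'a::{alg_closed_field,field_char_0} poly poly poly"
  assumes "lininv M M'" "C \<in> contact E (app M v)"
  shows "subst3 M ` C \<in> contact (subst3 M E) v"
  using assms max_tangent_subst unfolding contact_def by fastforce

lemma subst_image_inv:
  fixes C :: "'a::field_char_0 poly poly poly set"
  assumes "lininv M M'" shows "subst3 M ` subst3 M' ` C = C"
  by (simp add: image_image subst_subst[OF assms])

lemma max_tangent_subst_eq:
  fixes E :: "'a::{alg_closed_field,field_char_0} poly poly poly"
  assumes M: "lininv M M'"
  shows "max_tangent_cubics (subst3 M E) = (`) (subst3 M) ` max_tangent_cubics E"
proof (intro equalityI subsetI)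
  fix C assume "C \<in> max_tangent_cubics (subst3 M E)"
  then have "subst3 M' ` C \<in> max_tangent_cubics (subst3 M' (subst3 M E))" 
    using max_tangent_subst[OF lininv_sym[OF M]] by blast
  then have "subst3 M' ` C \<in> max_tangent_cubics E" unfolding subst_subst[OF lininv_sym[OF M]] .
  then have "subst3 M ` subst3 M' ` C \<in> (`) (subst3 M) ` max_tangent_cubics E" by blast
  then show "C \<in> (`) (subst3 M) ` max_tangent_cubics E" unfolding subst_image_inv[OF M] .
qed (use max_tangent_subst[OF M] in blast)

lemma contact_subst:
  fixes E :: "'a::{alg_closed_field,field_char_0} poly poly poly"
  assumes M: "lininv M M'"
  shows "contact (subst3 M E) v = (`) (subst3 M) ` contact E (app M v)"
proof (intro equalityI subsetI)
  fix C assume C: "C \<in> contact (subst3 M E) v"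
  have v: "v = app M' (app M v)" using M unfolding lininv_def by metis
  have "subst3 M' ` C \<in> contact (subst3 M' (subst3 M E)) (app M v)" 
    using contact_subst1[OF lininv_sym[OF M], of C "subst3 M E" "app M v"] C v by simp
  then have "subst3 M' ` C \<in> contact E (app M v)" unfolding subst_subst[OF lininv_sym[OF M]] .
  then have "subst3 M ` subst3 M' ` C \<in> (`) (subst3 M) ` contact E (app M v)" by blast
  then show "C \<in> (`) (subst3 M) ` contact E (app M v)" unfolding subst_image_inv[OF M] .
qed (use contact_subst1[OF M] in blast)

lemma inj_subst_image:
  assumes "lininv M (M' :: 'a::field_char_0 mat)" shows "inj ((`) (subst3 M))"
  by (metis assms injI lininv_sym subst_image_inv)

lemma max_tangent_scale:
  fixes E :: "'a::{alg_closed_field,field_char_0} poly poly poly"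
  assumes "c \<noteq> 0" shows "max_tangent_cubics (const3 c * E) = max_tangent_cubics E"
  unfolding max_tangent_cubics_def preimage_single_point_def using assms by (simp add: curve_scale)

lemma contact_scale:
  fixes E :: "'a::{alg_closed_field,field_char_0} poly poly poly"
  assumes "c \<noteq> 0" shows "contact (const3 c * E) p = contact E p"
  unfolding contact_def using assms by (simp add: max_tangent_scale)

section \<open>Two nodal cubics\<close>

text \<open>The smooth part of a nodal cubic is a multiplicative group with the flexes as cube roots
  of unity, and a contact of order nine sits at a ninth root of unity. Up to automorphisms of the
  curve there are two cases, a point that is not a flex (\<open>nodal1\<close>) and a flex
  (\<open>nodal2\<close>); in both the contact parameter is t = 0.\<close>

abbreviation "nodal1 \<equiv> nodal 1 1 (0, 0, 1, 1)"
abbreviation "nodal2 \<equiv> nodal 0 1 (1, 0, 0, 0)"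

lemma irreducible_nodal1: "irreducible (nodal1 :: 'a::field_char_0 poly poly poly)"
  by (rule irreducible_nodal[of "[:[:0, 0, 1:]:]" _ _ "[:0, -1:]"]) simp

lemma irreducible_nodal2: "irreducible (nodal2 :: 'a::field_char_0 poly poly poly)"
  by (rule irreducible_nodal[of "[:[:0, 0, 1:], 0, -1:]" _ _ "[:0, 1:]"]) simp

text \<open>Plays the part of Bezout's theorem: the pullback to the parameter line is linear in the
  ten coefficients of the cubic, and setting it to zero leaves one of them free.\<close>

lemma nodal1_unique:
  fixes G :: "'a::field_char_0 poly poly poly"
  assumes G: "form3 3 G" and van: "\<And>t. eval3 G (t + 1, t * (t^2 + t + 1), t^2 + t + 1) = 0"
  obtains m where "G = const3 m * nodal1"
proof -
  obtain a b c d e f g h i j where cub: "G = cub a b c d e f g h i j" using form3_3E[OF G] .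
  have "poly [:a + c + f + j,
      a*3 + b + c*3 + e + f*3 + i + j*3,
      a*3 + b*3 + c*4 + d + e*3 + f*5 + h + i*3 + j*6,
      a + b*4 + c*3 + d*3 + e*5 + f*5 + g + h*3 + i*6 + j*7,
      b*3 + c + d*5 + e*5 + f*3 + g*3 + h*6 + i*7 + j*6,
      b + d*5 + e*3 + f + g*6 + h*7 + i*6 + j*3,
      d*3 + e + g*7 + h*6 + i*3 + j,
      d + g*6 + h*3 + i,
      g*3 + h,
      g:] t = 0" for t
    using van[of t] unfolding cub eval3_cub poly_pCons poly_0 by Groebner_Basis.algebra
  then have "[:a + c + f + j,
      a*3 + b + c*3 + e + f*3 + i + j*3,
      a*3 + b*3 + c*4 + d + e*3 + f*5 + h + i*3 + j*6,
      a + b*4 + c*3 + d*3 + e*5 + f*5 + g + h*3 + i*6 + j*7,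
      b*3 + c + d*5 + e*5 + f*3 + g*3 + h*6 + i*7 + j*6,
      b + d*5 + e*3 + f + g*6 + h*7 + i*6 + j*3,
      d*3 + e + g*7 + h*6 + i*3 + j,
      d + g*6 + h*3 + i,
      g*3 + h,
      g:] = 0"
    using poly_all_0_iff_0 by blast
  then have eqs: "a + c + f + j = 0" "a*3 + b + c*3 + e + f*3 + i + j*3 = 0" "a*3 + b*3 + c*4 + d + e*3 + f*5 + h + i*3 + j*6 = 0" "a + b*4 + c*3 + d*3 + e*5 + f*5 + g + h*3 + i*6 + j*7 = 0" "b*3 + c + d*5 + e*5 + f*3 + g*3 + h*6 + i*7 + j*6 = 0" "b + d*5 + e*3 + f + g*6 + h*7 + i*6 + j*3 = 0" "d*3 + e + g*7 + h*6 + i*3 + j = 0" "d + g*6 + h*3 + i = 0" "g*3 + h = 0" "g = 0"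
    unfolding pCons_eq_0_iff by blast+
  have g: "g = 0" and h: "h = 0" using eqs(9,10) by simp_all
  have i: "i = - d" using eqs(8) by (simp add: g h add_eq_0_iff2)
  have j: "j = - e" using eqs(7) by (simp add: g h i add_eq_0_iff2)
  have "b + f = d" using eqs(6) unfolding g h i j by Groebner_Basis.algebra
  then have b: "b = d - f" by (simp add: algebra_simps)
  have "c + d = e" using eqs(5) unfolding g h i j b by Groebner_Basis.algebra
  then have c: "c = e - d" by (simp add: algebra_simps)
  have "a + e + f = 2 * d" using eqs(4) unfolding g h i j b c by Groebner_Basis.algebra
  then have a: "a = 2 * d - e - f" by (simp add: algebra_simps)
  have ef: "e = d" using eqs(1) unfolding g h i j b c a by Groebner_Basis.algebra
  have f: "f = d" using eqs(3) unfolding g h i j b c a ef by Groebner_Basis.algebra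
  have "G = const3 d * nodal1"
    by (rule eval3_eqI, subst eval3_mult, subst eval3_nodal) (simp add: cub a b c ef f g h i j algebra_simps power2_eq_square power3_eq_cube)
  then show ?thesis by (rule that)
qed

lemma nodal2_unique:
  fixes G :: "'a::field_char_0 poly poly poly"
  assumes G: "form3 3 G" and van: "\<And>t. eval3 G (t^3, t * (t^2 + 1), t^2 + 1) = 0"
  obtains m where "G = const3 m * nodal2"
proof -
  obtain a b c d e f g h i j where cub: "G = cub a b c d e f g h i j" using form3_3E[OF G] .
  have "poly [:j,
      i,
      h + j*3,
      f + g + i*3,
      e + h*3 + j*3,
      d + f*2 + g*3 + i*3,
      c + e*2 + h*3 + j,
      b + d*2 + f + g*3 + i,
      c + e + h,
      a + b + d + g:] t = 0" for t
    using van[of t] unfolding cub eval3_cub poly_pCons poly_0 by Groebner_Basis.algebra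
  then have "[:j,
      i,
      h + j*3,
      f + g + i*3,
      e + h*3 + j*3,
      d + f*2 + g*3 + i*3,
      c + e*2 + h*3 + j,
      b + d*2 + f + g*3 + i,
      c + e + h,
      a + b + d + g:] = 0"
    using poly_all_0_iff_0 by blast
  then have eqs: "j = 0" "i = 0" "h + j*3 = 0" "f + g + i*3 = 0" "e + h*3 + j*3 = 0" "d + f*2 + g*3 + i*3 = 0" "c + e*2 + h*3 + j = 0" "b + d*2 + f + g*3 + i = 0" "c + e + h = 0" "a + b + d + g = 0"
    unfolding pCons_eq_0_iff by blast+
  have s: "j = 0" "i = 0" using eqs(1,2) by simp_all
  have s: "j = 0" "i = 0" "h = 0" using eqs(3) s by simp_all
  have s: "j = 0" "i = 0" "h = 0" "e = 0" using eqs(5) s by simp_all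
  have s: "j = 0" "i = 0" "h = 0" "e = 0" "c = 0" using eqs(9) s by simp_all
  have g: "g = - f" using eqs(4) s by (simp add: add_eq_0_iff)
  have d: "d = f" using eqs(6) unfolding s g by Groebner_Basis.algebra
  have b: "b = 0" using eqs(8) unfolding s g d by Groebner_Basis.algebra
  have a: "a = 0" using eqs(10) unfolding s g d b by Groebner_Basis.algebra
  have "G = const3 f * nodal2"
    by (rule eval3_eqI, subst eval3_mult, subst eval3_nodal) (simp add: cub a b d g s algebra_simps power2_eq_square power3_eq_cube)
  then show ?thesis by (rule that)
qed

section \<open>The three cubics at a point of order nine\<close>

text \<open>This is x^2 y + y^2 z + z^2 x + al x y z. The tangent at (1,0,0) passes through (0,0,1),
  the one there through (0,1,0), and the one there through (1,0,0) again.\<close>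

abbreviation "ninefold al \<equiv> cub 0 1 0 0 al 1 0 1 0 (0 :: 'a::comm_ring_1)"

text \<open>Equal to -k times \<open>ninefold al\<close> plus 3 + al k times al x y^2 + x y z - y^3
  + al^2 y^2 z + 2 al y z^2 + z^3. The second form does not involve \<open>k\<close> and is singular
  at (1,0,0); with the curve it spans the pencil of contact nine at this point.\<close>

definition nineG :: "'a::comm_ring_1 \<Rightarrow> 'a \<Rightarrow> 'a poly poly poly" where
  "nineG al k = cub 0 (-k) 0 (3*al + al^2*k) 3 (-k) (-(3 + al*k)) (3*al^2 + al^3*k - k) (6*al + 2*al^2*k) (3 + al*k)"

text \<open>\<open>nineM'\<close> carries the parametrisation of \<open>nodal1\<close> to the one
  obtained by solving the contact equations; \<open>nineM\<close> is its inverse when k^3 =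
  1.\<close>

definition nineM :: "'a::comm_ring_1 \<Rightarrow> 'a \<Rightarrow> 'a mat" where
  "nineM al k = ((-1, (al*k + 3)*al*k^2, (al*k + 3)*k^2), (0, (al*k + 2)*k, k^2),
    (-1, (al*k + 3)*al*k^2 + k, (al*k + 3)*k^2))"

definition nineM' :: "'a::comm_ring_1 \<Rightarrow> 'a \<Rightarrow> 'a mat" where
  "nineM' al k = ((2*(al*k + 3) - 1, al*k + 3, -2*(al*k + 3)), (-(k^2), 0, k^2), 
    (k*(al*k + 2), k, -k*(al*k + 2)))"

lemma nineM_inv:
  fixes k :: "'a::field_char_0"
  assumes k: "k^3 = 1" shows "lininv (nineM al k) (nineM' al k)"
  unfolding lininv_def
proof (intro conjI allI)
  fix v :: "'a vec" obtain x y z where v: "v = (x, y, z)" by (cases v)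
  show "app (nineM al k) (app (nineM' al k) v) = v"
    unfolding v nineM_def nineM'_def app.simps dot.simps prod.inject
    by (intro conjI; (use k in Groebner_Basis.algebra | (simp, use k in Groebner_Basis.algebra)
      | (simp add: algebra_simps power2_eq_square power3_eq_cube, use k in Groebner_Basis.algebra)
      | simp add: algebra_simps power2_eq_square power3_eq_cube))
  show "app (nineM' al k) (app (nineM al k) v) = v"
    unfolding v nineM_def nineM'_def app.simps dot.simps prod.inject
    by (intro conjI; (use k in Groebner_Basis.algebra | (simp, use k in Groebner_Basis.algebra)
      | (simp add: algebra_simps power2_eq_square power3_eq_cube, use k in Groebner_Basis.algebra)
      | simp add: algebra_simps power2_eq_square power3_eq_cube))
qed

lemma nineG_eq:
  fixes k :: "'a::field_char_0"
  assumes k: "k^3 = 1" shows "subst3 (nineM al k) nodal1 = nineG al k"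
proof (rule eval3_eqI)
  fix x y z :: 'a
  show "eval3 (subst3 (nineM al k) nodal1) (x, y, z) = eval3 (nineG al k) (x, y, z)"
    unfolding eval3_subst nineM_def app.simps dot.simps eval3_nodal nineG_def eval3_cub bev.simps
    using k by Groebner_Basis.algebra
qed

text \<open>The factor \<open>k\<close> accounts for the automorphisms \<open>diag(1, k\<^sup>2, k)\<close>, which carry \<open>al\<close> to \<open>al k\<close>.\<close>

lemma nine_param:
  fixes k :: "'a::field_char_0"
  assumes k: "k^3 = 1"
  shows "app (nineM' al k) (bev (0, 0, 1, 1) t s, t * (t^2 + 1*t*s + 1*s^2), s * (t^2 + 1*t*s + 1*s^2)) =
    (bev (-1, al + 2*k^2, -(3*k + al*k^2), 3 + al*k) s (k*t), bev (0, 0, 1, 0) s (k*t), bev (0, 1, -al - k^2, k) s (k*t))"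
  unfolding nineM'_def app.simps dot.simps bev.simps prod.inject
  by (intro conjI; (use k in Groebner_Basis.algebra | (simp, use k in Groebner_Basis.algebra)
      | (simp add: algebra_simps power2_eq_square power3_eq_cube, use k in Groebner_Basis.algebra)
      | simp add: algebra_simps power2_eq_square power3_eq_cube))

lemma nine_contact_value:
  fixes k :: "'a::field_char_0"
  assumes k: "k^3 = 1"
  shows "eval3 (ninefold al) (bev (-1, al + 2*k^2, -(3*k + al*k^2), 3 + al*k) s u, bev (0, 0, 1, 0) s u,
    bev (0, 1, -al - k^2, k) s u) = (3 + al*k) * k^2 * u^9"
proof -
  have k4: "k^4 = k" "k^5 = k^2" "k^6 = 1" using k by Groebner_Basis.algebra+
  show ?thesis unfolding eval3_cub bev.simps using k by Groebner_Basis.algebra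
qed

text \<open>With be = ga = 0 and R = de = 1 the contact equations express everything through
  \<open>k2\<close> and force \<open>k2^3 = 1\<close>. The quantity 3 + al k is the coefficient
  \<open>f3\<close> of the solution, whose vanishing would destroy the contact.\<close>

lemma contact_nine:
  fixes al :: "'a::{alg_closed_field,field_char_0}"
  assumes al: "\<And>k. k^3 = 1 \<Longrightarrow> 3 + al*k \<noteq> 0"
  shows "contact (ninefold al) (1, 0, 0) = (\<lambda>k. curve (nineG al k)) ` {k. k^3 = 1}"
proof (intro equalityI subsetI)
  fix C assume "C \<in> (\<lambda>k. curve (nineG al k)) ` {k. k^3 = 1}"
  then obtain k where k: "k^3 = 1" and C: "C = curve (nineG al k)" by auto
  have "curve nodal1 \<in> max_tangent_cubics (subst3 (nineM' al k) (ninefold al))"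
  proof (rule nodal_max_tangent[OF irreducible_nodal1])
    fix t u :: 'a assume "t^2 + 1*t*u + 1*u^2 = 0" "bev (0, 0, 1, 1) t u = 0"
    then have "u^4 = 0" "t^4 = 0" unfolding bev.simps by Groebner_Basis.algebra+
    then show "t = 0 \<and> u = 0" by simp
  next
    show "(3 + al*k) * k^2 * k^9 \<noteq> 0" using al[OF k] k by (metis mult_eq_0_iff power_eq_0_iff power_one power_zero_numeral zero_neq_one)
    show "(0, 1) \<noteq> (0, 0 :: 'a)" by simp
    fix s u :: 'a
    show "eval3 (subst3 (nineM' al k) (ninefold al)) (bev (0, 0, 1, 1) s u, s * (s^2 + 1*s*u + 1*u^2), u * (s^2 + 1*s*u + 1*u^2))
      = (3 + al*k) * k^2 * k^9 * (1 * s - 0 * u)^9"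
      unfolding eval3_subst nine_param[OF k] nine_contact_value[OF k] by (simp add: power_mult_distrib)
  qed
  from max_tangent_subst[OF nineM_inv[OF k, of al] this]
  have "C \<in> max_tangent_cubics (ninefold al)"
    unfolding subst_curve nineG_eq[OF k] subst_subst[OF nineM_inv[OF k]] C .
  moreover have "nineG al k \<in> C" unfolding C by (rule curve_self)
  moreover have "eval3 (nineG al k) (1, 0, 0) = 0" by (simp add: nineG_def)
  ultimately show "C \<in> contact (ninefold al) (1, 0, 0)" unfolding contact_def by (auto simp: bexI)
next
  fix C assume "C \<in> contact (ninefold al) (1, 0, 0)"
  then obtain G0 where C: "C \<in> max_tangent_cubics (ninefold al)" "G0 \<in> C" "eval3 G0 (1, 0, 0) = 0"
    and E0: "eval3 (ninefold al) (1, 0, 0) = 0"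
    unfolding contact_def by blast
  obtain G f g h l where G: "C = curve G" "form3 3 G" "G \<noteq> 0" and T: "tparam (ninefold al) G f g h"
    and l: "l \<noteq> 0" "(1, 0, 0) = scal l (bev f 1 0, bev g 1 0, bev h 1 0)"
    by (rule contact_param[OF form3_cub C(1) _ E0 C(2,3)]) auto
  have p: "bev f 1 0 \<noteq> 0" "bev g 1 0 = 0" "bev h 1 0 = 0" using l by auto
  obtain f0 f1 f2 f3 k1 k2 where T': "tparam (ninefold al) G (f0, f1, f2, f3) (0, 0, 1, 0) (0, 1, k1, k2)" 
    and f0: "f0 \<noteq> 0" 
    by (rule nonflex_normalise[OF refl _ T G(2) p]) auto
  note e = nonflex_equations[OF refl _ T' f0]
  have e': "f0 = -1" "f1 = -(2*k1 + al)" "f2 = -(k1^2 + 2*k2 + al*k1)" "f3 + (2*k1*k2 + al*k2) = 1"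
    "f3 \<noteq> 0" "f3 = (k1^2 + 2*k2 + al*k1) * k2^2" "2*k1 + al + k2^2 = k1" 
    "k1^2 + 2*k2 + al*k1 + (2*k1 + al) * k2^2 = k2"
    using e by simp_all
  have "k1 + (al + k2^2) = (2*k1 + al + k2^2) - k1" by (simp add: algebra_simps)
  then have "k1 + (al + k2^2) = 0" using e'(7) by simp
  then have k1: "k1 = -al - k2^2" by (simp add: add_eq_0_iff2)
  \<comment> \<open>Put q1 = 2 k1 + al. The fourth equation gives f3 = 1 - k2 q1, while the sixth
    and eighth give f3 = k2^3 (1 - k2 q1).\<close>
  have "f3 * (k2^3 - 1) = 0" using e'(4,6,8) by Groebner_Basis.algebra
  then have k: "k2^3 = 1" using e'(5) by simp
  have f1: "f1 = al + 2*k2^2" using e'(2) k1 by simp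
  have f2: "f2 = -(3*k2 + al*k2^2)" using e'(3) k unfolding k1 by Groebner_Basis.algebra
  have f3: "f3 = 3 + al*k2" using e'(4) k unfolding k1 by Groebner_Basis.algebra
  have "eval3 (subst3 (nineM' al k2) G) (t + 1, t * (t^2 + t + 1), t^2 + t + 1) = 0" for t
  proof -
    have "(t + 1, t * (t^2 + t + 1), t^2 + t + 1) = (bev (0, 0, 1, 1) t 1, t * (t^2 + 1*t*1 + 1*1^2), 1 * (t^2 + 1*t*1 + 1*1^2))"
      by simp
    then have "app (nineM' al k2) (t + 1, t * (t^2 + t + 1), t^2 + t + 1) =
      (bev (f0, f1, f2, f3) 1 (k2 * t), bev (0, 0, 1, 0) 1 (k2 * t), bev (0, 1, k1, k2) 1 (k2 * t))"
      unfolding e'(1) f1 f2 f3 k1 by (simp only: nine_param[OF k])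
    then show ?thesis using T' unfolding tparam_def eval3_subst by metis
  qed
  then obtain m where m: "subst3 (nineM' al k2) G = const3 m * nodal1" 
    using nodal1_unique form3_subst[OF G(2)] by blast
  have "subst3 (nineM al k2) (subst3 (nineM' al k2) G) = const3 m * nineG al k2"
    unfolding m subst_mult subst_const3 nineG_eq[OF k] ..
  then have G': "G = const3 m * nineG al k2" unfolding subst_subst[OF nineM_inv[OF k]] .
  then have "m \<noteq> 0" using G(3) by auto
  then have "C = curve (nineG al k2)" unfolding G(1) G' by (rule curve_scale)
  then show "C \<in> (\<lambda>k. curve (nineG al k)) ` {k. k^3 = 1}" using k by blast
qed

lemma nineG_inj:
  assumes "curve (nineG al k) = curve (nineG al (k' :: 'a::field_char_0))" shows "k = k'"
proof -
  obtain c where c: "nineG al k = const3 c * nineG al k'" using assms curve_eq_iff by blast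
  have *: "coeff3 (const3 c * G) i j l = c * coeff3 G i j l" for G i j l
    by (simp add: const3_def coeff3_def)
  have "c = 1" using arg_cong[OF c, of "\<lambda>G. coeff3 G (Suc 0) (Suc 0) (Suc 0)"] by (simp add: * nineG_def)
  then show ?thesis using arg_cong[OF c, of "\<lambda>G. coeff3 G 2 (Suc 0) 0"] by (simp add: nineG_def)
qed

section \<open>The two cubics at a flex\<close>

text \<open>The curve d x^3 + z (c y^2 + (3 x + z)^2) = 0, whence the constants 9 and 6. The line x
  = 0 contains three flexes, among them (0,1,0) with tangent z = 0.\<close>

abbreviation "flexE c d \<equiv> cub d 0 9 0 0 6 0 c 0 (1 :: 'a::field)"

text \<open>Differs from \<open>flexE\<close> by a multiple of z^3, the cube of the flex tangent.
  With e as coefficient of z^3 the curve is singular iff d x^3 + 9 x^2 + 6 x + e has a double root.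
  The derivative has discriminant 36 (9 - 2 d), so for r^2 = 9 - 2 d the double root is -2 / (3 -
  r), and this gives the stated e.\<close>

definition flexG :: "'a::field \<Rightarrow> 'a \<Rightarrow> 'a \<Rightarrow> 'a poly poly poly" where
  "flexG c d r = cub d 0 9 0 0 6 0 c 0 (4 * (3 - 2*r) / (3 - r)^2)"

definition flexM' :: "'a::field \<Rightarrow> 'a \<Rightarrow> 'a \<Rightarrow> 'a mat" where
  "flexM' m d r = ((- (r + 3) * m^3, 3 * r * m^3, 0), (0, 0, - 3 * r * m^2), (d * m^3, 0, 0))"

lemma flexG_nodal:
  fixes r :: "'a::field_char_0"
  assumes d: "2 * d = 9 - r^2" "r \<noteq> 3" and c: "c = - 3 * r * m^2"
  shows "subst3 (flexM' m d r) (flexG c d r) = const3 (- 27 * r^3 * d * m^9) * nodal2"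
proof -
  define e where "e = 4 * (3 - 2*r) / (3 - r)^2"
  have e: "e * (3 - r)^2 = 4 * (3 - 2*r)" using d(2) by (simp add: e_def)
  have d': "d = (9 - r^2) / 2" using d(1) by (simp add: field_simps)
  \<comment> \<open>Since 2 d = (3 - r) (3 + r), the factor d^2 clears the denominator of
    \<open>e\<close>.\<close>
  have ed: "e * d^2 = (3 - 2*r) * (3 + r)^2" 
  proof -
    have "4 * (e * d^2) = e * (2 * d)^2" by (simp add: power_mult_distrib)
    also have "\<dots> = (e * (3 - r)^2) * (3 + r)^2" unfolding d by Groebner_Basis.algebra
    also have "\<dots> = 4 * ((3 - 2*r) * (3 + r)^2)" unfolding e by Groebner_Basis.algebra
    finally show ?thesis by (simp only: mult_cancel_left) simp
  qed
  show ?thesis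
  proof (rule eval3_eqI)
    fix x y z :: 'a
    have "eval3 (subst3 (flexM' m d r) (flexG c d r)) (x, y, z) = m^9 * d * 
      ((3*r*y - (r+3)*x)^3 + 9*(3*r*y - (r+3)*x)^2*x + 3*(2*d)*(3*r*y - (r+3)*x)*x^2 + (e*d^2)*x^3 - 27*r^3*x*z^2)"
      unfolding eval3_subst flexM'_def app.simps dot.simps flexG_def eval3_cub c e_def[symmetric]
      by Groebner_Basis.algebra
    also have "\<dots> = eval3 (const3 (- 27 * r^3 * d * m^9) * nodal2) (x, y, z)"
      unfolding d ed eval3_mult eval3_const3 eval3_nodal bev.simps by Groebner_Basis.algebra
    finally show "eval3 (subst3 (flexM' m d r) (flexG c d r)) (x, y, z) 
      = eval3 (const3 (- 27 * r^3 * d * m^9) * nodal2) (x, y, z)" .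
  qed
qed

lemma flex_difference:
  fixes r :: "'a::field_char_0"
  assumes "r \<noteq> 3"
  shows "eval3 (flexE c d) (x, y, z) - eval3 (flexG c d r) (x, y, z) = (r - 1) * (r + 3) / (3 - r)^2 * z^3"
proof -
  have "1 - 4 * (3 - 2*r) / (3 - r)^2 = (r - 1) * (r + 3) / (3 - r)^2"
  proof -
    have "(3 - r)^2 \<noteq> 0" using assms by simp
    then have "1 - 4 * (3 - 2*r) / (3 - r)^2 = ((3 - r)^2 - 4 * (3 - 2*r)) / (3 - r)^2" by (simp add: diff_divide_distrib)
    also have "(3 - r)^2 - 4 * (3 - 2*r) = (r - 1) * (r + 3)" by Groebner_Basis.algebra
    finally show ?thesis .
  qed
  then have "z^3 - 4 * (3 - 2*r) / (3 - r)^2 * z^3 = (r - 1) * (r + 3) / (3 - r)^2 * z^3"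
    by (metis left_diff_distrib mult_1_left)
  then show ?thesis unfolding flexG_def eval3_cub by simp
qed

text \<open>Along the parametrisation z is a multiple of s^3. As \<open>flexE\<close> differs from
  the cubic by a multiple of z^3, it pulls back to a multiple of s^9; the factor (r - 1) (r + 3) is
  nonzero by hypothesis.\<close>

lemma flexG_max_tangent:
  fixes r :: "'a::{alg_closed_field,field_char_0}"
  assumes d: "2 * d = 9 - r^2" and c: "c \<noteq> 0" and r: "r \<noteq> 0" "r \<noteq> 1" "r \<noteq> 3" "r \<noteq> -3"
  shows "curve (flexG c d r) \<in> max_tangent_cubics (flexE c d)"
proof -
  obtain m where "m^2 = - c / (3 * r)" using nth_root_exists[of 2 "- c / (3 * r)"] by auto
  then have m: "c = - 3 * r * m^2" using r by (simp add: field_simps)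
  then have m0: "m \<noteq> 0" using c by auto
  have d0: "d \<noteq> 0"
  proof
    assume "d = 0"
    then have "(3 - r) * (3 + r) = 0" using d by (simp add: algebra_simps power2_eq_square)
    moreover have "3 + r \<noteq> 0" using r(4) by (metis add.commute eq_neg_iff_add_eq_0)
    ultimately show False using r by simp
  qed
  let ?M = "flexM' m d r"
  have "det3 ?M = - (3 * r * m^3) * (3 * r * m^2 * (d * m^3))" by (simp add: flexM'_def)
  then have det: "det3 ?M \<noteq> 0" using r m0 d0 by simp
  then have M: "lininv ?M (minv ?M)" by (rule lininv_minv)
  define nu where "nu = (r - 1) * (r + 3) / (3 - r)^2"
  have nu: "nu \<noteq> 0" using r by (auto simp: nu_def eq_neg_iff_add_eq_0)
  have "curve nodal2 \<in> max_tangent_cubics (subst3 ?M (flexE c d))"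
  proof (rule nodal_max_tangent[OF irreducible_nodal2])
    fix t u :: 'a assume "t^2 + 0*t*u + 1*u^2 = 0" "bev (1, 0, 0, 0) t u = 0"
    then show "t = 0 \<and> u = 0" by simp
  next
    show "nu * (d * m^3)^3 \<noteq> 0" using nu d0 m0 by simp
    show "(0, 1) \<noteq> (0, 0 :: 'a)" by simp
    fix s u :: 'a
    let ?P = "(bev (1, 0, 0, 0) s u, s * (s^2 + 0*s*u + 1*u^2), u * (s^2 + 0*s*u + 1*u^2))"
    obtain x y where xy: "app ?M ?P = (x, y, d * m^3 * s^3)" by (simp add: flexM'_def)
    have "eval3 (subst3 ?M (flexG c d r)) ?P = 0"
      unfolding flexG_nodal[OF d r(3) m] eval3_mult eval3_nodal by (simp, Groebner_Basis.algebra)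
    then have "eval3 (flexE c d) (x, y, d * m^3 * s^3) = nu * (d * m^3 * s^3)^3"
      using flex_difference[OF r(3), where c = c and d = d and x = x and y = y and z = "d * m^3 * s^3"] unfolding eval3_subst xy nu_def by simp
    then show "eval3 (subst3 ?M (flexE c d)) ?P = nu * (d * m^3)^3 * (1 * s - 0 * u)^9"
      unfolding eval3_subst xy by (simp add: power_mult_distrib flip: power_mult)
  qed
  from max_tangent_subst[OF lininv_sym[OF M] this]
  have "curve (subst3 (minv ?M) nodal2) \<in> max_tangent_cubics (flexE c d)"
    unfolding subst_curve subst_subst[OF lininv_sym[OF M]] .
  moreover have "flexG c d r = const3 (- 27 * r^3 * d * m^9) * subst3 (minv ?M) nodal2"
    using arg_cong[OF flexG_nodal[OF d r(3) m], of "subst3 (minv ?M)"]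
    unfolding subst_subst[OF lininv_sym[OF M]] subst_mult subst_const3 .
  then have "curve (flexG c d r) = curve (subst3 (minv ?M) nodal2)"
    using r d0 m0 by (simp add: curve_scale)
  ultimately show ?thesis by simp
qed

lemma bev_eqI:
  fixes x y :: "'a::field_char_0 bcub"
  assumes "\<And>s u. bev x s u = bev y s u" shows "x = y"
proof -
  obtain a b c d a' b' c' d' where xy: "x = (a, b, c, d)" "y = (a', b', c', d')" by (cases x; cases y)
  have "poly [:a, b, c, d:] w = poly [:a', b', c', d':] w" for w
    using assms[of 1 w] by (simp add: xy algebra_simps power2_eq_square power3_eq_cube)
  then have "[:a, b, c, d:] = [:a', b', c', d':]" using poly_eq_poly_eq_iff by blast
  then show ?thesis by (simp add: xy)
qed

text \<open>At a flex the branch has contact three with the tangent z = 0, so z is a multiple of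
  u^3; a shift of s then removes the coefficient of s u^2 in x.\<close>

lemma flex_normalise:
  fixes c d :: "'a::field_char_0"
  assumes T: "tparam (flexE c d) G f g h" and G: "form3 3 G" and cd: "c \<noteq> 0" "d \<noteq> 0"
    and p: "bev f 1 0 = 0" "bev g 1 0 \<noteq> 0" "bev h 1 0 = 0"
  obtains f1 f3 g0 g1 g2 g3 h3 where "tparam (flexE c d) G (0, f1, 0, f3) (g0, g1, g2, g3) (0, 0, 0, h3)"
    "f1 \<noteq> 0" "g0 \<noteq> 0" "h3 \<noteq> 0"
proof -
  obtain f1 f2 f3 g0 g1 g2 g3 h1 h2 h3 where f: "f = (0, f1, f2, f3)" and g: "g = (g0, g1, g2, g3)"
    and h: "h = (0, h1, h2, h3)" using p by (cases f; cases g; cases h) auto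
  have g0: "g0 \<noteq> 0" using p g by simp
  obtain l where l: "\<And>s u. eval3 (flexE c d) (bev f s u, bev g s u, bev h s u) = l * u^9"
    using T unfolding tparam_def by blast
  define F where "F = [:f1, f2, f3:]"
  define Gp where "Gp = [:g0, g1, g2, g3:]"
  have ev: "bev f 1 w = w * poly F w" "bev g 1 w = poly Gp w" "bev h 1 w = w * (h1 + w * h2 + w^2 * h3)" for w
    by (simp_all add: f g h F_def Gp_def algebra_simps power2_eq_square power3_eq_cube)
  have F0: "poly F 0 = f1" "poly Gp 0 = g0" by (simp_all add: F_def Gp_def)
  have "poly (smult c (Gp^2 * [:h1, h2, h3:]) + [:0, 0, 1:] * (smult d (F^3) + smult 9 (F^2 * [:h1, h2, h3:])
    + smult 6 (F * [:h1, h2, h3:]^2) + [:h1, h2, h3:]^3)) 0 = poly ([:l:] * [:0, 1:]^8) 0"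
  proof (rule poly_eq_at_0)
    fix w :: 'a assume w: "w \<noteq> 0"
    have 1: "poly [:h1, h2, h3:] w = h1 + w * h2 + w^2 * h3" "poly [:0, 0, 1:] w = w^2"
      by (simp_all add: algebra_simps power2_eq_square)
    have 2: "poly [:0, 1:] w = w" "poly [:l:] w = l" by simp_all
    have "w * (c * ((poly Gp w)^2 * (h1 + w * h2 + w^2 * h3)) + w^2 * (d * (poly F w)^3 + 9 * ((poly F w)^2 * (h1 + w * h2 + w^2 * h3))
     + 6 * (poly F w * (h1 + w * h2 + w^2 * h3)^2) + (h1 + w * h2 + w^2 * h3)^3)) = w * (l * w^8)"
      using l[of 1 w] unfolding ev eval3_cub by Groebner_Basis.algebra
    then show "poly (smult c (Gp^2 * [:h1, h2, h3:]) + [:0, 0, 1:] * (smult d (F^3) + smult 9 (F^2 * [:h1, h2, h3:])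
    + smult 6 (F * [:h1, h2, h3:]^2) + [:h1, h2, h3:]^3)) w = poly ([:l:] * [:0, 1:]^8) w"
      unfolding poly_add poly_mult poly_smult poly_power 1 2 using w by (metis mult_left_cancel)
  qed
  then have h1: "h1 = 0" using g0 cd by (simp add: F0)
  have ev3: "bev h 1 w = w^2 * (h2 + w * h3)" for w unfolding ev h1 by (simp add: algebra_simps power2_eq_square)
  have "poly (smult c (Gp^2 * [:h2, h3:]) + [:0, 1:] * (smult d (F^3) + smult 9 ([:0, 1:] * F^2 * [:h2, h3:])
    + smult 6 ([:0, 1:]^2 * F * [:h2, h3:]^2) + [:0, 1:]^3 * [:h2, h3:]^3)) 0 = poly ([:l:] * [:0, 1:]^7) 0"
  proof (rule poly_eq_at_0)
    fix w :: 'a assume w: "w \<noteq> 0"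
    have 1: "poly [:h2, h3:] w = h2 + w * h3" by simp
    have 2: "poly [:0, 1:] w = w" "poly [:l:] w = l" by simp_all
    have "w^2 * (c * ((poly Gp w)^2 * (h2 + w * h3)) + w * (d * (poly F w)^3 + 9 * (w * (poly F w)^2 * (h2 + w * h3))
     + 6 * (w^2 * poly F w * (h2 + w * h3)^2) + w^3 * (h2 + w * h3)^3)) = w^2 * (l * w^7)"
      using l[of 1 w] unfolding ev(1,2) ev3 eval3_cub by Groebner_Basis.algebra
    then show "poly (smult c (Gp^2 * [:h2, h3:]) + [:0, 1:] * (smult d (F^3) + smult 9 ([:0, 1:] * F^2 * [:h2, h3:])
    + smult 6 ([:0, 1:]^2 * F * [:h2, h3:]^2) + [:0, 1:]^3 * [:h2, h3:]^3)) w = poly ([:l:] * [:0, 1:]^7) w"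
      unfolding poly_add poly_mult poly_smult poly_power 1 2 using w by (metis mult_left_cancel power_eq_0_iff)
  qed
  then have h2: "h2 = 0" using g0 cd by (simp add: F0)
  have ev4: "bev h 1 w = w^3 * h3" for w unfolding ev3 h2 by (simp add: algebra_simps power2_eq_square power3_eq_cube)
  have "poly (smult (c * h3) (Gp^2) + smult d (F^3) + [:0, 1:] * (smult (9 * h3) ([:0, 1:] * F^2)
    + smult (6 * h3^2) ([:0, 1:]^3 * F) + smult (h3^3) ([:0, 1:]^5))) 0 = poly ([:l:] * [:0, 1:]^6) 0"
  proof (rule poly_eq_at_0)
    fix w :: 'a assume w: "w \<noteq> 0"
    have 2: "poly [:0, 1:] w = w" "poly [:l:] w = l" by simp_all
    have "w^3 * (c * h3 * (poly Gp w)^2 + d * (poly F w)^3 + w * (9 * h3 * (w * (poly F w)^2)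
     + 6 * h3^2 * (w^3 * poly F w) + h3^3 * w^5)) = w^3 * (l * w^6)"
      using l[of 1 w] unfolding ev(1,2) ev4 eval3_cub by Groebner_Basis.algebra
    then show "poly (smult (c * h3) (Gp^2) + smult d (F^3) + [:0, 1:] * (smult (9 * h3) ([:0, 1:] * F^2)
    + smult (6 * h3^2) ([:0, 1:]^3 * F) + smult (h3^3) ([:0, 1:]^5))) w = poly ([:l:] * [:0, 1:]^6) w"
      unfolding poly_add poly_mult poly_smult poly_power 2 using w by (metis mult_left_cancel power_eq_0_iff)
  qed
  then have fg: "c * h3 * g0^2 + d * f1^3 = 0" by (simp add: F0)
  have h3: "h3 \<noteq> 0"
  proof
    assume "h3 = 0"
    then have "dot (0, 0, 1) (bev f s u, bev g s u, bev h s u) = 0" for s u by (simp add: h h1 h2)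
    then show False using T unfolding tparam_def by (metis prod.inject zero_neq_one)
  qed
  then have f1: "f1 \<noteq> 0" using fg g0 cd by auto
  define b where "b = - f2 / (2 * f1)"
  have b: "2 * b * f1 + f2 = 0" using f1 by (simp add: b_def)
  have one: "(1 :: 'a) \<noteq> 0" by simp
  obtain f' g' h' where T': "tparam (flexE c d) G f' g' h'"
    and f': "\<And>s u. bev f' s u = 1 * bev f (1 * s + b * u) (1 * u)"
    and h': "\<And>s u. bev h' s u = 1 * bev h (1 * s + b * u) (1 * u)"
    and g': "\<And>s u. bev g' s u = 1 * bev g (1 * s + b * u) (1 * u)"
    by (rule tparam_reparam[OF T form3_cub G one one one, of b]) blast
  have "f' = (0, f1, 0, f3 + b * f2 + b^2 * f1)"
  proof (rule bev_eqI)
    fix s u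
    have "bev f' s u = bev (0, f1, 0, f3 + b * f2 + b^2 * f1) s u + (2 * b * f1 + f2) * s * u^2"
      unfolding f' f by (simp add: algebra_simps power2_eq_square power3_eq_cube)
    then show "bev f' s u = bev (0, f1, 0, f3 + b * f2 + b^2 * f1) s u" using b by simp
  qed
  moreover have "h' = (0, 0, 0, h3)" by (rule bev_eqI) (simp add: h' h h1 h2)
  moreover obtain x0 x1 x2 x3 where x: "g' = (x0, x1, x2, x3)" by (cases g')
  moreover have "x0 = g0" using g'[of 1 0] by (simp add: x g)
  ultimately show ?thesis using that T' f1 g0 h3 by blast
qed

text \<open>The equations determine g0^2, g0 g2 and g2^2 up to the common factor c h3, and the
  compatibility of the three products is a quadratic equation with solution r^2 = 9 - 2 d. The
  conditions on \<open>d\<close> keep \<open>r\<close> away from 0, 1, 3 and -3.\<close>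

lemma contact_flexE:
  fixes c d :: "'a::{alg_closed_field,field_char_0}"
  assumes cd: "c \<noteq> 0" "d \<noteq> 0" "d \<noteq> 4" "2 * d \<noteq> 9"
  shows "contact (flexE c d) (0, 1, 0) = (\<lambda>r. curve (flexG c d r)) ` {r. r^2 = 9 - 2 * d}"
proof (intro equalityI subsetI)
  have r_ne: "r \<noteq> 0 \<and> r \<noteq> 1 \<and> r \<noteq> 3 \<and> r \<noteq> -3" if "r^2 = 9 - 2 * d" for r
  proof -
    have "2 * d \<noteq> 0" "2 * d \<noteq> 2 * 4" using cd by (simp_all only: mult_cancel_left) simp_all
    then show ?thesis using that cd by (auto simp: algebra_simps)
  qed
  {
    fix C assume "C \<in> (\<lambda>r. curve (flexG c d r)) ` {r. r^2 = 9 - 2 * d}"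
    then obtain r where r: "r^2 = 9 - 2 * d" and C: "C = curve (flexG c d r)" by auto
    have d: "2 * d = 9 - r^2" using r by simp
    have "C \<in> max_tangent_cubics (flexE c d)"
      unfolding C using flexG_max_tangent[OF d cd(1)] r_ne[OF r] by blast
    moreover have "flexG c d r \<in> C" unfolding C by (rule curve_self)
    moreover have "eval3 (flexG c d r) (0, 1, 0) = 0" by (simp add: flexG_def)
    moreover have "eval3 (flexE c d) (0, 1, 0) = 0" by simp
    ultimately show "C \<in> contact (flexE c d) (0, 1, 0)" unfolding contact_def by blast
  next
    fix C assume "C \<in> contact (flexE c d) (0, 1, 0)"
    then obtain G0 where C: "C \<in> max_tangent_cubics (flexE c d)" "G0 \<in> C" "eval3 G0 (0, 1, 0) = 0"
      and E0: "eval3 (flexE c d) (0, 1, 0) = 0"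
      unfolding contact_def by blast
    obtain G f g h l where G: "C = curve G" "form3 3 G" "G \<noteq> 0" and T: "tparam (flexE c d) G f g h"
      and l: "l \<noteq> 0" "(0, 1, 0) = scal l (bev f 1 0, bev g 1 0, bev h 1 0)"
      by (rule contact_param[OF form3_cub C(1) _ E0 C(2,3)]) auto
    have p: "bev f 1 0 = 0" "bev g 1 0 \<noteq> 0" "bev h 1 0 = 0" using l by auto
    obtain f1 f3 g0 g1 g2 g3 h3 where T': "tparam (flexE c d) G (0, f1, 0, f3) (g0, g1, g2, g3) (0, 0, 0, h3)"
      and nz: "f1 \<noteq> 0" "g0 \<noteq> 0" "h3 \<noteq> 0"
      by (rule flex_normalise[OF T G(2) cd(1,2) p]) blast
    obtain k where k: "\<And>s u. eval3 (flexE c d) (bev (0, f1, 0, f3) s u, bev (g0, g1, g2, g3) s u, bev (0, 0, 0, h3) s u) = k * u^9"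
      using T' unfolding tparam_def by blast
    have "poly [:0, 0, 0, c*h3*g0^2 + d*f1^3, 2*c*h3*g0*g1, c*h3*(2*g0*g2 + g1^2) + 3*d*f1^2*f3 + 9*h3*f1^2,
        c*h3*(2*g0*g3 + 2*g1*g2), c*h3*(2*g1*g3 + g2^2) + 3*d*f1*f3^2 + 18*h3*f1*f3 + 6*h3^2*f1,
        2*c*h3*g2*g3, c*h3*g3^2 + d*f3^3 + 9*h3*f3^2 + 6*h3^2*f3 + h3^3 - k:] w = 0" for w
      using k[of 1 w] unfolding eval3_cub bev.simps poly_pCons poly_0
      by (simp only: power_one mult_1_right mult_1_left mult_zero_left add_0_left add_0_right mult_zero_right,
        Groebner_Basis.algebra)
    then have "[:0, 0, 0, c*h3*g0^2 + d*f1^3, 2*c*h3*g0*g1, c*h3*(2*g0*g2 + g1^2) + 3*d*f1^2*f3 + 9*h3*f1^2,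
        c*h3*(2*g0*g3 + 2*g1*g2), c*h3*(2*g1*g3 + g2^2) + 3*d*f1*f3^2 + 18*h3*f1*f3 + 6*h3^2*f1,
        2*c*h3*g2*g3, c*h3*g3^2 + d*f3^3 + 9*h3*f3^2 + 6*h3^2*f3 + h3^3 - k:] = 0"
      using poly_all_0_iff_0 by blast
    then have w: "c*h3*g0^2 + d*f1^3 = 0" "2*c*h3*g0*g1 = 0" "c*h3*(2*g0*g2 + g1^2) + 3*d*f1^2*f3 + 9*h3*f1^2 = 0"
      "c*h3*(2*g0*g3 + 2*g1*g2) = 0" "c*h3*(2*g1*g3 + g2^2) + 3*d*f1*f3^2 + 18*h3*f1*f3 + 6*h3^2*f1 = 0"
      unfolding pCons_eq_0_iff by blast+
    have g1: "g1 = 0" using w(2) nz cd by simp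
    have g3: "g3 = 0" using w(4) nz cd g1 by simp
    \<comment> \<open>Half of d f3 / h3 + 3: this completes the square in the quadratic equation for
      d f3 / h3.\<close>
    define r where "r = (d * f3 + 3 * h3) / (2 * h3)"
    have r: "d * f3 = (2 * r - 3) * h3" using nz by (simp add: r_def field_simps)
    have w3: "2*c*h3*g0*g2 = - 3 * f1^2 * (d * f3 + 3 * h3)" using w(3) unfolding g1 zero_power2 add_0_right by Groebner_Basis.algebra
    have w5: "c*h3*g2^2 = - 3 * f1 * (d*f3^2 + 6*h3*f3 + 2*h3^2)" using w(5) unfolding g1 g3 mult_zero_right mult_zero_left add_0_left by Groebner_Basis.algebra
    have w1: "c*h3*g0^2 = - d*f1^3" using w(1) by Groebner_Basis.algebra
    have "(2*c*h3*g0*g2)^2 = 4 * (c*h3*g0^2) * (c*h3*g2^2)" by Groebner_Basis.algebra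
    then have "3 * f1^4 * (3 * (d * f3 + 3 * h3)^2) = 3 * f1^4 * (4 * d * (d*f3^2 + 6*h3*f3 + 2*h3^2))"
      unfolding w3 w5 w1 by Groebner_Basis.algebra
    then have "3 * (d * f3 + 3 * h3)^2 = 4 * d * (d*f3^2 + 6*h3*f3 + 2*h3^2)" using nz by simp
    then have "h3^2 * 4 * r^2 = h3^2 * 4 * (9 - 2 * d)" using r by Groebner_Basis.algebra
    then have r2: "r^2 = 9 - 2 * d" using nz by simp
    then have d: "2 * d = 9 - r^2" by simp
    define e where "e = 4 * (3 - 2*r) / (3 - r)^2"
    have e: "e * (3 - r)^2 = 4 * (3 - 2*r)" using r_ne[OF r2] by (simp add: e_def)
    have "4 * (e * d^2) = e * (2 * d)^2" by (simp add: power_mult_distrib)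
    also have "\<dots> = (e * (3 - r)^2) * (3 + r)^2" unfolding d by Groebner_Basis.algebra
    also have "\<dots> = 4 * ((3 - 2*r) * (3 + r)^2)" unfolding e by Groebner_Basis.algebra
    finally have ed: "e * d^2 = (3 - 2*r) * (3 + r)^2" by (simp only: mult_cancel_left) simp
    have "d^2 * (d*f3^3 + 9*h3*f3^2 + 6*h3^2*f3 + e * h3^3)
      = (d*f3)^3 + 9*h3*(d*f3)^2 + 3*(2*d)*h3^2*(d*f3) + (e*d^2)*h3^3" by Groebner_Basis.algebra
    also have "\<dots> = 0" unfolding r d ed by Groebner_Basis.algebra
    finally have top: "d*f3^3 + 9*h3*f3^2 + 6*h3^2*f3 + e * h3^3 = 0" using cd by simp
    have van: "eval3 (flexG c d r) (bev (0, f1, 0, f3) s u, bev (g0, g1, g2, g3) s u, bev (0, 0, 0, h3) s u) = 0" for s u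
    proof -
      have "eval3 (flexG c d r) (bev (0, f1, 0, f3) s u, bev (g0, g1, g2, g3) s u, bev (0, 0, 0, h3) s u)
        = s^6*u^3 * (c*h3*g0^2 + d*f1^3) + s^4*u^5 * (2*c*h3*g0*g2 + 3 * f1^2 * (d * f3 + 3 * h3))
         + s^2*u^7 * (c*h3*g2^2 + 3 * f1 * (d*f3^2 + 6*h3*f3 + 2*h3^2)) + u^9 * (d*f3^3 + 9*h3*f3^2 + 6*h3^2*f3 + e * h3^3)"
        unfolding flexG_def e_def[symmetric] g1 g3 eval3_cub bev.simps by Groebner_Basis.algebra
      also have "\<dots> = 0" unfolding w1 w3 w5 top by Groebner_Basis.algebra
      finally show ?thesis .
    qed
    have "d * f3 + 3 * h3 = 2 * r * h3" using r by Groebner_Basis.algebra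
    then have "2*c*h3*g0*g2 \<noteq> 0" unfolding w3 using nz r_ne[OF r2] by simp
    then have g2: "g2 \<noteq> 0" by auto
    \<comment> \<open>With this scale y becomes a multiple of t^2 + 1, and the curve takes the
      parametrisation of \<open>nodal2\<close>. Both \<open>G\<close> and \<open>flexG c d r\<close>
      vanish on it, so both are multiples of the same form.\<close>
    obtain m where "m^2 = g0 / g2" using nth_root_exists[of 2 "g0 / g2"] by auto
    then have m: "g2 * m^2 = g0" using g2 by simp
    then have m0: "m \<noteq> 0" using nz by auto
    define M :: "'a mat" where "M = ((f3 * m^3 - f1 * m, f1 * m, 0), (0, 0, g0), (h3 * m^3, 0, 0))"
    have "det3 M = f1 * m * (g0 * (h3 * m^3))" by (simp add: M_def)
    then have "det3 M \<noteq> 0" using nz m0 by simp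
    then have M: "lininv M (minv M)" by (rule lininv_minv)
    have par: "app M (t^3, t * (t^2 + 1), t^2 + 1) = (bev (0, f1, 0, f3) 1 (m * t), bev (g0, g1, g2, g3) 1 (m * t), bev (0, 0, 0, h3) 1 (m * t))" for t
      unfolding M_def app.simps dot.simps g1 g3 bev.simps m[symmetric] by (simp add: algebra_simps power2_eq_square power3_eq_cube)
    have "eval3 (subst3 M G) (t^3, t * (t^2 + 1), t^2 + 1) = 0" for t
      unfolding eval3_subst par using T' unfolding tparam_def by blast
    then obtain k1 where k1: "subst3 M G = const3 k1 * nodal2" using nodal2_unique form3_subst[OF G(2)] by blast
    have "eval3 (subst3 M (flexG c d r)) (t^3, t * (t^2 + 1), t^2 + 1) = 0" for t
      unfolding eval3_subst par by (rule van)
    moreover have "form3 3 (flexG c d r)" by (simp add: flexG_def)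
    ultimately obtain k2 where k2: "subst3 M (flexG c d r) = const3 k2 * nodal2" using nodal2_unique form3_subst by blast
    have inv: "Q = const3 k3 * subst3 (minv M) nodal2" if "subst3 M Q = const3 k3 * nodal2" for Q k3
      using arg_cong[OF that, of "subst3 (minv M)"] 
      unfolding subst_subst[OF lininv_sym[OF M]] subst_mult subst_const3 .
    have G1: "G = const3 k1 * subst3 (minv M) nodal2" using inv[OF k1] .
    have G2: "flexG c d r = const3 k2 * subst3 (minv M) nodal2" using inv[OF k2] .
    have "k1 \<noteq> 0" using G1 G(3) by auto
    moreover have "k2 \<noteq> 0"
    proof
      assume "k2 = 0"
      then have "coeff3 (flexG c d r) 2 0 (Suc 0) = 0" unfolding G2 by simp
      then show False by (simp add: flexG_def)
    qed
    ultimately have "C = curve (flexG c d r)" unfolding G(1) G1 G2 by (simp add: curve_scale)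
    then show "C \<in> (\<lambda>r. curve (flexG c d r)) ` {r. r^2 = 9 - 2 * d}" using r2 by blast
  }
qed

lemma coeff3_const3_mult: "coeff3 (const3 c * G) i j l = c * coeff3 G i j l"
  by (simp add: const3_def coeff3_def)

lemma flexG_inj:
  fixes r :: "'a::field_char_0"
  assumes "curve (flexG c d r) = curve (flexG c d r')" "r^2 = r'^2" "r \<noteq> 0" "r^2 \<noteq> 9"
  shows "r = r'"
proof (rule ccontr)
  assume "r \<noteq> r'"
  then have r': "r' = - r" using assms(2) by (metis minus_minus power2_eq_iff)
  obtain k where k: "flexG c d r = const3 k * flexG c d r'" using assms(1) curve_eq_iff by blast
  have "k = 1" using arg_cong[OF k, of "\<lambda>G. coeff3 G 2 0 (Suc 0)"] 
    by (simp add: coeff3_const3_mult flexG_def)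
  then have e: "4 * (3 - 2*r) / (3 - r)^2 = 4 * (3 - 2*r') / (3 - r')^2"
    using arg_cong[OF k, of "\<lambda>G. coeff3 G 0 0 3"] by (simp add: flexG_def)
  have "(3 - r) * (3 + r) = 9 - r^2" by Groebner_Basis.algebra
  then have "3 - r \<noteq> 0" "3 + r \<noteq> 0" using assms(4) by auto
  then have "4 * (3 - 2*r) * (3 + r)^2 = 4 * (3 + 2*r) * (3 - r)^2"
    using e unfolding r' by (simp add: frac_eq_eq)
  then have "16 * r^3 = 0" by Groebner_Basis.algebra
  then show False using assms(3) by simp
qed

section \<open>Contact points\<close>

lemma contact_exists:
  fixes E :: "'a::{alg_closed_field,field_char_0} poly poly poly"
  assumes "C \<in> max_tangent_cubics E" obtains p where "p \<noteq> (0, 0, 0)" "C \<in> contact E p"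
proof -
  obtain G \<phi> where G: "C = curve G" "normalisation \<phi> G" "preimage_single_point \<phi> E"
    using assms unfolding max_tangent_cubics_def by blast
  obtain s0 u0 where su: "(s0, u0) \<noteq> (0, 0)" "\<And>s u. (s, u) \<noteq> (0, 0) \<Longrightarrow> 
      eval3 E (eval_param \<phi> (s, u)) = 0 \<longleftrightarrow> (\<exists>c. c \<noteq> 0 \<and> (s, u) = (c * s0, c * u0))"
    using G(3) unfolding preimage_single_point_def by blast
  have "eval_param \<phi> (s0, u0) \<noteq> (0, 0, 0)" using G(2) su(1) unfolding normalisation_def line_to_plane_def by auto
  moreover have "eval3 G (eval_param \<phi> (s0, u0)) = 0" using normalisation_zero[OF G(2) su(1)] .
  moreover have "eval3 E (eval_param \<phi> (s0, u0)) = 0" unfolding su(2)[OF su(1)] by (rule exI[of _ 1]) simp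
  ultimately show ?thesis using that assms G(1) curve_self unfolding contact_def by blast
qed

text \<open>Only one parameter lies over \<open>E\<close>, and a contact point is its image; hence
  the sets \<open>contact E p\<close> are disjoint for different points of the plane.\<close>

lemma contact_unique:
  fixes E :: "'a::{alg_closed_field,field_char_0} poly poly poly"
  assumes E: "form3 3 E" and C: "C \<in> contact E p" "C \<in> contact E q" and nz: "p \<noteq> (0, 0, 0)" "q \<noteq> (0, 0, 0)"
  obtains c where "c \<noteq> 0" "p = scal c q"
proof -
  obtain G \<phi> where G: "C = curve G" "form3 3 G" "normalisation \<phi> G" "preimage_single_point \<phi> E"
    using C(1) unfolding contact_def max_tangent_cubics_def by blast
  obtain f g h n where \<phi>: "\<phi> = (f, g, h)" "form2 n f" "form2 n g" "form2 n h"
    using G(3) unfolding normalisation_def line_to_plane_def by (cases \<phi>) auto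
  have sc: "eval_param \<phi> (c * s, c * u) = scal (c ^ n) (eval_param \<phi> (s, u))" for c s u
    by (simp add: \<phi>(1) eval_param_def eval2_scal[OF \<phi>(2)] eval2_scal[OF \<phi>(3)] eval2_scal[OF \<phi>(4)])
  obtain s0 u0 where su: "(s0, u0) \<noteq> (0, 0)" "\<And>s u. (s, u) \<noteq> (0, 0) \<Longrightarrow> 
      eval3 E (eval_param \<phi> (s, u)) = 0 \<longleftrightarrow> (\<exists>c. c \<noteq> 0 \<and> (s, u) = (c * s0, c * u0))"
    using G(4) unfolding preimage_single_point_def by blast
  have *: "\<exists>c. c \<noteq> 0 \<and> x = scal c (eval_param \<phi> (s0, u0))" if x: "C \<in> contact E x" "x \<noteq> (0, 0, 0)" for x
  proof -
    have "eval3 E x = 0" "eval3 G x = 0" using x(1) G(1) unfolding contact_def curve_alt by auto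
    then obtain p' c' where p': "p' \<noteq> (0, 0)" "c' \<noteq> 0" "x = scal c' (eval_param \<phi> p')"
      using G(3) x(2) unfolding normalisation_def image_is_alt by blast
    obtain s u where p'': "p' = (s, u)" by (cases p')
    have "eval3 E (eval_param \<phi> (s, u)) = 0" using \<open>eval3 E x = 0\<close> p'(2) unfolding p'(3) p'' eval3_scal[OF E] by auto
    then obtain l where l: "l \<noteq> 0" "(s, u) = (l * s0, l * u0)" using su(2) p'(1) p'' by blast
    then have "x = scal (c' * l ^ n) (eval_param \<phi> (s0, u0))" unfolding p'(3) p'' by (simp add: sc)
    then show ?thesis using p'(2) l(1) by (intro exI[of _ "c' * l ^ n"]) simp
  qed
  obtain a b where "a \<noteq> 0" "p = scal a (eval_param \<phi> (s0, u0))" "b \<noteq> 0" "q = scal b (eval_param \<phi> (s0, u0))"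
    using * C nz by blast
  then have "p = scal (a / b) q" "a / b \<noteq> 0" by simp_all
  then show ?thesis using that by blast
qed

lemma contact_scal:
  fixes E :: "'a::{alg_closed_field,field_char_0} poly poly poly"
  assumes "form3 3 E" "c \<noteq> 0" shows "contact E (scal c p) = contact E p"
proof -
  have "eval3 G (scal c p) = 0 \<longleftrightarrow> eval3 G p = 0" if C: "C \<in> max_tangent_cubics E" and G: "G \<in> C" for C G
  proof -
    obtain G' where "C = curve G'" "form3 3 G'" using C by (auto simp: max_tangent_cubics_def)
    then have "form3 3 G" using G unfolding curve_alt by (auto intro: form3_const3_mult)
    then show ?thesis using assms(2) by (simp add: eval3_scal)
  qed
  then show ?thesis using assms unfolding contact_def eval3_scal[OF assms(1)] by auto
qed

section \<open>Contact points on the Hesse pencil and the cubics they support\<close>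

section \<open>Cubics in Hesse form\<close>

abbreviation "hesse s \<equiv> cub s 0 0 0 1 0 s 0 0 (s :: 'a::comm_ring_1)"

lemma polar_hesse:
  "polar (hesse s) (x, y, z) (p, q, r) =
    (3*s*x^2 + y*z) * p + (3*s*y^2 + x*z) * q + (3*s*z^2 + x*y) * (r :: 'a::field_char_0)"
  unfolding polar_cub by (simp add: algebra_simps)

lemma eval3_hesse: "eval3 (hesse s) (x, y, z) = s * (x^3 + y^3 + z^3) + x * y * z"
  by (simp add: algebra_simps)

text \<open>Multiplying the three partial derivatives by x, y and z gives 3 s x^3 = 3 s y^3 = 3 s
  z^3 = - x y z at a singular point; so the cubes agree, and cubing the relation leaves the factor
  27 s^3 + 1.\<close>

lemma hesse_nonsing:
  fixes s :: "'a::field_char_0"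
  assumes s: "s \<noteq> 0" "27 * s^3 + 1 \<noteq> 0" and v: "v \<noteq> (0, 0, 0)"
  obtains w where "polar (hesse s) v w \<noteq> 0"
proof -
  have "\<exists>w. polar (hesse s) v w \<noteq> 0"
  proof (rule ccontr)
    assume "\<not> ?thesis"
    then have 0: "polar (hesse s) v w = 0" for w by blast
    obtain x y z where xyz: "v = (x, y, z)" by (cases v)
    have e: "3*s*x^2 + y*z = 0" "3*s*y^2 + x*z = 0" "3*s*z^2 + x*y = 0"
      using 0[of "(1, 0, 0)"] 0[of "(0, 1, 0)"] 0[of "(0, 0, 1)"] unfolding xyz polar_hesse by simp_all
    have "(27 * s^3 + 1) * x^3 * (x^3)^2 = 0" "(27 * s^3 + 1) * y^3 * (y^3)^2 = 0" "(27 * s^3 + 1) * z^3 * (z^3)^2 = 0"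
    proof -
      have *: "3*s*x^3 = - (x*y*z)" "3*s*y^3 = - (x*y*z)" "3*s*z^3 = - (x*y*z)" using e by Groebner_Basis.algebra+
      have "3*s*(x^3 - y^3) = 0" "3*s*(x^3 - z^3) = 0" using * by Groebner_Basis.algebra+
      then have eq: "y^3 = x^3" "z^3 = x^3" using s by simp_all
      have "(3*s*x^3)^3 = - (x^3 * y^3 * z^3)" unfolding * by Groebner_Basis.algebra
      then have 1: "(27 * s^3 + 1) * x^3 * (x^3)^2 = 0" unfolding eq by Groebner_Basis.algebra
      then show "(27 * s^3 + 1) * x^3 * (x^3)^2 = 0" "(27 * s^3 + 1) * y^3 * (y^3)^2 = 0" "(27 * s^3 + 1) * z^3 * (z^3)^2 = 0"
        unfolding eq by simp_all
    qed
    then have "x = 0" "y = 0" "z = 0" using s(2) by simp_all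
    then show False using v xyz by simp
  qed
  then show ?thesis using that by blast
qed

fun colm :: "'a vec \<Rightarrow> 'a vec \<Rightarrow> 'a vec \<Rightarrow> 'a mat" where
  "colm (a, b, c) (d, e, f) (g, h, i) = ((a, d, g), (b, e, h), (c, f, i))"

lemma app_colm: "app (colm p q r) (x, y, z) = vadd (vadd (scal x p) (scal y q)) (scal z r)"
  by (cases p; cases q; cases r) (simp add: mult.commute)

lemma app_colm_simps [simp]:
  "app (colm p q r) (1, 0, 0) = p" "app (colm p q r) (0, 1, 0) = q" "app (colm p q r) (0, 0, 1) = r"
  by (cases p; cases q; cases r; simp)+

lemma lininv_colm:
  fixes p q r :: "'a::field vec"
  assumes "\<And>x y z. vadd (vadd (scal x p) (scal y q)) (scal z r) = (0, 0, 0) \<Longrightarrow> x = 0 \<and> y = 0 \<and> z = 0"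
  shows "lininv (colm p q r) (minv (colm p q r))"
proof (rule lininv_minv)
  obtain r1 r2 r3 where c: "colm p q r = (r1, r2, r3)" by (cases "colm p q r")
  show "det3 (colm p q r) \<noteq> 0"
  proof
    assume "det3 (colm p q r) = 0"
    then obtain n where n: "n \<noteq> (0, 0, 0)" "dot n r1 = 0" "dot n r2 = 0" "dot n r3 = 0"
      unfolding c by (rule orth3)
    have "dot a b = dot b a" for a b :: "'a vec" by (cases a; cases b) (simp add: mult.commute)
    then have "app (colm p q r) n = (0, 0, 0)" using n by (simp add: c)
    then show False using assms n(1) by (cases n) (auto simp: app_colm)
  qed
qed

text \<open>In a basis of vectors nine coefficients of the cubic are its values and derivatives
  there; only the coefficient of x y z stays open.\<close>

lemma subst_colm:
  fixes G :: "'a::field_char_0 poly poly poly"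
  assumes G: "form3 3 G"
  obtains e where "subst3 (colm p q r) G = cub (eval3 G p) (polar G p q) (polar G p r) (polar G q p) e
    (polar G r p) (eval3 G q) (polar G q r) (polar G r q) (eval3 G r)"
proof -
  obtain a b c d e f g h i j where cub: "subst3 (colm p q r) G = cub a b c d e f g h i j" 
    using form3_3E form3_subst[OF G] by blast
  have ev: "eval3 G (app (colm p q r) v) = eval3 (cub a b c d e f g h i j) v" for v
    using arg_cong[OF cub, of "\<lambda>G. eval3 G v"] by simp
  have po: "polar G (app (colm p q r) v) (app (colm p q r) w) = polar (cub a b c d e f g h i j) v w" for v w
    using arg_cong[OF cub, of "\<lambda>G. polar G v w"] by (simp add: polar_subst)
  have "eval3 G p = a" "eval3 G q = g" "eval3 G r = j"
    using ev[of "(1, 0, 0)"] ev[of "(0, 1, 0)"] ev[of "(0, 0, 1)"] by simp_all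
  moreover have "polar G p q = b" "polar G p r = c" "polar G q p = d" "polar G r p = f" "polar G q r = h" "polar G r q = i"
    using po[of "(1, 0, 0)" "(0, 1, 0)"] po[of "(1, 0, 0)" "(0, 0, 1)"] po[of "(0, 1, 0)" "(1, 0, 0)"]
      po[of "(0, 0, 1)" "(1, 0, 0)"] po[of "(0, 1, 0)" "(0, 0, 1)"] po[of "(0, 0, 1)" "(0, 1, 0)"]
    by (simp_all add: polar_cub)
  ultimately show ?thesis using that cub by blast
qed

text \<open>In the basis \<open>p, r, q\<close> the curve has the shape of
  \<open>nonflex_tangential\<close>: up to a common factor, be, de and ga are the derivative at
  \<open>r\<close> towards \<open>p\<close>, the one towards \<open>q\<close>, and the value at
  \<open>r\<close>.\<close>

lemma contact_tangent_chain:
  fixes G :: "'a::{alg_closed_field,field_char_0} poly poly poly"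
  assumes G: "form3 3 G" and ns: "\<And>v. v \<noteq> (0, 0, 0) \<Longrightarrow> \<exists>w. polar G v w \<noteq> 0"
    and M: "lininv (colm p r q) M'"
    and z: "eval3 G p = 0" "polar G p q = 0" "eval3 G q = 0" "polar G q r = 0" "polar G q p \<noteq> 0"
    and ne: "contact G p \<noteq> {}"
  shows "polar G r q \<noteq> 0" and "eval3 G r = 0 \<Longrightarrow> polar G r p = 0"
proof -
  have p0: "p \<noteq> (0, 0, 0)" using lininv_nz[OF M, of "(1, 0, 0)"] by simp
  \<comment> \<open>Otherwise \<open>p\<close> would be singular, as the derivatives at
    \<open>p\<close> towards \<open>p\<close> and \<open>q\<close> already vanish.\<close>
  have P: "polar G p r \<noteq> 0"
  proof
    assume P: "polar G p r = 0"
    have "polar G p w = 0" for w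
    proof -
      obtain a b c where "M' = M'" "app M' w = (a, b, c)" by (cases "app M' w") auto
      then have w: "w = vadd (vadd (scal a p) (scal b r)) (scal c q)" 
        using M unfolding lininv_def by (metis app_colm)
      have "w = vadd (scal 1 (vadd (scal a p) (scal b r))) (scal c q)" by (simp add: w)
      then show ?thesis using P z by (simp only: polar_lin[OF G]) simp
    qed
    then show False using ns[OF p0] by blast
  qed
  obtain e where e: "subst3 (colm p r q) G = cub 0 (polar G p r) 0 (polar G r p) e (polar G q p) (eval3 G r) (polar G r q) 0 0"
    using subst_colm[OF G, of p r q] unfolding z by blast
  define E where "E = cub 0 1 0 (polar G r p / polar G p r) (e / polar G p r) (polar G q p / polar G p r) 
    (eval3 G r / polar G p r) (polar G r q / polar G p r) 0 0"
  have E: "subst3 (colm p r q) G = const3 (polar G p r) * E"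
    unfolding e E_def using P by (intro eval3_eqI) (simp add: distrib_left)
  have "contact E (1, 0, 0) \<noteq> {}"
    using contact_subst[OF M, of G "(1, 0, 0)"] ne unfolding E contact_scale[OF P] by simp
  then obtain C where "C \<in> contact E (1, 0, 0)" by blast
  then obtain G0 where C: "C \<in> max_tangent_cubics E" "G0 \<in> C" "eval3 G0 (1, 0, 0) = 0"
    and E0: "eval3 E (1, 0, 0) = 0"
    unfolding contact_def by blast
  have fE: "form3 3 E" unfolding E_def by (rule form3_cub)
  obtain G1 f g h l where G1: "form3 3 G1" and T: "tparam E G1 f g h"
    and l: "l \<noteq> 0" "(1, 0, 0) = scal l (bev f 1 0, bev g 1 0, bev h 1 0)"
    by (rule contact_param[OF fE C(1) _ E0 C(2,3)]) auto
  have pp: "bev f 1 0 \<noteq> 0" "bev g 1 0 = 0" "bev h 1 0 = 0" using l by auto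
  have R: "polar G q p / polar G p r \<noteq> 0" using z P by simp
  obtain f0 f1 f2 f3 k1 k2 where T': "tparam E G1 (f0, f1, f2, f3) (0, 0, 1, 0) (0, 1, k1, k2)" 
    and f0: "f0 \<noteq> 0" 
    by (rule nonflex_normalise[OF E_def R T G1 pp]) blast
  from nonflex_tangential[OF E_def R T' f0] P
  show "polar G r q \<noteq> 0" "eval3 G r = 0 \<Longrightarrow> polar G r p = 0" by simp_all
qed

text \<open>The classical formula for the further intersection of the tangent with the curve, that
  is -2p for a flex as origin. It is the same for all members of the Hesse pencil.\<close>

fun tang :: "'a::comm_ring_1 vec \<Rightarrow> 'a vec" where
  "tang (x, y, z) = (x * (y^3 - z^3), y * (z^3 - x^3), z * (x^3 - y^3))"

lemma tang_hesse:
  fixes s :: "'a::field_char_0"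
  assumes "eval3 (hesse s) p = 0"
  shows "eval3 (hesse s) (tang p) = 0" "polar (hesse s) p (tang p) = 0"
proof -
  obtain x y z where p: "p = (x, y, z)" by (cases p)
  have H: "s * (x^3 + y^3 + z^3) + x * y * z = 0" using assms unfolding p eval3_hesse .
  show "polar (hesse s) p (tang p) = 0" unfolding p tang.simps polar_hesse by Groebner_Basis.algebra
  have "eval3 (hesse s) (tang p) = (s * (x^3 + y^3 + z^3) + x * y * z) * ((y^3 - z^3) * (z^3 - x^3) * (x^3 - y^3))"
    unfolding p tang.simps eval3_hesse by Groebner_Basis.algebra
  then show "eval3 (hesse s) (tang p) = 0" by (simp add: H)
qed

lemma hesse_cubes:
  fixes s :: "'a::field_char_0"
  assumes s: "s \<noteq> 0" "27 * s^3 + 1 \<noteq> 0" and H: "eval3 (hesse s) (x, y, z) = 0"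
    and nz: "x * y * z \<noteq> 0"
  shows "(x^3 + y^3 + z^3)^3 - 27 * x^3 * y^3 * z^3 \<noteq> 0" and "\<not> (x^3 = y^3 \<and> y^3 = z^3)"
proof -
  have H': "s * (x^3 + y^3 + z^3) = - (x * y * z)" using H unfolding eval3_hesse by (simp add: add_eq_0_iff2)
  have "s^3 * ((x^3 + y^3 + z^3)^3 - 27 * x^3 * y^3 * z^3) = (s * (x^3 + y^3 + z^3))^3 - 27 * s^3 * (x * y * z)^3"
    by Groebner_Basis.algebra
  also have "\<dots> = - ((27 * s^3 + 1) * (x * y * z)^3)" unfolding H' by Groebner_Basis.algebra
  finally have *: "s^3 * ((x^3 + y^3 + z^3)^3 - 27 * x^3 * y^3 * z^3) \<noteq> 0" using s nz by simp
  then show 1: "(x^3 + y^3 + z^3)^3 - 27 * x^3 * y^3 * z^3 \<noteq> 0" by auto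
  show "\<not> (x^3 = y^3 \<and> y^3 = z^3)"
  proof
    assume "x^3 = y^3 \<and> y^3 = z^3"
    then have "x^3 = z^3" "y^3 = z^3" by auto
    then have "(x^3 + y^3 + z^3)^3 - 27 * x^3 * y^3 * z^3 = 0" by (simp add: power2_eq_square power3_eq_cube algebra_simps)
    with 1 show False by simp
  qed
qed

text \<open>The points with x y z = 0 are the flexes. On a flex tangent the cubic is a pure cube, so
  the second mixed coefficient vanishes along with the first.\<close>

lemma polar_flex_tangent:
  fixes s :: "'a::field_char_0"
  assumes H: "eval3 (hesse s) (x1, y1, z1) = 0" and nz: "(x1, y1, z1) \<noteq> (0, 0, 0)" and s: "s \<noteq> 0"
    and x1: "x1 * y1 * z1 = 0" and r: "polar (hesse s) (x1, y1, z1) r = 0"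
  shows "polar (hesse s) r (x1, y1, z1) = 0"
proof -
  obtain r1 r2 r3 where rr: "r = (r1, r2, r3)" by (cases r)
  have c: "x1^3 + y1^3 + z1^3 = 0" using H s x1 unfolding eval3_hesse by simp
  have r0: "(3*s*x1^2 + y1*z1) * r1 + (3*s*y1^2 + x1*z1) * r2 + (3*s*z1^2 + x1*y1) * r3 = 0"
    using r unfolding rr polar_hesse .
  have "(3*s*r1^2 + r2*r3) * x1 + (3*s*r2^2 + r1*r3) * y1 + (3*s*r3^2 + r1*r2) * z1 = 0"
  proof -
    consider "x1 = 0" | "y1 = 0" | "z1 = 0" using x1 by auto
    then show ?thesis
    proof cases
      case 1
      have nz1: "y1 * z1 \<noteq> 0" using c nz 1 by auto
      have "y1 * z1 * ((3*s*r1^2 + r2*r3) * x1 + (3*s*r2^2 + r1*r3) * y1 + (3*s*r3^2 + r1*r2) * z1) = 0"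
        using r0 c 1 by Groebner_Basis.algebra
      then show ?thesis using nz1 by simp
    next
      case 2
      have nz1: "x1 * z1 \<noteq> 0" using c nz 2 by auto
      have "x1 * z1 * ((3*s*r1^2 + r2*r3) * x1 + (3*s*r2^2 + r1*r3) * y1 + (3*s*r3^2 + r1*r2) * z1) = 0"
        using r0 c 2 by Groebner_Basis.algebra
      then show ?thesis using nz1 by simp
    next
      case 3
      have nz1: "x1 * y1 \<noteq> 0" using c nz 3 by auto
      have "x1 * y1 * ((3*s*r1^2 + r2*r3) * x1 + (3*s*r2^2 + r1*r3) * y1 + (3*s*r3^2 + r1*r2) * z1) = 0"
        using r0 c 3 by Groebner_Basis.algebra
      then show ?thesis using nz1 by simp
    qed
  qed
  then show ?thesis unfolding rr polar_hesse .
qed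

text \<open>The product of the two quadratic and the six cubic factors vanishes exactly at the points \<open>p\<close>
  with \<open>9p = 0\<close> and \<open>3p \<noteq> 0\<close> (for a flex as origin); \<open>A, B, C\<close> are the cubes of the coordinates.\<close>

definition torsion9 :: "'a::comm_ring_1 \<Rightarrow> 'a \<Rightarrow> 'a \<Rightarrow> 'a" where
  "torsion9 A B C = (A^2 + B^2 + C^2 - A*B - B*C - C*A) * (A^2*B + B^2*C + C^2*A - 3*A*B*C)
    * (A*B^2 + B*C^2 + C*A^2 - 3*A*B*C)"

text \<open>For cubes A, B, C of x, y, z the point \<open>tang (tang (x, y, z))\<close>, which is
  4p, equals (x U, y V, z W). The left-hand side is, up to the factor s, the condition that the
  tangent at 4p passes through p; the first factor on the right is nonzero by
  \<open>hesse_cubes\<close>.\<close>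

lemma torsion9_identity:
  fixes A B C :: "'a::field_char_0"
  defines "U \<equiv> (B - C) * (B * (C - A)^3 - C * (A - B)^3)" and "V \<equiv> (C - A) * (C * (A - B)^3 - A * (B - C)^3)"
    and "W \<equiv> (A - B) * (A * (B - C)^3 - B * (C - A)^3)"
  shows "3 * (A * U^2 + B * V^2 + C * W^2) - (A + B + C) * (U * V + V * W + W * U)
    = ((A + B + C)^3 - 27 * A * B * C) * torsion9 A B C"
  unfolding assms torsion9_def by Groebner_Basis.algebra

text \<open>Follows p, q = -2p and p2 = 4p. The chain of tangents is used twice: with an arbitrary
  \<open>r\<close> on the tangent at \<open>q\<close>, which shows that \<open>q\<close> is not a
  flex, and then with the further intersection \<open>r'\<close>, whose tangent must pass through
  \<open>p\<close>.\<close>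

lemma contact_nonflex:
  fixes s :: "'a::{alg_closed_field,field_char_0}"
  assumes s: "s \<noteq> 0" "27 * s^3 + 1 \<noteq> 0" and H: "eval3 (hesse s) (x, y, z) = 0"
    and nz: "x * y * z \<noteq> 0" and ne: "contact (hesse s) (x, y, z) \<noteq> {}"
  shows "torsion9 (x^3) (y^3) (z^3) = 0"
proof -
  let ?H = "hesse s"
  define p where "p = (x, y, z)"
  define q where "q = tang p"
  have fH: "form3 3 ?H" by (rule form3_cub)
  have H': "x * y * z = - (s * (x^3 + y^3 + z^3))" using H unfolding eval3_hesse by (simp add: add_eq_0_iff)
  note cubes = hesse_cubes[OF s H nz]
  have Hp: "eval3 ?H p = 0" using H by (simp add: p_def)
  have q: "eval3 ?H q = 0" "polar ?H p q = 0" unfolding q_def using tang_hesse[OF Hp] by blast+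
  have q': "q = (x * (y^3 - z^3), y * (z^3 - x^3), z * (x^3 - y^3))" by (simp add: q_def p_def)
  have q0: "q \<noteq> (0, 0, 0)" using cubes(2) nz unfolding q' by auto
  have "polar ?H q p = s * ((x^3 + y^3 + z^3)^3 - 27 * x^3 * y^3 * z^3)"
    using H' unfolding q' p_def polar_hesse by Groebner_Basis.algebra
  then have qp: "polar ?H q p \<noteq> 0" using s cubes(1) by simp
  obtain L where L: "\<And>w. polar ?H q w = dot L w"
  proof -
    obtain x1 y1 z1 where "q = (x1, y1, z1)" by (cases q)
    then have "polar ?H q w = dot (3*s*x1^2 + y1*z1, 3*s*y1^2 + x1*z1, 3*s*z1^2 + x1*y1) w" for w
      by (cases w) (simp only: polar_hesse dot.simps)
    then show ?thesis using that by blast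
  qed
  obtain u where u: "dot u q \<noteq> 0"
  proof -
    have "dot (1, 0, 0) q \<noteq> 0 \<or> dot (0, 1, 0) q \<noteq> 0 \<or> dot (0, 0, 1) q \<noteq> 0" using q0 by (cases q) auto
    then show ?thesis using that by blast
  qed
  have sym: "dot a b = dot b a" for a b :: "'a vec" by (cases a; cases b) (simp add: mult.commute)
  have dl: "dot a (vadd (vadd (scal k1 v1) (scal k2 v2)) (scal k3 v3)) = k1 * dot a v1 + k2 * dot a v2 + k3 * dot a v3"
    for a v1 v2 v3 :: "'a vec" and k1 k2 k3 by (cases a; cases v1; cases v2; cases v3) (simp add: algebra_simps)
  have "det3 (L, u, (0, 0, 0)) = 0" by (cases L; cases u) simp
  then obtain r where r: "r \<noteq> (0, 0, 0)" "dot r L = 0" "dot r u = 0" by (rule orth3)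
  have Lq: "dot L q = 0" using L[of q] polar_lin(4)[OF fH, of q] q by simp
  have Lp: "dot L p \<noteq> 0" using L[of p] qp by simp
  have ns: "\<exists>w. polar ?H v w \<noteq> 0" if "v \<noteq> (0, 0, 0)" for v using hesse_nonsing[OF s that] by blast
  have ne': "contact ?H p \<noteq> {}" using ne by (simp add: p_def)
  have indep: "lininv (colm p (vadd (scal 1 r) (scal m q)) q) (minv (colm p (vadd (scal 1 r) (scal m q)) q))" for m
  proof (rule lininv_colm)
    fix k1 k2 k3 assume eq: "vadd (vadd (scal k1 p) (scal k2 (vadd (scal 1 r) (scal m q)))) (scal k3 q) = (0, 0, 0)"
    have d2: "dot a (vadd (scal 1 r) (scal m q)) = dot a r + m * dot a q" for a
      by (cases a; cases r; cases q) (simp add: algebra_simps)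
    have *: "k1 * dot a p + k2 * (dot a r + m * dot a q) + k3 * dot a q = 0" for a
      using dl[of a k1 p k2 "vadd (scal 1 r) (scal m q)" k3 q] unfolding eq d2 by (cases a) simp
    have k1: "k1 = 0" using *[of L] Lq Lp r(2) sym[of L r] by simp
    have **: "k2 * dot a r = - (k2 * m + k3) * dot a q" for a
      using *[of a] k1 by (simp add: algebra_simps add_eq_0_iff2)
    have "(k2 * m + k3) * dot u q = 0"
      using **[of u] r(3) sym[of u r] by (metis minus_mult_left mult_zero_right neg_equal_0_iff_equal)
    then have k3: "k2 * m + k3 = 0" using u by (metis mult_eq_0_iff)
    have "k2 * dot a r = 0" for a using **[of a] unfolding k3 by simp
    from this[of "(1,0,0)"] this[of "(0,1,0)"] this[of "(0,0,1)"] have "k2 = 0" using r(1) by (cases r) auto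
    then show "k1 = 0 \<and> k2 = 0 \<and> k3 = 0" using k1 k3 by simp
  qed
  have qr: "polar ?H q (vadd (scal 1 r) (scal m q)) = 0" for m
    unfolding polar_lin(1)[OF fH] L Lq using r(2) sym[of L r] by simp
  have rq: "polar ?H r q \<noteq> 0"
    using contact_tangent_chain(1)[OF fH ns indep[of 0] Hp q(2,1) qr qp ne'] by (cases r; cases q) simp
  \<comment> \<open>Moves \<open>r\<close> along the tangent at \<open>q\<close> onto the curve. On
    this line the cubic is linear in \<open>m\<close>, and its slope is the nonzero derivative at
    \<open>r\<close> towards \<open>q\<close>.\<close>
  define m where "m = - eval3 ?H r / polar ?H r q"
  define r' where "r' = vadd (scal 1 r) (scal m q)"
  have Hr': "eval3 ?H r' = 0"
  proof -
    have "polar ?H q r = 0" using qr[of 0] by (cases r; cases q) simp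
    then have "eval3 ?H r' = eval3 ?H r + m * polar ?H r q" unfolding r'_def eval3_line[OF fH] by (simp add: q)
    then show ?thesis using rq by (simp add: m_def)
  qed
  have r'q: "polar ?H r' q \<noteq> 0" and r'p: "polar ?H r' p = 0"
    using contact_tangent_chain[OF fH ns indep[of m] Hp q(2,1) qr qp ne'] Hr' unfolding r'_def by blast+
  define p2 where "p2 = tang q"
  have p2: "eval3 ?H p2 = 0" "polar ?H q p2 = 0" unfolding p2_def using tang_hesse[OF q(1)] by blast+
  obtain x1 y1 z1 where xyz1: "q = (x1, y1, z1)" by (cases q)
  have qnf: "x1 * y1 * z1 \<noteq> 0"
    using polar_flex_tangent[of s x1 y1 z1 r'] r'q q(1) q0 s(1) qr[of m] unfolding xyz1 r'_def by blast
  note cubes2 = hesse_cubes[OF s q(1)[unfolded xyz1] qnf]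
  have p20: "p2 \<noteq> (0, 0, 0)" using cubes2(2) qnf unfolding p2_def xyz1 tang.simps by auto
  obtain a b c where "app (minv (colm p r' q)) p2 = (a, b, c)" by (cases "app (minv (colm p r' q)) p2")
  then have abc: "p2 = vadd (vadd (scal a p) (scal b r')) (scal c q)"
    using indep[of m] unfolding r'_def[symmetric] lininv_def by (metis app_colm)
  have Lr': "dot L r' = 0" using qr[of m] unfolding L r'_def .
  have "a * dot L p = 0" using p2(2) unfolding L abc dl Lr' Lq by simp
  then have a: "a = 0" using Lp by simp
  have p2': "p2 = vadd (scal b r') (scal c q)" unfolding abc a by (cases p; cases r'; cases q) simp
  have "polar ?H q r' = 0" unfolding L by (rule Lr')
  then have "b^2 * c * polar ?H r' q = 0" using p2(1) unfolding p2' eval3_line[OF fH] Hr' q(1) by simp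
  \<comment> \<open>The tangent at \<open>q\<close> meets the curve only in \<open>q\<close> and
    \<open>r'\<close>. The point \<open>p2\<close> is not \<open>q\<close>, since then the
    coordinates of \<open>q\<close> would have equal cubes.\<close>
  then consider "b = 0" | "c = 0" using r'q by auto
  then have "polar ?H p2 p = 0"
  proof cases
    case 1
    then have "p2 = scal c q" unfolding p2' by (cases r'; cases q) simp
    then have e: "x1 * (y1^3 - z1^3) = c * x1" "y1 * (z1^3 - x1^3) = c * y1" "z1 * (x1^3 - y1^3) = c * z1"
      unfolding p2_def xyz1 by auto
    have "y1^3 - z1^3 = c" "z1^3 - x1^3 = c" "x1^3 - y1^3 = c" using e qnf by simp_all
    then have c: "y1^3 - z1^3 = c" "z1^3 - x1^3 = c" "x1^3 - y1^3 = c" by blast+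
    have "3 * c = (y1^3 - z1^3) + (z1^3 - x1^3) + (x1^3 - y1^3)" unfolding c by simp
    then have "3 * c = 0" by simp
    then have False using c cubes2(2) by simp
    then show ?thesis ..
  next
    case 2
    then have "p2 = scal b r'" unfolding p2' by (cases r'; cases q) simp
    then show ?thesis unfolding polar_lin(2)[OF fH] by (simp only:) (simp add: polar_lin(2)[OF fH] r'p)
  qed
  moreover define A B C where "A = x^3" and "B = y^3" and "C = z^3"
  define U V W where "U = (B - C) * (B * (C - A)^3 - C * (A - B)^3)" and "V = (C - A) * (C * (A - B)^3 - A * (B - C)^3)"
    and "W = (A - B) * (A * (B - C)^3 - B * (C - A)^3)"
  have p2e: "p2 = (x * U, y * V, z * W)"
    unfolding p2_def q' tang.simps U_def V_def W_def A_def B_def C_def by (simp add: power_mult_distrib mult.assoc)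
  have "polar ?H p2 p = 3 * s * (x^3 * U^2 + y^3 * V^2 + z^3 * W^2) + x * y * z * (U * V + V * W + W * U)"
    unfolding p2e p_def polar_hesse by Groebner_Basis.algebra
  also have "\<dots> = s * (3 * (A * U^2 + B * V^2 + C * W^2) - (A + B + C) * (U * V + V * W + W * U))"
    unfolding H' A_def B_def C_def by Groebner_Basis.algebra
  also have "\<dots> = s * (((A + B + C)^3 - 27 * A * B * C) * torsion9 A B C)"
    unfolding U_def V_def W_def torsion9_identity ..
  finally show ?thesis using s(1) cubes(1) unfolding A_def B_def C_def by simp
qed

section \<open>The points of order three and nine on a cubic in Hesse form\<close>

definition pt :: "'a::field vec \<Rightarrow> 'a vec set" where
  "pt v = {scal c v | c. c \<noteq> 0}"

lemma pt_self: "v \<in> pt v"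
  unfolding pt_def by (auto intro!: exI[of _ 1] simp: scal_1[symmetric] simp del: scal_1)

lemma pt_eq_iff: "pt v = pt w \<longleftrightarrow> (\<exists>c. c \<noteq> 0 \<and> v = scal c w)"
proof
  assume "pt v = pt w"
  then have "v \<in> pt w" using pt_self by blast
  then show "\<exists>c. c \<noteq> 0 \<and> v = scal c w" unfolding pt_def by blast
next
  assume "\<exists>c. c \<noteq> 0 \<and> v = scal c w"
  then obtain c where c: "c \<noteq> 0" "v = scal c w" by blast
  have "scal d v = scal (d * c) w" "scal d w = scal (d / c) v" for d using c by simp_all
  then show "pt v = pt w" unfolding pt_def using c(1) by (auto; metis divide_eq_0_iff mult_eq_0_iff)
qed

lemma app_pt: "app M ` pt v = pt (app M v)"
  unfolding pt_def by (auto simp: app_scal) (metis (mono_tags, lifting) app_scal imageI mem_Collect_eq)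

definition zset :: "'a::field poly poly poly \<Rightarrow> ('a vec \<Rightarrow> 'a) \<Rightarrow> 'a vec set set" where
  "zset E K = {pt v | v. v \<noteq> (0, 0, 0) \<and> eval3 E v = 0 \<and> K v = 0}"

lemma zset_transport:
  fixes E :: "'a::field_char_0 poly poly poly"
  assumes N: "lininv N N'" and E: "c \<noteq> 0" "\<And>v. eval3 E (app N v) = c * eval3 E' v"
    and K: "c' \<noteq> 0" "\<And>v. K (app N v) = c' * K' v"
  shows "zset E K = (`) (app N) ` zset E' K'"
proof (intro equalityI subsetI)
  fix Q assume "Q \<in> zset E K"
  then obtain v where v: "Q = pt v" "v \<noteq> (0, 0, 0)" "eval3 E v = 0" "K v = 0" unfolding zset_def by blast
  have v': "v = app N (app N' v)" using N unfolding lininv_def by metis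
  have "app N' v \<noteq> (0, 0, 0)" using v(2) lininv_nz[OF lininv_sym[OF N]] by blast
  moreover have "eval3 E' (app N' v) = 0" "K' (app N' v) = 0"
    using E(2)[of "app N' v"] K(2)[of "app N' v"] v(3,4) E(1) K(1) unfolding v'[symmetric] by simp_all
  ultimately have "pt (app N' v) \<in> zset E' K'" unfolding zset_def by blast
  moreover have "Q = app N ` pt (app N' v)" unfolding app_pt v'[symmetric] v(1) ..
  ultimately show "Q \<in> (`) (app N) ` zset E' K'" by blast
next
  fix Q assume "Q \<in> (`) (app N) ` zset E' K'"
  then obtain v where v: "Q = app N ` pt v" "v \<noteq> (0, 0, 0)" "eval3 E' v = 0" "K' v = 0" unfolding zset_def by blast
  have "Q = pt (app N v)" "app N v \<noteq> (0, 0, 0)" "eval3 E (app N v) = 0" "K (app N v) = 0"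
    using v E K lininv_nz[OF N] by (simp_all add: app_pt)
  then show "Q \<in> zset E K" unfolding zset_def by blast
qed

lemma card_zset_transport:
  fixes E :: "'a::field_char_0 poly poly poly"
  assumes N: "lininv N N'" and E: "c \<noteq> 0" "\<And>v. eval3 E (app N v) = c * eval3 E' v"
    and K: "c' \<noteq> 0" "\<And>v. K (app N v) = c' * K' v"
  shows "card (zset E K) = card (zset E' K')"
proof -
  have "inj (app N)" using N unfolding lininv_def by (metis injI)
  then have "inj_on ((`) (app N)) S" for S by (meson inj_image_eq_iff inj_onI)
  moreover have "zset E K = (`) (app N) ` zset E' K'" using zset_transport[of N N' c E E' c' K K'] assms by blast
  ultimately show ?thesis by (metis card_image)
qed

fun kform :: "nat \<Rightarrow> 'a::comm_ring_1 \<Rightarrow> 'a vec \<Rightarrow> 'a" where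
  "kform g c (x, y, z) = (if g = 0 then x^3 + c * y^3 + c^2 * z^3
    else if g = 1 then x^2*y + c * y^2*z + c^2 * z^2*x else x^2*z + c * y^2*x + c^2 * z^2*y)"

text \<open>Translations by the eight nonzero points of order three; \<open>kform g c p = 0\<close> says that
  \<open>ktrans g c p\<close> lies on the tangent at \<open>p\<close>.\<close>

fun ktrans :: "nat \<Rightarrow> 'a::comm_ring_1 \<Rightarrow> 'a vec \<Rightarrow> 'a vec" where
  "ktrans g c (x, y, z) = (if g = 0 then (x, c * y, c^2 * z)
    else if g = 1 then (y, c * z, c^2 * x) else (z, c * x, c^2 * y))"

text \<open>The pair (0, 1) is left out: it would be the identity instead of a translation of order
  three.\<close>

definition kindex :: "(nat \<times> 'a::comm_ring_1) set" where
  "kindex = {(g, c). g \<le> 2 \<and> c^3 = 1 \<and> (g = 0 \<longrightarrow> c \<noteq> 1)}"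

lemma cube_root_one:
  fixes c :: "'a::field"
  assumes "c^3 = 1" "c \<noteq> 1" shows "c^2 + c + 1 = 0"
proof -
  have "(c - 1) * (c^2 + c + 1) = c^3 - 1" by (simp add: algebra_simps power2_eq_square power3_eq_cube)
  then show ?thesis using assms by simp
qed

lemma omega_exists:
  obtains w :: "'a::{alg_closed_field,field_char_0}" where "w^2 + w + 1 = 0" "w^3 = 1" "w \<noteq> 1" "w^2 \<noteq> 1" "w^2 \<noteq> w"
    "{c :: 'a. c^3 = 1} = {1, w, w^2}"
proof -
  obtain w :: 'a where "poly [:1, 1, 1:] w = 0" using alg_closed_imp_poly_has_root[of "[:1, 1, 1 :: 'a:]"] by auto
  then have w: "w^2 + w + 1 = 0" by (simp add: algebra_simps power2_eq_square)
  have w3: "w^3 = 1" using w by Groebner_Basis.algebra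
  have w1: "w \<noteq> 1"
  proof
    assume "w = 1" then have "(3 :: 'a) = 0" using w by simp
    then show False by simp
  qed
  have w0: "w \<noteq> 0" using w by auto
  have w21: "w^2 \<noteq> 1"
  proof
    assume "w^2 = 1" then have "w * 1 = 1" using w3 by (simp add: power2_eq_square power3_eq_cube)
    then show False using w1 by simp
  qed
  have w22: "w^2 \<noteq> w" using w0 w1 by (simp add: power2_eq_square)
  have "c \<in> {1, w, w^2}" if c: "c^3 = 1" for c
  proof -
    have "(c - 1) * (c - w) * (c - w^2) = 0" using c w by Groebner_Basis.algebra
    then show ?thesis by auto
  qed
  moreover have "(w^2)^3 = 1" using w3 by Groebner_Basis.algebra
  ultimately have "{c :: 'a. c^3 = 1} = {1, w, w^2}" using w3 by auto
  then show ?thesis using that w w3 w1 w21 w22 by blast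
qed

text \<open>With cube roots of unity, a^2 + b^2 + c^2 - a b - b c - c a has two linear factors and
  a^3 + b^3 + c^3 - 3 a b c has three. Applied to the cubes of the coordinates, and to monomials
  such as x^2 y, these are the eight forms \<open>kform\<close>.\<close>

lemma torsion9_cases:
  fixes x y z :: "'a::{alg_closed_field,field_char_0}"
  assumes "torsion9 (x^3) (y^3) (z^3) = 0"
  obtains g c where "(g, c) \<in> kindex" "kform g c (x, y, z) = 0"
proof -
  obtain w :: 'a where w: "w^2 + w + 1 = 0" "w^3 = 1" "w \<noteq> 1" "w^2 \<noteq> 1" 
    using omega_exists[where 'a = 'a] by metis
  have w6: "(w^2)^3 = 1" using w by Groebner_Basis.algebra
  have quad: "a^2 + b^2 + c^2 - a*b - b*c - c*a = (a + w*b + w^2*c) * (a + w^2*b + (w^2)^2*c)" for a b c :: 'a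
    using w(1) by Groebner_Basis.algebra
  have cube: "a^3 + b^3 + c^3 - 3*a*b*c = (a + b + c) * ((a + w*b + w^2*c) * (a + w^2*b + (w^2)^2*c))" for a b c :: 'a
    using w(1) by Groebner_Basis.algebra
  have "torsion9 (x^3) (y^3) (z^3) = ((x^3)^2 + (y^3)^2 + (z^3)^2 - x^3*y^3 - y^3*z^3 - z^3*x^3)
    * (((x^2*y)^3 + (y^2*z)^3 + (z^2*x)^3 - 3*(x^2*y)*(y^2*z)*(z^2*x))
    * ((x^2*z)^3 + (y^2*x)^3 + (z^2*y)^3 - 3*(x^2*z)*(y^2*x)*(z^2*y)))"
    unfolding torsion9_def by Groebner_Basis.algebra
  then have "(kform 0 w (x, y, z) * kform 0 (w^2) (x, y, z)) * ((kform 1 1 (x, y, z) * (kform 1 w (x, y, z) * kform 1 (w^2) (x, y, z)))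
    * (kform 2 1 (x, y, z) * (kform 2 w (x, y, z) * kform 2 (w^2) (x, y, z)))) = 0"
    using assms unfolding quad cube by (simp add: mult.assoc)
  then consider "kform 0 w (x, y, z) = 0" | "kform 0 (w^2) (x, y, z) = 0" | "kform 1 1 (x, y, z) = 0" 
    | "kform 1 w (x, y, z) = 0" | "kform 1 (w^2) (x, y, z) = 0" | "kform 2 1 (x, y, z) = 0" 
    | "kform 2 w (x, y, z) = 0" | "kform 2 (w^2) (x, y, z) = 0" 
    unfolding mult_eq_0_iff by blast
  then show ?thesis by cases (rule that[rotated], assumption, use w w6 in \<open>simp add: kindex_def\<close>)+
qed

text \<open>The points with x y z = 0 are flexes; they satisfy 3p = 0 and belong to none of the
  eight classes.\<close>

lemma kform_nz:
  fixes s :: "'a::field_char_0"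
  assumes s: "s \<noteq> 0" and v: "(x, y, z) \<noteq> (0, 0, 0)" "eval3 (hesse s) (x, y, z) = 0" 
    and k: "(g, c) \<in> kindex" "kform g c (x, y, z) = 0"
  shows "x * y * z \<noteq> 0"
proof
  assume 0: "x * y * z = 0"
  have "s * (x^3 + y^3 + z^3) = 0" using v(2) unfolding eval3_hesse 0 by simp
  then have H: "x^3 + y^3 + z^3 = 0" using s by simp
  have c: "c^3 = 1" using k(1) by (simp add: kindex_def)
  then have c0: "c \<noteq> 0" by auto
  consider "g = 0" | "g = 1" | "g = 2" using k(1) by (auto simp: kindex_def le_Suc_eq numeral_2_eq_2)
  then show False
  proof cases
    case 1
    then have c1: "c \<noteq> 1" using k(1) by (simp add: kindex_def)
    have c2: "c^2 \<noteq> 1" using c c1 by (metis mult_1 power2_eq_square power3_eq_cube)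
    have c3: "c^2 \<noteq> c" using c0 c1 by (simp add: power2_eq_square)
    have K: "x^3 + c * y^3 + c^2 * z^3 = 0" using k(2) 1 by simp
    have "(c - 1) * y^3 + (c^2 - 1) * z^3 = 0" using K H by Groebner_Basis.algebra
    moreover have "(1 - c) * x^3 + (c^2 - c) * z^3 = 0" using K H by Groebner_Basis.algebra
    moreover have "(1 - c^2) * x^3 + (c - c^2) * y^3 = 0" using K H by Groebner_Basis.algebra
    ultimately show False using 0 v(1) c1 c2 c3 by auto
  next
    case 2
    then have "x^2*y + c * y^2*z + c^2 * z^2*x = 0" using k(2) by simp
    then show False using 0 H v(1) c0 by auto
  next
    case 3
    then have "x^2*z + c * y^2*x + c^2 * z^2*y = 0" using k(2) by simp
    then show False using 0 H v(1) c0 by auto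
  qed
qed

text \<open>On the class of the translation by t one has -2p = p + t. So the class consists of the
  solutions of 3p = -t, and nine points are to be expected.\<close>

lemma tang_ktrans:
  fixes s :: "'a::field_char_0"
  assumes s: "s \<noteq> 0" "27 * s^3 + 1 \<noteq> 0" and H: "eval3 (hesse s) (x, y, z) = 0" and nz: "x * y * z \<noteq> 0"
    and k: "(g, c) \<in> kindex" "kform g c (x, y, z) = 0"
  obtains m where "m \<noteq> 0" "tang (x, y, z) = scal m (ktrans g c (x, y, z))"
proof -
  have c: "c^3 = 1" using k(1) by (simp add: kindex_def)
  have "\<exists>m. tang (x, y, z) = scal m (ktrans g c (x, y, z))"
  proof -
    consider "g = 0" | "g = 1" | "g = 2" using k(1) by (auto simp: kindex_def le_Suc_eq numeral_2_eq_2)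
    then show ?thesis
    proof cases
      case 1
      then have "c \<noteq> 1" using k(1) by (simp add: kindex_def)
      then have c': "c^2 + c + 1 = 0" using cube_root_one[OF c] by blast
      have K: "x^3 + c * y^3 + c^2 * z^3 = 0" using k(2) 1 by simp
      have "y * (z^3 - x^3) = (y^3 - z^3) * (c * y)" "z * (x^3 - y^3) = (y^3 - z^3) * (c^2 * z)"
        using K c' by Groebner_Basis.algebra+
      then show ?thesis using 1 by (intro exI[of _ "y^3 - z^3"]) simp
    next
      case 2
      have K: "x^2*y + c * y^2*z + c^2 * z^2*x = 0" using k(2) 2 by simp
      have "y * (y * (z^3 - x^3)) = (x * (y^3 - z^3)) * (c * z)" "y * (z * (x^3 - y^3)) = (x * (y^3 - z^3)) * (c^2 * x)"
        using K c by Groebner_Basis.algebra+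
      then show ?thesis using 2 nz by (intro exI[of _ "x * (y^3 - z^3) / y"]) (simp add: field_simps)
    next
      case 3
      have K: "x^2*z + c * y^2*x + c^2 * z^2*y = 0" using k(2) 3 by simp
      have "z * (y * (z^3 - x^3)) = (x * (y^3 - z^3)) * (c * x)" "z * (z * (x^3 - y^3)) = (x * (y^3 - z^3)) * (c^2 * y)"
        using K c by Groebner_Basis.algebra+
      then show ?thesis using 3 nz by (intro exI[of _ "x * (y^3 - z^3) / z"]) (simp add: field_simps)
    qed
  qed
  then obtain m where m: "tang (x, y, z) = scal m (ktrans g c (x, y, z))" by blast
  have "tang (x, y, z) \<noteq> (0, 0, 0)" using hesse_cubes(2)[OF s H nz] nz by auto
  moreover have "scal 0 u = (0, 0, 0)" for u :: "'a vec" by (cases u) simp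
  ultimately have "m \<noteq> 0" using m by metis
  with m show ?thesis using that by blast
qed

text \<open>The translation can be recovered from -2p. If two translations of different index
  \<open>g\<close> agreed on a point, the cubes of its coordinates would be a cycle A = L B, B = L
  C, C = L A; then they are equal or have sum zero, and both are excluded on the curve.\<close>

lemma kform_disjoint:
  fixes s :: "'a::field_char_0"
  assumes s: "s \<noteq> 0" "27 * s^3 + 1 \<noteq> 0" and v: "(x, y, z) \<noteq> (0, 0, 0)" "eval3 (hesse s) (x, y, z) = 0"
    and k: "(g, c) \<in> kindex" "kform g c (x, y, z) = 0" and k': "(g', c') \<in> kindex" "kform g' c' (x, y, z) = 0"
  shows "(g, c) = (g', c')"
proof -
  have nz: "x * y * z \<noteq> 0" using kform_nz[OF s(1) v k] .
  obtain m where m: "m \<noteq> 0" "tang (x, y, z) = scal m (ktrans g c (x, y, z))" using tang_ktrans[OF s v(2) nz k] .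
  obtain m' where m': "m' \<noteq> 0" "tang (x, y, z) = scal m' (ktrans g' c' (x, y, z))" using tang_ktrans[OF s v(2) nz k'] .
  have eq: "scal m (ktrans g c (x, y, z)) = scal m' (ktrans g' c' (x, y, z))" using m m' by simp
  have c: "c^3 = 1" "c'^3 = 1" using k(1) k'(1) by (simp_all add: kindex_def)
  have cyc: False if "A = L * B" "B = L * C" "C = L * A" "A + B + C = x^3 + y^3 + z^3" "A * B * C = x^3 * y^3 * z^3"
      "A = B \<and> B = C \<longrightarrow> x^3 = y^3 \<and> y^3 = z^3" for A B C L
  proof -
    have A0: "A \<noteq> 0" "B \<noteq> 0" "C \<noteq> 0" using that(5) nz by auto
    have "A * (L^3 - 1) = 0" using that(1-3) by Groebner_Basis.algebra
    then have L: "L^3 = 1" using A0 by simp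
    show False
    proof (cases "L = 1")
      case True
      then show False using that(1-3,6) hesse_cubes(2)[OF s v(2) nz] by simp
    next
      case False
      then have "L^2 + L + 1 = 0" using cube_root_one[OF L] by blast
      then have "A + B + C = 0" using that(1-3) by Groebner_Basis.algebra
      then show False using that(4) v(2) nz unfolding eval3_hesse by simp
    qed
  qed
  define L where "L = (m' / m)^3"
  have Lm: "L * m^3 = m'^3" using m by (simp add: L_def power_divide)
  have can: "a = L * b" if "m^3 * a = m'^3 * b" for a b
  proof -
    have "m^3 * a = m^3 * (L * b)" using that Lm by (simp add: mult_ac) 
    then show ?thesis using m(1) by simp
  qed
  have cub: "(m * (c^i * u))^3 = m^3 * u^3" "(m' * (c'^i * u))^3 = m'^3 * u^3" for u i
  proof -
    have "(c^i)^3 = 1" "(c'^i)^3 = 1" using c by (metis power_commutes power_mult power_one mult.commute)+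
    then show "(m * (c^i * u))^3 = m^3 * u^3" "(m' * (c'^i * u))^3 = m'^3 * u^3" by (simp_all add: power_mult_distrib)
  qed
  note cub' = cub[of 1, simplified] cub[of 2]
  have gg: "g = 0 \<or> g = 1 \<or> g = 2" "g' = 0 \<or> g' = 1 \<or> g' = 2"
    using k(1) k'(1) by (auto simp: kindex_def le_Suc_eq numeral_2_eq_2)
  have cubes: "g = 0 \<Longrightarrow> g' = 1 \<Longrightarrow> False" "g = 0 \<Longrightarrow> g' = 2 \<Longrightarrow> False" "g = 1 \<Longrightarrow> g' = 0 \<Longrightarrow> False" 
    "g = 1 \<Longrightarrow> g' = 2 \<Longrightarrow> False" "g = 2 \<Longrightarrow> g' = 0 \<Longrightarrow> False" "g = 2 \<Longrightarrow> g' = 1 \<Longrightarrow> False"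
  proof -
    have e3: "m^3 * t1^3 = m'^3 * t1'^3" "m^3 * t2^3 = m'^3 * t2'^3" "m^3 * t3^3 = m'^3 * t3'^3"
      if "ktrans g c (x, y, z) = (t1, c * t2, c^2 * t3)" "ktrans g' c' (x, y, z) = (t1', c' * t2', c'^2 * t3')" for t1 t2 t3 t1' t2' t3'
    proof -
      have "m * t1 = m' * t1'" "m * (c * t2) = m' * (c' * t2')" "m * (c^2 * t3) = m' * (c'^2 * t3')"
        using eq unfolding that by simp_all
      then have "(m * t1)^3 = (m' * t1')^3" "(m * (c * t2))^3 = (m' * (c' * t2'))^3" "(m * (c^2 * t3))^3 = (m' * (c'^2 * t3'))^3"
        by simp_all
      then show "m^3 * t1^3 = m'^3 * t1'^3" "m^3 * t2^3 = m'^3 * t2'^3" "m^3 * t3^3 = m'^3 * t3'^3"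
        unfolding cub' by (simp_all add: power_mult_distrib)
    qed
    { assume gs: "g = 0" "g' = 1"
      have E: "x^3 = L * y^3" "y^3 = L * z^3" "z^3 = L * x^3"
        using can[OF e3(1)[of x y z y z x]] can[OF e3(2)[of x y z y z x]] can[OF e3(3)[of x y z y z x]] by (simp_all add: gs)
      show False by (rule cyc[of "x^3" L "y^3" "z^3", OF E]) (auto simp: ac_simps) }
    { assume gs: "g = 0" "g' = 2"
      have E: "x^3 = L * z^3" "z^3 = L * y^3" "y^3 = L * x^3"
        using can[OF e3(1)[of x y z z x y]] can[OF e3(2)[of x y z z x y]] can[OF e3(3)[of x y z z x y]] by (simp_all add: gs)
      show False by (rule cyc[of "x^3" L "z^3" "y^3", OF E]) (auto simp: ac_simps) }
    { assume gs: "g = 1" "g' = 0"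
      have E: "y^3 = L * x^3" "x^3 = L * z^3" "z^3 = L * y^3"
        using can[OF e3(1)[of y z x x y z]] can[OF e3(2)[of y z x x y z]] can[OF e3(3)[of y z x x y z]] by (simp_all add: gs)
      show False by (rule cyc[of "y^3" L "x^3" "z^3", OF E]) (auto simp: ac_simps) }
    { assume gs: "g = 1" "g' = 2"
      have E: "y^3 = L * z^3" "z^3 = L * x^3" "x^3 = L * y^3"
        using can[OF e3(1)[of y z x z x y]] can[OF e3(2)[of y z x z x y]] can[OF e3(3)[of y z x z x y]] by (simp_all add: gs)
      show False by (rule cyc[of "y^3" L "z^3" "x^3", OF E]) (auto simp: ac_simps) }
    { assume gs: "g = 2" "g' = 0"
      have E: "z^3 = L * x^3" "x^3 = L * y^3" "y^3 = L * z^3"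
        using can[OF e3(1)[of z x y x y z]] can[OF e3(2)[of z x y x y z]] can[OF e3(3)[of z x y x y z]] by (simp_all add: gs)
      show False by (rule cyc[of "z^3" L "x^3" "y^3", OF E]) (auto simp: ac_simps) }
    { assume gs: "g = 2" "g' = 1"
      have E: "z^3 = L * y^3" "y^3 = L * x^3" "x^3 = L * z^3"
        using can[OF e3(1)[of z x y y z x]] can[OF e3(2)[of z x y y z x]] can[OF e3(3)[of z x y y z x]] by (simp_all add: gs)
      show False by (rule cyc[of "z^3" L "y^3" "x^3", OF E]) (auto simp: ac_simps) }
  qed
  then have "g = g'" using gg by blast
  moreover have "c = c'"
    using gg(1) eq nz m unfolding \<open>g = g'\<close>[symmetric] by auto
  ultimately show ?thesis by simp
qed

text \<open>In the chart z = 1 the class equation gives x^3 in terms of y^3, and the curve becomes x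
  y = - s l(y). Cubing the latter eliminates x and leaves a polynomial of degree nine in y, each
  root of which determines x.\<close>

lemma card_kform0:
  fixes s :: "'a::{alg_closed_field,field_char_0}"
  assumes s: "s \<noteq> 0" "27 * s^3 + 1 \<noteq> 0" and w: "w^2 + w + 1 = 0" "w \<noteq> 1"
  shows "card (zset (hesse s) (kform 0 w)) = 9"
proof -
  have w3: "w^3 = 1" using w(1) by Groebner_Basis.algebra
  have w2: "w^2 \<noteq> 1" using w(2) w3 by (metis mult_1 power2_eq_square power3_eq_cube)
  define l where "l y = (1 - w) * y^3 + 1 - w^2" for y
  define Q where "Q = smult (s^3) ([:1 - w^2, 0, 0, 1 - w:]^3) + - [:0, 0, 0, w^2, 0, 0, w:]"
  have Q: "poly Q y = s^3 * l y^3 - (w * y^3 + w^2) * y^3" for y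
    by (simp add: Q_def l_def algebra_simps power2_eq_square power3_eq_cube)
  have Q': "poly (pderiv Q) y = 3 * y^2 * (3 * s^3 * (1 - w) * l y^2 - 2 * w * y^3 - w^2)" for y
    unfolding Q_def l_def
    by (simp add: pderiv_add pderiv_smult pderiv_power pderiv_minus pderiv_pCons numeral_3_eq_3 algebra_simps power2_eq_square power3_eq_cube)
  have "degree ([:1 - w^2, 0, 0, 1 - w:]^3) = 9" using w(2) by (subst degree_power_eq) auto
  then have "degree (smult (s^3) ([:1 - w^2, 0, 0, 1 - w:]^3)) = 9" using s by simp
  moreover have "degree (- [:0, 0, 0, w^2, 0, 0, w:]) < 9" by (auto simp: degree_pCons_eq_if)
  ultimately have dQ: "degree Q = 9" unfolding Q_def by (subst degree_add_eq_left) auto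
  have y0: "y \<noteq> 0" if "poly Q y = 0" for y
    using that s w2 by (auto simp: Q l_def)
  have cQ: "card {y. poly Q y = 0} = 9" unfolding dQ[symmetric]
  proof (rule card_simple_roots)
    show "Q \<noteq> 0" using dQ by auto
    fix y assume y: "poly Q y = 0"
    show "poly (pderiv Q) y \<noteq> 0"
    proof
      assume "poly (pderiv Q) y = 0"
      then have 1: "3 * s^3 * (1 - w) * l y^2 - 2 * w * y^3 - w^2 = 0" using y0[OF y] by (simp add: Q')
      have 2: "s^3 * l y^3 = (w * y^3 + w^2) * y^3" using y by (simp add: Q)
      \<comment> \<open>At a double root y^3 = 1, where the equation itself turns into 27 s^3 + 1 =
        0; smoothness of the curve thus makes the roots simple.\<close>
      have "(1 - w) * (y^3 - 1)^2 = 0" using 1 2 w(1) unfolding l_def by Groebner_Basis.algebra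
      then have y1: "y^3 = 1" using w(2) by simp
      have "27 * s^3 + 1 = 0" using 2 w(1) unfolding l_def y1 by Groebner_Basis.algebra
      then show False using s by simp
    qed
  qed
  define f where "f y = pt (- s * l y / y, y, 1)" for y
  have "zset (hesse s) (kform 0 w) = f ` {y. poly Q y = 0}"
  proof (intro equalityI subsetI)
    fix P assume "P \<in> zset (hesse s) (kform 0 w)"
    then obtain v where v: "P = pt v" "v \<noteq> (0, 0, 0)" "eval3 (hesse s) v = 0" "kform 0 w v = 0" unfolding zset_def by blast
    obtain x y z where xyz: "v = (x, y, z)" by (cases v)
    have nz: "x * y * z \<noteq> 0" using kform_nz[of s x y z 0 w] v s w w3 unfolding xyz by (simp add: kindex_def)
    define x' y' where "x' = x / z" and "y' = y / z"
    have v': "v = scal z (x', y', 1)" using nz by (simp add: xyz x'_def y'_def)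
    have nz': "z \<noteq> 0" "x' \<noteq> 0" "y' \<noteq> 0" using nz by (auto simp: x'_def y'_def)
    have "z^3 * eval3 (hesse s) (x', y', 1) = 0" using v(3) unfolding v' eval3_scal[OF form3_cub] .
    then have H: "s * (x'^3 + y'^3 + 1) + x' * y' = 0" using nz' unfolding eval3_hesse by simp
    have "z^3 * (x'^3 + w * y'^3 + w^2) = 0" using v(4) unfolding v' by (simp add: algebra_simps power_mult_distrib)
    then have K0: "x'^3 + w * y'^3 + w^2 = 0" using nz' by (metis mult_eq_0_iff power_eq_0_iff)
    have "x'^3 = (x'^3 + w * y'^3 + w^2) - w * y'^3 - w^2" by simp
    then have K: "x'^3 = - w * y'^3 - w^2" unfolding K0 by simp
    have xy: "x' * y' = - s * l y'" using H unfolding K l_def by Groebner_Basis.algebra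
    have "(x' * y')^3 = (- w * y'^3 - w^2) * y'^3" by (simp add: power_mult_distrib K)
    then have "poly Q y' = 0" unfolding xy Q by Groebner_Basis.algebra
    moreover have "x' = - s * l y' / y'" using xy nz' by (simp add: field_simps)
    then have "P = f y'" unfolding v(1) f_def pt_eq_iff v' using nz' by blast
    ultimately show "P \<in> f ` {y. poly Q y = 0}" by blast
  next
    fix P assume "P \<in> f ` {y. poly Q y = 0}"
    then obtain y where y: "poly Q y = 0" "P = f y" by blast
    define x where "x = - s * l y / y"
    have xy: "x * y = - s * l y" using y0[OF y(1)] by (simp add: x_def)
    have "(x * y)^3 = - (s^3 * l y^3)" unfolding xy by Groebner_Basis.algebra
    then have "y^3 * x^3 = y^3 * (- w * y^3 - w^2)" using y(1) unfolding Q by (simp add: power_mult_distrib algebra_simps)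
    then have K: "x^3 = - w * y^3 - w^2" using y0[OF y(1)] by (metis mult_left_cancel power_eq_0_iff)
    have "eval3 (hesse s) (x, y, 1) = 0" unfolding eval3_hesse mult_1_right xy K l_def power_one by Groebner_Basis.algebra
    moreover have "kform 0 w (x, y, 1) = 0" using K by simp
    ultimately show "P \<in> zset (hesse s) (kform 0 w)" unfolding zset_def y(2) f_def x_def[symmetric] by force
  qed
  moreover have "inj_on f {y. poly Q y = 0}"
    by (rule inj_onI) (auto simp: f_def pt_eq_iff)
  ultimately show ?thesis using cQ by (simp add: card_image)
qed

abbreviation swapyz :: "'a::comm_ring_1 mat" where "swapyz \<equiv> ((1, 0, 0), (0, 0, 1), (0, 1, 0))"

lemma swapyz: "lininv swapyz swapyz" "app swapyz (x, y, z) = (x, z, y)"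
  by (simp_all add: lininv_def)

text \<open>The discrete Fourier transform permutes the members of the Hesse pencil and exchanges
  diagonal translations with cyclic ones.\<close>

abbreviation dft :: "'a::comm_ring_1 \<Rightarrow> 'a mat" where "dft w \<equiv> ((1, 1, 1), (1, w, w^2), (1, w^2, w))"

lemma dft_inv:
  fixes w :: "'a::field_char_0"
  assumes w: "w^2 + w + 1 = 0" "w \<noteq> 1" shows "lininv (dft w) (minv (dft w))"
proof (rule lininv_minv)
  have w3: "w^3 = 1" using w(1) by Groebner_Basis.algebra
  have "w^2 \<noteq> w"
  proof
    assume "w^2 = w"
    then have "w * (w - 1) = 0" by (simp add: algebra_simps power2_eq_square)
    then show False using w by auto
  qed
  moreover have d: "det3 (dft w) = 3 * (w^2 - w)" unfolding det3.simps using w(1) by Groebner_Basis.algebra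
  ultimately show "det3 (dft w) \<noteq> 0" unfolding d by simp
qed

text \<open>The other classes are brought to a diagonal one by the Fourier transform, by rescaling z
  and by exchanging y and z. The Fourier transform changes the parameter to (3 s + 1) / (18 s - 3),
  which is defined because 216 s^3 is not 1.\<close>

lemma card_kform:
  fixes s :: "'a::{alg_closed_field,field_char_0}"
  assumes s: "s \<noteq> 0" "27 * s^3 + 1 \<noteq> 0" "216 * s^3 \<noteq> 1" and gc: "(g, c) \<in> kindex"
  shows "card (zset (hesse s) (kform g c)) = 9"
proof -
  obtain w :: 'a where w: "w^2 + w + 1 = 0" "w^3 = 1" "w \<noteq> 1" 
    using omega_exists[where 'a = 'a] by metis
  have c: "c^3 = 1" using gc by (simp add: kindex_def)
  then have c0: "c \<noteq> 0" by auto
  have k11: "card (zset (hesse s) (kform 1 1)) = 9" if s: "s \<noteq> 0" "27 * s^3 + 1 \<noteq> 0" "216 * s^3 \<noteq> 1" for s :: 'a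
  proof -
    have fac: "(6*s - 1) * (36*s^2 + 6*s + 1) = 216 * s^3 - 1" "(3*s + 1) * (9*s^2 - 3*s + 1) = 27 * s^3 + 1" 
      by Groebner_Basis.algebra+
    then have nz: "6*s - 1 \<noteq> 0" "3*s + 1 \<noteq> 0" "9*s^2 - 3*s + 1 \<noteq> 0" using s by auto
    define m where "m = 18*s - 3"
    have "m = 3 * (6*s - 1)" by (simp add: m_def)
    then have m0: "m \<noteq> 0" using nz by (simp only: mult_eq_0_iff) simp
    define s' where "s' = (3*s + 1) / m"
    have s'm: "s' * m = 3*s + 1" using m0 by (simp add: s'_def)
    have "(27 * s'^3 + 1) * m^3 = 27 * (s' * m)^3 + m^3" by Groebner_Basis.algebra
    also have "\<dots> = 27 * (3*s + 1)^3 + m^3" unfolding s'm ..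
    also have "\<dots> = 729 * s * (9*s^2 - 3*s + 1)" unfolding m_def by Groebner_Basis.algebra
    finally have ok: "27 * s'^3 + 1 \<noteq> 0" using nz s by auto
    have ok0: "s' \<noteq> 0" using s'm nz by auto
    have "card (zset (hesse s) (kform 1 1)) = card (zset (hesse s') (kform 0 w))"
    proof (rule card_zset_transport[OF dft_inv[OF w(1,3)] m0])
      show "(3 :: 'a) \<noteq> 0" by simp
      fix v :: "'a vec" obtain x y z where v: "v = (x, y, z)" by (cases v)
      have "eval3 (hesse s) (app (dft w) v) = (3*s + 1) * (x^3 + y^3 + z^3) + (18*s - 3) * (x * y * z)"
        unfolding v app.simps dot.simps eval3_hesse mult_1_left using w(1) by Groebner_Basis.algebra
      then have "eval3 (hesse s) (app (dft w) v) = (s' * m) * (x^3 + y^3 + z^3) + m * (x * y * z)"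
        unfolding s'm by (simp only: m_def)
      then show "eval3 (hesse s) (app (dft w) v) = m * eval3 (hesse s') v"
        unfolding v eval3_hesse by (simp add: algebra_simps)
      have "(x+y+z)^2 * (x+w*y+w^2*z) + (x+w*y+w^2*z)^2 * (x+w^2*y+w*z) + (x+w^2*y+w*z)^2 * (x+y+z)
        = 3 * (x^3 + w * y^3 + w^2 * z^3)" using w(1) by Groebner_Basis.algebra
      then show "kform 1 1 (app (dft w) v) = 3 * kform 0 w v" unfolding v by simp
    qed
    then show ?thesis using card_kform0[OF ok0 ok w(1,3)] by simp
  qed
  have k1: "card (zset (hesse s) (kform 1 c)) = 9" if c: "c^3 = 1" for c
  proof -
    have c0: "c \<noteq> 0" using c by auto
    have cc: "c^2 * (c * u) = u" "c * (c^2 * u) = u" for u :: 'a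
      using c by Groebner_Basis.algebra+
    then have N: "lininv ((1, 0, 0), (0, 1, 0), (0, 0, c^2)) ((1, 0, 0), (0, 1, 0), (0, 0, c))"
      by (simp add: lininv_def cc)
    have "card (zset (hesse s) (kform 1 c)) = card (zset (hesse (s * c)) (kform 1 1))"
    proof (rule card_zset_transport[OF N])
      show "c^2 \<noteq> 0" "(1 :: 'a) \<noteq> 0" using c0 by simp_all
      fix v :: "'a vec" obtain x y z where v: "v = (x, y, z)" by (cases v)
      show "eval3 (hesse s) (app ((1, 0, 0), (0, 1, 0), (0, 0, c^2)) v) = c^2 * eval3 (hesse (s * c)) v"
        unfolding v app.simps dot.simps eval3_hesse mult_1_left mult_zero_left add_0_left add_0_right
        using c by Groebner_Basis.algebra
      have "x^2*y + c * y^2*(c^2*z) + c^2 * (c^2*z)^2*x = x^2*y + y^2*z + z^2*x" using c by Groebner_Basis.algebra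
      then show "kform 1 c (app ((1, 0, 0), (0, 1, 0), (0, 0, c^2)) v) = 1 * kform 1 1 v"
        unfolding v by simp
    qed
    also have "\<dots> = 9" using s c0 by (intro k11) (simp_all add: power_mult_distrib c)
    finally show ?thesis .
  qed
  consider "g = 0" | "g = 1" | "g = 2" using gc by (auto simp: kindex_def le_Suc_eq numeral_2_eq_2)
  then show ?thesis
  proof cases
    case 1
    then have "c \<noteq> 1" using gc by (simp add: kindex_def)
    then show ?thesis using card_kform0[OF s(1,2) cube_root_one[OF c]] 1 by simp
  next
    case 2
    then show ?thesis using k1[OF c] by simp
  next
    case 3
    have "card (zset (hesse s) (kform 2 c)) = card (zset (hesse s) (kform 1 (c^2)))"
    proof (rule card_zset_transport[OF swapyz(1)])
      show "(1 :: 'a) \<noteq> 0" "(1 :: 'a) \<noteq> 0" by simp_all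
      fix v :: "'a vec" obtain x y z where v: "v = (x, y, z)" by (cases v)
      show "eval3 (hesse s) (app swapyz v) = 1 * eval3 (hesse s) v" unfolding v swapyz eval3_hesse by (simp add: algebra_simps)
      have "x^2*y + c * z^2*x + c^2 * y^2*z = x^2*y + c^2 * y^2*z + (c^2)^2 * z^2*x" using c by Groebner_Basis.algebra
      then show "kform 2 c (app swapyz v) = 1 * kform 1 (c^2) v" unfolding v swapyz by simp
    qed
    moreover have "(c^2)^3 = 1" using c by Groebner_Basis.algebra
    ultimately show ?thesis using k1 3 by simp
  qed
qed

definition flexes :: "'a::field vec set set" where
  "flexes = (\<lambda>c. pt (0, 1, -c)) ` {c. c^3 = 1} \<union> (\<lambda>c. pt (-c, 0, 1)) ` {c. c^3 = 1} \<union> (\<lambda>c. pt (1, -c, 0)) ` {c. c^3 = 1}"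

lemma card_flexes: "card (flexes :: 'a::{alg_closed_field,field_char_0} vec set set) = 9"
proof -
  obtain w :: 'a where w: "w \<noteq> 1" "w^2 \<noteq> 1" "w^2 \<noteq> w" "{c :: 'a. c^3 = 1} = {1, w, w^2}"
    by (rule omega_exists)
  have 3: "card {c :: 'a. c^3 = 1} = 3" "finite {c :: 'a. c^3 = 1}" unfolding w(4) using w(1-3) by auto
  have i1: "inj_on (\<lambda>c :: 'a. pt (0, 1, -c)) {c. c^3 = 1}" and i2: "inj_on (\<lambda>c :: 'a. pt (-c, 0, 1)) {c. c^3 = 1}"
    and i3: "inj_on (\<lambda>c :: 'a. pt (1, -c, 0)) {c. c^3 = 1}"
    by (auto intro!: inj_onI simp: pt_eq_iff)
  let ?A = "(\<lambda>c :: 'a. pt (0, 1, -c)) ` {c. c^3 = 1}" and ?B = "(\<lambda>c :: 'a. pt (-c, 0, 1)) ` {c. c^3 = 1}"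
    and ?C = "(\<lambda>c :: 'a. pt (1, -c, 0)) ` {c. c^3 = 1}"
  have "card ?A = 3" "card ?B = 3" "card ?C = 3" using 3 i1 i2 i3 by (simp_all add: card_image)
  moreover have "finite ?A" "finite ?B" "finite ?C" using 3 by simp_all
  moreover have "?A \<inter> ?B = {}" "?A \<inter> ?C = {}" "?B \<inter> ?C = {}" by (auto simp: pt_eq_iff)
  then have "?A \<inter> ?B = {}" "(?A \<union> ?B) \<inter> ?C = {}" by blast+
  ultimately show ?thesis unfolding flexes_def by (simp add: card_Un_disjoint)
qed

lemma hesse_flexes:
  fixes s :: "'a::field"
  assumes s: "s \<noteq> 0" and v: "(x, y, z) \<noteq> (0, 0, 0)" "s * (x^3 + y^3 + z^3) + x * y * z = 0" and xyz: "x * y * z = 0"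
  shows "pt (x, y, z) \<in> flexes"
proof -
  have H: "x^3 + y^3 + z^3 = 0" using s v(2) xyz by simp
  have neg: "(- (a / b))^3 = 1" if "a^3 + b^3 = 0" "b \<noteq> 0" for a b :: 'a
  proof -
    have "a^3 = - (b^3)" using that(1) by (simp add: eq_neg_iff_add_eq_0)
    then show ?thesis using that(2) by (simp add: power_divide)
  qed
  consider "x = 0" | "y = 0" | "z = 0" using xyz by auto
  then show ?thesis
  proof cases
    case 1
    then have "y \<noteq> 0" "z^3 + y^3 = 0" using H v(1) by (auto simp: add.commute)
    then have "pt (x, y, z) = pt (0, 1, - (- (z / y)))" "(- (z / y))^3 = 1"
      using neg 1 by (auto simp: pt_eq_iff)
    then show ?thesis unfolding flexes_def by blast
  next
    case 2
    then have "z \<noteq> 0" "x^3 + z^3 = 0" using H v(1) by auto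
    then have "pt (x, y, z) = pt (- (- (x / z)), 0, 1)" "(- (x / z))^3 = 1"
      using neg 2 by (auto simp: pt_eq_iff)
    then show ?thesis unfolding flexes_def by blast
  next
    case 3
    then have "x \<noteq> 0" "y^3 + x^3 = 0" using H v(1) by (auto simp: add.commute)
    then have "pt (x, y, z) = pt (1, - (- (y / x)), 0)" "(- (y / x))^3 = 1"
      using neg 3 by (auto simp: pt_eq_iff)
    then show ?thesis unfolding flexes_def by blast
  qed
qed

section \<open>The cubics with a given contact point\<close>

text \<open>Smoothness provides both side conditions of the solved case: \<open>be = 0\<close> would
  make (1,0,0) singular, and 3 + al k = 0 with al = de / be the point (1, k^2, k).\<close>

lemma nine_contact:
  fixes s :: "'a::{alg_closed_field,field_char_0}"
  assumes s: "s \<noteq> 0" "27 * s^3 + 1 \<noteq> 0" and M: "lininv (colm p q r) M'"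
    and sub: "subst3 (colm p q r) (hesse s) = cub 0 be 0 0 de be 0 be 0 0"
  shows "be \<noteq> 0" "\<And>k. k^3 = 1 \<Longrightarrow> 3 + de / be * k \<noteq> 0"
    "contact (hesse s) p = (\<lambda>k. curve (subst3 M' (nineG (de / be) k))) ` {k. k^3 = 1}"
proof -
  let ?E = "cub 0 be 0 0 de be 0 be 0 0"
  have ns: "\<exists>w. polar ?E v w \<noteq> 0" if v: "v \<noteq> (0, 0, 0)" for v
  proof -
    have "app (colm p q r) v \<noteq> (0, 0, 0)" using v lininv_nz[OF M] by blast
    then obtain w where "polar (hesse s) (app (colm p q r) v) w \<noteq> 0" by (rule hesse_nonsing[OF s])
    moreover have "w = app (colm p q r) (app M' w)" using M unfolding lininv_def by metis
    ultimately have "polar (subst3 (colm p q r) (hesse s)) v (app M' w) \<noteq> 0" unfolding polar_subst by metis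
    then show ?thesis unfolding sub by blast
  qed
  show be: "be \<noteq> 0"
  proof
    assume "be = 0"
    then have "polar ?E (1, 0, 0) w = 0" for w by (cases w) (simp add: polar_cub)
    then show False using ns[of "(1, 0, 0)"] by simp
  qed
  show al: "3 + de / be * k \<noteq> 0" if k: "k^3 = 1" for k
  proof
    assume "3 + de / be * k = 0"
    then have "be * (3 + de / be * k) = 0" by simp
    then have 0: "3 * be + de * k = 0" using be by (simp add: algebra_simps)
    have e1: "2*be*k^2 + de*(k^2*k) + be*k^2 = k^2 * (3 * be + de * k)"
      by (simp add: algebra_simps power2_eq_square)
    have e2: "be + de*k + 2*be*(k^2*k) = 3 * be + de * k"
      using k by Groebner_Basis.algebra
    have e3: "de*k^2 + 2*be*k + be*(k^2)^2 = k * (3 * be + de * k)"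
      using k by Groebner_Basis.algebra
    have "polar ?E (1, k^2, k) w = 0" for w
    proof -
      obtain a b c where w: "w = (a, b, c)" by (cases w)
      have "polar ?E (1, k^2, k) w = (2*be*k^2 + de*(k^2*k) + be*k^2) * a + (be + de*k + 2*be*(k^2*k)) * b
        + (de*k^2 + 2*be*k + be*(k^2)^2) * c" unfolding w polar_cub by (simp add: mult.assoc)
      then show ?thesis unfolding e1 e2 e3 0 by simp
    qed
    then show False using ns[of "(1, k^2, k)"] by simp
  qed
  have "subst3 (colm p q r) (hesse s) = const3 be * ninefold (de / be)"
    unfolding sub using be by (intro eval3_eqI) (simp add: distrib_left)
  then have "contact (ninefold (de / be)) (1, 0, 0) = (`) (subst3 (colm p q r)) ` contact (hesse s) p"
    using contact_subst[OF M, of "hesse s" "(1, 0, 0)"] by (simp add: contact_scale[OF be])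
  then have "(`) (subst3 M') ` contact (ninefold (de / be)) (1, 0, 0) = contact (hesse s) p"
    by (simp add: image_image subst_subst[OF lininv_sym[OF M]])
  then have *: "contact (hesse s) p = (`) (subst3 M') ` contact (ninefold (de / be)) (1, 0, 0)" by simp
  have cn: "contact (ninefold (de / be)) (1, 0, 0) = (\<lambda>k. curve (nineG (de / be) k)) ` {k. k^3 = 1}"
    by (rule contact_nine) (rule al)
  show "contact (hesse s) p = (\<lambda>k. curve (subst3 M' (nineG (de / be) k))) ` {k. k^3 = 1}"
    unfolding * image_image subst_curve cn by (simp add: image_image subst_curve)
qed

lemma nine_inj:
  fixes al :: "'a::field_char_0"
  assumes M: "lininv M M'"
  shows "inj_on (\<lambda>k. curve (subst3 M' (nineG al k))) S"
proof (rule inj_onI)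
  fix k k' assume "curve (subst3 M' (nineG al k)) = curve (subst3 M' (nineG al k'))"
  then have "subst3 M' ` curve (nineG al k) = subst3 M' ` curve (nineG al k')" unfolding subst_curve .
  then have "curve (nineG al k) = curve (nineG al k')" using inj_subst_image[OF lininv_sym[OF M]] by (metis injD)
  then show "k = k'" by (rule nineG_inj)
qed

text \<open>The columns are p, p + 2t and p + t. The last is -2p and has to take the place of
  (0,0,1), the further intersection of the tangent at (1,0,0).\<close>

definition kmat :: "nat \<Rightarrow> 'a::comm_ring_1 \<Rightarrow> 'a vec \<Rightarrow> 'a mat" where
  "kmat g c p = colm p (ktrans g c (ktrans g c p)) (ktrans g c p)"

text \<open>By the equation of the curve the determinant is a nonzero multiple of x y z for a
  diagonal translation; otherwise it is x^3 + y^3 + z^3 times a linear factor of 27 s^3 + 1, up to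
  sign.\<close>

lemma kmat_inv:
  fixes s :: "'a::field_char_0"
  assumes s: "s \<noteq> 0" "27 * s^3 + 1 \<noteq> 0" and v: "(x, y, z) \<noteq> (0, 0, 0)" "eval3 (hesse s) (x, y, z) = 0"
    and k: "(g, c) \<in> kindex" "kform g c (x, y, z) = 0"
  shows "lininv (kmat g c (x, y, z)) (minv (kmat g c (x, y, z)))"
proof (rule lininv_minv)
  have nz: "x * y * z \<noteq> 0" using kform_nz[OF s(1) v k] .
  have c: "c^3 = 1" using k(1) by (simp add: kindex_def)
  then have c0: "c \<noteq> 0" by auto
  have H: "x * y * z = - s * (x^3 + y^3 + z^3)" using v(2) unfolding eval3_hesse by (simp add: add_eq_0_iff)
  then have e1: "x^3 + y^3 + z^3 \<noteq> 0" using nz by auto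
  have nc: "d + 3 * s \<noteq> 0" if "d^3 = 1" for d
  proof
    assume "d + 3 * s = 0"
    then have "3 * s = - d" by (simp add: eq_neg_iff_add_eq_0 add.commute)
    then have "(3 * s)^3 = - 1" using that by simp
    then show False using s(2) by (simp add: power_mult_distrib)
  qed
  have gg: "g = 0 \<or> g = 1 \<or> g = 2" using k(1) by (auto simp: kindex_def le_Suc_eq numeral_2_eq_2)
  then consider "g = 0" | "g = 1" | "g = 2" by blast
  then show "det3 (kmat g c (x, y, z)) \<noteq> 0"
  proof cases
    case 1
    then have c1: "c \<noteq> 1" using k(1) by (simp add: kindex_def)
    have "det3 (kmat g c (x, y, z)) = x * (c * (c * y) * (c^2 * z) - c * y * (c^2 * (c^2 * z))) - x * (y * (c^2 * z) - c * y * z) + x * (y * (c^2 * (c^2 * z)) - c * (c * y) * z)"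
      by (simp add: kmat_def 1)
    also have "\<dots> = 3 * (x * y * z) * (c * (1 - c))" using c by Groebner_Basis.algebra
    finally show ?thesis using nz c0 c1 by simp
  next
    case 2
    have "det3 (kmat g c (x, y, z)) = x * (c * (c^2 * x) * (c^2 * x) - c * z * (c^2 * y)) - c * z * (y * (c^2 * x) - c * z * z) + y * (y * (c^2 * y) - c * (c^2 * x) * z)"
      by (simp add: kmat_def 2)
    also have "\<dots> = c^2 * (x^3 + y^3 + z^3) - 3 * (x * y * z)" using c by Groebner_Basis.algebra
    also have "\<dots> = (c^2 + 3 * s) * (x^3 + y^3 + z^3)" unfolding H by Groebner_Basis.algebra
    finally have d: "det3 (kmat g c (x, y, z)) = (c^2 + 3 * s) * (x^3 + y^3 + z^3)" .
    have "(c^2)^3 = 1" using c by Groebner_Basis.algebra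
    then show ?thesis unfolding d using nc[of "c^2"] e1 by simp
  next
    case 3
    have "det3 (kmat g c (x, y, z)) = x * (c * z * (c^2 * y) - c * x * (c^2 * (c * x))) - c^2 * y * (y * (c^2 * y) - c * x * z) + z * (y * (c^2 * (c * x)) - c * z * z)"
      by (simp add: kmat_def 3)
    also have "\<dots> = 3 * (x * y * z) - c * (x^3 + y^3 + z^3)" using c by Groebner_Basis.algebra
    also have "\<dots> = - (c + 3 * s) * (x^3 + y^3 + z^3)" unfolding H by Groebner_Basis.algebra
    finally have d: "det3 (kmat g c (x, y, z)) = - (c + 3 * s) * (x^3 + y^3 + z^3)" .
    show ?thesis unfolding d using nc[OF c] e1 by (simp only: mult_eq_0_iff neg_equal_0_iff_equal) simp
  qed
qed

lemma ktrans_hesse: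
  fixes s :: "'a::field_char_0"
  assumes c: "c^3 = 1" shows "eval3 (hesse s) (ktrans g c p) = eval3 (hesse s) p"
proof -
  obtain x y z where p: "p = (x, y, z)" by (cases p)
  have "eval3 (hesse s) (x, c * y, c^2 * z) = eval3 (hesse s) p" "eval3 (hesse s) (y, c * z, c^2 * x) = eval3 (hesse s) p"
    "eval3 (hesse s) (z, c * x, c^2 * y) = eval3 (hesse s) p"
    unfolding p eval3_hesse using c by Groebner_Basis.algebra+
  then show ?thesis by (simp add: p)
qed

lemma ktrans_polar:
  fixes s :: "'a::field_char_0"
  assumes c: "c^3 = 1" shows "polar (hesse s) (ktrans g c p) (ktrans g c q) = polar (hesse s) p q"
proof -
  have "ktrans g c (vadd p q) = vadd (ktrans g c p) (ktrans g c q)" for p q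
    by (cases p; cases q) (simp add: algebra_simps)
  moreover have "ktrans g c (scal m q) = scal m (ktrans g c q)" for m q
    by (cases q) (simp add: algebra_simps)
  ultimately show ?thesis unfolding polar_def by (metis ktrans_hesse[OF c])
qed

lemma ktrans_cube:
  fixes c :: "'a::field_char_0"
  assumes c: "c^3 = 1" shows "ktrans g c (ktrans g c (ktrans g c p)) = p"
proof -
  obtain x y z where p: "p = (x, y, z)" by (cases p)
  have "c * (c * (c * u)) = u" "c^2 * (c^2 * (c^2 * u)) = u" "c * (c^2 * u) = u" "c^2 * (c * u) = u" for u
    using c by Groebner_Basis.algebra+
  then show ?thesis by (simp add: p)
qed

text \<open>The translation preserves the curve and permutes the columns cyclically. Hence the
  single incidence of p + t with the tangent at p yields all the vanishing coefficients and the
  equality of the other three. The values for \<open>g = 0\<close> serve the computation of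
  limits.\<close>

lemma kmat_subst:
  fixes s :: "'a::field_char_0"
  assumes H: "eval3 (hesse s) (x, y, z) = 0"
    and k: "(g, c) \<in> kindex" "kform g c (x, y, z) = 0"
  obtains be de where "subst3 (kmat g c (x, y, z)) (hesse s) = cub 0 be 0 0 de be 0 be 0 0"
    "g = 0 \<Longrightarrow> be = 3 * s * (x^3 + c^2 * y^3 + c * z^3) \<and> de = - 9 * (x * y * z)"
proof -
  let ?H = "hesse s"
  define p where "p = (x, y, z)"
  define r where "r = ktrans g c p"
  define q where "q = ktrans g c r"
  have c: "c^3 = 1" using k(1) by (simp add: kindex_def)
  have qp: "ktrans g c q = p" unfolding q_def r_def by (rule ktrans_cube[OF c])
  have ev: "eval3 ?H p = 0" "eval3 ?H r = 0" "eval3 ?H q = 0"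
    using H unfolding p_def[symmetric] q_def r_def by (simp_all only: ktrans_hesse[OF c])
  have gg: "g = 0 \<or> g = 1 \<or> g = 2" using k(1) by (auto simp: kindex_def le_Suc_eq numeral_2_eq_2)
  have pr: "polar ?H p r = 0"
  proof -
    from gg consider "g = 0" | "g = 1" | "g = 2" by blast
    then show ?thesis
    proof cases
      case 1
      then have "c \<noteq> 1" using k(1) by (simp add: kindex_def)
      then have c': "c^2 + c + 1 = 0" using cube_root_one[OF c] by blast
      have K: "x^3 + c * y^3 + c^2 * z^3 = 0" using k(2) 1 by simp
      have "r = (x, c * y, c^2 * z)" by (simp add: r_def p_def 1)
      moreover have "(3 * s * x^2 + y * z) * x + (3 * s * y^2 + x * z) * (c * y) + (3 * s * z^2 + x * y) * (c^2 * z)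
        = 3 * s * (x^3 + c * y^3 + c^2 * z^3) + x * y * z * (c^2 + c + 1)" by Groebner_Basis.algebra
      ultimately show ?thesis unfolding p_def polar_hesse using K c' by (simp only: polar_hesse) simp
    next
      case 2
      have K: "x^2*y + c * y^2*z + c^2 * z^2*x = 0" using k(2) 2 by simp
      have r: "r = (y, c * z, c^2 * x)" by (simp add: r_def p_def 2)
      show ?thesis unfolding p_def r polar_hesse using K c by Groebner_Basis.algebra
    next
      case 3
      have K: "x^2*z + c * y^2*x + c^2 * z^2*y = 0" using k(2) 3 by simp
      have r: "r = (z, c * x, c^2 * y)" by (simp add: r_def p_def 3)
      show ?thesis unfolding p_def r polar_hesse using K c by Groebner_Basis.algebra
    qed
  qed
  note inv = ktrans_polar[OF c, of s g, symmetric]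
  have rq: "polar ?H r q = 0" using inv[of p r] pr by (simp add: q_def r_def)
  have qp0: "polar ?H q p = 0" using inv[of r q] rq qp by (simp add: q_def)
  have qr: "polar ?H q r = polar ?H p q" using inv[of q r] qp by (simp add: q_def)
  have rp: "polar ?H r p = polar ?H p q" using inv[of p q] qp by (simp add: r_def)
  obtain e where "subst3 (colm p q r) ?H = cub (eval3 ?H p) (polar ?H p q) (polar ?H p r) (polar ?H q p) e
    (polar ?H r p) (eval3 ?H q) (polar ?H q r) (polar ?H r q) (eval3 ?H r)" by (rule subst_colm[OF form3_cub])
  then have e: "subst3 (colm p q r) ?H = cub 0 (polar ?H p q) 0 0 e (polar ?H p q) 0 (polar ?H p q) 0 0"
    unfolding ev pr rq qp0 qr rp .
  moreover have "polar ?H p q = 3 * s * (x^3 + c^2 * y^3 + c * z^3) \<and> e = - 9 * (x * y * z)" if g: "g = 0"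
  proof -
    have "c \<noteq> 1" using k(1) g by (simp add: kindex_def)
    then have c': "c^2 + c + 1 = 0" using cube_root_one[OF c] by blast
    have K: "x^3 + c * y^3 + c^2 * z^3 = 0" using k(2) g by simp
    have r: "r = (x, c * y, c^2 * z)" by (simp add: r_def p_def g)
    have "c^2 * (c^2 * z) = c * z" using c by Groebner_Basis.algebra
    then have q: "q = (x, c^2 * y, c * z)" by (simp add: q_def r g power2_eq_square mult.assoc)
    have pq: "polar ?H p q = 3 * s * (x^3 + c^2 * y^3 + c * z^3)"
      unfolding p_def q polar_hesse using c' by Groebner_Basis.algebra
    \<comment> \<open>The three translates add up to (3x, 0, 0); evaluating there isolates the
      coefficient of x y z.\<close>
    have "app (colm p q r) (1, 1, 1) = (3 * x, (c^2 + c + 1) * y, (c^2 + c + 1) * z)"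
      unfolding p_def q r by (simp add: algebra_simps)
    then have "eval3 ?H (3 * x, 0, 0) = 3 * polar ?H p q + e"
      using arg_cong[OF e, of "\<lambda>G. eval3 G (1, 1, 1)"] unfolding eval3_subst c' by simp
    then have "27 * s * x^3 = 3 * polar ?H p q + e" by (simp add: power_mult_distrib mult_ac)
    then have "e = - 9 * (x * y * z)" using K H c' unfolding pq eval3_hesse by Groebner_Basis.algebra
    then show ?thesis using pq by blast
  qed
  ultimately show ?thesis using that unfolding kmat_def p_def[symmetric] r_def[symmetric] q_def[symmetric] by blast
qed

lemma class_contact_card:
  fixes s :: "'a::{alg_closed_field,field_char_0}"
  assumes s: "s \<noteq> 0" "27 * s^3 + 1 \<noteq> 0" and v: "(x, y, z) \<noteq> (0, 0, 0)" "eval3 (hesse s) (x, y, z) = 0"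
    and k: "(g, c) \<in> kindex" "kform g c (x, y, z) = 0"
  shows "card (contact (hesse s) (x, y, z)) = 3"
proof -
  note M = kmat_inv[OF s v k]
  obtain be de where sub: "subst3 (kmat g c (x, y, z)) (hesse s) = cub 0 be 0 0 de be 0 be 0 0"
    using kmat_subst[OF v(2) k] by metis
  have "card {k :: 'a. k^3 = 1} = 3" 
    using omega_exists[where 'a = 'a] by (metis card_3_iff)
  then show ?thesis
    unfolding nine_contact(3)[OF s M[unfolded kmat_def] sub[unfolded kmat_def]]
    using nine_inj[OF M[unfolded kmat_def]] by (simp add: card_image)
qed

text \<open>The third row is the tangent at the flex (0, 1, -1), the first the line x = 0 that
  contains this flex and two others, and the second the coordinate y - z, odd under the symmetry
  that exchanges y and z.\<close>

definition flexmat :: "'a::comm_ring_1 \<Rightarrow> 'a mat" where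
  "flexmat s = ((1, 0, 0), (0, 1, -1), (-1, 3 * s, 3 * s))"

text \<open>Pulling \<open>flexE\<close> back by \<open>flexmat\<close> and matching it with 108 s^2
  times the Hesse cubic gives c = 27 s^2 and d = 4 (27 s^3 + 1), so r^2 = 9 - 2 d = 1 - 216 s^3. At
  216 s^3 = 1 the two values of \<open>r\<close> would merge.\<close>

lemma flex_contact:
  fixes s :: "'a::{alg_closed_field,field_char_0}"
  assumes s: "s \<noteq> 0" "27 * s^3 + 1 \<noteq> 0" "216 * s^3 \<noteq> 1"
  shows "contact (hesse s) (0, 1, -1) =
    (\<lambda>r. curve (subst3 (flexmat s) (flexG (27 * s^2) (4 * (27 * s^3 + 1)) r))) ` {r. r^2 = 1 - 216 * s^3}"
    and "card (contact (hesse s) (0, 1, -1)) = 2"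
proof -
  have "det3 (flexmat s) = 6 * s" by (simp add: flexmat_def)
  then have N: "lininv (flexmat s) (minv (flexmat s))" using s by (intro lininv_minv) simp
  define d where "d = 4 * (27 * s^3 + 1)"
  have d: "27 * s^2 \<noteq> 0" "d \<noteq> 0" "d \<noteq> 4" "2 * d \<noteq> 9"
  proof -
    show "27 * s^2 \<noteq> 0" using s(1) by simp
    show "d \<noteq> 0" unfolding d_def using s(2) by (simp only: mult_eq_0_iff) simp
    have "d - 4 = 108 * s^3" "2 * d - 9 = 216 * s^3 - 1" by (simp_all add: d_def)
    then show "d \<noteq> 4" "2 * d \<noteq> 9" using s(1,3) by auto
  qed
  have d2: "9 - 2 * d = 1 - 216 * s^3" by (simp add: d_def)
  have sub: "subst3 (flexmat s) (flexE (27 * s^2) d) = const3 (108 * s^2) * hesse s"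
  proof (rule eval3_eqI)
    fix x y z :: 'a
    show "eval3 (subst3 (flexmat s) (flexE (27 * s^2) d)) (x, y, z) = eval3 (const3 (108 * s^2) * hesse s) (x, y, z)"
      unfolding eval3_subst flexmat_def app.simps dot.simps eval3_mult eval3_const3 eval3_cub d_def
      by Groebner_Basis.algebra
  qed
  have "app (flexmat s) (0, 1, -1) = scal 2 (0, 1, 0)" by (simp add: flexmat_def)
  then have "contact (const3 (108 * s^2) * hesse s) (0, 1, -1) = (`) (subst3 (flexmat s)) ` contact (flexE (27 * s^2) d) (scal 2 (0, 1, 0))"
    unfolding sub[symmetric] contact_subst[OF N] by simp
  then have *: "contact (hesse s) (0, 1, -1) = (\<lambda>r. curve (subst3 (flexmat s) (flexG (27 * s^2) d r))) ` {r. r^2 = 1 - 216 * s^3}"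
    using contact_scale[of "108 * s^2" "hesse s"] s(1)
    unfolding contact_scal[OF form3_cub, of 2, simplified] contact_flexE[OF d] image_image subst_curve d2 by simp
  then show "contact (hesse s) (0, 1, -1) =
    (\<lambda>r. curve (subst3 (flexmat s) (flexG (27 * s^2) (4 * (27 * s^3 + 1)) r))) ` {r. r^2 = 1 - 216 * s^3}"
    by (simp only: d_def)
  obtain r0 where r0: "r0^2 = 1 - 216 * s^3" using nth_root_exists[of 2 "1 - 216 * s^3"] by auto
  then have r0nz: "r0 \<noteq> 0" using s by auto
  have "{r. r^2 = 1 - 216 * s^3} = {r0, - r0}" unfolding r0[symmetric] by (auto simp: power2_eq_iff)
  then have "card {r. r^2 = 1 - 216 * s^3} = 2" using r0nz by simp
  moreover have "inj_on (\<lambda>r. curve (subst3 (flexmat s) (flexG (27 * s^2) d r))) {r. r^2 = 1 - 216 * s^3}"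
  proof (rule inj_onI)
    fix r r' assume r: "r \<in> {r. r^2 = 1 - 216 * s^3}" "r' \<in> {r. r^2 = 1 - 216 * s^3}"
      and "curve (subst3 (flexmat s) (flexG (27 * s^2) d r)) = curve (subst3 (flexmat s) (flexG (27 * s^2) d r'))"
    then have "subst3 (flexmat s) ` curve (flexG (27 * s^2) d r) = subst3 (flexmat s) ` curve (flexG (27 * s^2) d r')" unfolding subst_curve by simp
    then have "curve (flexG (27 * s^2) d r) = curve (flexG (27 * s^2) d r')" using inj_subst_image[OF N] by (metis injD)
    moreover have "r^2 \<noteq> 9" 
    proof
      assume "r^2 = 9"
      then have "8 * (27 * s^3 + 1) = 0" using r(1) by (simp add: algebra_simps)
      then show False using s(2) by (simp only: mult_eq_0_iff) simp
    qed
    moreover have "r \<noteq> 0" using r(1) s by auto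
    ultimately show "r = r'" using flexG_inj r by (metis (mono_tags, lifting) mem_Collect_eq)
  qed
  ultimately show "card (contact (hesse s) (0, 1, -1)) = 2" unfolding * by (simp add: card_image)
qed

definition cset :: "'a::alg_closed_field poly poly poly \<Rightarrow> 'a vec set \<Rightarrow> 'a poly poly poly set set" where
  "cset E Q = (\<Union>p\<in>Q. contact E p)"

lemma cset_pt:
  fixes E :: "'a::{alg_closed_field,field_char_0} poly poly poly"
  assumes "form3 3 E" shows "cset E (pt p) = contact E p"
proof -
  have "contact E q = contact E p" if "q \<in> pt p" for q
    using that contact_scal[OF assms] unfolding pt_def by blast
  then show ?thesis unfolding cset_def using pt_self by blast
qed

text \<open>The predicate \<open>P\<close> is free, so one partition by contact points serves the
  total and each refined count. There are two classes with \<open>g = 0\<close> and three each with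
  \<open>g = 1\<close> and \<open>g = 2\<close>, of nine points each.\<close>

lemma hesse_count:
  fixes s :: "'a::{alg_closed_field,field_char_0}"
  assumes s: "s \<noteq> 0" "27 * s^3 + 1 \<noteq> 0" "216 * s^3 \<noteq> 1"
    and fl: "\<And>Q. Q \<in> flexes \<Longrightarrow> finite (cset (hesse s) Q) \<and> card {C \<in> cset (hesse s) Q. P C} = a"
    and kl: "\<And>Q g c. (g, c) \<in> kindex \<Longrightarrow> Q \<in> zset (hesse s) (kform g c) \<Longrightarrow> card {C \<in> cset (hesse s) Q. P C} = b g"
  shows "card {C \<in> max_tangent_cubics (hesse s). P C} = 9 * a + 18 * b 0 + 27 * b 1 + 27 * b 2"
proof -
  let ?H = "hesse s"
  define Z where "Z i = zset ?H (kform (fst i) (snd i))" for i :: "nat \<times> 'a"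
  obtain w :: 'a where w: "w \<noteq> 1" "w^2 \<noteq> 1" "w^2 \<noteq> w" "{c :: 'a. c^3 = 1} = {1, w, w^2}"
    by (rule omega_exists)
  have kin: "kindex = {(0, w), (0, w^2), (1, 1), (1, w), (1, w^2), (2, 1), (2, w), (2, w^2)}"
  proof -
    have "c^3 = 1 \<longleftrightarrow> c = 1 \<or> c = w \<or> c = w^2" for c :: 'a using w(4) by blast
    then show ?thesis using w(1-3) by (auto simp: kindex_def le_Suc_eq numeral_2_eq_2)
  qed
  have finZ: "finite (Z i)" and cardZ: "card (Z i) = 9" if "i \<in> kindex" for i
  proof -
    show "card (Z i) = 9" unfolding Z_def using card_kform[OF s, of "fst i" "snd i"] that by simp
    then show "finite (Z i)" by (intro card_ge_0_finite) simp
  qed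
  have fform: "form3 3 ?H" by (rule form3_cub)
  have disjpt: "Q = Q'" if CQ: "C \<in> cset ?H Q" "C \<in> cset ?H Q'" "Q = pt p" "Q' = pt p'" and pp: "p \<noteq> (0, 0, 0)" "p' \<noteq> (0, 0, 0)" for C Q Q' p p'
  proof -
    have "C \<in> contact ?H p" "C \<in> contact ?H p'" using CQ by (simp_all add: cset_pt)
    then obtain k where "k \<noteq> 0" "p = scal k p'" using contact_unique[OF fform] pp by metis
    then show ?thesis using CQ(3,4) pt_eq_iff by blast
  qed
  define S where "S = flexes \<union> (\<Union>i\<in>kindex. Z i)"
  have Spt: "\<exists>p. Q = pt p \<and> p \<noteq> (0, 0, 0)" if "Q \<in> S" for Q
    using that unfolding S_def flexes_def Z_def zset_def by (auto simp del: split_paired_Ex)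
  have cov: "max_tangent_cubics ?H = (\<Union>Q\<in>S. cset ?H Q)"
  proof (intro equalityI subsetI)
    fix C assume C: "C \<in> max_tangent_cubics ?H"
    then obtain p where p: "p \<noteq> (0, 0, 0)" "C \<in> contact ?H p" by (rule contact_exists)
    obtain x y z where xyz: "p = (x, y, z)" by (cases p)
    have H: "eval3 ?H (x, y, z) = 0" using p(2) unfolding xyz contact_def by blast
    have "pt p \<in> S"
    proof (cases "x * y * z = 0")
      case True
      then show ?thesis using hesse_flexes[OF s(1) _ H[unfolded eval3_hesse]] p(1) unfolding xyz S_def by blast
    next
      case False
      have "torsion9 (x^3) (y^3) (z^3) = 0" using contact_nonflex[OF s(1,2) H False] p(2) xyz by blast
      then obtain g c where gc: "(g, c) \<in> kindex" "kform g c (x, y, z) = 0" by (rule torsion9_cases)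
      then have "pt p \<in> Z (g, c)" unfolding Z_def zset_def xyz fst_conv snd_conv using H p(1)[unfolded xyz] by blast
      then show ?thesis unfolding S_def using gc(1) by blast
    qed
    moreover have "C \<in> cset ?H (pt p)" using p(2) by (simp add: cset_pt)
    ultimately show "C \<in> (\<Union>Q\<in>S. cset ?H Q)" by blast
  next
    fix C assume "C \<in> (\<Union>Q\<in>S. cset ?H Q)"
    then show "C \<in> max_tangent_cubics ?H" unfolding cset_def contact_def by blast
  qed
  have finfl: "finite (flexes :: 'a vec set set)" by (rule card_ge_0_finite) (simp add: card_flexes)
  have "finite (kindex :: (nat \<times> 'a) set)" unfolding kin by simp
  then have finU: "finite (\<Union>i\<in>kindex. Z i)" using finZ by blast
  then have finS: "finite S" unfolding S_def using finfl by blast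
  have finc: "finite (cset ?H Q)" if Q: "Q \<in> S" for Q
  proof (cases "Q \<in> flexes")
    case True then show ?thesis using fl by blast
  next
    case False
    then obtain g c where gc: "(g, c) \<in> kindex" "Q \<in> zset ?H (kform g c)" using Q unfolding S_def Z_def by auto
    then obtain v where v: "Q = pt v" "v \<noteq> (0, 0, 0)" "eval3 ?H v = 0" "kform g c v = 0" unfolding zset_def by blast
    obtain x y z where xyz: "v = (x, y, z)" by (cases v)
    have "card (contact ?H v) = 3" using class_contact_card[OF s(1,2) _ _ gc(1)] v(2-4) unfolding xyz by blast
    then show ?thesis unfolding v(1) cset_pt[OF fform] using card.infinite by fastforce
  qed
  have "card {C \<in> max_tangent_cubics ?H. P C} = card (\<Union>Q\<in>S. {C \<in> cset ?H Q. P C})"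
    unfolding cov by (rule arg_cong[of _ _ card]) blast
  also have "\<dots> = (\<Sum>Q\<in>S. card {C \<in> cset ?H Q. P C})"
  proof (rule card_UN_disjoint[OF finS])
    show "\<forall>Q\<in>S. finite {C \<in> cset ?H Q. P C}" using finc by simp
    show "\<forall>Q\<in>S. \<forall>Q'\<in>S. Q \<noteq> Q' \<longrightarrow> {C \<in> cset ?H Q. P C} \<inter> {C \<in> cset ?H Q'. P C} = {}"
    proof (intro ballI impI, rule ccontr)
      fix Q Q' assume QQ: "Q \<in> S" "Q' \<in> S" "Q \<noteq> Q'" and ne: "{C \<in> cset ?H Q. P C} \<inter> {C \<in> cset ?H Q'. P C} \<noteq> {}"
      from ne obtain C where C: "C \<in> cset ?H Q" "C \<in> cset ?H Q'" by blast
      obtain p p' where "Q = pt p" "p \<noteq> (0, 0, 0)" "Q' = pt p'" "p' \<noteq> (0, 0, 0)" using Spt QQ by blast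
      then show False using disjpt[OF C] QQ(3) by blast
    qed
  qed
  also have "\<dots> = (\<Sum>Q\<in>flexes. card {C \<in> cset ?H Q. P C}) + (\<Sum>Q\<in>(\<Union>i\<in>kindex. Z i). card {C \<in> cset ?H Q. P C})"
    unfolding S_def
  proof (rule sum.union_disjoint)
    show "finite (\<Union>i\<in>kindex. Z i)" by (rule finU)
    show "flexes \<inter> (\<Union>i\<in>kindex. Z i) = {}"
    proof (rule ccontr)
      assume "flexes \<inter> (\<Union>i\<in>kindex. Z i) \<noteq> {}"
      then obtain Q g c where Q: "Q \<in> flexes" "(g, c) \<in> kindex" "Q \<in> zset ?H (kform g c)" unfolding Z_def by auto
      then obtain v where v: "Q = pt v" "v \<noteq> (0, 0, 0)" "eval3 ?H v = 0" "kform g c v = 0" unfolding zset_def by blast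
      obtain x y z where xyz: "v = (x, y, z)" by (cases v)
      have "x * y * z \<noteq> 0" using kform_nz[OF s(1) _ _ Q(2)] v unfolding xyz by blast
      moreover have "x * y * z = 0" using Q(1) unfolding v(1) xyz flexes_def by (auto simp: pt_eq_iff)
      ultimately show False by blast
    qed
  qed (rule finfl)
  also have "(\<Sum>Q\<in>flexes. card {C \<in> cset ?H Q. P C}) = 9 * a" using fl card_flexes[where 'a = 'a] by simp
  also have "(\<Sum>Q\<in>(\<Union>i\<in>kindex. Z i). card {C \<in> cset ?H Q. P C}) = (\<Sum>i\<in>kindex. \<Sum>Q\<in>Z i. card {C \<in> cset ?H Q. P C})"
  proof (rule sum.UNION_disjoint)
    show "finite (kindex :: (nat \<times> 'a) set)" unfolding kin by simp
    show "\<forall>i\<in>kindex. finite (Z i)" using finZ by blast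
    show "\<forall>i\<in>kindex. \<forall>j\<in>kindex. i \<noteq> j \<longrightarrow> Z i \<inter> Z j = {}"
    proof (intro ballI impI, rule ccontr)
      fix i j assume ij: "i \<in> kindex" "j \<in> kindex" "i \<noteq> j" "Z i \<inter> Z j \<noteq> {}"
      obtain g c g' c' where gc: "i = (g, c)" "j = (g', c')" by (cases i; cases j)
      obtain Q where Q: "Q \<in> Z i" "Q \<in> Z j" using ij(4) by blast
      obtain v where v: "Q = pt v" "v \<noteq> (0, 0, 0)" "eval3 ?H v = 0" "kform g c v = 0" using Q(1) unfolding Z_def zset_def gc by auto
      obtain v' where v': "Q = pt v'" "kform g' c' v' = 0" using Q(2) unfolding Z_def zset_def gc by auto
      obtain k where k: "k \<noteq> 0" "v' = scal k v" using v(1) v'(1) pt_eq_iff by metis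
      obtain x y z where xyz: "v = (x, y, z)" by (cases v)
      have "kform g' c' v' = k^3 * kform g' c' v" unfolding k(2) xyz by (simp add: algebra_simps power2_eq_square power3_eq_cube)
      then have "kform g' c' v = 0" using v'(2) k(1) by simp
      then show False using kform_disjoint[OF s(1,2)] v ij gc unfolding xyz by blast
    qed
  qed
  also have "\<dots> = (\<Sum>i\<in>(kindex :: (nat \<times> 'a) set). 9 * b (fst i))"
  proof (rule sum.cong[OF refl])
    fix i :: "nat \<times> 'a" assume i: "i \<in> kindex"
    have "card {C \<in> cset ?H Q. P C} = b (fst i)" if "Q \<in> Z i" for Q
      using kl[of "fst i" "snd i" Q] i that by (simp add: Z_def)
    then show "(\<Sum>Q\<in>Z i. card {C \<in> cset ?H Q. P C}) = 9 * b (fst i)" using cardZ[OF i] by simp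
  qed
  also have "\<dots> = 18 * b 0 + 27 * b 1 + 27 * b 2" unfolding kin using w(1-3) by simp
  finally show ?thesis by simp
qed

section \<open>Limits at a place, and the multidegrees on the Hesse pencil\<close>

section \<open>Limits along a place\<close>

fun mat_all :: "('a \<Rightarrow> bool) \<Rightarrow> 'a \<times> 'a \<times> 'a \<Rightarrow> bool" where
  "mat_all P (a, b, c) \<longleftrightarrow> P a \<and> P b \<and> P c"

fun vmap :: "('a \<Rightarrow> 'b) \<Rightarrow> 'a \<times> 'a \<times> 'a \<Rightarrow> 'b \<times> 'b \<times> 'b" where
  "vmap f (a, b, c) = (f a, f b, f c)"

text \<open>The linear maps that permute the sides of the triangle; the six patterns are spelled out
  so that inverses and substitutions can be computed.\<close>

definition monomial_mat :: "'a::field mat \<Rightarrow> bool" where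
  "monomial_mat N \<longleftrightarrow> (\<exists>a b c. a \<noteq> 0 \<and> b \<noteq> 0 \<and> c \<noteq> 0 \<and>
     (N = ((a, 0, 0), (0, b, 0), (0, 0, c)) \<or> N = ((0, a, 0), (0, 0, b), (c, 0, 0)) \<or>
      N = ((0, 0, a), (b, 0, 0), (0, c, 0)) \<or> N = ((a, 0, 0), (0, 0, b), (0, c, 0)) \<or>
      N = ((0, a, 0), (b, 0, 0), (0, 0, c)) \<or> N = ((0, 0, a), (0, b, 0), (c, 0, 0))))"

lemma monomial_minv:
  assumes "monomial_mat N" shows "det3 N \<noteq> 0" "monomial_mat (minv N)"
proof -
  obtain a b c where nz: "a \<noteq> 0" "b \<noteq> 0" "c \<noteq> 0" and
    N: "N = ((a, 0, 0), (0, b, 0), (0, 0, c)) \<or> N = ((0, a, 0), (0, 0, b), (c, 0, 0)) \<or>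
      N = ((0, 0, a), (b, 0, 0), (0, c, 0)) \<or> N = ((a, 0, 0), (0, 0, b), (0, c, 0)) \<or>
      N = ((0, a, 0), (b, 0, 0), (0, 0, c)) \<or> N = ((0, 0, a), (0, b, 0), (c, 0, 0))"
    using assms unfolding monomial_mat_def by blast
  show "det3 N \<noteq> 0" using N nz by auto
  have nzs: "\<And>u v w. u \<noteq> 0 \<Longrightarrow> v \<noteq> 0 \<Longrightarrow> w \<noteq> 0 \<Longrightarrow> monomial_mat ((u, 0, 0), (0, v, 0), (0, 0, w)) \<and>
      monomial_mat ((0, u, 0), (0, 0, v), (w, 0, 0)) \<and> monomial_mat ((0, 0, u), (v, 0, 0), (0, w, 0)) \<and>
      monomial_mat ((u, 0, 0), (0, 0, v), (0, w, 0)) \<and> monomial_mat ((0, u, 0), (v, 0, 0), (0, 0, w)) \<and>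
      monomial_mat ((0, 0, u), (0, v, 0), (w, 0, 0))" unfolding monomial_mat_def by blast
  show "monomial_mat (minv N)" using N
    by (elim disjE) (simp_all add: Let_def nz nzs)
qed

lemma toric_mono3: "var_x ^ a * var_y ^ b * var_z ^ c = (mono3 1 a b c :: 'a::{idom,ring_char_0} poly poly poly)"
  by (rule eval3_eqI) simp

lemma toric_subst:
  fixes N :: "'a::field_char_0 mat"
  assumes "monomial_mat N"
  shows "\<exists>d0' d1' d2'. subst3 N ` toric_cycle d0 d1 d2 = toric_cycle d0' d1' d2' \<and> {#d0', d1', d2'#} = {#d0, d1, d2#}"
proof -
  obtain a b c where nz: "a \<noteq> 0" "b \<noteq> 0" "c \<noteq> 0" and
    N: "N = ((a, 0, 0), (0, b, 0), (0, 0, c)) \<or> N = ((0, a, 0), (0, 0, b), (c, 0, 0)) \<or>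
      N = ((0, 0, a), (b, 0, 0), (0, c, 0)) \<or> N = ((a, 0, 0), (0, 0, b), (0, c, 0)) \<or>
      N = ((0, a, 0), (b, 0, 0), (0, 0, c)) \<or> N = ((0, 0, a), (0, b, 0), (c, 0, 0))"
    using assms unfolding monomial_mat_def by blast
  define e where "e = a ^ d0 * b ^ d1 * c ^ d2"
  have e: "e \<noteq> 0" using nz by (simp add: e_def)
  have *: "subst3 N ` toric_cycle d0 d1 d2 = toric_cycle i j k"
    if "\<And>x y z. eval3 (subst3 N (mono3 1 d0 d1 d2)) (x, y, z) = e * (x ^ i * y ^ j * z ^ k)" for i j k
  proof -
    have "subst3 N (mono3 1 d0 d1 d2) = const3 e * mono3 1 i j k"
      using that by (intro eval3_eqI) (simp del: eval3_subst)
    then show ?thesis unfolding toric_cycle_def subst_curve toric_mono3 by (simp add: curve_scale[OF e])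
  qed
  from N consider "N = ((a, 0, 0), (0, b, 0), (0, 0, c))" | "N = ((0, a, 0), (0, 0, b), (c, 0, 0))" |
      "N = ((0, 0, a), (b, 0, 0), (0, c, 0))" | "N = ((a, 0, 0), (0, 0, b), (0, c, 0))" |
      "N = ((0, a, 0), (b, 0, 0), (0, 0, c))" | "N = ((0, 0, a), (0, b, 0), (c, 0, 0))" by blast
  then show ?thesis
  proof cases
    case 1 show ?thesis by (rule exI[of _ d0], rule exI[of _ d1], rule exI[of _ d2], intro conjI *)
        (simp_all add: 1 e_def power_mult_distrib mult_ac add_mset_commute del: subst3.simps)
  next
    case 2 show ?thesis by (rule exI[of _ d2], rule exI[of _ d0], rule exI[of _ d1], intro conjI *)
        (simp_all add: 2 e_def power_mult_distrib mult_ac add_mset_commute del: subst3.simps)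
  next
    case 3 show ?thesis by (rule exI[of _ d1], rule exI[of _ d2], rule exI[of _ d0], intro conjI *)
        (simp_all add: 3 e_def power_mult_distrib mult_ac add_mset_commute del: subst3.simps)
  next
    case 4 show ?thesis by (rule exI[of _ d0], rule exI[of _ d2], rule exI[of _ d1], intro conjI *)
        (simp_all add: 4 e_def power_mult_distrib mult_ac add_mset_commute del: subst3.simps)
  next
    case 5 show ?thesis by (rule exI[of _ d1], rule exI[of _ d0], rule exI[of _ d2], intro conjI *)
        (simp_all add: 5 e_def power_mult_distrib mult_ac add_mset_commute del: subst3.simps)
  next
    case 6 show ?thesis by (rule exI[of _ d2], rule exI[of _ d1], rule exI[of _ d0], intro conjI *)
        (simp_all add: 6 e_def power_mult_distrib mult_ac add_mset_commute del: subst3.simps)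
  qed
qed

lemma toric_inj:
  assumes "toric_cycle a b c = (toric_cycle a' b' c' :: 'a::field_char_0 poly poly poly set)"
  shows "a = a' \<and> b = b' \<and> c = c'"
proof -
  obtain e :: 'a where "mono3 1 a b c = const3 e * mono3 1 a' b' c'"
    using assms unfolding toric_cycle_def toric_mono3 curve_eq_iff by blast
  from arg_cong[OF this, of "\<lambda>G. coeff3 G a b c"] show ?thesis
    by (auto simp: coeff3_const3_mult split: if_splits)
qed

locale place =
  fixes V :: "'k::{alg_closed_field,field_char_0} geom set" and \<rho> :: "'k geom \<Rightarrow> 'k"
  assumes place: "place_over_0 V \<rho>"
begin

lemma V_diff [simp]: "a \<in> V \<Longrightarrow> b \<in> V \<Longrightarrow> a - b \<in> V"
  and V_mult [simp]: "a \<in> V \<Longrightarrow> b \<in> V \<Longrightarrow> a * b \<in> V"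
  and V_total: "a \<in> V \<or> inverse a \<in> V"
  and r_add [simp]: "a \<in> V \<Longrightarrow> b \<in> V \<Longrightarrow> \<rho> (a + b) = \<rho> a + \<rho> b"
  and r_mult [simp]: "a \<in> V \<Longrightarrow> b \<in> V \<Longrightarrow> \<rho> (a * b) = \<rho> a * \<rho> b"
  and V_embed [simp]: "embed p \<in> V" and r_embed [simp]: "\<rho> (embed p) = poly p 0"
  using place unfolding place_over_0_def by blast+

lemma embed_add: "embed (p + q :: 'k poly) = embed p + embed q"
  and embed_mult: "embed (p * q :: 'k poly) = embed p * embed q"
  and embed_0 [simp]: "embed (0 :: 'k poly) = 0" and embed_1 [simp]: "embed (1 :: 'k poly) = 1"
  and embed_inj: "embed p = embed q \<longleftrightarrow> p = (q :: 'k poly)"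
  by (simp_all add: embed_def eq_fract flip: Zero_fract_def One_fract_def to_ac_add to_ac_mult)

lemma V_0 [simp]: "0 \<in> V" and V_1 [simp]: "1 \<in> V" and r_0 [simp]: "\<rho> 0 = 0" and r_1 [simp]: "\<rho> 1 = 1"
  using V_embed[of 0] V_embed[of 1] r_embed[of 0] r_embed[of 1] by simp_all

lemma V_uminus [simp]: "a \<in> V \<Longrightarrow> - a \<in> V" using V_diff[of 0 a] by simp

lemma V_add [simp]: "a \<in> V \<Longrightarrow> b \<in> V \<Longrightarrow> a + b \<in> V" using V_diff[of a "- b"] by simp

lemma r_uminus [simp]: "a \<in> V \<Longrightarrow> \<rho> (- a) = - \<rho> a" using r_add[of a "- a"] by (simp add: minus_unique)

lemma r_diff [simp]: "a \<in> V \<Longrightarrow> b \<in> V \<Longrightarrow> \<rho> (a - b) = \<rho> a - \<rho> b" using r_add[of a "- b"] by simp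

lemma V_power [simp]: "a \<in> V \<Longrightarrow> a ^ n \<in> V" by (induction n) auto

lemma r_power [simp]: "a \<in> V \<Longrightarrow> \<rho> (a ^ n) = \<rho> a ^ n" by (induction n) auto

lemma of_nat_V: "of_nat n \<in> V \<and> \<rho> (of_nat n) = of_nat n" by (induction n) auto

lemma V_numeral [simp]: "numeral n \<in> V" and r_numeral [simp]: "\<rho> (numeral n) = numeral n"
  using of_nat_V[of "numeral n"] by simp_all

lemma V_sum: "(\<And>a. a \<in> A \<Longrightarrow> f a \<in> V) \<Longrightarrow> sum f A \<in> V \<and> \<rho> (sum f A) = (\<Sum>a\<in>A. \<rho> (f a))"
  by (induction A rule: infinite_finite_induct) auto

text \<open>Let b be a minus the constant with the same residue, so b has residue 0. Then b / a is
  in \<open>V\<close>, since a / b in \<open>V\<close> would give a the residue 0, and a (1 - b / a)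
  is a nonzero constant.\<close>

lemma unit_inverse:
  assumes a: "a \<in> V" "\<rho> a \<noteq> 0" shows "inverse a \<in> V"
proof -
  define c where "c = embed [:\<rho> a:]"
  define ci where "ci = embed [:inverse (\<rho> a):]"
  have cc: "c * ci = 1" using a(2) unfolding c_def ci_def embed_mult[symmetric] by (simp flip: one_pCons)
  have V: "c \<in> V" "ci \<in> V" unfolding c_def ci_def by simp_all
  have c: "\<rho> c = \<rho> a" by (simp add: c_def)
  define b where "b = a - c"
  have b: "b \<in> V" "\<rho> b = 0" using a V c by (simp_all add: b_def)
  have a0: "a \<noteq> 0" using a by auto
  have "b / a \<in> V \<or> a / b \<in> V" using V_total[of "b / a"] by simp
  moreover have False if "a / b \<in> V" "b \<noteq> 0" using r_mult[OF that(1) b(1)] that a b by simp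
  moreover have "inverse a = (1 - b / a) * ci"
  proof -
    have "(1 - b / a) * a = c" using a0 by (simp add: b_def field_simps)
    then have "((1 - b / a) * ci) * a = 1" unfolding mult.assoc mult.commute[of ci] unfolding mult.assoc[symmetric] using cc by simp
    then show ?thesis using a0 by (simp add: field_simps)
  qed
  ultimately show ?thesis using V by (cases "b = 0") auto
qed

lemma r_inverse: "a \<in> V \<Longrightarrow> \<rho> a \<noteq> 0 \<Longrightarrow> \<rho> (inverse a) = inverse (\<rho> a)"
  using r_mult[OF _ unit_inverse, of a a] by (cases "a = 0") (auto simp: field_simps)

lemma V_divide [simp]: "a \<in> V \<Longrightarrow> b \<in> V \<Longrightarrow> \<rho> b \<noteq> 0 \<Longrightarrow> a / b \<in> V"
  and r_divide [simp]: "a \<in> V \<Longrightarrow> b \<in> V \<Longrightarrow> \<rho> b \<noteq> 0 \<Longrightarrow> \<rho> (a / b) = \<rho> a / \<rho> b"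
  by (simp_all add: divide_inverse unit_inverse r_inverse)

lemma not_V: assumes "a \<notin> V" shows "inverse a \<in> V" "\<rho> (inverse a) = 0" "a \<noteq> 0"
proof -
  show a: "inverse a \<in> V" "a \<noteq> 0" using V_total[of a] assms by auto
  show "\<rho> (inverse a) = 0" using unit_inverse[of "inverse a"] a assms by auto
qed

text \<open>The instance of integral closedness that keeps square roots and cube roots inside the
  valuation ring.\<close>

lemma power_in_V: assumes "a ^ n \<in> V" "n > 0" shows "a \<in> V"
proof (rule ccontr)
  assume "a \<notin> V"
  note a = not_V[OF this]
  have "inverse a ^ n * a ^ n = 1" using a(3) by (simp add: power_inverse)
  then have "\<rho> (inverse a ^ n) * \<rho> (a ^ n) = 1" using r_mult[of "inverse a ^ n" "a ^ n"] a(1) assms(1) by simp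
  then show False using a assms(2) by (simp add: power_0_left)
qed

text \<open>Division by a coordinate that divides the other two in the valuation ring.\<close>

lemma normalise:
  assumes "v \<noteq> (0, 0, 0)"
  obtains k where "k \<noteq> 0" "mat_all (\<lambda>a. a \<in> V) (scal k v)" "vmap \<rho> (scal k v) \<noteq> (0, 0, 0)"
proof -
  obtain x y z where v: "v = (x, y, z)" by (cases v)
  have tot: "a / b \<in> V \<or> b / a \<in> V" for a b using V_total[of "a / b"] by simp
  have tr: "a / c \<in> V" if "a / b \<in> V" "b / c \<in> V" "b \<noteq> 0" for a b c using V_mult[OF that(1,2)] that(3) by simp
  have z: "0 / b \<in> V" for b by simp
  have "\<exists>c. c \<noteq> 0 \<and> c \<in> {x, y, z} \<and> x / c \<in> V \<and> y / c \<in> V \<and> z / c \<in> V"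
  proof -
    have two: "\<exists>c. c \<noteq> 0 \<and> c \<in> {a, b} \<and> a / c \<in> V \<and> b / c \<in> V" if "a \<noteq> 0 \<or> b \<noteq> 0" for a b
    proof (cases "a = 0 \<or> b = 0")
      case True
      then have "a = 0 \<or> b = 0" .
      then show ?thesis using that by (elim disjE) (auto intro: exI[of _ a] exI[of _ b])
    next
      case False
      then show ?thesis using tot[of a b] by (elim disjE) (auto intro: exI[of _ a] exI[of _ b])
    qed
    show ?thesis
    proof (cases "x = 0 \<and> y = 0")
      case True
      then show ?thesis using assms v by (intro exI[of _ z]) auto
    next
      case False
      then obtain c where c: "c \<noteq> 0" "c \<in> {x, y}" "x / c \<in> V" "y / c \<in> V" using two[of x y] by blast
      from two[of c z] c(1) obtain d where d: "d \<noteq> 0" "d \<in> {c, z}" "c / d \<in> V" "z / d \<in> V" by blast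
      have "x / d \<in> V" "y / d \<in> V" using tr[OF c(3) d(3) c(1)] tr[OF c(4) d(3) c(1)] by auto
      then show ?thesis using d c(2) by (intro exI[of _ d]) auto
    qed
  qed
  then obtain c where c: "c \<noteq> 0" "c \<in> {x, y, z}" "x / c \<in> V" "y / c \<in> V" "z / c \<in> V" by blast
  show ?thesis
  proof
    show "1 / c \<noteq> 0" using c by simp
    show "mat_all (\<lambda>a. a \<in> V) (scal (1 / c) v)" using c by (simp add: v)
    show "vmap \<rho> (scal (1 / c) v) \<noteq> (0, 0, 0)" using c by (auto simp: v)
  qed
qed

definition VG :: "'k geom poly poly poly \<Rightarrow> bool" where
  "VG G \<longleftrightarrow> (\<forall>i j k. coeff3 G i j k \<in> V)"

abbreviation red :: "'k geom poly poly poly \<Rightarrow> 'k poly poly poly" where "red \<equiv> map3 \<rho>"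

lemma coeff3_red [simp]: "coeff3 (red G) i j k = \<rho> (coeff3 G i j k)"
  by (simp add: coeff3_def coeff_map_poly)

lemma VG_add: "VG A \<Longrightarrow> VG B \<Longrightarrow> VG (A + B) \<and> red (A + B) = red A + red B"
  by (auto simp: VG_def intro!: coeff3_eqI)

lemma VG_mult: assumes "VG A" "VG B" shows "VG (A * B) \<and> red (A * B) = red A * red B"
proof -
  have "coeff3 (A * B) i j k \<in> V \<and> \<rho> (coeff3 (A * B) i j k) = coeff3 (red A * red B) i j k" for i j k
  proof -
    have 1: "(\<Sum>k'\<le>k. coeff3 A i' j' k' * coeff3 B (i - i') (j - j') (k - k')) \<in> V \<and>
        \<rho> (\<Sum>k'\<le>k. coeff3 A i' j' k' * coeff3 B (i - i') (j - j') (k - k'))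
      = (\<Sum>k'\<le>k. \<rho> (coeff3 A i' j' k') * \<rho> (coeff3 B (i - i') (j - j') (k - k')))" for i' j'
      using V_sum[of "{..k}" "\<lambda>k'. coeff3 A i' j' k' * coeff3 B (i - i') (j - j') (k - k')"] assms
      by (simp add: VG_def)
    have 2: "(\<Sum>j'\<le>j. \<Sum>k'\<le>k. coeff3 A i' j' k' * coeff3 B (i - i') (j - j') (k - k')) \<in> V \<and>
        \<rho> (\<Sum>j'\<le>j. \<Sum>k'\<le>k. coeff3 A i' j' k' * coeff3 B (i - i') (j - j') (k - k'))
      = (\<Sum>j'\<le>j. \<Sum>k'\<le>k. \<rho> (coeff3 A i' j' k') * \<rho> (coeff3 B (i - i') (j - j') (k - k')))" for i'
      using V_sum[of "{..j}" "\<lambda>j'. \<Sum>k'\<le>k. coeff3 A i' j' k' * coeff3 B (i - i') (j - j') (k - k')"] 1 by simp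
    show ?thesis unfolding coeff3_mult coeff3_red
      using V_sum[of "{..i}" "\<lambda>i'. \<Sum>j'\<le>j. \<Sum>k'\<le>k. coeff3 A i' j' k' * coeff3 B (i - i') (j - j') (k - k')"] 2 by simp
  qed
  then show ?thesis by (auto simp: VG_def intro!: coeff3_eqI)
qed

lemma VG_mono3: "c \<in> V \<Longrightarrow> VG (mono3 c i j k) \<and> red (mono3 c i j k) = mono3 (\<rho> c) i j k"
  by (auto simp: VG_def intro!: coeff3_eqI)

lemma const3_mono3: "const3 c = mono3 (c :: 'a::{idom,ring_char_0}) 0 0 0"
  by (rule eval3_eqI) simp

lemma VG_const3: "c \<in> V \<Longrightarrow> VG (const3 c) \<and> red (const3 c) = const3 (\<rho> c)"
  unfolding const3_mono3 by (rule VG_mono3)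

lemma VG_power: "VG A \<Longrightarrow> VG (A ^ n) \<and> red (A ^ n) = red A ^ n"
proof (induction n)
  case 0 then show ?case using VG_const3[of 1] by simp
next
  case (Suc n) then show ?case using VG_mult[of A "A ^ n"] by simp
qed

lemma var_mono3:
  "var_x = mono3 (1 :: 'a::{idom,ring_char_0}) 1 0 0"
  "var_y = mono3 (1 :: 'a) 0 1 0"
  "var_z = mono3 (1 :: 'a) 0 0 1"
  by (rule eval3_eqI, simp)+

lemma VG_lin: "mat_all (\<lambda>a. a \<in> V) r \<Longrightarrow> VG (lin r) \<and> red (lin r) = lin (vmap \<rho> r)"
  by (cases r) (simp add: var_mono3 VG_add VG_mult VG_const3 VG_mono3)

lemma VG_cub:
  "\<lbrakk>a \<in> V; b \<in> V; c \<in> V; d \<in> V; e \<in> V; f \<in> V; g \<in> V; h \<in> V; i \<in> V; j \<in> V\<rbrakk> \<Longrightarrow> VG (cub a b c d e f g h i j) \<and>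
   red (cub a b c d e f g h i j) = cub (\<rho> a) (\<rho> b) (\<rho> c) (\<rho> d) (\<rho> e) (\<rho> f) (\<rho> g) (\<rho> h) (\<rho> i) (\<rho> j)"
  unfolding cub_def by (simp add: VG_add VG_mono3)

definition VM :: "'k geom mat \<Rightarrow> bool" where
  "VM M \<longleftrightarrow> mat_all (mat_all (\<lambda>a. a \<in> V)) M"

definition rmat :: "'k geom mat \<Rightarrow> 'k mat" where "rmat = vmap (vmap \<rho>)"

lemma VM_simp [simp]: "VM (r1, r2, r3) \<longleftrightarrow> mat_all (\<lambda>a. a \<in> V) r1 \<and> mat_all (\<lambda>a. a \<in> V) r2 \<and> mat_all (\<lambda>a. a \<in> V) r3"
  and rmat_simp [simp]: "rmat (r1, r2, r3) = (vmap \<rho> r1, vmap \<rho> r2, vmap \<rho> r3)"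
  by (simp_all add: VM_def rmat_def)

lemma subst_mono3:
  "subst3 (r1, r2, r3) (mono3 (c :: 'a::{idom,ring_char_0}) i j k) = const3 c * lin r1 ^ i * lin r2 ^ j * lin r3 ^ k"
  by (rule eval3_eqI) (simp add: eval3_lin del: lin.simps subst3.simps)

lemma VG_subst:
  assumes "form3 3 G" "VG G" "VM M"
  shows "VG (subst3 M G) \<and> red (subst3 M G) = subst3 (rmat M) (red G)"
proof -
  obtain r1 r2 r3 where M: "M = (r1, r2, r3)" by (cases M)
  note L = VG_lin[of r1] VG_lin[of r2] VG_lin[of r3]
  have m: "VG (subst3 M (mono3 c i j k)) \<and> red (subst3 M (mono3 c i j k)) = subst3 (rmat M) (mono3 (\<rho> c) i j k)"
    if "c \<in> V" for c i j k
    using L assms(3) that unfolding M rmat_simp subst_mono3 by (simp add: VG_mult VG_power VG_const3 del: lin.simps)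
  obtain a b c d e f g h i j where G: "G = cub a b c d e f g h i j" using assms(1) by (rule form3_3E)
  have v: "coeff3 G i j k \<in> V" for i j k using assms(2) by (simp add: VG_def)
  have V: "a \<in> V" "b \<in> V" "c \<in> V" "d \<in> V" "e \<in> V" "f \<in> V" "g \<in> V" "h \<in> V" "i \<in> V" "j \<in> V"
    using v[of 3 0 0] v[of 2 1 0] v[of 2 0 1] v[of 1 2 0] v[of 1 1 1] v[of 1 0 2] v[of 0 3 0] v[of 0 2 1] v[of 0 1 2] v[of 0 0 3]
    unfolding G by simp_all
  have r: "red G = cub (\<rho> a) (\<rho> b) (\<rho> c) (\<rho> d) (\<rho> e) (\<rho> f) (\<rho> g) (\<rho> h) (\<rho> i) (\<rho> j)"
    unfolding G by (rule conjunct2[OF VG_cub[OF V]])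
  have add: "VG (A + B) \<and> red (A + B) = A' + B'" if "VG A \<and> red A = A'" "VG B \<and> red B = B'" for A A' B B'
    using VG_add[of A B] that by simp
  show ?thesis unfolding r unfolding G cub_def subst_add by (intro add m V)
qed

text \<open>Integral substitutions whose reduction permutes the sides of the triangle. Their
  determinants are units, so their inverses are of the same kind, and they preserve limiting
  multidegrees.\<close>

definition vmono :: "'k geom mat \<Rightarrow> bool" where "vmono M \<longleftrightarrow> VM M \<and> monomial_mat (rmat M)"

lemma vmono_minv:
  assumes "vmono M" shows "lininv M (minv M)" "vmono (minv M)"
proof -
  obtain a b c d e f g h i where M: "M = ((a, b, c), (d, e, f), (g, h, i))" by (rule mat_cases)
  have V: "a \<in> V" "b \<in> V" "c \<in> V" "d \<in> V" "e \<in> V" "f \<in> V" "g \<in> V" "h \<in> V" "i \<in> V"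
    using assms unfolding vmono_def M by simp_all
  have m: "monomial_mat (rmat M)" using assms by (simp add: vmono_def)
  note mi = monomial_minv[OF m]
  have dV: "det3 M \<in> V" "\<rho> (det3 M) = det3 (rmat M)" using V by (simp_all add: M)
  have d: "det3 M \<noteq> 0" using dV mi(1) by auto
  then show "lininv M (minv M)" by (rule lininv_minv)
  define r where "r = inverse (det3 M)"
  have r: "r \<in> V" "\<rho> r = inverse (det3 (rmat M))" unfolding r_def using unit_inverse r_inverse dV mi(1) by auto
  have "VM (minv M)" "rmat (minv M) = minv (rmat M)"
    using V r unfolding r_def M minv.simps Let_def by (simp_all add: Let_def M)
  then show "vmono (minv M)" using mi(2) by (simp add: vmono_def)
qed

abbreviation lmd :: "'k geom poly poly poly set \<Rightarrow> nat multiset \<Rightarrow> bool" where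
  "lmd \<equiv> limiting_multidegree V \<rho>"

lemma limit_curve_iff:
  "limit_curve V \<rho> C C0 \<longleftrightarrow> (\<exists>G\<in>C. VG G \<and> red G \<noteq> 0 \<and> C0 = curve (red G))"
  by (simp add: limit_curve_def VG_def)

text \<open>Of two proportional integral equations one is an integral multiple of the other. As its
  reduction is not zero, the factor has nonzero residue, and the reductions are
  proportional.\<close>

lemma limit_unique:
  assumes "limit_curve V \<rho> (curve G) C1" "limit_curve V \<rho> (curve G) C2" shows "C1 = C2"
proof -
  obtain G1 where G1: "G1 \<in> curve G" "VG G1" "red G1 \<noteq> 0" "C1 = curve (red G1)" using assms(1) by (auto simp: limit_curve_iff)
  obtain G2 where G2: "G2 \<in> curve G" "VG G2" "red G2 \<noteq> 0" "C2 = curve (red G2)" using assms(2) by (auto simp: limit_curve_iff)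
  have *: "curve (red B) = curve (red A)" if "c \<in> V" "B = const3 c * A" "VG A" "red B \<noteq> 0" for A B c
  proof -
    have "red B = const3 (\<rho> c) * red A" unfolding that(2) using VG_mult[of "const3 c" A] VG_const3[of c] that by simp
    then show ?thesis using that(4) curve_scale by (cases "\<rho> c = 0") auto
  qed
  have "curve G1 = curve G2" using G1(1) G2(1) curve_memD by blast
  then obtain c where c: "c \<noteq> 0" "G1 = const3 c * G2" unfolding curve_eq_iff by blast
  have "G2 = const3 (inverse c) * G1" using c by (simp add: mult.assoc[symmetric] flip: const3_mult)
  then show ?thesis using *[OF _ c(2) G2(2) G1(3)] *[of "inverse c" G2 G1] G1 G2 V_total[of c] by auto
qed

lemma lmd_unique: "lmd (curve G) A \<Longrightarrow> lmd (curve G) B \<Longrightarrow> A = B"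
  unfolding limiting_multidegree_def using limit_unique toric_inj by metis

lemma lmdI:
  assumes "k \<noteq> 0" "e \<noteq> 0" "VG (const3 k * G)" "red (const3 k * G) = mono3 e a b c"
  shows "lmd (curve G) {#a, b, c#}"
proof -
  have "mono3 e a b c = const3 e * mono3 1 a b c" by (rule eval3_eqI) simp
  then have cm: "curve (mono3 e a b c) = toric_cycle a b c"
    unfolding toric_cycle_def toric_mono3 using curve_scale[OF assms(2), of "mono3 1 a b c"] by (simp only:)
  have nz: "mono3 e a b c \<noteq> 0"
  proof
    assume "mono3 e a b c = 0"
    from arg_cong[OF this, of "\<lambda>G. coeff3 G a b c"] show False using assms(2) by simp
  qed
  have "limit_curve V \<rho> (curve G) (toric_cycle a b c)"
    unfolding limit_curve_iff
  proof (rule bexI)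
    show "const3 k * G \<in> curve G" unfolding curve_alt using assms(1) by blast
    show "VG (const3 k * G) \<and> red (const3 k * G) \<noteq> 0 \<and> toric_cycle a b c = curve (red (const3 k * G))"
      using assms(3) cm nz unfolding assms(4) by blast
  qed
  then show ?thesis unfolding limiting_multidegree_def by blast
qed

lemma lmd_subst:
  assumes "vmono M" "form3 3 G" "lmd (curve G) D" shows "lmd (subst3 M ` curve G) D"
proof -
  obtain d0 d1 d2 where D: "limit_curve V \<rho> (curve G) (toric_cycle d0 d1 d2)" "D = {#d0, d1, d2#}"
    using assms(3) unfolding limiting_multidegree_def by blast
  then obtain G' where G': "G' \<in> curve G" "VG G'" "red G' \<noteq> 0" "toric_cycle d0 d1 d2 = curve (red G')"
    unfolding limit_curve_iff by blast
  have f: "form3 3 G'" using G'(1) assms(2) form3_const3_mult unfolding curve_alt by blast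
  have m: "monomial_mat (rmat M)" using assms(1) by (simp add: vmono_def)
  obtain e0 e1 e2 where e: "subst3 (rmat M) ` toric_cycle d0 d1 d2 = toric_cycle e0 e1 e2" "{#e0, e1, e2#} = {#d0, d1, d2#}"
    using toric_subst[OF m] by blast
  have S: "VG (subst3 M G')" "red (subst3 M G') = subst3 (rmat M) (red G')"
    using VG_subst[OF f G'(2)] assms(1) by (simp_all add: vmono_def)
  have "subst3 (rmat M) (red G') \<noteq> 0"
    using subst_subst[OF lininv_sym[OF lininv_minv[OF monomial_minv(1)[OF m]]], of "red G'"] G'(3) subst_0 by metis
  moreover have "toric_cycle e0 e1 e2 = curve (subst3 (rmat M) (red G'))"
    unfolding e(1)[symmetric] G'(4) subst_curve ..
  ultimately have "limit_curve V \<rho> (subst3 M ` curve G) (toric_cycle e0 e1 e2)"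
    unfolding limit_curve_iff using S G'(1) by (intro bexI[of _ "subst3 M G'"]) simp_all
  then show ?thesis unfolding limiting_multidegree_def D(2) e(2)[symmetric] by blast
qed

lemma lmd_subst_iff:
  assumes "vmono M" "form3 3 G" shows "lmd (subst3 M ` curve G) D \<longleftrightarrow> lmd (curve G) D"
proof
  note mi = vmono_minv[OF assms(1)]
  assume "lmd (subst3 M ` curve G) D"
  then have "lmd (subst3 (minv M) ` curve (subst3 M G)) D"
    using lmd_subst[OF mi(2) form3_subst[OF assms(2)]] unfolding subst_curve by blast
  then show "lmd (curve G) D" unfolding subst_curve subst_subst[OF lininv_sym[OF mi(1)]] .
qed (rule lmd_subst[OF assms])

lemma max_tangent_lmd_subst:
  assumes "vmono M" "C \<in> max_tangent_cubics E" shows "lmd (subst3 M ` C) D \<longleftrightarrow> lmd C D"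
  using lmd_subst_iff[OF assms(1)] assms(2) unfolding max_tangent_cubics_def by blast

lemma lmd_count:
  assumes "inj_on f S" "\<And>k. k \<in> S \<Longrightarrow> \<exists>G. f k = curve G" "\<And>k. k \<in> S \<Longrightarrow> lmd (f k) (g k)"
  shows "card {C \<in> f ` S. lmd C D} = card {k \<in> S. g k = D}"
proof -
  have "{C \<in> f ` S. lmd C D} = f ` {k \<in> S. g k = D}"
  proof (intro equalityI subsetI)
    fix C assume "C \<in> {C \<in> f ` S. lmd C D}"
    then obtain k where k: "k \<in> S" "C = f k" "lmd (f k) D" by blast
    obtain G where "f k = curve G" using assms(2)[OF k(1)] by blast
    then have "g k = D" using lmd_unique[of G] assms(3)[OF k(1)] k(3) by simp
    then show "C \<in> f ` {k \<in> S. g k = D}" using k by blast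
  next
    fix C assume "C \<in> f ` {k \<in> S. g k = D}"
    then show "C \<in> {C \<in> f ` S. lmd C D}" using assms(3) by blast
  qed
  then show ?thesis using inj_on_subset[OF assms(1)] by (simp add: card_image)
qed

end

section \<open>Limits for the Hesse pencil\<close>

lemma monomial_matI:
  assumes "u \<noteq> 0" "v \<noteq> 0" "w \<noteq> 0"
  shows "monomial_mat ((u, 0, 0), (0, v, 0), (0, 0, w))" "monomial_mat ((0, u, 0), (0, 0, v), (w, 0, 0))"
    "monomial_mat ((0, 0, u), (v, 0, 0), (0, w, 0))" "monomial_mat ((u, 0, 0), (0, 0, v), (0, w, 0))"
    "monomial_mat ((0, u, 0), (v, 0, 0), (0, 0, w))" "monomial_mat ((0, 0, u), (0, v, 0), (w, 0, 0))"
  using assms unfolding monomial_mat_def by blast+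

lemma monomial_xyz:
  fixes N :: "'a::field_char_0 mat"
  assumes "monomial_mat N" obtains e where "e \<noteq> 0" "subst3 N (mono3 1 1 1 1) = mono3 e 1 1 1"
proof -
  obtain a b c where abc: "subst3 N ` toric_cycle 1 1 1 = toric_cycle a b c" "{#a, b, c#} = {#1, 1, 1#}"
    using toric_subst[OF assms, of 1 1 1] by blast
  have "set_mset {#a, b, c#} = {1}" unfolding abc(2) by simp
  then have "a = 1" "b = 1" "c = 1" by auto
  then have "curve (subst3 N (mono3 1 1 1 1)) = curve (mono3 1 1 1 1)"
    using abc(1) unfolding toric_cycle_def toric_mono3 subst_curve by simp
  then obtain e where e: "e \<noteq> 0" "subst3 N (mono3 1 1 1 1) = const3 e * mono3 1 1 1 1" unfolding curve_eq_iff by blast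
  have "const3 e * mono3 1 1 1 1 = mono3 e 1 1 1" by (rule eval3_eqI) simp
  then show ?thesis using that e by simp
qed

text \<open>\<open>None\<close> stands for no condition on the limit. The total and the three
  refined counts thus become one additive computation with triples.\<close>

definition weight :: "nat multiset option \<Rightarrow> nat \<Rightarrow> nat \<Rightarrow> nat \<Rightarrow> nat" where
  "weight D a b c = (case D of None \<Rightarrow> a + b + c | Some m \<Rightarrow>
     if m = {#1, 1, 1#} then a else if m = {#2, 1, 0#} then b else if m = {#3, 0, 0#} then c else 0)"

lemma multidegree_distinct:
  "{#1, 1, 1#} \<noteq> {#2, 1, 0 :: nat#}" "{#1, 1, 1#} \<noteq> {#3, 0, 0 :: nat#}" "{#2, 1, 0 :: nat#} \<noteq> {#3, 0, 0#}"
proof -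
  have "a \<noteq> b" if "count a n \<noteq> count b n" for a b :: "nat multiset" and n using that by auto
  note * = this
  show "{#1, 1, 1#} \<noteq> {#2, 1, 0 :: nat#}" by (rule *[of _ 2]) simp
  show "{#1, 1, 1#} \<noteq> {#3, 0, 0 :: nat#}" "{#2, 1, 0 :: nat#} \<noteq> {#3, 0, 0#}" by (rule *[of _ 3]; simp)+
qed

lemma cub_mono3:
  "cub a 0 0 0 0 0 0 0 0 0 = mono3 (a :: 'a::{idom,ring_char_0}) 3 0 0"
  "cub 0 0 0 0 a 0 0 0 0 0 = mono3 a 1 1 1" "cub 0 0 0 0 0 0 0 a 0 0 = mono3 a 0 2 1"
  by (rule eval3_eqI, simp)+

text \<open>The tangent cubic at the flex within its pencil: 108 s^2 times the curve plus a multiple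
  of the cube of the flex tangent. The limit depends on which summand dominates.\<close>

lemma flexG_eval:
  fixes s :: "'a::field_char_0"
  assumes "r \<noteq> 3"
  shows "eval3 (subst3 (flexmat s) (flexG (27 * s^2) (4 * (27 * s^3 + 1)) r)) (x, y, z)
    = 108 * s^2 * (s * (x^3 + y^3 + z^3) + x * y * z) + (r - 1) * (r + 3) / (3 - r)^2 * (x - 3 * s * (y + z))^3"
proof -
  define nu where "nu = (r - 1) * (r + 3) / (3 - r)^2"
  have swap: "B = A - C" if "A - B = C" for A B C :: 'a unfolding that[symmetric] by simp
  have a: "app (flexmat s) (x, y, z) = (x, y - z, - x + 3 * s * y + 3 * s * z)" by (simp add: flexmat_def)
  have "eval3 (flexG (27 * s^2) (4 * (27 * s^3 + 1)) r) (x, y - z, - x + 3 * s * y + 3 * s * z)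
    = eval3 (flexE (27 * s^2) (4 * (27 * s^3 + 1))) (x, y - z, - x + 3 * s * y + 3 * s * z) - nu * (- x + 3 * s * y + 3 * s * z)^3"
    unfolding nu_def by (rule swap[OF flex_difference[OF assms]])
  also have "\<dots> = 108 * s^2 * (s * (x^3 + y^3 + z^3) + x * y * z) + nu * (x - 3 * s * (y + z))^3"
    unfolding eval3_cub by Groebner_Basis.algebra
  finally show ?thesis unfolding eval3_subst a nu_def .
qed

context place
begin

definition has_lmd :: "nat multiset option \<Rightarrow> 'k geom poly poly poly set \<Rightarrow> bool" where
  "has_lmd D C \<longleftrightarrow> (case D of None \<Rightarrow> True | Some m \<Rightarrow> lmd C m)"

lemma weight_count:
  assumes S: "finite S" and f: "inj_on f S" "\<And>k. k \<in> S \<Longrightarrow> \<exists>G. f k = curve G" "\<And>k. k \<in> S \<Longrightarrow> lmd (f k) (g k)"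
    and g: "\<And>k. k \<in> S \<Longrightarrow> g k \<in> {{#1, 1, 1#}, {#2, 1, 0#}, {#3, 0, 0#}}"
  shows "card {C \<in> f ` S. has_lmd D C}
    = weight D (card {k \<in> S. g k = {#1, 1, 1#}}) (card {k \<in> S. g k = {#2, 1, 0#}}) (card {k \<in> S. g k = {#3, 0, 0#}})"
proof (cases D)
  case (Some m)
  have "{k \<in> S. g k = m} = {}" if "m \<noteq> {#1, 1, 1#}" "m \<noteq> {#2, 1, 0#}" "m \<noteq> {#3, 0, 0#}" using g that by blast
  then have "card {k \<in> S. g k = m} = weight D (card {k \<in> S. g k = {#1, 1, 1#}}) (card {k \<in> S. g k = {#2, 1, 0#}}) (card {k \<in> S. g k = {#3, 0, 0#}})"
    unfolding weight_def Some option.case by (metis card.empty)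
  then show ?thesis using lmd_count[OF f, of m] by (simp add: has_lmd_def Some)
next
  case None
  have "S = {k \<in> S. g k = {#1, 1, 1#}} \<union> {k \<in> S. g k = {#2, 1, 0#}} \<union> {k \<in> S. g k = {#3, 0, 0#}}"
    using g by blast
  then have "card S = card ({k \<in> S. g k = {#1, 1, 1#}} \<union> {k \<in> S. g k = {#2, 1, 0#}} \<union> {k \<in> S. g k = {#3, 0, 0#}})" by simp
  also have "\<dots> = card ({k \<in> S. g k = {#1, 1, 1#}} \<union> {k \<in> S. g k = {#2, 1, 0#}}) + card {k \<in> S. g k = {#3, 0, 0#}}"
    using S multidegree_distinct by (intro card_Un_disjoint) auto
  also have "card ({k \<in> S. g k = {#1, 1, 1#}} \<union> {k \<in> S. g k = {#2, 1, 0#}}) = card {k \<in> S. g k = {#1, 1, 1#}} + card {k \<in> S. g k = {#2, 1, 0#}}"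
    using S multidegree_distinct by (intro card_Un_disjoint) auto
  finally show ?thesis using f(1) by (simp add: None weight_def has_lmd_def card_image)
qed

lemma contact_transport:
  assumes "vmono M" "subst3 M E = E"
  shows "card {C \<in> contact E v. has_lmd D C} = card {C \<in> contact E (app M v). has_lmd D C}"
    and "finite (contact E (app M v)) \<Longrightarrow> finite (contact E v)"
proof -
  note M = vmono_minv(1)[OF assms(1)]
  have im: "contact E v = (`) (subst3 M) ` contact E (app M v)" using contact_subst[OF M, of E v] assms(2) by simp
  moreover have "has_lmd D (subst3 M ` C) \<longleftrightarrow> has_lmd D C" if "C \<in> contact E (app M v)" for C
    using that max_tangent_lmd_subst[OF assms(1)] unfolding contact_def has_lmd_def by (cases D) auto
  ultimately have "{C \<in> contact E v. has_lmd D C} = (`) (subst3 M) ` {C \<in> contact E (app M v). has_lmd D C}" by auto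
  moreover have "inj_on ((`) (subst3 M)) S" for S
    by (rule inj_on_subset[OF inj_subst_image[OF M] subset_UNIV])
  ultimately show "card {C \<in> contact E v. has_lmd D C} = card {C \<in> contact E (app M v). has_lmd D C}" by (simp add: card_image)
  show "finite (contact E v)" if "finite (contact E (app M v))" unfolding im using that by simp
qed

text \<open>A root c other than 1 satisfies c^2 + c + 1 = 0, and the residue 1 would turn this into
  3 = 0.\<close>

lemma cube_root_V: assumes "c^3 = 1" shows "c \<in> V" "\<rho> c^3 = 1" "\<rho> c \<noteq> 0" "c \<noteq> 1 \<Longrightarrow> \<rho> c \<noteq> 1"
proof -
  show V: "c \<in> V" using power_in_V[of c 3] assms by simp
  show r: "\<rho> c^3 = 1" using r_power[OF V, of 3] assms by simp
  show "\<rho> c \<noteq> 0" using r by auto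
  assume "c \<noteq> 1"
  then have "c^2 + c + 1 = 0" using cube_root_one[OF assms] by blast
  then have "\<rho> (c^2 + c + 1) = 0" by simp
  then have "\<rho> c^2 + \<rho> c + 1 = 0" using V by simp
  then show "\<rho> c \<noteq> 1" by auto
qed

lemma hesse_cyc:
  "subst3 ((0, 1, 0), (0, 0, 1), (1, 0, 0)) (hesse s) = hesse (s :: 'k geom)"
  "subst3 ((0, 0, 1), (1, 0, 0), (0, 1, 0)) (hesse s) = hesse (s :: 'k geom)"
  by (rule eval3_eqI, simp add: mult_ac add_ac del: subst3.simps)+

lemma vmono_cyc: "vmono ((0, 1, 0), (0, 0, 1), (1, 0, 0))" "vmono ((0, 0, 1), (1, 0, 0), (0, 1, 0))"
  unfolding vmono_def by (simp_all add: monomial_matI)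

end

locale hesse_place = place V \<rho> for V :: "'k::{alg_closed_field,field_char_0} geom set" and \<rho> +
  fixes s :: "'k geom"
  assumes s: "s \<in> V" "\<rho> s = 0" "s \<noteq> 0"
begin

lemma s_nz: "27 * s^3 + 1 \<noteq> 0" "216 * s^3 \<noteq> 1"
proof -
  have "\<rho> (27 * s^3 + 1) = 1" "\<rho> (216 * s^3) = 0" using s by simp_all
  then show "27 * s^3 + 1 \<noteq> 0" "216 * s^3 \<noteq> 1" by auto
qed

text \<open>The two values of \<open>r\<close> have residues 1 and -1. For residue 1 the coefficient
  of the tangent cube is a multiple of s^3, so after division by 108 s^2 the curve dominates and x y
  z remains. For residue -1 that coefficient is a unit, and the tangent x - 3 s (y + z) reduces to
  x, which leaves x^3.\<close>

lemma flex_limits: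
  "card {C \<in> contact (hesse s) (0, 1, -1). has_lmd D C} = weight D 1 0 1"
  "finite (contact (hesse s) (0, 1, -1))"
proof -
  define S where "S = {r. r^2 = 1 - 216 * s^3}"
  define f where "f r = curve (subst3 (flexmat s) (flexG (27 * s^2) (4 * (27 * s^3 + 1)) r))" for r
  note fc = flex_contact[OF s(3) s_nz, folded S_def f_def]
  obtain r0 where r0: "r0^2 = 1 - 216 * s^3" using nth_root_exists[of 2 "1 - 216 * s^3"] by auto
  have "r0 \<in> V" using power_in_V[of r0 2] r0 s(1) by simp
  moreover have "\<rho> r0^2 = 1" using r_power[OF \<open>r0 \<in> V\<close>, of 2] r0 s by simp
  ultimately obtain r where r: "r^2 = 1 - 216 * s^3" "r \<in> V" "\<rho> r = 1"
    using r0 by (metis (no_types, lifting) V_uminus minus_minus power2_eq_1_iff power2_minus r_uminus)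
  have rn: "r \<noteq> - r"
  proof
    assume "r = - r" then have "2 * r = 0" by simp
    then have "r = 0" by simp
    then show False using r(3) by simp
  qed
  have S: "S = {r, - r}" unfolding S_def r(1)[symmetric] by (auto simp: power2_eq_iff)
  then have cS: "finite S" "card S = 2" using rn by auto
  have inj: "inj_on f S" using fc cS by (intro eq_card_imp_inj_on) simp_all
  have sub: "lmd (curve (subst3 (flexmat s) (flexG (27 * s^2) (4 * (27 * s^3 + 1)) r))) {#1, 1, 1#}"
  proof -
    have u: "\<rho> (r + 1) = 2" "\<rho> (3 - r) = 2" using r by simp_all
    then have nz: "r + 1 \<noteq> 0" "3 - r \<noteq> 0" by auto
    define A where "A = (r + 3) / (3 - r)^2"
    define i where "i = 1 / (r + 1)"
    define n where "n = - 2 * A * i"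
    define nu where "nu = (r - 1) * (r + 3) / (3 - r)^2"
    have n: "n \<in> V" unfolding n_def A_def i_def using u r(2) by simp
    \<comment> \<open>As r + 1 has residue 2, the factor r - 1 carries all of s^3.\<close>
    have "(r - 1) * (r + 1) = - 216 * s^3" using r(1) by Groebner_Basis.algebra
    then have r1: "r - 1 = - 216 * s^3 * i" using nz(1) by (simp add: i_def field_simps)
    have "nu = (r - 1) * A" by (simp add: nu_def A_def)
    then have nu: "nu = 108 * s^2 * (s * n)" unfolding r1 n_def by Groebner_Basis.algebra
    have "r \<noteq> 3" using nz(2) by auto
    define k where "k = 1 / (108 * s^2)"
    have k: "k \<noteq> 0" "k * (108 * s^2) = 1" using s(3) by (simp_all add: k_def)
    have eq: "const3 k * subst3 (flexmat s) (flexG (27 * s^2) (4 * (27 * s^3 + 1)) r)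
      = cub (s + s*n) (-9*s^2*n) (-9*s^2*n) (27*s^3*n) (1 + 54*s^3*n) (27*s^3*n) (s - 27*s^4*n) (-81*s^4*n) (-81*s^4*n) (s - 27*s^4*n)"
    proof (rule eval3_eqI)
      fix x y z
      have "eval3 (const3 k * subst3 (flexmat s) (flexG (27 * s^2) (4 * (27 * s^3 + 1)) r)) (x, y, z)
        = k * (108 * s^2 * (s * (x^3 + y^3 + z^3) + x * y * z) + nu * (x - 3 * s * (y + z))^3)"
        unfolding eval3_mult eval3_const3 flexG_eval[OF \<open>r \<noteq> 3\<close>] nu_def ..
      also have "\<dots> = (k * (108 * s^2)) * ((s * (x^3 + y^3 + z^3) + x * y * z) + s * n * (x - 3 * s * (y + z))^3)"
        unfolding nu by Groebner_Basis.algebra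
      also have "\<dots> = (s * (x^3 + y^3 + z^3) + x * y * z) + s * n * (x - 3 * s * (y + z))^3" unfolding k(2) by (rule mult_1_left)
      also have "\<dots> = eval3 (cub (s + s*n) (-9*s^2*n) (-9*s^2*n) (27*s^3*n) (1 + 54*s^3*n) (27*s^3*n) (s - 27*s^4*n) (-81*s^4*n) (-81*s^4*n) (s - 27*s^4*n)) (x, y, z)"
        unfolding eval3_cub by Groebner_Basis.algebra
      finally show "eval3 (const3 k * subst3 (flexmat s) (flexG (27 * s^2) (4 * (27 * s^3 + 1)) r)) (x, y, z)
        = eval3 (cub (s + s*n) (-9*s^2*n) (-9*s^2*n) (27*s^3*n) (1 + 54*s^3*n) (27*s^3*n) (s - 27*s^4*n) (-81*s^4*n) (-81*s^4*n) (s - 27*s^4*n)) (x, y, z)" .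
    qed
    have V: "VG (cub (s + s*n) (-9*s^2*n) (-9*s^2*n) (27*s^3*n) (1 + 54*s^3*n) (27*s^3*n) (s - 27*s^4*n) (-81*s^4*n) (-81*s^4*n) (s - 27*s^4*n))
      \<and> red (cub (s + s*n) (-9*s^2*n) (-9*s^2*n) (27*s^3*n) (1 + 54*s^3*n) (27*s^3*n) (s - 27*s^4*n) (-81*s^4*n) (-81*s^4*n) (s - 27*s^4*n)) = mono3 1 1 1 1"
      using VG_cub[of "s + s*n" "-9*s^2*n" "-9*s^2*n" "27*s^3*n" "1 + 54*s^3*n" "27*s^3*n" "s - 27*s^4*n" "-81*s^4*n" "-81*s^4*n" "s - 27*s^4*n"]
        s n by (simp add: cub_mono3)
    show ?thesis by (intro lmdI[OF k(1), of 1]) (rule one_neq_zero, simp_all only: eq V)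
  qed
  have sub': "lmd (curve (subst3 (flexmat s) (flexG (27 * s^2) (4 * (27 * s^3 + 1)) (- r)))) {#3, 0, 0#}"
  proof -
    have u: "\<rho> (3 + r) = 4" using r by simp
    have nz: "- r \<noteq> 3"
    proof
      assume "- r = 3"
      then have "3 + r = 0" by (metis add.left_inverse)
      then show False using u by simp
    qed
    define nu where "nu = (- r - 1) * (- r + 3) / (3 - - r)^2"
    have nu: "nu \<in> V" "\<rho> nu = - 1 / 4" unfolding nu_def using u r(2,3) by simp_all
    have eq: "const3 1 * subst3 (flexmat s) (flexG (27 * s^2) (4 * (27 * s^3 + 1)) (- r))
      = cub (108*s^3 + nu) (-9*s*nu) (-9*s*nu) (27*s^2*nu) (108*s^2 + 54*s^2*nu) (27*s^2*nu) (108*s^3 - 27*s^3*nu) (-81*s^3*nu) (-81*s^3*nu) (108*s^3 - 27*s^3*nu)"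
    proof (rule eval3_eqI)
      fix x y z
      show "eval3 (const3 1 * subst3 (flexmat s) (flexG (27 * s^2) (4 * (27 * s^3 + 1)) (- r))) (x, y, z)
        = eval3 (cub (108*s^3 + nu) (-9*s*nu) (-9*s*nu) (27*s^2*nu) (108*s^2 + 54*s^2*nu) (27*s^2*nu) (108*s^3 - 27*s^3*nu) (-81*s^3*nu) (-81*s^3*nu) (108*s^3 - 27*s^3*nu)) (x, y, z)"
        unfolding eval3_mult eval3_const3 flexG_eval[OF nz, folded nu_def] eval3_cub mult_1_left by Groebner_Basis.algebra
    qed
    have V: "VG (cub (108*s^3 + nu) (-9*s*nu) (-9*s*nu) (27*s^2*nu) (108*s^2 + 54*s^2*nu) (27*s^2*nu) (108*s^3 - 27*s^3*nu) (-81*s^3*nu) (-81*s^3*nu) (108*s^3 - 27*s^3*nu))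
      \<and> red (cub (108*s^3 + nu) (-9*s*nu) (-9*s*nu) (27*s^2*nu) (108*s^2 + 54*s^2*nu) (27*s^2*nu) (108*s^3 - 27*s^3*nu) (-81*s^3*nu) (-81*s^3*nu) (108*s^3 - 27*s^3*nu)) = mono3 (- 1 / 4) 3 0 0"
      using VG_cub[of "108*s^3 + nu" "-9*s*nu" "-9*s*nu" "27*s^2*nu" "108*s^2 + 54*s^2*nu" "27*s^2*nu" "108*s^3 - 27*s^3*nu" "-81*s^3*nu" "-81*s^3*nu" "108*s^3 - 27*s^3*nu"]
        s nu by (simp add: cub_mono3)
    show ?thesis by (intro lmdI[OF one_neq_zero, of "- 1 / 4"]) (simp, simp_all only: eq V)
  qed
  define g where "g r' = (if r' = r then {#1, 1, 1 :: nat#} else {#3, 0, 0#})" for r'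
  have cc: "card {C \<in> f ` S. has_lmd D C} = weight D (card {k \<in> S. g k = {#1, 1, 1#}}) (card {k \<in> S. g k = {#2, 1, 0#}}) (card {k \<in> S. g k = {#3, 0, 0#}})"
    by (rule weight_count[OF cS(1) inj]) (use sub sub' rn in \<open>auto simp: f_def g_def S\<close>)
  have sets: "{k \<in> S. g k = {#1, 1, 1#}} = {r}" "{k \<in> S. g k = {#2, 1, 0#}} = {}" "{k \<in> S. g k = {#3, 0, 0#}} = {- r}"
    unfolding S g_def using rn multidegree_distinct multidegree_distinct[symmetric] by auto
  show "card {C \<in> contact (hesse s) (0, 1, -1). has_lmd D C} = weight D 1 0 1" unfolding fc(1) cc sets by simp
  show "finite (contact (hesse s) (0, 1, -1))" unfolding fc(1) using cS(1) by simp
qed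

text \<open>The matrices diag(1, c^2, c) and the cyclic permutations preserve the curve, move every
  flex to (0, 1, -1) and are monomial, so they do not affect limits.\<close>

lemma all_flex_limits:
  assumes "Q \<in> flexes"
  shows "finite (cset (hesse s) Q) \<and> card {C \<in> cset (hesse s) Q. has_lmd D C} = weight D 1 0 1"
proof -
  let ?H = "hesse s"
  have ff: "form3 3 ?H" by simp
  have base: "finite (contact ?H (0, 1, - c)) \<and> card {C \<in> contact ?H (0, 1, - c). has_lmd D C} = weight D 1 0 1" if c: "c^3 = 1" for c
  proof -
    note cV = cube_root_V[OF c]
    let ?M = "((1, 0, 0), (0, c^2, 0), (0, 0, c))"
    have vm: "vmono ?M" unfolding vmono_def using cV by (simp add: monomial_matI)
    have inv: "subst3 ?M ?H = ?H"
    proof (rule eval3_eqI)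
      fix x y z
      have "(c^2 * y)^3 = y^3" "(c * z)^3 = z^3" "x * (c^2 * y) * (c * z) = x * y * z" using c by Groebner_Basis.algebra+
      then show "eval3 (subst3 ?M ?H) (x, y, z) = eval3 ?H (x, y, z)" by (simp del: subst3.simps)
    qed
    have "app ?M (0, 1, - c) = scal (c^2) (0, 1, -1)" by (simp add: power2_eq_square)
    then have "contact ?H (app ?M (0, 1, - c)) = contact ?H (0, 1, -1)"
      using contact_scal[OF ff, of "c^2"] cV(3) by (metis power_eq_0_iff r_0)
    then show ?thesis using contact_transport[OF vm inv, of "(0, 1, - c)"] flex_limits by simp
  qed
  from assms consider c where "c^3 = 1" "Q = pt (0, 1, - c)" | c where "c^3 = 1" "Q = pt (- c, 0, 1)"
    | c where "c^3 = 1" "Q = pt (1, - c, 0)" unfolding flexes_def by blast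
  then show ?thesis
  proof cases
    case (1 c) then show ?thesis using base[of c] by (simp add: cset_pt)
  next
    case (2 c) then show ?thesis using base[of c] contact_transport[OF vmono_cyc(1) hesse_cyc(1), where v = "(- c, 0, 1)"]
      by (simp add: cset_pt)
  next
    case (3 c) then show ?thesis using base[of c] contact_transport[OF vmono_cyc(2) hesse_cyc(2), where v = "(1, - c, 0)"]
      by (simp add: cset_pt)
  qed
qed

text \<open>Because \<open>s\<close> has residue 0 the point reduces to the triangle, and the class
  equation forces the reduction to be a vertex. These translations permute the vertices cyclically,
  so the three columns of \<open>kmat\<close> reduce to the three vertices, and \<open>kmat\<close>
  preserves limits.\<close>

lemma class12_limits:
  assumes V: "x \<in> V" "y \<in> V" "z \<in> V" and nz: "(\<rho> x, \<rho> y, \<rho> z) \<noteq> (0, 0, 0)" and H: "eval3 (hesse s) (x, y, z) = 0"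
    and k: "(g, c) \<in> kindex" "kform g c (x, y, z) = 0" "g \<noteq> 0"
  shows "card {C \<in> contact (hesse s) (x, y, z). has_lmd D C} = weight D 0 3 0"
proof -
  have c: "c^3 = 1" using k(1) by (simp add: kindex_def)
  note cV = cube_root_V[OF c]
  have nz': "(x, y, z) \<noteq> (0, 0, 0)" using nz by auto
  let ?M = "kmat g c (x, y, z)"
  have g: "g = 1 \<or> g = 2" using k(1,3) by (auto simp: kindex_def le_Suc_eq numeral_2_eq_2)
  have "\<rho> (x * y * z) = 0" 
  proof -
    have "x * y * z = - s * (x^3 + y^3 + z^3)" using H unfolding eval3_hesse by (simp add: add_eq_0_iff)
    then show ?thesis using s V by simp
  qed
  then have xyz: "\<rho> x * \<rho> y * \<rho> z = 0" using V by simp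
  have kf: "kform g (\<rho> c) (\<rho> x, \<rho> y, \<rho> z) = 0"
    using arg_cong[OF k(2), of \<rho>] g V cV(1) by auto
  have vert: "\<rho> x = 0 \<and> \<rho> y = 0 \<and> \<rho> z \<noteq> 0 \<or> \<rho> x = 0 \<and> \<rho> z = 0 \<and> \<rho> y \<noteq> 0 \<or> \<rho> y = 0 \<and> \<rho> z = 0 \<and> \<rho> x \<noteq> 0"
    using g kf xyz nz cV(3) by auto
  have vm: "vmono ?M" unfolding vmono_def
  proof
    show "VM ?M" using g V cV(1) by (auto simp: kmat_def)
    show "monomial_mat (rmat ?M)" using g vert V cV(1,3) by (elim disjE conjE) (simp_all add: kmat_def monomial_matI)
  qed
  note M = vmono_minv[OF vm]
  obtain be de where sub: "subst3 ?M (hesse s) = cub 0 be 0 0 de be 0 be 0 0" using kmat_subst[OF H k(1,2)] by metis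
  note nine = nine_contact[OF s(3) s_nz(1) M(1)[unfolded kmat_def] sub[unfolded kmat_def], folded kmat_def]
  have S: "VG (hesse s)" "red (hesse s) = mono3 1 1 1 1"
    using VG_cub[of s 0 0 0 1 0 s 0 0 s] s by (simp_all add: cub_mono3)
  have S2: "VG (cub 0 be 0 0 de be 0 be 0 0)" "red (cub 0 be 0 0 de be 0 be 0 0) = subst3 (rmat ?M) (mono3 1 1 1 1)"
    using VG_subst[OF form3_cub S(1), of ?M] vm S(2) unfolding vmono_def sub by simp_all
  obtain e where e: "e \<noteq> 0" "subst3 (rmat ?M) (mono3 1 1 1 1) = mono3 e 1 1 1"
    using monomial_xyz vm unfolding vmono_def by blast
  have bV: "be \<in> V" "de \<in> V" using S2(1)[unfolded VG_def, rule_format, of 2 1 0] S2(1)[unfolded VG_def, rule_format, of 1 1 1] by simp_all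
  have br: "\<rho> be = 0" "\<rho> de = e"
    using arg_cong[OF S2(2), of "\<lambda>G. coeff3 G 2 1 0"] arg_cong[OF S2(2), of "\<lambda>G. coeff3 G 1 1 1"] unfolding e(2) by simp_all
  define al where "al = de / be"
  have al: "de = al * be" using nine(1) by (simp add: al_def)
  have lim: "lmd (curve (subst3 (minv ?M) (nineG al k))) {#2, 1, 0#}" if k: "k^3 = 1" for k
  proof -
    note kV = cube_root_V[OF k]
    let ?G = "cub 0 (- k*be^3) 0 (3*de*be^2 + de^2*k*be) (3*be^3) (- k*be^3) (- (3*be^3 + de*k*be^2)) (3*de^2*be + de^3*k - k*be^3)
      (6*de*be^2 + 2*de^2*k*be) (3*be^3 + de*k*be^2)"
    \<comment> \<open>\<open>al = de / be\<close> has a pole: \<open>be\<close> has residue 0 and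
      \<open>de\<close> is a unit. The factor \<open>be^3\<close> clears the denominators, and only
      the term de^3 k in front of y^2 z survives the reduction.\<close>
    have eq: "const3 (be^3) * nineG al k = ?G"
      unfolding al by (rule eval3_eqI) (simp add: nineG_def algebra_simps power2_eq_square power3_eq_cube)
    have V: "VG ?G \<and> red ?G = mono3 (e^3 * \<rho> k) 0 2 1"
      using VG_cub[of 0 "- k*be^3" 0 "3*de*be^2 + de^2*k*be" "3*be^3" "- k*be^3" "- (3*be^3 + de*k*be^2)" "3*de^2*be + de^3*k - k*be^3"
        "6*de*be^2 + 2*de^2*k*be" "3*be^3 + de*k*be^2"] bV br kV(1) by (simp add: cub_mono3)
    have "be^3 \<noteq> 0" "e^3 * \<rho> k \<noteq> 0" using e(1) kV(3) nine(1) by simp_all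
    then have "lmd (curve (nineG al k)) {#0, 2, 1#}" by (rule lmdI) (simp_all only: eq V)
    moreover have "{#0, 2, 1#} = {#2, 1, 0 :: nat#}" by (simp add: add_mset_commute)
    ultimately have "lmd (curve (nineG al k)) {#2, 1, 0#}" by (simp only:)
    then show ?thesis using lmd_subst[OF M(2), of "nineG al k"] unfolding subst_curve by (simp add: nineG_def)
  qed
  obtain w :: "'k geom" where w: "w \<noteq> 1" "w^2 \<noteq> 1" "w^2 \<noteq> w" "{c. c^3 = 1} = {1, w, w^2}" by (rule omega_exists)
  have fin: "finite {k :: 'k geom. k^3 = 1}" "card {k :: 'k geom. k^3 = 1} = 3" unfolding w(4) using w(1-3) by auto
  have "card {C \<in> contact (hesse s) (x, y, z). has_lmd D C} = weight D (card {k \<in> {k :: 'k geom. k^3 = 1}. {#2, 1, 0 :: nat#} = {#1, 1, 1#}})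
    (card {k \<in> {k :: 'k geom. k^3 = 1}. {#2, 1, 0 :: nat#} = {#2, 1, 0#}}) (card {k \<in> {k :: 'k geom. k^3 = 1}. {#2, 1, 0 :: nat#} = {#3, 0, 0#}})"
    unfolding nine(3)[folded al_def]
    by (rule weight_count[OF fin(1) nine_inj[OF M(1)]]) (use lim in auto)
  also have "\<dots> = weight D 0 3 0"
    using multidegree_distinct multidegree_distinct(1)[symmetric] fin(2) by simp
  finally show ?thesis .
qed

end

context hesse_place
begin

text \<open>A diagonal translation keeps all translates on the side x = 0, so \<open>kmat\<close>
  degenerates. But \<open>al\<close> is integral with residue -3, so the coefficient 3 + al k of the
  second form in the pencil is small for k = 1 and a unit for the other two roots: the curve
  dominates once, the singular member twice.\<close>

lemma class0_limits_base:
  assumes V: "x \<in> V" "y \<in> V" "z \<in> V" and rx: "\<rho> x = 0" and nz: "(\<rho> x, \<rho> y, \<rho> z) \<noteq> (0, 0, 0)"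
    and H: "eval3 (hesse s) (x, y, z) = 0" and k: "(0, c) \<in> kindex" "kform 0 c (x, y, z) = 0"
  shows "card {C \<in> contact (hesse s) (x, y, z). has_lmd D C} = weight D 1 0 2"
proof -
  have c: "c^3 = 1" "c \<noteq> 1" using k(1) by (simp_all add: kindex_def)
  note cV = cube_root_V[OF c(1)]
  have c': "c^2 + c + 1 = 0" using cube_root_one[OF c] .
  have nz': "(x, y, z) \<noteq> (0, 0, 0)" using nz by auto
  let ?M = "kmat 0 c (x, y, z)"
  note M = kmat_inv[OF s(3) s_nz(1) nz' H k]
  have xyz0: "x * y * z \<noteq> 0" using kform_nz[OF s(3) nz' H k] .
  have K: "x^3 + c * y^3 + c^2 * z^3 = 0" using k(2) by simp
  have "\<rho> (x^3 + c * y^3 + c^2 * z^3) = 0" using K by simp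
  then have rK: "\<rho> c * (\<rho> y^3 + \<rho> c * \<rho> z^3) = 0" using V cV(1) rx by (simp add: algebra_simps power2_eq_square)
  then have ry: "\<rho> y^3 = - (\<rho> c * \<rho> z^3)" using cV(3) by (simp add: add_eq_0_iff2)
  have rz: "\<rho> z \<noteq> 0" "\<rho> y \<noteq> 0" using ry nz rx cV(3) by auto
  define w where "w = x^3 + c^2 * y^3 + c * z^3"
  define sg where "sg = x^3 + y^3 + z^3"
  have wV: "w \<in> V" "sg \<in> V" using V cV(1) by (simp_all add: w_def sg_def)
  have rw: "\<rho> w = (\<rho> c - 1) * \<rho> z^3" "\<rho> sg = (1 - \<rho> c) * \<rho> z^3"
  proof -
    have "\<rho> w = \<rho> c^2 * \<rho> y^3 + \<rho> c * \<rho> z^3" "\<rho> sg = \<rho> y^3 + \<rho> z^3" using V cV(1) rx by (simp_all add: w_def sg_def)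
    moreover have "\<rho> c^2 * (- (\<rho> c * \<rho> z^3)) + \<rho> c * \<rho> z^3 = (\<rho> c - 1) * \<rho> z^3" using cV(2) by Groebner_Basis.algebra
    moreover have "- (\<rho> c * \<rho> z^3) + \<rho> z^3 = (1 - \<rho> c) * \<rho> z^3" by (simp add: algebra_simps)
    ultimately show "\<rho> w = (\<rho> c - 1) * \<rho> z^3" "\<rho> sg = (1 - \<rho> c) * \<rho> z^3" unfolding ry by simp_all
  qed
  have rw0: "\<rho> w \<noteq> 0" using rw(1) cV(4)[OF c(2)] rz(1) by simp
  then have w0: "w \<noteq> 0" by auto
  obtain be de where sub: "subst3 ?M (hesse s) = cub 0 be 0 0 de be 0 be 0 0"
    and "(0::nat) = 0 \<Longrightarrow> be = 3 * s * (x^3 + c^2 * y^3 + c * z^3) \<and> de = - 9 * (x * y * z)"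
    using kmat_subst[OF H k] by metis
  then have be: "be = 3 * s * w" and de: "de = - 9 * (x * y * z)" by (simp_all add: w_def)
  have Hs: "x * y * z = - s * sg" using H unfolding eval3_hesse sg_def by (simp add: add_eq_0_iff)
  note nine = nine_contact[OF s(3) s_nz(1) M[unfolded kmat_def] sub[unfolded kmat_def], folded kmat_def]
  define al where "al = de / be"
  have al: "al = 3 * sg / w" using nine(1) s(3) w0 unfolding al_def be de Hs by simp
  have alV: "al \<in> V" using wV rw0 by (simp add: al)
  have ral: "\<rho> al = -3"
  proof -
    have "\<rho> al = 3 * ((1 - \<rho> c) * \<rho> z^3) / ((\<rho> c - 1) * \<rho> z^3)" unfolding al using wV rw0 rw by simp
    moreover have "3 * ((1 - \<rho> c) * \<rho> z^3) = - 3 * ((\<rho> c - 1) * \<rho> z^3)" by (simp add: algebra_simps)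
    ultimately show ?thesis using rw0 unfolding rw by simp
  qed
  \<comment> \<open>This is x times the inverse of \<open>kmat\<close>, an inverse Fourier transform
    composed with a scaling. It is integral because y and z are units.\<close>
  define M1 :: "'k geom mat" where "M1 = ((1/3, x/(3*y), x/(3*z)), (1/3, c*(x/(3*y)), c^2*(x/(3*z))), (1/3, c^2*(x/(3*y)), c*(x/(3*z))))"
  have M1V: "VM M1" unfolding M1_def using V cV(1) rz by simp
  have rM1: "rmat M1 = ((1/3, 0, 0), (1/3, 0, 0), (1/3, 0, 0))" unfolding M1_def using V cV(1) rz rx by simp
  have M1: "app (minv ?M) (scal x v) = app M1 v" for v
  proof -
    obtain u1 u2 u3 where v: "v = (u1, u2, u3)" by (cases v)
    define t a b where "t = (1/3 :: 'k geom)" and "a = x/(3*y)" and "b = x/(3*z)"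
    have tab: "3 * t = 1" "3 * (y * a) = x" "3 * (z * b) = x" using xyz0 by (simp_all add: t_def a_def b_def)
    have "app ?M (app ((t, a, b), (t, c*a, c^2*b), (t, c^2*a, c*b)) v) = 
     (x * (t*u1 + a*u2 + b*u3) + x * (t*u1 + c*a*u2 + c^2*b*u3) + x * (t*u1 + c^2*a*u2 + c*b*u3),
      y * (t*u1 + a*u2 + b*u3) + c*(c*y) * (t*u1 + c*a*u2 + c^2*b*u3) + c*y * (t*u1 + c^2*a*u2 + c*b*u3),
      z * (t*u1 + a*u2 + b*u3) + c^2*(c^2*z) * (t*u1 + c*a*u2 + c^2*b*u3) + c^2*z * (t*u1 + c^2*a*u2 + c*b*u3))"
      unfolding v by (simp add: kmat_def)
    also have "\<dots> = (x * u1, x * u2, x * u3)"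
      unfolding prod.inject
    proof (intro conjI)
      show "x * (t*u1 + a*u2 + b*u3) + x * (t*u1 + c*a*u2 + c^2*b*u3) + x * (t*u1 + c^2*a*u2 + c*b*u3) = x * u1"
        using tab c' by Groebner_Basis.algebra
      have "y * (t*u1 + a*u2 + b*u3) + c*(c*y) * (t*u1 + c*a*u2 + c^2*b*u3) + c*y * (t*u1 + c^2*a*u2 + c*b*u3) = 3 * (y * a) * u2"
        using c' by Groebner_Basis.algebra
      then show "y * (t*u1 + a*u2 + b*u3) + c*(c*y) * (t*u1 + c*a*u2 + c^2*b*u3) + c*y * (t*u1 + c^2*a*u2 + c*b*u3) = x * u2" unfolding tab .
      have "z * (t*u1 + a*u2 + b*u3) + c^2*(c^2*z) * (t*u1 + c*a*u2 + c^2*b*u3) + c^2*z * (t*u1 + c^2*a*u2 + c*b*u3) = 3 * (z * b) * u3"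
        using c' by Groebner_Basis.algebra
      then show "z * (t*u1 + a*u2 + b*u3) + c^2*(c^2*z) * (t*u1 + c*a*u2 + c^2*b*u3) + c^2*z * (t*u1 + c^2*a*u2 + c*b*u3) = x * u3" unfolding tab .
    qed
    finally have "app ?M (app M1 v) = scal x v" unfolding M1_def t_def a_def b_def v by simp
    then show ?thesis using M unfolding lininv_def by metis
  qed
  \<comment> \<open>The member of the pencil that does not involve \<open>k\<close> and is singular
    at the contact point. \<open>M1\<close> reduces to a matrix of rank one, so the pullback
    \<open>K1\<close> reduces to the value of the reduced form at (1/3, 1/3, 1/3) times x^3.\<close>
  define Nn where "Nn = cub 0 0 0 al 1 0 (-1) (al^2) (2*al) 1"
  define K1 where "K1 = subst3 M1 Nn"
  have NV: "VG Nn" "red Nn = cub 0 0 0 (-3) 1 0 (-1) 9 (-6) 1"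
    unfolding Nn_def using VG_cub[of 0 0 0 al 1 0 "-1" "al^2" "2*al" 1] alV ral by simp_all
  have K1: "VG K1" "red K1 = mono3 (1/27) 3 0 0"
  proof -
    have "form3 3 Nn" by (simp add: Nn_def)
    then have *: "VG K1 \<and> red K1 = subst3 (rmat M1) (red Nn)" unfolding K1_def using VG_subst NV(1) M1V by blast
    have "subst3 (rmat M1) (red Nn) = mono3 (1/27) 3 0 0"
      unfolding rM1 NV(2) by (rule eval3_eqI) (simp del: subst3.simps add: field_simps power2_eq_square power3_eq_cube)
    then show "VG K1" "red K1 = mono3 (1/27) 3 0 0" using * by simp_all
  qed
  have ev: "be * (x^3 * eval3 (subst3 (minv ?M) (nineG al k)) v) = - k * x^3 * eval3 (hesse s) v + be * (3 + al * k) * eval3 K1 v" for k v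
  proof -
    have bal: "be * al = de" using nine(1) by (simp add: al_def)
    obtain a b c where abc: "app (minv ?M) v = (a, b, c)" by (cases "app (minv ?M) v")
    have 1: "eval3 (hesse s) v = eval3 (cub 0 be 0 0 de be 0 be 0 0) (a, b, c)"
      using arg_cong[OF sub, of "\<lambda>G. eval3 G (a, b, c)"] M unfolding eval3_subst abc[symmetric] lininv_def by simp
    have 2: "eval3 K1 v = x^3 * eval3 Nn (a, b, c)"
      unfolding K1_def eval3_subst M1[symmetric] app_scal abc using eval3_scal[of 3 Nn x "(a, b, c)"] by (simp add: Nn_def)
    show ?thesis unfolding 1 2 eval3_subst abc bal[symmetric] by (simp add: nineG_def Nn_def algebra_simps power2_eq_square power3_eq_cube)
  qed
  have b0: "be \<noteq> 0" using nine(1) .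
  have S: "VG (hesse s)" "red (hesse s) = mono3 1 1 1 1"
    using VG_cub[of s 0 0 0 1 0 s 0 0 s] s by (simp_all add: cub_mono3)
  have lim1: "lmd (curve (subst3 (minv ?M) (nineG al 1))) {#1, 1, 1#}"
  proof -
    \<comment> \<open>The small coefficient is known exactly. Its factor x^3 cancels against the one
      in front of the curve, and the remaining s makes the \<open>K1\<close> term vanish in the
      limit.\<close>
    have "be * (3 + al) = 27 * s * x^3"
    proof -
      have "be * (3 + al) = 3 * be + de" using b0 by (simp add: al_def distrib_left)
      also have "\<dots> = 9 * s * (w + sg)" unfolding be de Hs by (simp add: algebra_simps)
      also have "w + sg = 3 * x^3 - (x^3 + c * y^3 + c^2 * z^3) + (c^2 + c + 1) * (y^3 + z^3)" unfolding w_def sg_def by Groebner_Basis.algebra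
      finally show ?thesis unfolding K c' by simp
    qed
    note e = this
    have x0: "x \<noteq> 0" using xyz0 by auto
    have "const3 be * subst3 (minv ?M) (nineG al 1) = const3 (-1) * hesse s + const3 (27 * s) * K1"
    proof (rule eval3_eqI)
      fix a b d
      have gen: "x^3 * (be * A) = x^3 * (- B + 27 * s * L)" if "be * (x^3 * A) = - 1 * x^3 * B + 27 * s * x^3 * L" for A B L
        using that by (simp add: algebra_simps)
      have "x^3 * (be * eval3 (subst3 (minv ?M) (nineG al 1)) (a, b, d)) = x^3 * (- eval3 (hesse s) (a, b, d) + 27 * s * eval3 K1 (a, b, d))"
        by (rule gen[OF ev[of 1 "(a, b, d)", unfolded mult_1_right e]])
      then have "be * eval3 (subst3 (minv ?M) (nineG al 1)) (a, b, d) = - eval3 (hesse s) (a, b, d) + 27 * s * eval3 K1 (a, b, d)"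
        using x0 by (simp only: mult_cancel_left) simp
      then show "eval3 (const3 be * subst3 (minv ?M) (nineG al 1)) (a, b, d) = eval3 (const3 (-1) * hesse s + const3 (27 * s) * K1) (a, b, d)"
        unfolding eval3_mult eval3_add eval3_const3 by simp
    qed
    moreover have "VG (const3 (-1) * hesse s + const3 (27 * s) * K1) \<and>
      red (const3 (-1) * hesse s + const3 (27 * s) * K1) = const3 (-1) * mono3 1 1 1 1"
      using VG_add VG_mult VG_const3[of "-1"] VG_const3[of "27 * s"] S K1 s by simp
    moreover have "const3 (-1) * mono3 1 1 1 1 = mono3 (-1 :: 'k) 1 1 1" by (rule eval3_eqI) simp
    ultimately show ?thesis using b0 by (intro lmdI[of be "-1"]) simp_all
  qed
  have lim2: "lmd (curve (subst3 (minv ?M) (nineG al k))) {#3, 0, 0#}" if k: "k^3 = 1" "k \<noteq> 1" for k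
  proof -
    note kV = cube_root_V[OF k(1)]
    \<comment> \<open>By the equation of the curve x is divisible by s, as y and z are units. So x^3
      is a multiple of be = 3 s w by a factor of residue 0, and the curve disappears from the
      limit.\<close>
    define u where "u = - sg / (y * z)"
    have uV: "u \<in> V" unfolding u_def using wV V rz by simp
    have xu: "x = s * u" using xyz0 Hs by (simp add: u_def field_simps)
    define d where "d = - k * (x^2 * u / (3 * w))"
    have dV: "d \<in> V" "\<rho> d = 0" unfolding d_def using V uV kV(1) wV rw0 rx by simp_all
    have "- k * x^3 = be * d" 
    proof -
      have "x^3 = x^2 * (s * u)" using xu by (simp add: power3_eq_cube power2_eq_square)
      then show ?thesis using w0 unfolding be d_def by simp
    qed
    then have "const3 (x^3) * subst3 (minv ?M) (nineG al k) = const3 d * hesse s + const3 (3 + al * k) * K1"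
    proof (intro eval3_eqI)
      fix a b e assume kx: "- k * x^3 = be * d"
      have gen: "be * A = be * (d * B + (3 + al * k) * L)" if "be * A = be * d * B + be * (3 + al * k) * L" for A B L
        using that by (simp add: algebra_simps)
      have "be * (x^3 * eval3 (subst3 (minv ?M) (nineG al k)) (a, b, e)) = be * (d * eval3 (hesse s) (a, b, e) + (3 + al * k) * eval3 K1 (a, b, e))"
        by (rule gen[OF ev[of k "(a, b, e)", unfolded kx]])
      then have "x^3 * eval3 (subst3 (minv ?M) (nineG al k)) (a, b, e) = d * eval3 (hesse s) (a, b, e) + (3 + al * k) * eval3 K1 (a, b, e)"
        using b0 by (simp only: mult_cancel_left) simp
      then show "eval3 (const3 (x^3) * subst3 (minv ?M) (nineG al k)) (a, b, e) = eval3 (const3 d * hesse s + const3 (3 + al * k) * K1) (a, b, e)"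
        unfolding eval3_mult eval3_add eval3_const3 by simp
    qed
    moreover have "VG (const3 d * hesse s + const3 (3 + al * k) * K1) \<and>
      red (const3 d * hesse s + const3 (3 + al * k) * K1) = const3 (3 - 3 * \<rho> k) * mono3 (1/27) 3 0 0"
      using VG_add VG_mult VG_const3[of d] VG_const3[of "3 + al * k"] S K1 dV alV ral kV(1) by simp
    moreover have "const3 (3 - 3 * \<rho> k) * mono3 (1/27) 3 0 0 = mono3 ((3 - 3 * \<rho> k) / 27) 3 0 0" by (rule eval3_eqI) simp
    moreover have "(3 - 3 * \<rho> k) / 27 \<noteq> 0" using kV(4)[OF k(2)] by simp
    moreover have "x^3 \<noteq> 0" using xyz0 by simp
    ultimately show ?thesis by (intro lmdI[of "x^3" "(3 - 3 * \<rho> k) / 27"]) simp_all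
  qed
  obtain w :: "'k geom" where w: "w \<noteq> 1" "w^2 \<noteq> 1" "w^2 \<noteq> w" "{c. c^3 = 1} = {1, w, w^2}" by (rule omega_exists)
  let ?S = "{k :: 'k geom. k^3 = 1}"
  have fin: "finite ?S" unfolding w(4) by simp
  define g where "g k = (if k = 1 then {#1, 1, 1 :: nat#} else {#3, 0, 0#})" for k :: "'k geom"
  have cc: "card {C \<in> contact (hesse s) (x, y, z). has_lmd D C} = weight D (card {k \<in> ?S. g k = {#1, 1, 1#}})
    (card {k \<in> ?S. g k = {#2, 1, 0#}}) (card {k \<in> ?S. g k = {#3, 0, 0#}})"
    unfolding nine(3)[folded al_def]
    by (rule weight_count[OF fin nine_inj[OF M]]) (use lim1 lim2 in \<open>auto simp: g_def\<close>)
  have sets: "{k \<in> ?S. g k = {#1, 1, 1#}} = {1}" "{k \<in> ?S. g k = {#2, 1, 0#}} = {}" "{k \<in> ?S. g k = {#3, 0, 0#}} = {w, w^2}"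
  proof -
    have "g k = {#1, 1, 1#} \<longleftrightarrow> k = 1" "g k \<noteq> {#2, 1, 0#}" "g k = {#3, 0, 0#} \<longleftrightarrow> k \<noteq> 1" for k
      unfolding g_def using multidegree_distinct multidegree_distinct[symmetric] by auto
    then show "{k \<in> ?S. g k = {#1, 1, 1#}} = {1}" "{k \<in> ?S. g k = {#2, 1, 0#}} = {}" "{k \<in> ?S. g k = {#3, 0, 0#}} = {w, w^2}"
      unfolding w(4) using w(1,2) by auto
  qed
  show ?thesis unfolding cc sets using w(3) by (simp add: numeral_2_eq_2)
qed

lemma class0_limits:
  assumes V: "x \<in> V" "y \<in> V" "z \<in> V" and nz: "(\<rho> x, \<rho> y, \<rho> z) \<noteq> (0, 0, 0)"
    and H: "eval3 (hesse s) (x, y, z) = 0" and k: "(0, c) \<in> kindex" "kform 0 c (x, y, z) = 0"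
  shows "card {C \<in> contact (hesse s) (x, y, z). has_lmd D C} = weight D 1 0 2"
proof -
  have c: "c^3 = 1" using k(1) by (simp add: kindex_def)
  have K: "x^3 + c * y^3 + c^2 * z^3 = 0" using k(2) by simp
  have Hs: "x * y * z = - s * (x^3 + y^3 + z^3)" using H unfolding eval3_hesse by (simp add: add_eq_0_iff)
  then have "\<rho> (x * y * z) = 0" using s V by simp
  then consider "\<rho> x = 0" | "\<rho> y = 0" | "\<rho> z = 0" using V by auto
  then show ?thesis
  proof cases
    case 1 then show ?thesis using class0_limits_base[OF V _ nz H k] by blast
  next
    case 2
    have "y^3 + c * z^3 + c^2 * x^3 = c^2 * (x^3 + c * y^3 + c^2 * z^3)" using c by Groebner_Basis.algebra
    then have "kform 0 c (y, z, x) = 0" unfolding K by simp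
    moreover have "eval3 (hesse s) (y, z, x) = 0" using H unfolding eval3_hesse by (simp only: add_ac mult_ac)
    ultimately have "card {C \<in> contact (hesse s) (y, z, x). has_lmd D C} = weight D 1 0 2"
      using class0_limits_base[OF V(2,3,1) 2 _ _ k(1)] nz by blast
    then show ?thesis using contact_transport(1)[OF vmono_cyc(1) hesse_cyc(1), where v = "(x, y, z)" and D = D] by simp
  next
    case 3
    have "z^3 + c * x^3 + c^2 * y^3 = c * (x^3 + c * y^3 + c^2 * z^3)" using c by Groebner_Basis.algebra
    then have "kform 0 c (z, x, y) = 0" unfolding K by simp
    moreover have "eval3 (hesse s) (z, x, y) = 0" using H unfolding eval3_hesse by (simp only: add_ac mult_ac)
    ultimately have "card {C \<in> contact (hesse s) (z, x, y). has_lmd D C} = weight D 1 0 2"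
      using class0_limits_base[OF V(3,1,2) 3 _ _ k(1)] nz by blast
    then show ?thesis using contact_transport(1)[OF vmono_cyc(2) hesse_cyc(2), where v = "(x, y, z)" and D = D] by simp
  qed
qed

text \<open>In triples: 9 (1, 0, 1) from the flexes, 18 (1, 0, 2) from the diagonal classes and 54
  (0, 3, 0) from the others add up to (27, 162, 45).\<close>

theorem hesse_limits: "card {C \<in> max_tangent_cubics (hesse s). has_lmd D C} = weight D 27 162 45"
proof -
  have "card {C \<in> cset (hesse s) Q. has_lmd D C} = (if g = 0 then weight D 1 0 2 else weight D 0 3 0)"
    if gc: "(g, c) \<in> kindex" and Q: "Q \<in> zset (hesse s) (kform g c)" for Q g c
  proof -
    obtain v where v: "Q = pt v" "v \<noteq> (0, 0, 0)" "eval3 (hesse s) v = 0" "kform g c v = 0" using Q unfolding zset_def by blast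
    obtain k where k: "k \<noteq> 0" "mat_all (\<lambda>a. a \<in> V) (scal k v)" "vmap \<rho> (scal k v) \<noteq> (0, 0, 0)" using normalise[OF v(2)] .
    obtain x y z where xyz: "scal k v = (x, y, z)" by (cases "scal k v")
    have "kform g c (scal k v) = k^3 * kform g c v" by (cases v) (simp add: algebra_simps power2_eq_square power3_eq_cube)
    then have kf: "kform g c (x, y, z) = 0" using v(4) xyz by simp
    have H: "eval3 (hesse s) (x, y, z) = 0" using eval3_scal[of 3 "hesse s" k v] v(3) xyz by simp
    have "cset (hesse s) Q = contact (hesse s) (x, y, z)"
      using contact_scal[of "hesse s" k v] k(1) xyz unfolding v(1) by (simp add: cset_pt)
    moreover have V: "x \<in> V" "y \<in> V" "z \<in> V" using k(2) unfolding xyz by simp_all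
    moreover have nz: "(\<rho> x, \<rho> y, \<rho> z) \<noteq> (0, 0, 0)" using k(3) unfolding xyz vmap.simps .
    ultimately show ?thesis
      using class0_limits[OF V nz H, of c D] class12_limits[OF V nz H gc kf, of D] gc kf by (cases "g = 0") (simp_all del: kform.simps)
  qed
  then have "card {C \<in> max_tangent_cubics (hesse s). has_lmd D C}
    = 9 * weight D 1 0 1 + 18 * weight D 1 0 2 + 27 * weight D 0 3 0 + 27 * weight D 0 3 0"
    using hesse_count[where P = "has_lmd D" and b = "\<lambda>g. if g = 0 then weight D 1 0 2 else weight D 0 3 0", OF s(3) s_nz all_flex_limits] by simp
  also have "\<dots> = weight D 27 162 45" by (cases D) (simp_all add: weight_def)
  finally show ?thesis .
qed

end

section \<open>Flexes of a smooth plane cubic and its diagonal form\<close>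

section \<open>Flexes and the Hesse form of a plane cubic\<close>

lemma dot_commute: "dot v w = dot w (v :: 'a::comm_ring_1 vec)"
  by (cases v; cases w) (simp add: mult.commute)

lemma dot_vadd: "dot r (vadd v w) = dot r v + dot r (w :: 'a::comm_ring_1 vec)"
  by (cases r; cases v; cases w) (simp add: algebra_simps)

lemma dot_scal_left: "dot (scal c r) v = c * dot r (v :: 'a::comm_ring_1 vec)"
  by (cases r; cases v) (simp add: algebra_simps)

lemma lininvD: "lininv M M' \<Longrightarrow> app M (app M' v) = v" "lininv M M' \<Longrightarrow> app M' (app M v) = v"
  by (simp_all add: lininv_def del: split_paired_All)

fun row_app :: "'a::comm_ring_1 vec \<Rightarrow> 'a mat \<Rightarrow> 'a vec" where
  "row_app (u, v, w) ((a, b, c), (d, e, f), (g, h, i)) = (u*a + v*d + w*g, u*b + v*e + w*h, u*c + v*f + w*i)"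

lemma dot_row_app: "dot (row_app L M) q = dot L (app M q)"
  by (cases L; cases M rule: mat_cases; cases q) (simp add: algebra_simps)

lemma row_app_nz:
  assumes "lininv M M'" "L \<noteq> (0, 0, 0)" shows "row_app L M \<noteq> (0, 0, 0)"
proof
  assume "row_app L M = (0, 0, 0)"
  then have "dot L (app M q) = 0" for q unfolding dot_row_app[symmetric] by (cases q) simp
  then have "dot L q = 0" for q using assms(1) unfolding lininv_def by metis
  from this[of "(1, 0, 0)"] this[of "(0, 1, 0)"] this[of "(0, 0, 1)"] show False using assms(2) by (cases L) simp
qed

definition mmul :: "'a::comm_ring_1 mat \<Rightarrow> 'a mat \<Rightarrow> 'a mat" where
  "mmul A B = (case A of (r1, r2, r3) \<Rightarrow> (row_app r1 B, row_app r2 B, row_app r3 B))"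

lemma app_mmul: "app (mmul A B) q = app A (app B q)"
  by (cases A) (simp add: mmul_def dot_row_app)

lemma subst_mmul:
  fixes G :: "'a::{idom,ring_char_0} poly poly poly"
  shows "subst3 (mmul A B) G = subst3 B (subst3 A G)"
  by (rule eval3_eqI) (simp add: app_mmul)

lemma lininv_mmul: "lininv A A' \<Longrightarrow> lininv B B' \<Longrightarrow> lininv (mmul A B) (mmul B' A')"
  by (simp add: lininv_def app_mmul del: split_paired_All)

text \<open>Smoothness is stated with \<open>polar\<close>, on which substitutions act
  directly.\<close>

definition nonsing :: "'a::field poly poly poly \<Rightarrow> bool" where
  "nonsing G \<longleftrightarrow> (\<forall>v. v \<noteq> (0, 0, 0) \<longrightarrow> (\<exists>w. polar G v w \<noteq> 0))"

lemma nonsing_subst: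
  fixes G :: "'a::field_char_0 poly poly poly"
  assumes "lininv M M'" "nonsing G" shows "nonsing (subst3 M G)"
  unfolding nonsing_def polar_subst
proof (intro allI impI)
  fix v :: "'a vec" assume "v \<noteq> (0, 0, 0)"
  then obtain w where "polar G (app M v) w \<noteq> 0" using assms lininv_nz unfolding nonsing_def by blast
  then show "\<exists>w. polar G (app M v) (app M w) \<noteq> 0" using assms(1) unfolding lininv_def by metis
qed

text \<open>The tangent line \<open>L\<close> meets the cubic in the divisor \<open>3 p\<close>; the cube is that of a linear
  form \<open>N\<close>, as the field is algebraically closed.\<close>

definition flex :: "'a::comm_ring_1 poly poly poly \<Rightarrow> 'a vec \<Rightarrow> bool" where
  "flex G p \<longleftrightarrow> p \<noteq> (0, 0, 0) \<and> (\<exists>L N. L \<noteq> (0, 0, 0) \<and> dot L p = 0 \<and> dot N p = 0 \<and>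
     (\<forall>q. dot L q = 0 \<longrightarrow> eval3 G q = dot N q ^ 3))"

lemma flex_zero: "flex G p \<Longrightarrow> eval3 G p = 0"
  unfolding flex_def by (metis power_zero_numeral)

lemma flex_substD:
  fixes G :: "'a::field poly poly poly"
  assumes M: "lininv M M'" and fl: "flex (subst3 M G) p" shows "flex G (app M p)"
proof -
  obtain L N where L: "p \<noteq> (0, 0, 0)" "L \<noteq> (0, 0, 0)" "dot L p = 0" "dot N p = 0" "\<And>q. dot L q = 0 \<Longrightarrow> eval3 (subst3 M G) q = dot N q ^ 3"
    using fl unfolding flex_def by blast
  have "eval3 G q = dot (row_app N M') q ^ 3" if "dot (row_app L M') q = 0" for q
    using L(5)[of "app M' q"] that M unfolding dot_row_app eval3_subst lininv_def by simp
  moreover have "dot (row_app L M') (app M p) = 0" "dot (row_app N M') (app M p) = 0"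
    unfolding dot_row_app lininvD(2)[OF M] by (rule L(3), rule L(4))
  ultimately show ?thesis unfolding flex_def using L(1) lininv_nz[OF M] row_app_nz[OF lininv_sym[OF M] L(2)] by blast
qed

lemma flex_subst:
  fixes G :: "'a::field_char_0 poly poly poly"
  assumes M: "lininv M M'" shows "flex (subst3 M G) p \<longleftrightarrow> flex G (app M p)"
proof
  assume "flex G (app M p)"
  then have "flex (subst3 M' (subst3 M G)) (app M p)" by (simp only: subst_subst[OF lininv_sym[OF M]])
  from flex_substD[OF lininv_sym[OF M] this] show "flex (subst3 M G) p" unfolding lininvD(2)[OF M] .
qed (rule flex_substD[OF M])

text \<open>\<open>L\<close> is the equation of the line through \<open>p\<close> and
  \<open>v\<close>, and on it \<open>N\<close> is the coordinate along \<open>v\<close>. This turns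
  a parametrised line into the equational form used in \<open>flex\<close>.\<close>

lemma plane_span:
  fixes p v :: "'a::field vec"
  assumes p: "p \<noteq> (0, 0, 0)" and v: "\<And>k. v \<noteq> scal k p"
  obtains L N where "L \<noteq> (0, 0, 0)" "dot L p = 0" "dot N p = 0"
    "\<And>q. dot L q = 0 \<Longrightarrow> \<exists>s. q = vadd (scal s p) (scal (dot N q) v)"
proof -
  obtain M M' where M: "lininv M M'" "app M (1, 0, 0) = p" using ex_col[OF p] .
  then have M'p: "app M' p = (1, 0, 0)" by (metis lininv_def)
  obtain v1 v2 v3 where v': "app M' v = (v1, v2, v3)" by (cases "app M' v")
  have nz: "v2 \<noteq> 0 \<or> v3 \<noteq> 0"
  proof (rule ccontr)
    assume "\<not> ?thesis"
    then have "app M' v = scal v1 (1, 0, 0)" using v' by simp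
    then have "v = scal v1 p" using M by (metis app_scal lininv_def)
    then show False using v by blast
  qed
  obtain n2 n3 where n: "n2 * v2 + n3 * v3 = 1"
  proof (cases "v2 = 0")
    case True then show ?thesis using nz that[of 0 "1 / v3"] by simp
  next
    case False then show ?thesis using that[of "1 / v2" 0] by simp
  qed
  show ?thesis
  proof
    show "row_app (0, v3, - v2) M' \<noteq> (0, 0, 0)" using nz by (intro row_app_nz[OF lininv_sym[OF M(1)]]) auto
    show "dot (row_app (0, v3, - v2) M') p = 0" "dot (row_app (0, n2, n3) M') p = 0" by (simp_all add: dot_row_app M'p)
    fix q assume q: "dot (row_app (0, v3, - v2) M') q = 0"
    obtain q1 q2 q3 where q': "app M' q = (q1, q2, q3)" by (cases "app M' q")
    define m where "m = n2 * q2 + n3 * q3"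
    have e: "v3 * q2 - v2 * q3 = 0" using q by (simp add: dot_row_app q')
    have "m * v2 = q2" "m * v3 = q3" unfolding m_def using e n by Groebner_Basis.algebra+
    then have "app M' q = vadd (scal (q1 - m * v1) (1, 0, 0)) (scal m (v1, v2, v3))" unfolding q' by simp
    then have "app M' q = app M' (vadd (scal (q1 - m * v1) p) (scal m v))"
      unfolding M'p[symmetric] v'[symmetric] by (cases M') (simp add: dot_vadd dot_scal)
    then have "q = vadd (scal (q1 - m * v1) p) (scal m v)" using M(1) by (metis lininv_def)
    moreover have "dot (row_app (0, n2, n3) M') q = m" by (simp add: dot_row_app q' m_def)
    ultimately show "\<exists>s. q = vadd (scal s p) (scal (dot (row_app (0, n2, n3) M') q) v)" by (intro exI) (simp only:)
  qed
qed

lemma flexI: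
  fixes G :: "'a::alg_closed_field poly poly poly"
  assumes p: "p \<noteq> (0, 0, 0)" and v: "\<And>k. v \<noteq> scal k p"
    and G: "\<And>s u. eval3 G (vadd (scal s p) (scal u v)) = u^3 * c"
  shows "flex G p"
proof -
  obtain L N where L: "L \<noteq> (0, 0, 0)" "dot L p = 0" "dot N p = 0"
    "\<And>q. dot L q = 0 \<Longrightarrow> \<exists>s. q = vadd (scal s p) (scal (dot N q) v)" using plane_span[OF p v] by blast
  obtain n where n: "n^3 = c" using nth_root_exists[of 3 c] by auto
  have "eval3 G q = dot (scal n N) q ^ 3" if "dot L q = 0" for q
  proof -
    obtain s where "q = vadd (scal s p) (scal (dot N q) v)" using L(4)[OF \<open>dot L q = 0\<close>] by blast
    then have "eval3 G q = dot N q ^ 3 * c" using G by metis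
    then show ?thesis by (simp add: dot_scal_left power_mult_distrib n)
  qed
  moreover have "dot (scal n N) p = 0" using L(3) by (simp add: dot_scal_left)
  ultimately show ?thesis unfolding flex_def using p L(1,2) by blast
qed

lemma quadratic_zero:
  obtains y z :: "'a::alg_closed_field" where "(y, z) \<noteq> (0, 0)" "d * y^2 + e * y * z + f * z^2 = 0"
proof (cases "d = 0")
  case True then show ?thesis using that[of 1 0] by simp
next
  case False
  then have "degree [:f, e, d:] > 0" by simp
  then obtain y where "poly [:f, e, d:] y = 0" using alg_closed_imp_poly_has_root by blast
  then show ?thesis using that[of y 1] by (simp add: algebra_simps power2_eq_square)
qed

text \<open>If the line x = 0 lay on the curve, the only derivative left along it would be a binary
  quadratic form in y and z, and any zero of that form is a singular point.\<close>

lemma nonsing_no_line: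
  fixes G :: "'a::{alg_closed_field,field_char_0} poly poly poly"
  assumes G: "form3 3 G" "nonsing G" and L: "L \<noteq> (0, 0, 0)"
  obtains q where "dot L q = 0" "eval3 G q \<noteq> 0"
proof -
  have "\<exists>q. dot L q = 0 \<and> eval3 G q \<noteq> 0"
  proof (rule ccontr)
    assume none: "\<not> ?thesis"
    obtain M M' where M: "lininv M M'" "\<And>v. fst (app M' v) = dot L v" using ex_row[OF L] by blast
    obtain a b c d e f g h i j where C: "subst3 M G = cub a b c d e f g h i j" using form3_3E[OF form3_subst[OF G(1)]] .
    have z: "eval3 (cub a b c d e f g h i j) (0, y, z) = 0" for y z
    proof -
      have "dot L (app M (0, y, z)) = 0" using M by (metis fst_conv lininv_def)
      then show ?thesis using none unfolding C[symmetric] eval3_subst by blast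
    qed
    have g: "g = 0" "j = 0" using z[of 1 0] z[of 0 1] by simp_all
    have "h + i = 0" "i - h = 0" using z[of 1 1] z[of 1 "-1"] g by simp_all
    then have "2 * h = 0" "h + i = 0" by Groebner_Basis.algebra+
    then have h: "h = 0" "i = 0" by simp_all
    obtain y z where yz: "(y, z) \<noteq> (0, 0)" "d * y^2 + e * y * z + f * z^2 = 0" by (rule quadratic_zero)
    have "polar (cub a b c d e f g h i j) (0, y, z) w = 0" for w
      using yz(2) by (cases w) (simp add: polar_cub g h)
    moreover have "nonsing (cub a b c d e f g h i j)" using nonsing_subst[OF M(1) G(2)] unfolding C .
    moreover have "(0, y, z) \<noteq> (0, 0, 0)" using yz(1) by simp
    ultimately show False unfolding nonsing_def by blast
  qed
  then show ?thesis using that by blast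
qed

subsection \<open>Existence of a flex\<close>

text \<open>The norm of \<open>C\<^sub>1 x\<^sup>2 + C\<^sub>2 x + C\<^sub>3\<close> modulo the monic cubic \<open>x\<^sup>3 + A\<^sub>1 x\<^sup>2 + A\<^sub>2 x + A\<^sub>3\<close>, as
  the determinant of multiplication in the basis \<open>1, x, x\<^sup>2\<close>.\<close>

definition cubic_norm :: "'a::comm_ring_1 \<Rightarrow> 'a \<Rightarrow> 'a \<Rightarrow> 'a \<Rightarrow> 'a \<Rightarrow> 'a \<Rightarrow> 'a" where
  "cubic_norm A1 A2 A3 C1 C2 C3 = det3 ((C3, C2, C1), (- C1*A3, C3 - C1*A2, C2 - C1*A1),
    (- (C2 - C1*A1)*A3, - C1*A3 - (C2 - C1*A1)*A2, C3 - C1*A2 - (C2 - C1*A1)*A1))"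

text \<open>The norm is the product of the values of the quadratic at the three roots of the
  cubic.\<close>

lemma cubic_norm_zero:
  fixes A1 :: "'a::{alg_closed_field,field_char_0}"
  assumes "cubic_norm A1 A2 A3 C1 C2 C3 = 0"
  obtains x where "x^3 + A1*x^2 + A2*x + A3 = 0" "C1*x^2 + C2*x + C3 = 0"
proof -
  obtain r1 where "poly [:A3, A2, A1, 1:] r1 = 0" using alg_closed_imp_poly_has_root[of "[:A3, A2, A1, 1:]"] by auto
  then have r1: "r1^3 + A1*r1^2 + A2*r1 + A3 = 0" by (simp add: algebra_simps power2_eq_square power3_eq_cube)
  obtain r2 where "poly [:A2 + r1*(A1 + r1), A1 + r1, 1:] r2 = 0"
    using alg_closed_imp_poly_has_root[of "[:A2 + r1*(A1 + r1), A1 + r1, 1:]"] by auto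
  then have r2: "r2^2 + (A1 + r1)*r2 + (A2 + r1*(A1 + r1)) = 0" by (simp add: algebra_simps power2_eq_square)
  define r3 where "r3 = - A1 - r1 - r2"
  have A1: "A1 = - (r1 + r2 + r3)" by (simp add: r3_def)
  have A2: "A2 = r1*r2 + r1*r3 + r2*r3" using r2 unfolding r3_def by Groebner_Basis.algebra
  have A3: "A3 = - (r1*r2*r3)" using r1 r2 unfolding r3_def by Groebner_Basis.algebra
  have "cubic_norm A1 A2 A3 C1 C2 C3 = (C1*r1^2 + C2*r1 + C3) * (C1*r2^2 + C2*r2 + C3) * (C1*r3^2 + C2*r3 + C3)"
    unfolding cubic_norm_def det3.simps A1 A2 A3 by Groebner_Basis.algebra
  then have "C1*r1^2 + C2*r1 + C3 = 0 \<or> C1*r2^2 + C2*r2 + C3 = 0 \<or> C1*r3^2 + C2*r3 + C3 = 0" using assms by simp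
  moreover have "r2^3 + A1*r2^2 + A2*r2 + A3 = 0" "r3^3 + A1*r3^2 + A2*r3 + A3 = 0"
    unfolding A1 A2 A3 by Groebner_Basis.algebra+
  ultimately show ?thesis using that r1 by blast
qed

lemma cubic_norm_scale:
  "cubic_norm (k*A1) (k^2*A2) (k^3*A3) (k*C1) (k^2*C2) (k^3*C3) = (k::'a::idom)^9 * cubic_norm A1 A2 A3 C1 C2 C3"
  unfolding cubic_norm_def det3.simps by Groebner_Basis.algebra

text \<open>The norm is the resultant with respect to x, a binary form of degree nine in y and z.
  Without zeros it would be constant in one chart, hence r w^9 in the other, and that vanishes at w
  = 0.\<close>

lemma common_zero_aux:
  fixes A :: "'a::{alg_closed_field,field_char_0}"
  shows "\<exists>x y z. (x, y, z) \<noteq> (0, 0, 0) \<and> x^3 + (b*y + c*z)*x^2 + (d*y^2 + e*y*z + f*z^2)*x + (g*y^3 + h*y^2*z + i*y*z^2 + j*z^3) = 0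
    \<and> (b'*y + c'*z)*x^2 + (d'*y^2 + e'*y*z + f'*z^2)*x + (g'*y^3 + h'*y^2*z + i'*y*z^2 + j'*z^3) = (0::'a)"
proof -
  define R where "R y z = cubic_norm (b*y + c*z) (d*y^2 + e*y*z + f*z^2) (g*y^3 + h*y^2*z + i*y*z^2 + j*z^3)
    (b'*y + c'*z) (d'*y^2 + e'*y*z + f'*z^2) (g'*y^3 + h'*y^2*z + i'*y*z^2 + j'*z^3)" for y z
  have scale: "R (k*y) (k*z) = k^9 * R y z" for k y z
  proof -
    have e: "b*(k*y) + c*(k*z) = k * (b*y + c*z)" "d*(k*y)^2 + e*(k*y)*(k*z) + f*(k*z)^2 = k^2 * (d*y^2 + e*y*z + f*z^2)"
      "g*(k*y)^3 + h*(k*y)^2*(k*z) + i*(k*y)*(k*z)^2 + j*(k*z)^3 = k^3 * (g*y^3 + h*y^2*z + i*y*z^2 + j*z^3)"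
      for b c d e f g h i j by Groebner_Basis.algebra+
    show ?thesis unfolding R_def e cubic_norm_scale ..
  qed
  have "\<exists>y z. (y, z) \<noteq> (0, 0) \<and> R y z = 0"
  proof (rule ccontr)
    assume none: "\<not> ?thesis"
    define P where "P = cubic_norm [:c, b:] [:f, e, d:] [:j, i, h, g:] [:c', b':] [:f', e', d':] [:j', i', h', g':]"
    define Q where "Q = cubic_norm [:b, c:] [:d, e, f:] [:g, h, i, j:] [:b', c':] [:d', e', f':] [:g', h', i', j':]"
    have pN: "poly (cubic_norm A1 A2 A3 C1 C2 C3) x
      = cubic_norm (poly A1 x) (poly A2 x) (poly A3 x) (poly C1 x) (poly C2 x) (poly C3 x)" for A1 A2 A3 C1 C2 C3 :: "'a poly" and x
      by (simp add: cubic_norm_def)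
    have l: "poly [:c, b:] y = b*y + c*1" "poly [:f, e, d:] y = d*y^2 + e*y*1 + f*1^2"
      "poly [:j, i, h, g:] y = g*y^3 + h*y^2*1 + i*y*1^2 + j*1^3"
      "poly [:b, c:] y = b*1 + c*y" "poly [:d, e, f:] y = d*1^2 + e*1*y + f*y^2"
      "poly [:g, h, i, j:] y = g*1^3 + h*1^2*y + i*1*y^2 + j*y^3" for b c d e f g h i j y :: 'a
      by (simp_all add: algebra_simps power2_eq_square power3_eq_cube)
    have P: "poly P y = R y 1" for y unfolding P_def pN R_def l(1-3) ..
    have Q: "poly Q y = R 1 y" for y unfolding Q_def pN R_def l(4-6) ..
    have "degree P = 0"
    proof (rule ccontr)
      assume "degree P \<noteq> 0"
      then obtain y where "poly P y = 0" using alg_closed_imp_poly_has_root[of P] by auto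
      moreover have "(y, 1) \<noteq> (0, 0 :: 'a)" by simp
      ultimately show False using none unfolding P by blast
    qed
    then obtain r where r: "P = [:r:]" by (rule degree_eq_zeroE)
    have "poly ([:0, 1:] * (Q - monom r 9)) w = 0" for w
    proof (cases "w = 0")
      case False
      have "R 1 w = R (w * (1 / w)) (w * 1)" using False by simp
      also have "\<dots> = w^9 * r" unfolding scale P[symmetric] r by simp
      finally show ?thesis by (simp add: Q poly_monom)
    qed simp
    then have "[:0, 1:] * (Q - monom r 9) = 0" using poly_all_0_iff_0 by blast
    then have "Q = monom r 9" by (simp del: mult_pCons_left)
    then have "R 1 0 = 0" unfolding Q[symmetric] by (simp add: poly_monom)
    moreover have "(1, 0) \<noteq> (0 :: 'a, 0 :: 'a)" by simp
    ultimately show False using none by blast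
  qed
  then obtain y z where yz: "(y, z) \<noteq> (0, 0)" "R y z = 0" by blast
  obtain x where "x^3 + (b*y + c*z)*x^2 + (d*y^2 + e*y*z + f*z^2)*x + (g*y^3 + h*y^2*z + i*y*z^2 + j*z^3) = 0"
    "(b'*y + c'*z)*x^2 + (d'*y^2 + e'*y*z + f'*z^2)*x + (g'*y^3 + h'*y^2*z + i'*y*z^2 + j'*z^3) = 0"
    using cubic_norm_zero[OF yz(2)[unfolded R_def]] by blast
  then show ?thesis using yz(1) by (intro exI[of _ x] exI[of _ y] exI[of _ z]) auto
qed

lemma common_zero:
  fixes a :: "'a::{alg_closed_field,field_char_0}"
  assumes a: "a \<noteq> 0" and H: "form3 3 H"
  obtains v where "v \<noteq> (0, 0, 0)" "eval3 (cub a b c d e f g h i j) v = 0" "eval3 H v = 0"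
proof -
  obtain a' b' c' d' e' f' g' h' i' j' where H: "H = cub a' b' c' d' e' f' g' h' i' j'" using form3_3E[OF H] .
  define m where "m = a' / a"
  obtain x y z where v: "(x, y, z) \<noteq> (0, 0, 0)"
    and 1: "x^3 + (b/a*y + c/a*z)*x^2 + (d/a*y^2 + e/a*y*z + f/a*z^2)*x + (g/a*y^3 + h/a*y^2*z + i/a*y*z^2 + j/a*z^3) = 0"
    and 2: "((b' - m*b)*y + (c' - m*c)*z)*x^2 + ((d' - m*d)*y^2 + (e' - m*e)*y*z + (f' - m*f)*z^2)*x
      + ((g' - m*g)*y^3 + (h' - m*h)*y^2*z + (i' - m*i)*y*z^2 + (j' - m*j)*z^3) = 0"
    using common_zero_aux[of "b/a" "c/a" "d/a" "e/a" "f/a" "g/a" "h/a" "i/a" "j/a" "b' - m*b" "c' - m*c" "d' - m*d" "e' - m*e" "f' - m*f"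
      "g' - m*g" "h' - m*h" "i' - m*i" "j' - m*j"] by blast
  have "a * (x^3 + (b/a*y + c/a*z)*x^2 + (d/a*y^2 + e/a*y*z + f/a*z^2)*x + (g/a*y^3 + h/a*y^2*z + i/a*y*z^2 + j/a*z^3)) = eval3 (cub a b c d e f g h i j) (x, y, z)"
    using a by (simp add: distrib_left distrib_right mult_ac)
  then have F: "eval3 (cub a b c d e f g h i j) (x, y, z) = 0" unfolding 1 by simp
  have ma: "m * a = a'" using a by (simp add: m_def)
  have "eval3 H (x, y, z) = m * eval3 (cub a b c d e f g h i j) (x, y, z)
    + (((b' - m*b)*y + (c' - m*c)*z)*x^2 + ((d' - m*d)*y^2 + (e' - m*e)*y*z + (f' - m*f)*z^2)*x
      + ((g' - m*g)*y^3 + (h' - m*h)*y^2*z + (i' - m*i)*y*z^2 + (j' - m*j)*z^3))"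
    unfolding H eval3_cub ma[symmetric] by Groebner_Basis.algebra
  then show ?thesis using that[OF v F] unfolding F 2 by simp
qed

lemma form3_diff: "form3 d A \<Longrightarrow> form3 d B \<Longrightarrow> form3 d (A - B :: 'a::{idom,ring_char_0} poly poly poly)"
proof -
  assume A: "form3 d A" "form3 d B"
  have "A - B = A + const3 (-1) * B" by (rule eval3_eqI) simp
  then show ?thesis using A form3_const3_mult by (metis form3_add)
qed

text \<open>Take a common zero p of the cubic and its Hessian, and a kernel vector v of the matrix
  of second derivatives at p, whose rows are \<open>R1\<close>, \<open>R2\<close>,
  \<open>R3\<close>. Both mixed coefficients vanish on the line through p and v, so only a cube
  remains. By Euler's relation p would be singular if v were a multiple of p.\<close>

lemma flex_exists:
  fixes a :: "'a::{alg_closed_field,field_char_0}"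
  assumes a: "a \<noteq> 0" and ns: "nonsing (cub a b c d e f g h i j)"
  obtains p where "flex (cub a b c d e f g h i j) p"
proof -
  let ?F = "cub a b c d e f g h i j"
  define R1 R2 R3 where "R1 = (\<lambda>(x, y, z). (6*a*x + 2*b*y + 2*c*z, 2*b*x + 2*d*y + e*z, 2*c*x + e*y + 2*f*z))"
    and "R2 = (\<lambda>(x, y, z). (2*b*x + 2*d*y + e*z, 2*d*x + 6*g*y + 2*h*z, e*x + 2*h*y + 2*i*z))"
    and "R3 = (\<lambda>(x, y, z). (2*c*x + e*y + 2*f*z, e*x + 2*h*y + 2*i*z, 2*f*x + 2*i*y + 6*j*z))"
  let ?l11 = "lin (6*a, 2*b, 2*c)" and ?l12 = "lin (2*b, 2*d, e)" and ?l13 = "lin (2*c, e, 2*f)"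
  let ?l22 = "lin (2*d, 6*g, 2*h)" and ?l23 = "lin (e, 2*h, 2*i)" and ?l33 = "lin (2*f, 2*i, 6*j)"
  define H where "H = ?l11 * (?l22 * ?l33 - ?l23 * ?l23) - ?l12 * (?l12 * ?l33 - ?l23 * ?l13) + ?l13 * (?l12 * ?l23 - ?l22 * ?l13)"
  have l2: "form3 (Suc (Suc 0)) (lin r * lin r')" for r r' :: "'a vec" using form3_mult[OF form3_lin form3_lin] by simp
  have l3: "form3 3 (lin r * A)" if "form3 (Suc (Suc 0)) A" for r :: "'a vec" and A using form3_mult[OF form3_lin that] by (simp add: numeral_3_eq_3)
  have fH: "form3 3 H" unfolding H_def by (intro form3_add form3_diff l3 l2)
  obtain p where p: "p \<noteq> (0, 0, 0)" "eval3 ?F p = 0" "eval3 H p = 0" using common_zero[OF a fH] .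
  have eH: "eval3 H p = det3 (R1 p, R2 p, R3 p)"
    by (cases p) (simp add: H_def R1_def R2_def R3_def eval3_lin del: lin.simps)
  obtain v where v: "v \<noteq> (0, 0, 0)" "dot v (R1 p) = 0" "dot v (R2 p) = 0" "dot v (R3 p) = 0"
    using orth3[of "R1 p" "R2 p" "R3 p"] p(3) eH by metis
  obtain x y z where xyz: "p = (x, y, z)" by (cases p)
  obtain v1 v2 v3 where vv: "v = (v1, v2, v3)" by (cases v)
  have pp: "2 * polar ?F p (w1, w2, w3) = w1 * dot (R1 p) p + w2 * dot (R2 p) p + w3 * dot (R3 p) p" for w1 w2 w3
    unfolding xyz polar_cub R1_def R2_def R3_def prod.case dot.simps by Groebner_Basis.algebra
  have "2 * polar ?F p v = x * dot v (R1 p) + y * dot v (R2 p) + z * dot v (R3 p)"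
    unfolding xyz vv polar_cub R1_def R2_def R3_def prod.case dot.simps by Groebner_Basis.algebra
  then have pv: "polar ?F p v = 0" using v by simp
  have "2 * polar ?F v p = v1 * dot v (R1 p) + v2 * dot v (R2 p) + v3 * dot v (R3 p)"
    unfolding xyz vv polar_cub R1_def R2_def R3_def prod.case dot.simps by Groebner_Basis.algebra
  then have vp: "polar ?F v p = 0" using v by simp
  have "v \<noteq> scal k p" for k
  proof
    assume k: "v = scal k p"
    have "dot (R p) p = 0" if "dot v (R p) = 0" for R
    proof -
      have "k \<noteq> 0" using v(1) k by (cases p) auto
      moreover have "k * dot (R p) p = 0" using that unfolding k dot_scal_left by (simp add: dot_commute)
      ultimately show ?thesis by simp
    qed
    then have "2 * polar ?F p (w1, w2, w3) = 0" for w1 w2 w3 unfolding pp using v by simp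
    then have "polar ?F p w = 0" for w by (cases w) simp
    then show False using ns p(1) unfolding nonsing_def by blast
  qed
  note nk = this
  have "eval3 ?F (vadd (scal s p) (scal u v)) = u^3 * eval3 ?F v" for s u
    by (simp add: eval3_line[OF form3_cub] p(2) pv vp)
  from flexI[OF p(1) nk this] show ?thesis using that by blast
qed

lemma flexI_lines:
  "\<lbrakk>p \<noteq> (0, 0, 0); L \<noteq> (0, 0, 0); dot L p = 0; dot N p = 0; \<And>q. dot L q = 0 \<Longrightarrow> eval3 G q = dot N q ^ 3\<rbrakk> \<Longrightarrow> flex G p"
  unfolding flex_def by blast

lemma cub_zero_coeffs:
  fixes a :: "'a::field_char_0"
  assumes "\<And>x y. a * x^3 + b * x^2 * y + d * x * y^2 + g * y^3 = n * x^3"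
  shows "a = n" "b = 0" "d = 0" "g = 0"
proof -
  show a: "a = n" using assms[of 1 0] by simp
  show g: "g = 0" using assms[of 0 1] by simp
  have "b + d = 0" "d - b = 0" using assms[of 1 1] assms[of 1 "-1"] a g by (simp_all add: algebra_simps)
  then have "2 * d = 0" "b + d = 0" by Groebner_Basis.algebra+
  then show "d = 0" "b = 0" by simp_all
qed

text \<open>In Weierstrass form a x^3 + f' x z^2 + h y^2 z + j' z^3 with the given flex at (0,1,0),
  a further flex is found from a root of the three-division polynomial.\<close>

lemma second_flex:
  fixes F :: "'a::{alg_closed_field,field_char_0} poly poly poly"
  assumes F: "form3 3 F" "nonsing F" and p: "flex F p"
  obtains p' where "flex F p'" "\<And>k. p' \<noteq> scal k p"
proof -
  obtain L N where L: "p \<noteq> (0, 0, 0)" "L \<noteq> (0, 0, 0)" "dot L p = 0" "dot N p = 0" "\<And>q. dot L q = 0 \<Longrightarrow> eval3 F q = dot N q ^ 3"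
    using p unfolding flex_def by blast
  obtain A A' where A: "lininv A A'" "app A (1, 0, 0) = p" using ex_col[OF L(1)] .
  obtain l1 l2 l3 where l: "row_app L A = (l1, l2, l3)" by (cases "row_app L A")
  have "dot (row_app L A) (1, 0, 0) = 0" unfolding dot_row_app A(2) by (rule L(3))
  then have l1: "l1 = 0" unfolding l by simp
  have lnz: "(l1, l2, l3) \<noteq> (0, 0, 0)" using row_app_nz[OF A(1) L(2)] unfolding l .
  \<comment> \<open>\<open>A\<close> sends (1,0,0) to the flex; \<open>B\<close> is chosen so that
    for the product the flex is the image of (0,1,0) and the tangent becomes z = 0.\<close>
  define B where "B = (if l2 = 0 then ((0, 1, 0), (1, 0, 0), (0, 0, 1)) else ((0, 1, 0), (l3, 0, 1), (- l2, 0, 0)) :: 'a mat)"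
  have B: "lininv B (minv B)"
  proof (rule lininv_minv)
    show "det3 B \<noteq> 0" by (simp add: B_def)
  qed
  define M where "M = mmul A B"
  have M: "lininv M (mmul (minv B) A')" unfolding M_def by (rule lininv_mmul[OF A(1) B])
  have Mp: "app M (0, 1, 0) = p" unfolding M_def app_mmul using A(2) by (simp add: B_def)
  have LM: "dot L (app M (x, y, 0)) = 0" for x y
  proof -
    have "dot (row_app L A) (app B (x, y, 0)) = 0" unfolding l l1 by (simp add: B_def)
    then show ?thesis unfolding M_def app_mmul dot_row_app .
  qed
  obtain n1 n2 n3 where n: "row_app N M = (n1, n2, n3)" by (cases "row_app N M")
  have "dot (row_app N M) (0, 1, 0) = 0" unfolding dot_row_app Mp by (rule L(4))
  then have n2: "n2 = 0" unfolding n by simp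
  let ?G = "subst3 M F"
  obtain a b c d e f g h i j where G: "?G = cub a b c d e f g h i j" using form3_3E[OF form3_subst[OF F(1)]] .
  have nsG: "nonsing (cub a b c d e f g h i j)" using nonsing_subst[OF M F(2)] unfolding G .
  have "eval3 (cub a b c d e f g h i j) (x, y, 0) = n1^3 * x^3" for x y
  proof -
    have "eval3 ?G (x, y, 0) = dot (row_app N M) (x, y, 0) ^ 3" using L(5)[OF LM] unfolding eval3_subst dot_row_app .
    then show ?thesis unfolding G n n2 by (simp add: power_mult_distrib)
  qed
  note z0 = this
  have co: "a = n1^3" "b = 0" "d = 0" "g = 0"
    by (rule cub_zero_coeffs[of a b d g "n1^3"], use z0 in simp)+
  have h: "h \<noteq> 0"
  proof
    assume "h = 0"
    then have "polar (cub a b c d e f g h i j) (0, 1, 0) w = 0" for w by (cases w) (simp add: polar_cub co)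
    moreover have "(0, 1, 0) \<noteq> (0 :: 'a, 0 :: 'a, 0 :: 'a)" by simp
    ultimately show False using nsG unfolding nonsing_def by blast
  qed
  have a: "a \<noteq> 0"
  proof
    assume a0: "a = 0"
    have "(0, 0, 1) \<noteq> (0 :: 'a, 0 :: 'a, 0 :: 'a)" by simp
    from nonsing_no_line[OF form3_cub nsG this] obtain q where q: "dot (0, 0, 1) q = 0" "eval3 (cub a b c d e f g h i j) q \<noteq> 0" .
    then show False using a0 co by (cases q) auto
  qed
  \<comment> \<open>\<open>t\<close> completes the square in y, and \<open>k\<close> then completes
    the cube in x.\<close>
  define t where "t = 1 / (2 * h)"
  have t: "2 * h * t = 1" using h by (simp add: t_def)
  define k where "k = (c - e^2 * h * t^2) / (3 * a)"
  have k: "3 * a * k = c - e^2 * h * t^2" using a by (simp add: k_def)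
  define f' where "f' = - 3 * a * k^2 + f - e * i * t"
  define j' where "j' = 2 * a * k^3 - (f - e * i * t) * k + j - i^2 * h * t^2"
  define S :: "'a mat" where "S = ((1, 0, - k), (- e * t, 1, (e * k - i) * t), (0, 0, 1 :: 'a))"
  have S: "lininv S (minv S)" by (rule lininv_minv) (simp add: S_def)
  let ?G' = "cub a 0 0 0 0 f' 0 h 0 j'"
  have G': "subst3 S ?G = ?G'"
  proof (rule eval3_eqI)
    fix x y z
    define xx where "xx = x - k * z"
    define yy where "yy = y - t * (e * xx + i * z)"
    have "app S (x, y, z) = (xx, yy, z)" by (simp add: S_def xx_def yy_def algebra_simps)
    then have "eval3 (subst3 S ?G) (x, y, z) = a * xx^3 + c * xx^2 * z + e * xx * yy * z + f * xx * z^2 + h * yy^2 * z + i * yy * z^2 + j * z^3"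
      unfolding G eval3_subst by (simp add: co(2-4))
    also have "\<dots> = a * xx^3 + (c - e^2 * h * t^2) * xx^2 * z + (f - e * i * t) * xx * z^2 + h * y^2 * z + (j - i^2 * h * t^2) * z^3"
      unfolding yy_def using t by Groebner_Basis.algebra
    also have "\<dots> = a * x^3 + f' * x * z^2 + h * y^2 * z + j' * z^3"
      unfolding k[symmetric] xx_def f'_def j'_def by Groebner_Basis.algebra
    finally show "eval3 (subst3 S ?G) (x, y, z) = eval3 ?G' (x, y, z)" by simp
  qed
  have nsG': "nonsing ?G'" using nonsing_subst[OF S nsG] unfolding G[symmetric] G' .
  have fj: "f' \<noteq> 0 \<or> j' \<noteq> 0"
  proof (rule ccontr)
    assume "\<not> ?thesis"
    then have "polar ?G' (0, 0, 1) w = 0" for w by (cases w) (simp add: polar_cub)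
    moreover have "(0, 0, 1) \<noteq> (0 :: 'a, 0 :: 'a, 0 :: 'a)" by simp
    ultimately show False using nsG' unfolding nonsing_def by blast
  qed
  \<comment> \<open>The three-division polynomial. A nonzero root is taken, so that the slope
    \<open>m\<close> with h m^2 = -3 a x1 is nonzero and the intercept \<open>n\<close> can be
    solved for; on the line y = m x + n z the cubic is then a (x - x1 z)^3.\<close>
  obtain x1 where x1: "x1 \<noteq> 0" "3*a^2*x1^4 + 6*a*f'*x1^2 + 12*a*j'*x1 - f'^2 = 0"
  proof (cases "f' = 0")
    case True
    then have j: "j' \<noteq> 0" using fj by simp
    obtain x where x: "x^3 = - 4 * j' / a" using nth_root_exists[of 3 "- 4 * j' / a"] by auto
    then have "x \<noteq> 0" using j a by auto
    moreover have "a * x^3 = - 4 * j'" using x a by simp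
    then have "3*a^2*x^4 + 12*a*j'*x = 0" by Groebner_Basis.algebra
    ultimately show ?thesis using that[of x] True by simp
  next
    case False
    obtain x where "poly [:- (f'^2), 12*a*j', 6*a*f', 0, 3*a^2:] x = 0"
      using alg_closed_imp_poly_has_root[of "[:- (f'^2), 12*a*j', 6*a*f', 0, 3*a^2:]"] a by auto
    then have x: "3*a^2*x^4 + 6*a*f'*x^2 + 12*a*j'*x - f'^2 = 0"
      by (simp add: algebra_simps power2_eq_square power4_eq_xxxx)
    moreover have "x \<noteq> 0" using x False by auto
    ultimately show ?thesis using that by blast
  qed
  obtain m where m: "m^2 = - 3 * a * x1 / h" using nth_root_exists[of 2 "- 3 * a * x1 / h"] by auto
  then have m0: "m \<noteq> 0" using a h x1 by auto
  have hm: "h * m^2 = - 3 * a * x1" using m h by simp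
  define n where "n = (3*a*x1^2 - f') / (2*h*m)"
  have nn: "2*h*m*n = 3*a*x1^2 - f'" using m0 h by (simp add: n_def)
  have "12 * a * x1 * (h*n^2 + j' + a*x1^3) = 0" using nn hm x1(2) by Groebner_Basis.algebra
  then have hn: "h*n^2 + j' + a*x1^3 = 0" using a x1(1) by (simp only: mult_eq_0_iff) simp
  obtain r where r: "r^3 = a" using nth_root_exists[of 3 a] by auto
  let ?p = "(x1, m * x1 + n, 1)"
  have fl: "flex ?G' ?p"
  proof (rule flexI_lines[of _ "(m, -1, n)" "(r, 0, - r * x1)"])
    show "eval3 ?G' q = dot (r, 0, - r * x1) q ^ 3" if q: "dot (m, -1, n) q = 0" for q
    proof -
      obtain x y z where xyz: "q = (x, y, z)" by (cases q)
      have y: "y = m * x + n * z" using q unfolding xyz by (simp add: algebra_simps)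
      have "a*x^3 + f'*x*z^2 + h*(m*x + n*z)^2*z + j'*z^3 = (r*x - r*x1*z)^3" using hm nn hn r by Groebner_Basis.algebra
      then show "eval3 ?G' q = dot (r, 0, - r * x1) q ^ 3" unfolding xyz y by simp
    qed
  qed simp_all
  then have "flex (subst3 S ?G) ?p" unfolding G' .
  then have "flex F (app M (app S ?p))" unfolding flex_subst[OF S] flex_subst[OF M] .
  moreover have "app M (app S ?p) \<noteq> scal k p" for k
  proof
    assume "app M (app S ?p) = scal k p"
    then have "app M (app S ?p) = app M (scal k (0, 1, 0))" unfolding app_scal Mp .
    then have "app S ?p = scal k (0, 1, 0)" using lininvD(2)[OF M] by metis
    then show False by (simp add: S_def)
  qed
  ultimately show ?thesis using that by blast
qed

definition diag_cubic :: "'a::comm_ring_1 \<Rightarrow> 'a \<Rightarrow> 'a \<Rightarrow> 'a \<Rightarrow> 'a poly poly poly" where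
  "diag_cubic e1 e2 e3 mu = cub e1 0 0 0 mu 0 e2 0 0 e3"

lemma eval3_diag: "eval3 (diag_cubic e1 e2 e3 mu) (x, y, z) = e1 * x^3 + e2 * y^3 + e3 * z^3 + mu * x * y * z"
  by (simp add: diag_cubic_def)

text \<open>In coordinates in which the tangents at two flexes are \<open>y = 0\<close> and \<open>z = 0\<close> and the flexes
  lie on \<open>x = 0\<close>, the cubic is \<open>a x\<^sup>3 + y z l\<close> with \<open>l\<close> the tangent at the third collinear flex; a
  discrete Fourier transform of \<open>y, z, l\<close> makes it diagonal.\<close>

lemma diag_form:
  fixes F :: "'a::{alg_closed_field,field_char_0} poly poly poly"
  assumes F: "form3 3 F" "nonsing F" and fl: "flex F p1" "flex F p2" and np: "\<And>k. p2 \<noteq> scal k p1"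
  obtains M M' e1 e2 e3 mu where "lininv M M'" "subst3 M F = diag_cubic e1 e2 e3 mu" "e1 \<noteq> 0" "e2 \<noteq> 0" "e3 \<noteq> 0"
    "fst (app M' p1) = 0" "fst (app M' p2) = 0"
proof -
  have L1ex: "\<exists>L N. L \<noteq> (0, 0, 0) \<and> dot L p = 0 \<and> dot L p' \<noteq> 0 \<and> (\<forall>q. dot L q = 0 \<longrightarrow> eval3 F q = dot N q ^ 3) \<and> dot N p = 0"
    if pp: "flex F p" "flex F p'" "\<And>k. p' \<noteq> scal k p" for p p'
  proof -
    obtain L N where L: "p \<noteq> (0, 0, 0)" "L \<noteq> (0, 0, 0)" "dot L p = 0" "dot N p = 0" "\<And>q. dot L q = 0 \<Longrightarrow> eval3 F q = dot N q ^ 3"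
      using pp(1) unfolding flex_def by blast
    \<comment> \<open>Two different flexes have different tangents: otherwise \<open>N\<close>
      vanishes at both of them, hence on their line, and the line would lie on the curve.\<close>
    have "dot L p' \<noteq> 0"
    proof
      assume Lp: "dot L p' = 0"
      then have Np: "dot N p' = 0" using L(5)[OF Lp] flex_zero[OF pp(2)] by simp
      obtain q where q: "dot L q = 0" "eval3 F q \<noteq> 0" using nonsing_no_line[OF F L(2)] .
      then have Nq: "dot N q \<noteq> 0" using L(5) by auto
      obtain A A' where A: "lininv A A'" "\<And>v. fst (app A' v) = dot L v" using ex_row[OF L(2)] by blast
      obtain n1 n2 n3 where n: "row_app N A = (n1, n2, n3)" by (cases "row_app N A")
      have N: "dot N v = n2 * y + n3 * z" if "app A' v = (0, y, z)" for v y z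
      proof -
        have "dot N v = dot (row_app N A) (app A' v)" unfolding dot_row_app lininvD(1)[OF A(1)] ..
        then show ?thesis unfolding that n by simp
      qed
      have ex: "\<exists>y z. app A' v = (0, y, z)" if "dot L v = 0" for v using A(2)[of v] that by (cases "app A' v") auto
      obtain y z where y: "app A' p = (0, y, z)" using ex[OF L(3)] by blast
      obtain y' z' where y': "app A' p' = (0, y', z')" using ex[OF Lp] by blast
      obtain u w where u: "app A' q = (0, u, w)" using ex[OF q(1)] by blast
      have e: "n2 * y + n3 * z = 0" "n2 * y' + n3 * z' = 0" "n2 * u + n3 * w \<noteq> 0" using N y y' u L(4) Np Nq by auto
      have yz: "(y, z) \<noteq> (0, 0)" using lininv_nz[OF lininv_sym[OF A(1)], of p] L(1) y by auto
      have c: "y * z' = z * y'"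
      proof (cases "n2 = 0")
        case True then show ?thesis using e by auto
      next
        case False
        have "n2 * (y * z' - z * y') = 0" using e(1,2) by Groebner_Basis.algebra
        then show ?thesis using False by simp
      qed
      have "\<exists>k. (y', z') = (k * y, k * z)"
      proof (cases "y = 0")
        case True then show ?thesis using c yz by (intro exI[of _ "z' / z"]) auto
      next
        case False then show ?thesis using c by (intro exI[of _ "y' / y"]) (simp add: field_simps)
      qed
      then obtain k where "app A' p' = scal k (app A' p)" unfolding y y' by auto
      then have "p' = scal k p" using lininvD(1)[OF A(1)] by (metis app_scal)
      then show False using pp(3) by blast
    qed
    then show ?thesis using L by blast
  qed
  obtain L1 N1 where L1: "L1 \<noteq> (0, 0, 0)" "dot L1 p1 = 0" "dot L1 p2 \<noteq> 0" "\<And>q. dot L1 q = 0 \<Longrightarrow> eval3 F q = dot N1 q ^ 3" "dot N1 p1 = 0"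
    using L1ex[OF fl np] by blast
  have p0: "p1 \<noteq> (0, 0, 0)" "p2 \<noteq> (0, 0, 0)" using fl by (simp_all add: flex_def)
  have np': "p1 \<noteq> scal k p2" for k
  proof
    assume k: "p1 = scal k p2"
    then have "k \<noteq> 0" using p0 scal_nz by metis
    then have "p2 = scal (1 / k) p1" unfolding k by simp
    then show False using np by blast
  qed
  obtain L2 N2 where L2: "L2 \<noteq> (0, 0, 0)" "dot L2 p2 = 0" "dot L2 p1 \<noteq> 0" "\<And>q. dot L2 q = 0 \<Longrightarrow> eval3 F q = dot N2 q ^ 3" "dot N2 p2 = 0"
    using L1ex[OF fl(2,1) np'] by blast
  have "det3 (L1, L2, L2) = 0" by (cases L1; cases L2) (simp add: algebra_simps)
  then obtain v where v: "v \<noteq> (0, 0, 0)" "dot v L1 = 0" "dot v L2 = 0" using orth3 by metis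
  then have v12: "dot L1 v = 0" "dot L2 v = 0" by (simp_all add: dot_commute)
  let ?M = "colm v p2 p1"
  have M: "lininv ?M (minv ?M)"
  proof (rule lininv_colm)
    fix x y z assume 0: "vadd (vadd (scal x v) (scal y p2)) (scal z p1) = (0, 0, 0)"
    have d0: "dot L (0, 0, 0) = 0" for L :: "'a vec" by (cases L) simp
    have "y * dot L1 p2 = 0" using arg_cong[OF 0, of "dot L1"] by (simp add: dot_vadd dot_scal v12 L1 d0)
    moreover have "z * dot L2 p1 = 0" using arg_cong[OF 0, of "dot L2"] by (simp add: dot_vadd dot_scal v12 L2 d0)
    ultimately have yz: "y = 0" "z = 0" using L1(3) L2(3) by simp_all
    have "scal x v = (0, 0, 0)" using 0 unfolding yz by (cases v; cases p1; cases p2) simp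
    then show "x = 0 \<and> y = 0 \<and> z = 0" using yz v(1) by (simp add: scal_nz)
  qed
  obtain a b c d e f g h i j where G: "subst3 ?M F = cub a b c d e f g h i j" using form3_3E[OF form3_subst[OF F(1)]] .
  have nsG: "nonsing (cub a b c d e f g h i j)" using nonsing_subst[OF M F(2)] unfolding G .
  have s0: "scal 0 p = (0, 0, 0)" for p :: "'a vec" by (cases p) simp
  have v0: "vadd p (0, 0, 0) = p" for p :: "'a vec" by (cases p) simp
  have e1: "eval3 (cub a b c d e f g h i j) (x, 0, z) = dot N1 v ^ 3 * x^3" for x z
  proof -
    have q: "app ?M (x, 0, z) = vadd (scal x v) (scal z p1)" by (simp add: app_colm s0 v0)
    have "dot L1 (app ?M (x, 0, z)) = 0" unfolding q by (simp add: dot_vadd dot_scal v12 L1)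
    then have "eval3 F (app ?M (x, 0, z)) = (x * dot N1 v) ^ 3" using L1(4) unfolding q by (simp add: dot_vadd dot_scal L1)
    then show ?thesis unfolding G[symmetric] eval3_subst by (simp add: power_mult_distrib)
  qed
  have e2: "eval3 (cub a b c d e f g h i j) (x, y, 0) = dot N2 v ^ 3 * x^3" for x y
  proof -
    have q: "app ?M (x, y, 0) = vadd (scal x v) (scal y p2)" by (simp add: app_colm s0 v0)
    have "dot L2 (app ?M (x, y, 0)) = 0" unfolding q by (simp add: dot_vadd dot_scal v12 L2)
    then have "eval3 F (app ?M (x, y, 0)) = (x * dot N2 v) ^ 3" using L2(4) unfolding q by (simp add: dot_vadd dot_scal L2)
    then show ?thesis unfolding G[symmetric] eval3_subst by (simp add: power_mult_distrib)
  qed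
  have co: "b = 0" "d = 0" "g = 0" by (rule cub_zero_coeffs[of a b d g "dot N2 v ^ 3"], use e2 in simp)+
  have co': "c = 0" "f = 0" "j = 0" by (rule cub_zero_coeffs[of a c f j "dot N1 v ^ 3"], use e1 in simp)+
  have sing: False if "u \<noteq> (0, 0, 0)" "\<And>w. polar (cub a b c d e f g h i j) u w = 0" for u
    using nsG that unfolding nonsing_def by blast
  have hi: "h \<noteq> 0" "i \<noteq> 0"
  proof -
    show "h \<noteq> 0"
    proof
      assume "h = 0"
      then have "polar (cub a b c d e f g h i j) (0, 1, 0) w = 0" for w by (cases w) (simp add: polar_cub co co')
      then show False using sing[of "(0, 1, 0)"] by simp
    qed
    show "i \<noteq> 0"
    proof
      assume "i = 0"
      then have "polar (cub a b c d e f g h i j) (0, 0, 1) w = 0" for w by (cases w) (simp add: polar_cub co co')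
      then show False using sing[of "(0, 0, 1)"] by simp
    qed
  qed
  obtain w :: 'a where w: "w^2 + w + 1 = 0" "w^2 \<noteq> w" by (rule omega_exists)
  \<comment> \<open>With A = al x + y + z and B = al x + w y + w^2 z one has 3 al x - A - B = al x +
    w^2 y + w z. The product of the three forms is al^3 x^3 + y^3 + z^3 - 3 al x y z, which has the
    diagonal shape.\<close>
  define al where "al = - e / 3"
  have e: "e = - 3 * al" by (simp add: al_def)
  define h' where "h' = 1 / h"
  define i' where "i' = 1 / i"
  have hi': "h * h' = 1" "i * i' = 1" using hi by (simp_all add: h'_def i'_def)
  define T :: "'a mat" where "T = ((1, 0, 0), (al * h', h', h'), (al * i', w * i', w^2 * i'))"
  have "det3 T = h' * i' * (w^2 - w)" by (simp add: T_def algebra_simps)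
  moreover have "h' * i' * (w^2 - w) \<noteq> 0" using w(2) hi by (simp add: h'_def i'_def)
  ultimately have T: "lininv T (minv T)" by (intro lininv_minv) simp
  define k where "k = h' * i'"
  have D: "subst3 T (cub a b c d e f g h i j) = diag_cubic (a - k * al^3) (- k) (- k) (3 * k * al)"
  proof (rule eval3_eqI)
    fix x y z
    define A where "A = al * x + y + z"
    define B where "B = al * x + w * y + w^2 * z"
    have "app T (x, y, z) = (x, h' * A, i' * B)" by (simp add: T_def A_def B_def algebra_simps)
    then have "eval3 (subst3 T (cub a b c d e f g h i j)) (x, y, z)
      = a * x^3 + e * x * (h' * A) * (i' * B) + h * (h' * A)^2 * (i' * B) + i * (h' * A) * (i' * B)^2"
      unfolding eval3_subst by (simp add: co co')
    also have "\<dots> = a * x^3 + k * (A * B) * (e * x + (h * h') * A + (i * i') * B)" unfolding k_def by Groebner_Basis.algebra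
    also have "\<dots> = a * x^3 + k * (A * B) * (- 3 * al * x + 1 * A + 1 * B)" unfolding hi' e ..
    also have "\<dots> = a * x^3 + k * (A * B) * (- 3 * al * x + A + B)" by simp
    also have "\<dots> = (a - k * al^3) * x^3 - k * y^3 - k * z^3 + 3 * k * al * x * y * z"
      unfolding A_def B_def using w(1) by Groebner_Basis.algebra
    finally show "eval3 (subst3 T (cub a b c d e f g h i j)) (x, y, z) = eval3 (diag_cubic (a - k * al^3) (- k) (- k) (3 * k * al)) (x, y, z)"
      by (simp add: eval3_diag)
  qed
  have nsD: "nonsing (diag_cubic (a - k * al^3) (- k) (- k) (3 * k * al))" using nonsing_subst[OF T nsG] unfolding D .
  have "a - k * al^3 \<noteq> 0"
  proof
    assume "a - k * al^3 = 0"
    then have "polar (diag_cubic (a - k * al^3) (- k) (- k) (3 * k * al)) (1, 0, 0) w = 0" for w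
      by (cases w) (simp add: diag_cubic_def polar_cub)
    moreover have "(1, 0, 0) \<noteq> (0 :: 'a, 0 :: 'a, 0 :: 'a)" by simp
    ultimately show False using nsD unfolding nonsing_def by blast
  qed
  moreover have "- k \<noteq> 0" using hi by (simp add: k_def h'_def i'_def)
  moreover have "subst3 (mmul ?M T) F = diag_cubic (a - k * al^3) (- k) (- k) (3 * k * al)"
    unfolding subst_mmul G D ..
  moreover have fT: "fst (app (minv T) q) = fst q" for q
  proof -
    have "fst (app T v) = fst v" for v by (cases v) (simp add: T_def)
    then show ?thesis using lininvD(1)[OF T, of q] by metis
  qed
  have "app (minv ?M) p1 = (0, 0, 1)" "app (minv ?M) p2 = (0, 1, 0)"
    using lininvD(2)[OF M, of "(0, 0, 1)"] lininvD(2)[OF M, of "(0, 1, 0)"] by simp_all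
  then have "fst (app (mmul (minv T) (minv ?M)) p1) = 0" "fst (app (mmul (minv T) (minv ?M)) p2) = 0"
    by (simp_all add: app_mmul fT)
  ultimately show ?thesis using that[OF lininv_mmul[OF M T]] by blast
qed

text \<open>The tangent is m x + y - be z = 0. The relation for \<open>b\<close> cancels z^3 on it,
  and \<open>m\<close> is the value that cancels both mixed terms at once.\<close>

lemma flex_diag:
  fixes e1 :: "'a::{alg_closed_field,field_char_0}"
  assumes e: "e2 \<noteq> 0" "e3 \<noteq> 0" and b: "e2 + e3 * b^3 = 0"
  shows "flex (diag_cubic e1 e2 e3 mu) (0, 1, b)"
proof -
  have b0: "b \<noteq> 0" using b e by auto
  define be where "be = 1 / b"
  have be: "b * be = 1" using b0 by (simp add: be_def)
  define m where "m = mu * b / (3 * e2)"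
  have m: "3 * e2 * m = mu * b" using e by (simp add: m_def)
  have e3: "e3 = - e2 * be^3" using b be by Groebner_Basis.algebra
  obtain n where n: "n^3 = e1 - e2 * m^3" using nth_root_exists[of 3 "e1 - e2 * m^3"] by auto
  show ?thesis
  proof (rule flexI_lines[of _ "(m, 1, - be)" "(n, 0, 0)"])
    show "dot (m, 1, - be) (0, 1, b) = 0" using be by (simp add: mult.commute)
    show "eval3 (diag_cubic e1 e2 e3 mu) q = dot (n, 0, 0) q ^ 3" if q: "dot (m, 1, - be) q = 0" for q
    proof -
      obtain x y z where xyz: "q = (x, y, z)" by (cases q)
      have y: "y = be * z - m * x" using q unfolding xyz by (simp add: algebra_simps)
      have "e1 * x^3 + e2 * (be * z - m * x)^3 + (- e2 * be^3) * z^3 + mu * x * (be * z - m * x) * z = n^3 * x^3"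
        using m be n by Groebner_Basis.algebra
      then show "eval3 (diag_cubic e1 e2 e3 mu) q = dot (n, 0, 0) q ^ 3"
        unfolding xyz y e3 by (simp add: eval3_diag power_mult_distrib)
    qed
  qed simp_all
qed

abbreviation rot :: "'a::comm_ring_1 mat" where "rot \<equiv> ((0, 1, 0), (0, 0, 1), (1, 0, 0))"

abbreviation rot' :: "'a::comm_ring_1 mat" where "rot' \<equiv> ((0, 0, 1), (1, 0, 0), (0, 1, 0))"

lemma lininv_rot: "lininv rot rot'" by (simp add: lininv_def)

lemma diag_rot:
  fixes e1 :: "'a::field_char_0"
  shows "subst3 rot (diag_cubic e2 e3 e1 mu) = diag_cubic e1 e2 e3 mu"
  by (rule eval3_eqI) (simp add: eval3_diag algebra_simps del: subst3.simps)

lemma diag_flexes: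
  fixes e1 :: "'a::{alg_closed_field,field_char_0}"
  assumes e: "e1 \<noteq> 0" "e2 \<noteq> 0" "e3 \<noteq> 0"
  shows "e2 + e3 * b^3 = 0 \<Longrightarrow> flex (diag_cubic e1 e2 e3 mu) (0, 1, b)"
    and "e3 + e1 * b^3 = 0 \<Longrightarrow> flex (diag_cubic e1 e2 e3 mu) (b, 0, 1)"
    and "e1 + e2 * b^3 = 0 \<Longrightarrow> flex (diag_cubic e1 e2 e3 mu) (1, b, 0)"
proof -
  show "e2 + e3 * b^3 = 0 \<Longrightarrow> flex (diag_cubic e1 e2 e3 mu) (0, 1, b)" by (rule flex_diag[OF e(2,3)])
  show "flex (diag_cubic e1 e2 e3 mu) (b, 0, 1)" if "e3 + e1 * b^3 = 0"
    unfolding diag_rot[symmetric, of e1 e2 e3] flex_subst[OF lininv_rot] using flex_diag[OF e(3,1) that] by simp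
  show "flex (diag_cubic e1 e2 e3 mu) (1, b, 0)" if "e1 + e2 * b^3 = 0"
    unfolding diag_rot[symmetric, of e1 e2 e3] diag_rot[symmetric, of e2 e3 e1] flex_subst[OF lininv_rot]
    using flex_diag[OF e(1,2) that] by simp
qed

section \<open>Reduction of the flexes to the sides of the triangle\<close>

section \<open>Reduction of the flexes\<close>

definition nonprop :: "'a::times vec \<Rightarrow> 'a vec \<Rightarrow> bool" where
  "nonprop p q \<longleftrightarrow> (\<forall>k. q \<noteq> scal k p)"

text \<open>Cyclic rotation that makes the side numbered \<open>i\<close> the line x = 0, so that
  one analysis serves all three sides.\<close>

definition rotv :: "nat \<Rightarrow> 'a vec \<Rightarrow> 'a vec" where
  "rotv i = (\<lambda>(x, y, z). if i = 0 then (x, y, z) else if i = 1 then (y, z, x) else (z, x, y))"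

lemma rotv_simps [simp]:
  "rotv 0 v = v" "rotv (Suc 0) (x, y, z) = (y, z, x)" "rotv 2 (x, y, z) = (z, x, y)"
  by (cases v; simp add: rotv_def)+

lemma less3_cases: "i < 3 \<longleftrightarrow> i = 0 \<or> i = Suc 0 \<or> i = (2::nat)" by auto

lemma dot_rotv: "dot (rotv i v) (rotv i w) = dot v (w :: 'a::comm_ring_1 vec)"
  by (cases v; cases w) (simp add: rotv_def)

lemma rotv_scal: "rotv i (scal k v) = scal k (rotv i (v :: 'a::times vec))" by (cases v) (simp add: rotv_def)

lemma rotv_inj: "rotv i v = rotv i w \<longleftrightarrow> v = w" by (cases v; cases w) (auto simp: rotv_def)

lemma nonprop_rotv: "nonprop (rotv i p) (rotv i q) \<longleftrightarrow> nonprop p (q :: 'a::times vec)"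
  unfolding nonprop_def rotv_scal[symmetric] rotv_inj ..

lemma nonprop_app: assumes "lininv M M'" "nonprop p q" shows "nonprop (app M p) (app M q)"
  unfolding nonprop_def app_scal[symmetric] using assms lininvD(2)[OF assms(1)] unfolding nonprop_def by metis

lemma four_cubes:
  fixes a :: "'a::field"
  assumes "a^3 = d^3" "b^3 = d^3" "c^3 = d^3" "a \<noteq> b" "a \<noteq> c" "a \<noteq> d" "b \<noteq> c" "b \<noteq> d" "c \<noteq> d" shows False
proof -
  have *: "x^2 + x*y + y^2 = 0" if "x^3 = y^3" "x \<noteq> y" for x y :: 'a
  proof -
    have "(x - y) * (x^2 + x*y + y^2) = x^3 - y^3" by (simp add: algebra_simps power2_eq_square power3_eq_cube)
    then show ?thesis using that by simp
  qed
  have 1: "a^2 + a*b + b^2 = 0" "a^2 + a*c + c^2 = 0" "a^2 + a*d + d^2 = 0" using assms by (auto intro!: *)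
  have "(b - c) * (a + b + c) = 0" "(b - d) * (a + b + d) = 0" using 1 by Groebner_Basis.algebra+
  then have "a + b + c = 0" "a + b + d = 0" using assms by simp_all
  then show False using assms(9) by (metis add_left_cancel)
qed

lemma cancelD: "(c :: 'a::idom) * x = c * y \<Longrightarrow> c \<noteq> 0 \<Longrightarrow> x = y" by simp

lemma cubic_coeffs:
  fixes a :: "'a::field_char_0"
  assumes "\<And>y z. a*y^3 + b*y^2*z + c*y*z^2 + d*z^3 = (m*y + n*z)^3"
  shows "a = m^3" "b = 3*m^2*n" "c = 3*m*n^2" "d = n^3"
proof -
  show a: "a = m^3" and d: "d = n^3" using assms[of 1 0] assms[of 0 1] by simp_all
  have "a + b + c + d = (m + n)^3" "a - b + c - d = (m - n)^3" using assms[of 1 1] assms[of 1 "-1"] by simp_all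
  then have "2 * b = 2 * (3*m^2*n)" "2 * c = 2 * (3*m*n^2)" unfolding a d by Groebner_Basis.algebra+
  then show "b = 3*m^2*n" "c = 3*m*n^2" by (simp_all only: mult_cancel_left) simp_all
qed

context place
begin

definition red_pt :: "'k geom vec \<Rightarrow> 'k vec \<Rightarrow> bool" where
  "red_pt p r \<longleftrightarrow> (\<exists>k. k \<noteq> 0 \<and> mat_all (\<lambda>a. a \<in> V) (scal k p) \<and> vmap \<rho> (scal k p) = r)"

lemma r_dot: "mat_all (\<lambda>a. a \<in> V) v \<Longrightarrow> mat_all (\<lambda>a. a \<in> V) w \<Longrightarrow> dot v w \<in> V \<and> \<rho> (dot v w) = dot (vmap \<rho> v) (vmap \<rho> w)"
  by (cases v; cases w) simp

lemma red_pt_unique: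
  assumes "red_pt p r" "red_pt p r'" "r \<noteq> (0, 0, 0)" "r' \<noteq> (0, 0, 0)"
  obtains c where "c \<noteq> 0" "r' = scal c r"
proof -
  have *: "\<exists>c. c \<noteq> 0 \<and> r' = scal c r"
    if "k' = m * k" "m \<in> V" "mat_all (\<lambda>a. a \<in> V) (scal k p)" "vmap \<rho> (scal k p) = r" "vmap \<rho> (scal k' p) = r'" "r' \<noteq> (0, 0, 0)" for k k' m r r'
  proof -
    obtain x y z where xyz: "scal k p = (x, y, z)" by (cases "scal k p")
    have "scal k' p = scal m (scal k p)" using that(1) by simp
    then have "r' = scal (\<rho> m) r" using that xyz by auto
    then show ?thesis using that(6) by (cases "\<rho> m = 0"; cases r) auto
  qed
  obtain k k' where k: "k \<noteq> 0" "mat_all (\<lambda>a. a \<in> V) (scal k p)" "vmap \<rho> (scal k p) = r"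
    and k': "k' \<noteq> 0" "mat_all (\<lambda>a. a \<in> V) (scal k' p)" "vmap \<rho> (scal k' p) = r'" using assms unfolding red_pt_def by blast
  have "(k' / k) \<in> V \<or> (k / k') \<in> V" using V_total[of "k' / k"] by simp
  then show ?thesis
  proof
    assume "k' / k \<in> V"
    then show ?thesis using *[of k' "k' / k" k r r'] k k' assms(4) that by auto
  next
    assume "k / k' \<in> V"
    then obtain c where "c \<noteq> 0" "r = scal c r'" using *[of k "k / k'" k' r' r] k k' assms(3) by auto
    then show ?thesis using that[of "1 / c"] by simp
  qed
qed

lemma red_pt_axis_unique: assumes "red_pt p (0, a, 1)" "red_pt p (0, b, 1)" shows "a = b"
proof -
  obtain c where "(0, b, 1) = scal c (0, a, 1 :: 'k)" using red_pt_unique[OF assms] by auto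
  then show ?thesis by simp
qed

lemma mtc_lmd_transport:
  assumes "vmono M"
  shows "card {C \<in> max_tangent_cubics (subst3 M E). has_lmd D C} = card {C \<in> max_tangent_cubics E. has_lmd D C}"
proof -
  note M = vmono_minv(1)[OF assms]
  have im: "max_tangent_cubics (subst3 M E) = (`) (subst3 M) ` max_tangent_cubics E" by (rule max_tangent_subst_eq[OF M])
  moreover have "has_lmd D (subst3 M ` C) \<longleftrightarrow> has_lmd D C" if "C \<in> max_tangent_cubics E" for C
    using that max_tangent_lmd_subst[OF assms] unfolding has_lmd_def by (cases D) auto
  ultimately have "{C \<in> max_tangent_cubics (subst3 M E). has_lmd D C} = (`) (subst3 M) ` {C \<in> max_tangent_cubics E. has_lmd D C}" by auto
  moreover have "inj_on ((`) (subst3 M)) S" for S by (rule inj_on_subset[OF inj_subst_image[OF M] subset_UNIV])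
  ultimately show ?thesis by (simp add: card_image)
qed

end

text \<open>A cubic that reduces to the triangle \<open>x y z = 0\<close> and whose model is regular at its vertices.\<close>

locale triangle_cubic = place V \<rho> for V :: "'k::{alg_closed_field,field_char_0} geom set" and \<rho> +
  fixes t f1 f2 f3 f4 e f6 f7 f8 f9 f10 :: "'k geom"
  assumes t: "t \<in> V" "\<rho> t = 0" "t \<noteq> 0"
    and fV: "f1 \<in> V" "f2 \<in> V" "f3 \<in> V" "f4 \<in> V" "e \<in> V" "f6 \<in> V" "f7 \<in> V" "f8 \<in> V" "f9 \<in> V" "f10 \<in> V"
    and fu: "\<rho> e \<noteq> 0" "\<rho> f1 \<noteq> 0" "\<rho> f7 \<noteq> 0" "\<rho> f10 \<noteq> 0"
begin

definition "F = cub (t*f1) (t*f2) (t*f3) (t*f4) e (t*f6) (t*f7) (t*f8) (t*f9) (t*f10)"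

text \<open>A singular point would reduce to a singular point of the triangle, hence to a vertex.
  There two derivatives show that the two small coordinates are multiples of t; after division by t,
  the third then contradicts the unit coefficient of the cube at that vertex.\<close>

lemma nonsing_F: "nonsing F"
  unfolding nonsing_def
proof (intro allI impI, rule ccontr)
  fix v :: "'k geom vec" assume v: "v \<noteq> (0, 0, 0)" and none: "\<not> (\<exists>w. polar F v w \<noteq> 0)"
  obtain k where k: "k \<noteq> 0" "mat_all (\<lambda>a. a \<in> V) (scal k v)" "vmap \<rho> (scal k v) \<noteq> (0, 0, 0)" using normalise[OF v] .
  obtain x y z where xyz: "scal k v = (x, y, z)" by (cases "scal k v")
  have V: "x \<in> V" "y \<in> V" "z \<in> V" using k(2) xyz by simp_all
  have nz: "(\<rho> x, \<rho> y, \<rho> z) \<noteq> (0, 0, 0)" using k(3) unfolding xyz vmap.simps .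
  have p0: "polar F (x, y, z) w = 0" for w
  proof -
    have "polar F (scal k v) w = k^2 * polar F v w" by (rule polar_lin(2)) (simp add: F_def)
    moreover have "polar F v w = 0" using none by blast
    ultimately show ?thesis unfolding xyz by simp
  qed
  define A1 A2 A3 where "A1 = 3*f1*x^2 + 2*f2*x*y + 2*f3*x*z + f4*y^2 + f6*z^2"
    and "A2 = f2*x^2 + 2*f4*x*y + 3*f7*y^2 + 2*f8*y*z + f9*z^2" and "A3 = f3*x^2 + 2*f6*x*z + f8*y^2 + 2*f9*y*z + 3*f10*z^2"
  have AV: "A1 \<in> V" "A2 \<in> V" "A3 \<in> V" unfolding A1_def A2_def A3_def using V fV by simp_all
  have E: "t * A1 + e * y * z = 0" "t * A2 + e * x * z = 0" "t * A3 + e * x * y = 0"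
    using p0[of "(1, 0, 0)"] p0[of "(0, 1, 0)"] p0[of "(0, 0, 1)"] unfolding F_def polar_cub A1_def A2_def A3_def
    by (simp_all add: algebra_simps)
  have r0: "\<rho> C = 0" if "t * A + e * u * c = 0" "t * B + e * v * c = 0" "t * C + e * u * v = 0" "\<rho> c \<noteq> 0"
    "A \<in> V" "B \<in> V" "C \<in> V" "u \<in> V" "v \<in> V" "c \<in> V" for A B C u v c
  proof -
    define u' v' where "u' = - A / (e * c)" and "v' = - B / (e * c)"
    have UV: "u' \<in> V" "v' \<in> V" unfolding u'_def v'_def using that fV fu by simp_all
    have "e \<noteq> 0" "c \<noteq> 0" using fu that(4) by auto
    then have u: "u = t * u'" "v = t * v'" unfolding u'_def v'_def using that(1,2) by (simp_all add: field_simps add_eq_0_iff)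
    have "t * (C + e * t * u' * v') = 0" using that(3) unfolding u by (simp add: algebra_simps)
    then have "C = - (e * t * u' * v')" using t(3) by (simp add: add_eq_0_iff2)
    then show ?thesis using UV t fV by simp
  qed
  have "\<rho> (t * A1 + e * y * z) = 0" "\<rho> (t * A2 + e * x * z) = 0" "\<rho> (t * A3 + e * x * y) = 0" unfolding E by simp_all
  then have prods: "\<rho> y * \<rho> z = 0" "\<rho> x * \<rho> z = 0" "\<rho> x * \<rho> y = 0" using V fV fu t AV by simp_all
  then consider "\<rho> z \<noteq> 0" "\<rho> x = 0" "\<rho> y = 0" | "\<rho> y \<noteq> 0" "\<rho> x = 0" "\<rho> z = 0" | "\<rho> x \<noteq> 0" "\<rho> y = 0" "\<rho> z = 0"
    using nz by auto
  then show False
  proof cases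
    case 1
    have "\<rho> A3 = 0" by (rule r0[of A1 y z A2 x]) (use E 1 AV V in \<open>simp_all add: mult_ac\<close>)
    then show False unfolding A3_def using 1 V fV fu by simp
  next
    case 2
    have "\<rho> A2 = 0" by (rule r0[of A1 z y A3 x]) (use E 2 AV V in \<open>simp_all add: mult_ac\<close>)
    then show False unfolding A2_def using 2 V fV fu by simp
  next
    case 3
    have "\<rho> A1 = 0" by (rule r0[of A2 z x A3 y]) (use E 3 AV V in \<open>simp_all add: mult_ac\<close>)
    then show False unfolding A1_def using 3 V fV fu by simp
  qed
qed

text \<open>On the line x = al y + be z the cubic has the coefficients t W1, e al + t G1, e be + t
  G2 and t W2 at y^3, y^2 z, y z^2 and z^3.\<close>

definition "W1 al = f1*al^3 + f2*al^2 + f4*al + f7"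
definition "W2 be = f1*be^3 + f3*be^2 + f6*be + f10"
definition "G1 al be = 3*f1*al^2*be + 2*f2*al*be + f3*al^2 + f4*be + f8"
definition "G2 al be = 3*f1*al*be^2 + f2*be^2 + 2*f3*al*be + f6*al + f9"

text \<open>The cubic restricts to \<open>t c (y - a z)\<^sup>3\<close> on the line \<open>x = al y + be z\<close>.\<close>

definition axis_data :: "'k geom \<Rightarrow> 'k geom \<Rightarrow> 'k geom \<Rightarrow> 'k geom \<Rightarrow> bool" where
  "axis_data al be a c \<longleftrightarrow> al \<in> V \<and> be \<in> V \<and> a \<in> V \<and> c \<in> V \<and> \<rho> al = 0 \<and> \<rho> be = 0 \<and> \<rho> a \<noteq> 0 \<and> \<rho> c \<noteq> 0 \<and>
     c = W1 al \<and> W2 be = - c * a^3 \<and> e * al + t * G1 al be = - 3 * t * c * a \<and> e * be + t * G2 al be = 3 * t * c * a^2"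

definition axis :: "'k geom vec \<Rightarrow> bool" where
  "axis p \<longleftrightarrow> (\<exists>al be a c k. axis_data al be a c \<and> k \<noteq> 0 \<and> p = scal k (al * a + be, a, 1))"

lemma W_V: "al \<in> V \<Longrightarrow> W1 al \<in> V" "be \<in> V \<Longrightarrow> W2 be \<in> V" "al \<in> V \<Longrightarrow> be \<in> V \<Longrightarrow> G1 al be \<in> V"
  "al \<in> V \<Longrightarrow> be \<in> V \<Longrightarrow> G2 al be \<in> V"
  using fV by (simp_all add: W1_def W2_def G1_def G2_def)

text \<open>On the tangent the cubic is (n2 y + n3 z)^3. The outer coefficients are multiples of t,
  so \<open>n2\<close> and \<open>n3\<close> have residue 0; in the middle coefficients the unit
  \<open>e\<close> then forces residue 0 on \<open>al\<close> and \<open>be\<close>, that is, the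
  tangent reduces to x = 0.\<close>

lemma axisI:
  assumes p: "p \<noteq> (0, 0, 0)" and L: "dot (l1, l2, l3) p = 0" "dot N p = 0"
    and q: "\<And>q. dot (l1, l2, l3) q = 0 \<Longrightarrow> eval3 F q = dot N q ^ 3"
    and l: "l1 \<in> V" "l2 \<in> V" "l3 \<in> V" "\<rho> l1 \<noteq> 0"
  shows "axis p"
proof -
  define al be where "al = - l2 / l1" and "be = - l3 / l1"
  have V: "al \<in> V" "be \<in> V" unfolding al_def be_def using l by simp_all
  have l10: "l1 \<noteq> 0" using l(4) by auto
  have ll: "l1 * al = - l2" "l1 * be = - l3" using l10 by (simp_all add: al_def be_def)
  obtain N1 N2 N3 where N: "N = (N1, N2, N3)" by (cases N)
  define n2 n3 where "n2 = N1 * al + N2" and "n3 = N1 * be + N3"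
  have "(t * W1 al) * y^3 + (e * al + t * G1 al be) * y^2 * z + (e * be + t * G2 al be) * y * z^2 + (t * W2 be) * z^3 = (n2 * y + n3 * z)^3" for y z
  proof -
    have "l1 * (al * y + be * z) + l2 * y + l3 * z = (l1 * al + l2) * y + (l1 * be + l3) * z" by (simp add: algebra_simps)
    also have "\<dots> = 0" unfolding ll by simp
    finally have "eval3 F (al * y + be * z, y, z) = dot N (al * y + be * z, y, z) ^ 3" by (intro q) simp
    also have "dot N (al * y + be * z, y, z) = n2 * y + n3 * z" unfolding N n2_def n3_def by (simp add: algebra_simps)
    finally show ?thesis unfolding F_def eval3_cub W1_def W2_def G1_def G2_def by Groebner_Basis.algebra
  qed
  note c = cubic_coeffs[OF this]
  have nV: "n2 \<in> V" "n3 \<in> V" using power_in_V[of n2 3] power_in_V[of n3 3] W_V V t(1) unfolding c(1,4)[symmetric] by simp_all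
  have "\<rho> (n2^3) = 0" "\<rho> (n3^3) = 0" unfolding c(1,4)[symmetric] using W_V V t by simp_all
  then have rn: "\<rho> n2 = 0" "\<rho> n3 = 0" using nV by simp_all
  have "\<rho> (e * al + t * G1 al be) = 0" "\<rho> (e * be + t * G2 al be) = 0" unfolding c(2,3) using nV rn by simp_all
  then have ra: "\<rho> al = 0" "\<rho> be = 0" using V W_V t fV fu(1) by simp_all
  have rW: "\<rho> (W1 al) = \<rho> f7" "\<rho> (W2 be) = \<rho> f10" using V ra fV by (simp_all add: W1_def W2_def)
  then have W0: "W1 al \<noteq> 0" "W2 be \<noteq> 0" using fu by auto
  have "n2^3 \<noteq> 0" "n3^3 \<noteq> 0" unfolding c(1,4)[symmetric] using W0 t(3) by simp_all
  then have n0: "n2 \<noteq> 0" "n3 \<noteq> 0" by auto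
  define a where "a = - n3 / n2"
  have na: "n3 = - a * n2" using n0 by (simp add: a_def)
  have a3: "W2 be = - W1 al * a^3"
  proof -
    have "t * W2 be = t * (- W1 al * a^3)" using c(1,4) unfolding na by Groebner_Basis.algebra
    then show ?thesis by (rule cancelD[OF _ t(3)])
  qed
  have "a^3 = - W2 be / W1 al" using a3 W0 by simp
  then have "a^3 \<in> V" using V W_V rW fu by simp
  then have aV: "a \<in> V" by (rule power_in_V) simp
  have ra0: "\<rho> a \<noteq> 0" using arg_cong[OF a3, of \<rho>] rW fu aV W_V V by auto
  have "axis_data al be a (W1 al)" unfolding axis_data_def
  proof (intro conjI)
    show "e * al + t * G1 al be = - 3 * t * W1 al * a" unfolding c(2) na using c(1) by Groebner_Basis.algebra
    show "e * be + t * G2 al be = 3 * t * W1 al * a^2" unfolding c(3) na using c(1) by Groebner_Basis.algebra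
  qed (use V aV W_V ra ra0 rW fu a3 in simp_all)
  moreover have "\<exists>k. k \<noteq> 0 \<and> p = scal k (al * a + be, a, 1)"
  proof -
    obtain p1 p2 p3 where pp: "p = (p1, p2, p3)" by (cases p)
    have "l1 * p1 + l2 * p2 + l3 * p3 = 0" using L(1) unfolding pp by simp
    then have "l1 * (p1 - (al * p2 + be * p3)) = 0" using ll by Groebner_Basis.algebra
    then have p1: "p1 = al * p2 + be * p3" using l10 by simp
    have "N1 * p1 + N2 * p2 + N3 * p3 = 0" using L(2) unfolding pp N by simp
    then have "n2 * (p2 - a * p3) = 0" unfolding p1 using na n2_def n3_def by Groebner_Basis.algebra
    then have p2: "p2 = a * p3" using n0 by simp
    have "p3 \<noteq> 0" using p unfolding pp p1 p2 by auto
    then show ?thesis unfolding pp p1 p2 by (intro exI[of _ p3]) (simp add: algebra_simps)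
  qed
  ultimately show ?thesis unfolding axis_def by blast
qed

lemma axis_red:
  assumes "axis_data al be a c" "k \<noteq> 0" "p = scal k (al * a + be, a, 1)"
  shows "red_pt p (0, \<rho> a, 1)"
  unfolding red_pt_def
proof (intro exI conjI)
  have *: "scal (1 / k) p = (al * a + be, a, 1)" using assms(2) unfolding assms(3) by simp
  show "1 / k \<noteq> 0" using assms(2) by simp
  show "mat_all (\<lambda>a. a \<in> V) (scal (1 / k) p)" "vmap \<rho> (scal (1 / k) p) = (0, \<rho> a, 1)"
    unfolding * using assms(1) by (simp_all add: axis_data_def)
qed

text \<open>The reduced flexes on this side are zeros of f7 y^3 + f10 z^3, a form fixed by the
  regularity data at two vertices.\<close>

lemma axis_cube: assumes "axis_data al be a c" shows "\<rho> a ^ 3 = - \<rho> f10 / \<rho> f7"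
proof -
  have d: "al \<in> V" "be \<in> V" "a \<in> V" "\<rho> al = 0" "\<rho> be = 0" "W2 be = - W1 al * a^3" using assms by (simp_all add: axis_data_def)
  have "\<rho> (W2 be) = - \<rho> (W1 al) * \<rho> a^3" unfolding d(6) using d(1-5) W_V by simp
  moreover have "\<rho> (W1 al) = \<rho> f7" "\<rho> (W2 be) = \<rho> f10" using d(1-5) fV by (simp_all add: W1_def W2_def)
  ultimately show ?thesis using fu by (simp add: field_simps)
qed

text \<open>An argument in the manner of Hensel. Unless both vanish, divide by one of
  \<open>u\<close>, \<open>v\<close> that divides the other. A middle coefficient, where
  \<open>e\<close> is a unit, makes t (a1 - a2) over this difference a unit, while the outer
  coefficients show that the same quotient times 3 a1^2 has residue 0.\<close>

lemma axis_data_unique: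
  assumes d1: "axis_data al1 be1 a1 c1" and d2: "axis_data al2 be2 a2 c2" and r: "\<rho> a1 = \<rho> a2"
  shows "al1 = al2 \<and> be1 = be2 \<and> a1 = a2"
proof -
  have V: "al1 \<in> V" "be1 \<in> V" "a1 \<in> V" "c1 \<in> V" "al2 \<in> V" "be2 \<in> V" "a2 \<in> V" "c2 \<in> V"
    and R: "\<rho> al1 = 0" "\<rho> be1 = 0" "\<rho> al2 = 0" "\<rho> be2 = 0" "\<rho> a1 \<noteq> 0" "\<rho> c2 \<noteq> 0"
    and E1: "c1 = W1 al1" "c2 = W1 al2" and E4: "W2 be1 = - c1 * a1^3" "W2 be2 = - c2 * a2^3"
    and E2: "e * al1 + t * G1 al1 be1 = - 3 * t * c1 * a1" "e * al2 + t * G1 al2 be2 = - 3 * t * c2 * a2"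
    and E3: "e * be1 + t * G2 al1 be1 = 3 * t * c1 * a1^2" "e * be2 + t * G2 al2 be2 = 3 * t * c2 * a2^2"
    using d1 d2 unfolding axis_data_def by blast+
  define u v where "u = al1 - al2" and "v = be1 - be2"
  define q0 q2 where "q0 = f1*(al1^2 + al1*al2 + al2^2) + f2*(al1 + al2) + f4" and "q2 = f1*(be1^2 + be1*be2 + be2^2) + f3*(be1 + be2) + f6"
  define A B where "A = 3*f1*(al1 + al2)*be1 + 2*f2*be1 + f3*(al1 + al2)" and "B = 3*f1*al2^2 + 2*f2*al2 + f4"
  define C D where "C = 3*f1*be1^2 + 2*f3*be1 + f6" and "D = 3*f1*al2*(be1 + be2) + f2*(be1 + be2) + 2*f3*al2"
  have qV: "q0 \<in> V" "q2 \<in> V" "A \<in> V" "B \<in> V" "C \<in> V" "D \<in> V"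
    unfolding q0_def q2_def A_def B_def C_def D_def using V fV by simp_all
  have D1: "c1 - c2 = u * q0" unfolding E1 W1_def u_def q0_def by Groebner_Basis.algebra
  have D4: "c2 * a2^3 - c1 * a1^3 = v * q2"
  proof -
    have "c2 * a2^3 - c1 * a1^3 = W2 be1 - W2 be2" unfolding E4 by simp
    also have "\<dots> = v * q2" unfolding W2_def v_def q2_def by Groebner_Basis.algebra
    finally show ?thesis .
  qed
  have D2: "- 3 * t * (c1 * a1 - c2 * a2) = e * u + t * (u * A + v * B)"
  proof -
    have "G1 al1 be1 - G1 al2 be2 = u * A + v * B" unfolding G1_def u_def v_def A_def B_def by Groebner_Basis.algebra
    then show ?thesis using E2 unfolding u_def by Groebner_Basis.algebra
  qed
  have D3: "3 * t * (c1 * a1^2 - c2 * a2^2) = e * v + t * (u * C + v * D)"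
  proof -
    have "G2 al1 be1 - G2 al2 be2 = u * C + v * D" unfolding G2_def u_def v_def C_def D_def by Groebner_Basis.algebra
    then show ?thesis using E3 unfolding v_def by Groebner_Basis.algebra
  qed
  have uv: "u = 0 \<and> v = 0"
  proof (rule ccontr)
    assume "\<not> ?thesis"
    then have "(u \<noteq> 0 \<and> v / u \<in> V) \<or> (v \<noteq> 0 \<and> u / v \<in> V)" using V_total[of "v / u"] by auto
    then show False
    proof (elim disjE conjE)
      assume u: "u \<noteq> 0" "v / u \<in> V"
      define ka where "ka = v / u"
      have v: "v = ka * u" "ka \<in> V" using u by (simp_all add: ka_def)
      define d where "d = t / u * (c2 * (a1 - a2))"
      have ud: "u * d = t * (c2 * (a1 - a2))" using u(1) by (simp add: d_def)
      have "u * (3 * d) = u * (- (e + t * (A + ka * B)) - 3 * (t * q0 * a1))"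
        using D1 D2 ud unfolding v(1) by Groebner_Basis.algebra
      then have d: "3 * d = - (e + t * (A + ka * B)) - 3 * (t * q0 * a1)" by (rule cancelD[OF _ u(1)])
      then have d': "d = (- (e + t * (A + ka * B)) - 3 * (t * q0 * a1)) / 3" unfolding d[symmetric] by simp
      have dV: "d \<in> V" "\<rho> d \<noteq> 0" unfolding d' using V qV v(2) t fV fu by simp_all
      have "u * (d * (a1^2 + a1 * a2 + a2^2)) = u * (- (t * ka * q2) - t * q0 * a1^3)"
        using D1 D4 ud unfolding v(1) by Groebner_Basis.algebra
      then have "d * (a1^2 + a1 * a2 + a2^2) = - (t * ka * q2) - t * q0 * a1^3" by (rule cancelD[OF _ u(1)])
      from arg_cong[OF this, of \<rho>] have "\<rho> d * (\<rho> a1^2 + \<rho> a1 * \<rho> a2 + \<rho> a2^2) = 0" using dV V qV v(2) t by simp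
      then have "\<rho> d * (3 * \<rho> a1^2) = 0" unfolding r[symmetric] by (simp add: power2_eq_square)
      then show False using dV R(5) by simp
    next
      assume u: "v \<noteq> 0" "u / v \<in> V"
      define ka where "ka = u / v"
      have v: "u = ka * v" "ka \<in> V" using u by (simp_all add: ka_def)
      define d where "d = t / v * (c2 * (a1 - a2))"
      have ud: "v * d = t * (c2 * (a1 - a2))" using u(1) by (simp add: d_def)
      have "v * (3 * (d * (a1 + a2))) = v * (e + t * (ka * C + D) - 3 * (t * ka * q0 * a1^2))"
        using D1 D3 ud unfolding v(1) by Groebner_Basis.algebra
      then have d: "3 * (d * (a1 + a2)) = e + t * (ka * C + D) - 3 * (t * ka * q0 * a1^2)" by (rule cancelD[OF _ u(1)])
      have "\<rho> (a1 + a2) = 2 * \<rho> a1" using V r by simp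
      then have s: "\<rho> (3 * (a1 + a2)) \<noteq> 0" using V R(5) by simp
      then have "3 * (a1 + a2) \<noteq> 0" by auto
      then have d': "d = (e + t * (ka * C + D) - 3 * (t * ka * q0 * a1^2)) / (3 * (a1 + a2))"
        unfolding d[symmetric] mult.left_commute[of 3 d] by (rule nonzero_mult_div_cancel_right[symmetric])
      have dV: "d \<in> V" "\<rho> d \<noteq> 0" unfolding d' using s V qV v(2) t fV fu by simp_all
      have "v * (d * (a1^2 + a1 * a2 + a2^2)) = v * (- (t * q2) - t * ka * q0 * a1^3)"
        using D1 D4 ud unfolding v(1) by Groebner_Basis.algebra
      then have "d * (a1^2 + a1 * a2 + a2^2) = - (t * q2) - t * ka * q0 * a1^3" by (rule cancelD[OF _ u(1)])
      from arg_cong[OF this, of \<rho>] have "\<rho> d * (\<rho> a1^2 + \<rho> a1 * \<rho> a2 + \<rho> a2^2) = 0" using dV V qV v(2) t by simp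
      then have "\<rho> d * (3 * \<rho> a1^2) = 0" unfolding r[symmetric] by (simp add: power2_eq_square)
      then show False using dV R(5) by simp
    qed
  qed
  then have "c1 = c2" "t * (c1 * a1 - c2 * a2) = 0" using D1 D2 by simp_all
  moreover have "c2 \<noteq> 0" using R(6) by auto
  ultimately have "a1 = a2" using t(3) by simp
  then show ?thesis using uv by (simp add: u_def v_def)
qed

lemma axis_sep:
  assumes "axis p" "axis q" "red_pt p (0, a, 1)" "red_pt q (0, a, 1)" shows "\<not> nonprop p q"
proof -
  obtain al be b c k where p: "axis_data al be b c" "k \<noteq> 0" "p = scal k (al * b + be, b, 1)" using assms(1) unfolding axis_def by blast
  obtain al' be' b' c' k' where q: "axis_data al' be' b' c'" "k' \<noteq> 0" "q = scal k' (al' * b' + be', b', 1)" using assms(2) unfolding axis_def by blast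
  have "\<rho> b = \<rho> b'" using red_pt_axis_unique axis_red[OF p] axis_red[OF q] assms(3,4) by blast
  then have "al = al' \<and> be = be' \<and> b = b'" by (rule axis_data_unique[OF p(1) q(1)])
  then have "q = scal (k' / k) p" using p(2,3) q(3) by simp
  then show ?thesis unfolding nonprop_def by blast
qed

lemma axis_red_ex: "axis p \<Longrightarrow> \<exists>a. a \<noteq> 0 \<and> red_pt p (0, a, 1) \<and> a^3 = - \<rho> f10 / \<rho> f7"
  unfolding axis_def using axis_red axis_cube unfolding axis_data_def by metis

lemma axis_four:
  assumes "axis p1" "axis p2" "axis p3" "axis p4" "nonprop p1 p2" "nonprop p1 p3" "nonprop p1 p4" "nonprop p2 p3" "nonprop p2 p4" "nonprop p3 p4"
  shows False
proof -
  obtain a1 a2 a3 a4 where a: "red_pt p1 (0, a1, 1)" "a1^3 = - \<rho> f10 / \<rho> f7" "red_pt p2 (0, a2, 1)" "a2^3 = - \<rho> f10 / \<rho> f7"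
    "red_pt p3 (0, a3, 1)" "a3^3 = - \<rho> f10 / \<rho> f7" "red_pt p4 (0, a4, 1)" "a4^3 = - \<rho> f10 / \<rho> f7"
    using axis_red_ex assms(1-4) by metis
  have ne: "b \<noteq> b'" if "nonprop p q" "axis p" "axis q" "red_pt p (0, b, 1)" "red_pt q (0, b', 1)" for p q b b'
    using axis_sep that by blast
  have n: "a1 \<noteq> a2" "a1 \<noteq> a3" "a1 \<noteq> a4" "a2 \<noteq> a3" "a2 \<noteq> a4" "a3 \<noteq> a4"
    using ne[OF assms(5,1,2) a(1,3)] ne[OF assms(6,1,3) a(1,5)] ne[OF assms(7,1,4) a(1,7)]
      ne[OF assms(8,2,3) a(3,5)] ne[OF assms(9,2,4) a(3,7)] ne[OF assms(10,3,4) a(5,7)] by simp_all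
  show False by (rule four_cubes[of a1 a4 a2 a3]) (simp_all only: a(2,4,6,8) n not_False_eq_True)
qed

lemma F_rot: "subst3 rot' F = cub (t*f7) (t*f8) (t*f4) (t*f9) e (t*f2) (t*f10) (t*f6) (t*f3) (t*f1)"
  by (rule eval3_eqI) (simp add: F_def algebra_simps del: subst3.simps)

lemma triangle_rot: "triangle_cubic V \<rho> t f7 f8 f4 f9 e f2 f10 f6 f3 f1"
  by unfold_locales (use t fV fu in simp_all)

end

lemma three_cube_roots:
  fixes a b :: "'a::{alg_closed_field,field_char_0}"
  assumes "a \<noteq> 0" "b \<noteq> 0"
  obtains x y z where "a + b * x^3 = 0" "a + b * y^3 = 0" "a + b * z^3 = 0" "x \<noteq> y" "x \<noteq> z" "y \<noteq> z"
proof -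
  obtain x where "x^3 = - a / b" using nth_root_exists[of 3 "- a / b"] by auto
  then have x: "a + b * x^3 = 0" using assms by simp
  then have x0: "x \<noteq> 0" using assms by auto
  obtain w :: 'a where w: "w^3 = 1" "w \<noteq> 1" "w^2 \<noteq> 1" "w^2 \<noteq> w" by (rule omega_exists)
  have "(x * w)^3 = x^3" "(x * w^2)^3 = x^3" using w(1) by Groebner_Basis.algebra+
  then show ?thesis using that[of x "x * w" "x * w^2"] x x0 w by simp
qed

lemma nonprop_coords:
  fixes b :: "'a::field"
  shows "b \<noteq> b' \<Longrightarrow> nonprop (0, 1, b) (0, 1, b')" "b \<noteq> b' \<Longrightarrow> nonprop (b, 0, 1) (b', 0, 1)" "b \<noteq> b' \<Longrightarrow> nonprop (1, b, 0) (1, b', 0)"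
    "nonprop (0, 1, b) (b', 0, 1)" "nonprop (0, 1, b) (1, b', 0)" "nonprop (b, 0, 1) (1, b', 0)"
  by (auto simp: nonprop_def)

lemma vmap_rotv: "vmap f (rotv i v) = rotv i (vmap f v)" by (cases v) (simp add: rotv_def)

lemma mat_all_rotv: "mat_all P (rotv i v) \<longleftrightarrow> mat_all P v" by (cases v) (auto simp: rotv_def)

context place
begin

lemma row_red_dot:
  assumes X: "mat_all (\<lambda>a. a \<in> V) L" and p: "red_pt (rotv i p) r" "dot L p = 0"
  shows "dot (rotv i (vmap \<rho> L)) r = 0"
proof -
  obtain k where k: "mat_all (\<lambda>a. a \<in> V) (scal k (rotv i p))" "vmap \<rho> (scal k (rotv i p)) = r"
    using p(1) unfolding red_pt_def by blast
  have "dot (rotv i L) (scal k (rotv i p)) = 0" unfolding dot_scal dot_rotv p(2) by simp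
  moreover have "\<rho> (dot (rotv i L) (scal k (rotv i p))) = dot (vmap \<rho> (rotv i L)) r"
    using r_dot[of "rotv i L" "scal k (rotv i p)"] k X by (simp add: mat_all_rotv)
  ultimately show ?thesis by (simp add: vmap_rotv)
qed

text \<open>Two different points of a side determine it, so a line through two points with these
  reductions reduces to the side itself.\<close>

lemma row_red:
  assumes L: "L \<noteq> (0, 0, 0)" "dot L p = 0" "dot L q = 0"
    and r: "red_pt (rotv i p) (0, a, 1)" "red_pt (rotv i q) (0, b, 1)" "a \<noteq> b"
  obtains k u where "k \<noteq> 0" "u \<noteq> 0" "mat_all (\<lambda>a. a \<in> V) (scal k L)" "rotv i (vmap \<rho> (scal k L)) = (u, 0, 0)"
proof -
  obtain k where k: "k \<noteq> 0" "mat_all (\<lambda>a. a \<in> V) (scal k L)" "vmap \<rho> (scal k L) \<noteq> (0, 0, 0)" using normalise[OF L(1)] .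
  obtain u v w where uvw: "rotv i (vmap \<rho> (scal k L)) = (u, v, w)" by (cases "rotv i (vmap \<rho> (scal k L))")
  have "dot (scal k L) p = 0" "dot (scal k L) q = 0" using L by (simp_all add: dot_scal_left)
  then have e: "v * a + w = 0" "v * b + w = 0"
    using row_red_dot[OF k(2) r(1)] row_red_dot[OF k(2) r(2)] unfolding uvw by simp_all
  have "v * (a - b) = (v * a + w) - (v * b + w)" by (simp add: algebra_simps)
  then have "v * (a - b) = 0" unfolding e by simp
  then have v: "v = 0" "w = 0" using r(3) e by simp_all
  have "u \<noteq> 0"
  proof
    assume "u = 0"
    then have "rotv i (vmap \<rho> (scal k L)) = rotv i (0, 0, 0)" unfolding uvw v by (simp add: rotv_def)
    then show False using k(3) unfolding rotv_inj by blast
  qed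
  then show ?thesis using that k(1,2) uvw v by blast
qed

text \<open>The condition \<open>a \<noteq> 0\<close> places the reduced point in the interior of
  its side, away from the vertices, and interior points lie on no other side.\<close>

lemma row_type:
  assumes "mat_all (\<lambda>a. a \<in> V) L" "rotv i (vmap \<rho> L) = (u, 0, 0)" "u \<noteq> 0" "i < 3" "j < 3"
    and "red_pt (rotv j p) (0, a, 1)" "a \<noteq> 0" "dot L p = 0"
  shows "j = i"
proof -
  obtain x y z where v: "vmap \<rho> L = (x, y, z)" by (cases "vmap \<rho> L")
  have "dot (rotv j (x, y, z)) (0, a, 1) = 0" using row_red_dot[OF assms(1,6,8)] unfolding v .
  then show ?thesis using assms(2-5,7) unfolding v less3_cases by (elim disjE) auto
qed

end

context triangle_cubic
begin

text \<open>\<open>T i p\<close> records that the tangent at \<open>p\<close> reduces to the side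
  numbered \<open>i\<close>. The sides are handled by the same locale with rotated coefficients, and
  the four properties are the interface for the combinatorial argument.\<close>

lemma flex_types:
  obtains T :: "nat \<Rightarrow> 'k geom vec \<Rightarrow> bool" where
    "\<And>p. flex F p \<Longrightarrow> \<exists>i<3. T i p"
    "\<And>i p. i < 3 \<Longrightarrow> T i p \<Longrightarrow> \<exists>a. a \<noteq> 0 \<and> red_pt (rotv i p) (0, a, 1)"
    "\<And>i p q a. i < 3 \<Longrightarrow> T i p \<Longrightarrow> T i q \<Longrightarrow> nonprop p q \<Longrightarrow> red_pt (rotv i p) (0, a, 1) \<Longrightarrow> \<not> red_pt (rotv i q) (0, a, 1)"
    "\<And>i p1 p2 p3 p4. i < 3 \<Longrightarrow> T i p1 \<Longrightarrow> T i p2 \<Longrightarrow> T i p3 \<Longrightarrow> nonprop p1 p2 \<Longrightarrow> nonprop p1 p3 \<Longrightarrow> nonprop p2 p3 \<Longrightarrow>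
      nonprop p1 p4 \<Longrightarrow> nonprop p2 p4 \<Longrightarrow> nonprop p3 p4 \<Longrightarrow> \<not> T i p4"
proof -
  interpret R1: triangle_cubic V \<rho> t f7 f8 f4 f9 e f2 f10 f6 f3 f1 by (rule triangle_rot)
  interpret R2: triangle_cubic V \<rho> t f10 f6 f9 f3 e f8 f1 f2 f4 f7 by (rule R1.triangle_rot)
  have F1: "R1.F = subst3 rot' F" unfolding F_rot R1.F_def ..
  have F2: "R2.F = subst3 rot' R1.F" unfolding R1.F_rot R2.F_def ..
  define T where "T i p = (if i = 0 then axis p else if i = 1 then R1.axis (rotv 1 p) else R2.axis (rotv 2 p))" for i :: nat and p
  have T: "T 0 p = axis (rotv 0 p)" "T (Suc 0) p = R1.axis (rotv (Suc 0) p)" "T 2 p = R2.axis (rotv 2 p)" for p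
    by (simp_all add: T_def)
  show ?thesis
  proof (rule that[of T])
    fix p assume "flex F p"
    then obtain L N where L: "p \<noteq> (0, 0, 0)" "L \<noteq> (0, 0, 0)" "dot L p = 0" "dot N p = 0" "\<And>q. dot L q = 0 \<Longrightarrow> eval3 F q = dot N q ^ 3"
      unfolding flex_def by blast
    obtain k where k: "k \<noteq> 0" "mat_all (\<lambda>a. a \<in> V) (scal k L)" "vmap \<rho> (scal k L) \<noteq> (0, 0, 0)" using normalise[OF L(2)] .
    obtain l1 l2 l3 where l: "scal k L = (l1, l2, l3)" by (cases "scal k L")
    have q: "eval3 F q = dot N q ^ 3" if "dot (l1, l2, l3) q = 0" for q
      using L(5)[of q] that k(1) unfolding l[symmetric] dot_scal_left by simp
    have lp: "dot (l1, l2, l3) p = 0" unfolding l[symmetric] dot_scal_left L(3) by simp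
    have V: "l1 \<in> V" "l2 \<in> V" "l3 \<in> V" using k(2) unfolding l by simp_all
    obtain x y z where p: "p = (x, y, z)" by (cases p)
    obtain N1 N2 N3 where N: "N = (N1, N2, N3)" by (cases N)
    have Np: "N1 * x + N2 * y + N3 * z = 0" and Lp: "l1 * x + l2 * y + l3 * z = 0" using L(4) lp unfolding p N by simp_all
    consider "\<rho> l1 \<noteq> 0" | "\<rho> l2 \<noteq> 0" | "\<rho> l3 \<noteq> 0" using k(3) unfolding l by auto
    then show "\<exists>i<3. T i p"
    proof cases
      case 1
      have "axis p" by (rule axisI[OF L(1) lp L(4) q V 1])
      then show ?thesis by (intro exI[of _ 0]) (simp add: T)
    next
      case 2
      have "R1.axis (y, z, x)"
      proof (rule R1.axisI[of _ l2 l3 l1 "(N2, N3, N1)"])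
        show "eval3 R1.F v = dot (N2, N3, N1) v ^ 3" if v: "dot (l2, l3, l1) v = 0" for v
        proof -
          obtain a b c where abc: "v = (a, b, c)" by (cases v)
          have "dot (l1, l2, l3) (c, a, b) = 0" using v unfolding abc by (simp add: add_ac)
          from q[OF this] show ?thesis unfolding F1 eval3_subst abc N by (simp add: add_ac)
        qed
      qed (use L(1) p Np Lp V 2 in \<open>auto simp: add_ac\<close>)
      then show ?thesis by (intro exI[of _ "Suc 0"]) (simp add: T p)
    next
      case 3
      have "R2.axis (z, x, y)"
      proof (rule R2.axisI[of _ l3 l1 l2 "(N3, N1, N2)"])
        show "eval3 R2.F v = dot (N3, N1, N2) v ^ 3" if v: "dot (l3, l1, l2) v = 0" for v
        proof -
          obtain a b c where abc: "v = (a, b, c)" by (cases v)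
          have "dot (l1, l2, l3) (b, c, a) = 0" using v unfolding abc by (simp add: add_ac)
          from q[OF this] show ?thesis unfolding F2 F1 eval3_subst abc N by (simp add: add_ac)
        qed
      qed (use L(1) p Np Lp V 3 in \<open>auto simp: add_ac\<close>)
      then show ?thesis by (intro exI[of _ 2]) (simp add: T p)
    qed
  next
    fix i p assume "i < (3::nat)" "T i p"
    then show "\<exists>a. a \<noteq> 0 \<and> red_pt (rotv i p) (0, a, 1)" unfolding less3_cases
    proof (elim disjE)
      assume "T i p" "i = 0" then show ?thesis using axis_red_ex[of "rotv 0 p"] T(1)[of p] by blast
    next
      assume "T i p" "i = Suc 0" then show ?thesis using R1.axis_red_ex[of "rotv (Suc 0) p"] T(2)[of p] by blast
    next
      assume "T i p" "i = 2" then show ?thesis using R2.axis_red_ex[of "rotv 2 p"] T(3)[of p] by blast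
    qed
  next
    fix i p q a assume h: "i < (3::nat)" "T i p" "T i q" "nonprop p q" "red_pt (rotv i p) (0, a, 1)"
    show "\<not> red_pt (rotv i q) (0, a, 1)"
      using h(1) unfolding less3_cases
    proof (elim disjE)
      assume i: "i = 0" show ?thesis using axis_sep[of "rotv 0 p" "rotv 0 q" a] h(2-5) unfolding i T nonprop_rotv by blast
    next
      assume i: "i = Suc 0" show ?thesis using R1.axis_sep[of "rotv (Suc 0) p" "rotv (Suc 0) q" a] h(2-5) unfolding i T nonprop_rotv by blast
    next
      assume i: "i = 2" show ?thesis using R2.axis_sep[of "rotv 2 p" "rotv 2 q" a] h(2-5) unfolding i T nonprop_rotv by blast
    qed
  next
    fix i p1 p2 p3 p4 assume i3: "i < (3::nat)" and h: "T i p1" "T i p2" "T i p3" "nonprop p1 p2" "nonprop p1 p3" "nonprop p2 p3"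
      "nonprop p1 p4" "nonprop p2 p4" "nonprop p3 p4"
    show "\<not> T i p4"
      using i3 unfolding less3_cases
    proof (elim disjE)
      assume i: "i = 0" show ?thesis
        using axis_four[of "rotv 0 p1" "rotv 0 p2" "rotv 0 p3" "rotv 0 p4"] h unfolding i T nonprop_rotv by blast
    next
      assume i: "i = Suc 0" show ?thesis
        using R1.axis_four[of "rotv (Suc 0) p1" "rotv (Suc 0) p2" "rotv (Suc 0) p3" "rotv (Suc 0) p4"] h unfolding i T nonprop_rotv by blast
    next
      assume i: "i = 2" show ?thesis
        using R2.axis_four[of "rotv 2 p1" "rotv 2 p2" "rotv 2 p3" "rotv 2 p4"] h unfolding i T nonprop_rotv by blast
    qed
  qed
qed

text \<open>Each side of the triangle receives three flexes, so two of any four flexes reduce to the same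
  side.  In a diagonal form in which those two lie on \<open>x = 0\<close>, the nine flexes are sorted by the
  coordinate lines of the diagonal form, and these lines therefore reduce to the three sides.\<close>

lemma hesse_reduction:
  obtains A B s k where "vmono A" "vmono B" "s \<in> V" "\<rho> s = 0" "s \<noteq> 0" "k \<noteq> 0"
    "subst3 B (subst3 A F) = const3 k * hesse s"
proof -
  obtain T where T1: "\<And>p. flex F p \<Longrightarrow> \<exists>i<3. T i p"
    and T2: "\<And>i p. i < 3 \<Longrightarrow> T i p \<Longrightarrow> \<exists>a. a \<noteq> 0 \<and> red_pt (rotv i p) (0, a, 1)"
    and T3: "\<And>i p q a. i < 3 \<Longrightarrow> T i p \<Longrightarrow> T i q \<Longrightarrow> nonprop p q \<Longrightarrow> red_pt (rotv i p) (0, a, 1) \<Longrightarrow> \<not> red_pt (rotv i q) (0, a, 1)"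
    and T4: "\<And>i p1 p2 p3 p4. i < 3 \<Longrightarrow> T i p1 \<Longrightarrow> T i p2 \<Longrightarrow> T i p3 \<Longrightarrow> nonprop p1 p2 \<Longrightarrow> nonprop p1 p3 \<Longrightarrow> nonprop p2 p3 \<Longrightarrow>
      nonprop p1 p4 \<Longrightarrow> nonprop p2 p4 \<Longrightarrow> nonprop p3 p4 \<Longrightarrow> \<not> T i p4"
    by (rule flex_types) blast
  have fF: "form3 3 F" by (simp add: F_def)
  have "t * f1 \<noteq> 0" using t(3) fu(2) by auto
  then obtain p0 where p0: "flex F p0" using flex_exists nonsing_F unfolding F_def by blast
  obtain p1 where p1: "flex F p1" "\<And>k. p1 \<noteq> scal k p0" using second_flex[OF fF nonsing_F p0] by blast
  \<comment> \<open>Pigeonhole: four different flexes, three sides.\<close>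
  have "\<exists>p q i. flex F p \<and> flex F q \<and> nonprop p q \<and> i < 3 \<and> T i p \<and> T i q"
  proof -
    obtain M M' e1 e2 e3 mu where M: "lininv M M'" "subst3 M F = diag_cubic e1 e2 e3 mu" and e: "e1 \<noteq> 0" "e2 \<noteq> 0" "e3 \<noteq> 0"
      by (rule diag_form[OF fF nonsing_F p0 p1])
    have fl: "flex F (app M q)" if "flex (diag_cubic e1 e2 e3 mu) q" for q
      using that unfolding M(2)[symmetric] flex_subst[OF M(1)] .
    obtain b1 b2 b3 where b: "e2 + e3 * b1^3 = 0" "e2 + e3 * b2^3 = 0" "e2 + e3 * b3^3 = 0" "b1 \<noteq> b2" "b1 \<noteq> b3" "b2 \<noteq> b3"
      using three_cube_roots[OF e(2,3)] .
    obtain c where c: "e3 + e1 * c^3 = 0" using three_cube_roots[OF e(3,1)] .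
    define q1 q2 q3 q4 where "q1 = app M (0, 1, b1)" and "q2 = app M (0, 1, b2)" and "q3 = app M (0, 1, b3)" and "q4 = app M (c, 0, 1)"
    have fq: "flex F q1" "flex F q2" "flex F q3" "flex F q4" unfolding q1_def q2_def q3_def q4_def
      using fl diag_flexes[OF e] b c by blast+
    have n: "nonprop q1 q2" "nonprop q1 q3" "nonprop q1 q4" "nonprop q2 q3" "nonprop q2 q4" "nonprop q3 q4"
      unfolding q1_def q2_def q3_def q4_def
      by (rule nonprop_app[OF M(1) nonprop_coords(1)[OF b(4)]] nonprop_app[OF M(1) nonprop_coords(1)[OF b(5)]]
        nonprop_app[OF M(1) nonprop_coords(1)[OF b(6)]] nonprop_app[OF M(1) nonprop_coords(4)])+
    obtain i1 i2 i3 i4 where i: "i1 < 3" "T i1 q1" "i2 < 3" "T i2 q2" "i3 < 3" "T i3 q3" "i4 < 3" "T i4 q4"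
      using T1[OF fq(1)] T1[OF fq(2)] T1[OF fq(3)] T1[OF fq(4)] by blast
    have "i1 = i2 \<or> i1 = i3 \<or> i1 = i4 \<or> i2 = i3 \<or> i2 = i4 \<or> i3 = i4" using i(1,3,5,7) by linarith
    then show ?thesis using i fq n by blast
  qed
  then obtain p q i where pq: "flex F p" "flex F q" "nonprop p q" and i: "i < 3" "T i p" "T i q" by blast
  have npq: "q \<noteq> scal k p" for k using pq(3) unfolding nonprop_def by blast
  obtain M M' e1 e2 e3 mu where M: "lininv M M'" "subst3 M F = diag_cubic e1 e2 e3 mu" and e: "e1 \<noteq> 0" "e2 \<noteq> 0" "e3 \<noteq> 0"
    and pq0: "fst (app M' p) = 0" "fst (app M' q) = 0"
    by (rule diag_form[OF fF nonsing_F pq(1,2) npq])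
  obtain Lx Ly Lz where M': "M' = (Lx, Ly, Lz)" by (cases M')
  have rows: "dot Lx (app M (x, y, z)) = x" "dot Ly (app M (x, y, z)) = y" "dot Lz (app M (x, y, z)) = z" for x y z
    using lininvD(2)[OF M(1), of "(x, y, z)"] unfolding M' by simp_all
  have d0: "dot (0, 0, 0) v = 0" for v :: "'k geom vec" by (cases v) simp
  have Lnz: "Lx \<noteq> (0, 0, 0)" "Ly \<noteq> (0, 0, 0)" "Lz \<noteq> (0, 0, 0)"
    using rows(1)[of 1 0 0] rows(2)[of 0 1 0] rows(3)[of 0 0 1] d0 by (metis zero_neq_one)+
  have fl: "flex F (app M q)" if "flex (diag_cubic e1 e2 e3 mu) q" for q
    using that unfolding M(2)[symmetric] flex_subst[OF M(1)] .
  obtain b1 b2 b3 where b: "e2 + e3 * b1^3 = 0" "e2 + e3 * b2^3 = 0" "e2 + e3 * b3^3 = 0" "b1 \<noteq> b2" "b1 \<noteq> b3" "b2 \<noteq> b3"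
    using three_cube_roots[OF e(2,3)] .
  obtain c1 c2 c3 where c: "e3 + e1 * c1^3 = 0" "e3 + e1 * c2^3 = 0" "e3 + e1 * c3^3 = 0" "c1 \<noteq> c2" "c1 \<noteq> c3" "c2 \<noteq> c3"
    using three_cube_roots[OF e(3,1)] .
  obtain h1 h2 where h: "e1 + e2 * h1^3 = 0" "e1 + e2 * h2^3 = 0" "h1 \<noteq> h2" using three_cube_roots[OF e(1,2)] .
  define P Q R where "P b = app M (0, 1, b)" and "Q c = app M (c, 0, 1)" and "R h = app M (1, h, 0)" for b c h
  have fP: "flex F (P b1)" "flex F (P b2)" "flex F (P b3)" and fQ: "flex F (Q c1)" "flex F (Q c2)" "flex F (Q c3)"
    and fR: "flex F (R h1)" "flex F (R h2)"
    unfolding P_def Q_def R_def using fl diag_flexes[OF e] b c h by blast+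
  have nP: "nonprop (P b) (P b')" if "b \<noteq> b'" for b b' unfolding P_def by (rule nonprop_app[OF M(1) nonprop_coords(1)[OF that]])
  have nQ: "nonprop (Q b) (Q b')" if "b \<noteq> b'" for b b' unfolding Q_def by (rule nonprop_app[OF M(1) nonprop_coords(2)[OF that]])
  have nR: "nonprop (R b) (R b')" if "b \<noteq> b'" for b b' unfolding R_def by (rule nonprop_app[OF M(1) nonprop_coords(3)[OF that]])
  have nPQ: "nonprop (P b) (Q c)" and nPR: "nonprop (P b) (R c)" and nQR: "nonprop (Q b) (R c)" for b c
    unfolding P_def Q_def R_def
    by (rule nonprop_app[OF M(1) nonprop_coords(4)] nonprop_app[OF M(1) nonprop_coords(5)] nonprop_app[OF M(1) nonprop_coords(6)])+
  have dP: "dot Lx (P b) = 0" and dQ: "dot Ly (Q b) = 0" and dR: "dot Lz (R b) = 0" for b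
    unfolding P_def Q_def R_def rows by simp_all
  have rowE: "\<exists>k u. k \<noteq> 0 \<and> u \<noteq> 0 \<and> mat_all (\<lambda>a. a \<in> V) (scal k L) \<and> rotv j (vmap \<rho> (scal k L)) = (u, 0, 0)"
    if hyp: "L \<noteq> (0, 0, 0)" "dot L v = 0" "dot L w = 0" "j < 3" "T j v" "T j w" "nonprop v w" for L v w j
  proof -
    obtain a a' where a: "red_pt (rotv j v) (0, a, 1)" "red_pt (rotv j w) (0, a', 1)" 
      using T2[OF hyp(4,5)] T2[OF hyp(4,6)] by blast
    then have "a \<noteq> a'" using T3[OF hyp(4-7) a(1)] by auto
    then show ?thesis using row_red[OF hyp(1,2,3) a] by metis
  qed
  have line_type: "T j v" if hyp: "k \<noteq> 0" "u \<noteq> 0" "mat_all (\<lambda>a. a \<in> V) (scal k L)" "rotv j (vmap \<rho> (scal k L)) = (u, 0, 0)" "j < 3" "flex F v" "dot L v = 0" for k u L j v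
  proof -
    obtain l where l: "l < 3" "T l v" using T1[OF hyp(6)] by blast
    obtain a where "a \<noteq> 0" "red_pt (rotv l v) (0, a, 1)" using T2[OF l] by blast
    then have "l = j" using row_type[OF hyp(3,4,2,5) l(1)] hyp(7) by (simp add: dot_scal_left)
    then show ?thesis using l by simp
  qed
  have "dot Lx p = 0" "dot Lx q = 0" using pq0 unfolding M' by simp_all
  then obtain kx ux where kx: "kx \<noteq> 0" "ux \<noteq> 0" "mat_all (\<lambda>a. a \<in> V) (scal kx Lx)" "rotv i (vmap \<rho> (scal kx Lx)) = (ux, 0, 0)"
    using rowE[OF Lnz(1) _ _ i pq(3)] by blast
  have TP: "T i (P b1)" "T i (P b2)" "T i (P b3)" using line_type[OF kx i(1)] fP dP by blast+
  \<comment> \<open>The side \<open>i\<close> is exhausted by the three flexes on x = 0, so flexes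
    on the other coordinate lines go to other sides.\<close>
  have noti: "\<not> T i v" if "nonprop (P b1) v" "nonprop (P b2) v" "nonprop (P b3) v" for v
    by (rule T4[OF i(1) TP nP[OF b(4)] nP[OF b(5)] nP[OF b(6)] that])
  obtain j1 j2 j3 where j123: "j1 < 3" "T j1 (Q c1)" "j2 < 3" "T j2 (Q c2)" "j3 < 3" "T j3 (Q c3)"
    using T1[OF fQ(1)] T1[OF fQ(2)] T1[OF fQ(3)] by blast
  have "j1 \<noteq> i" "j2 \<noteq> i" "j3 \<noteq> i" using j123 noti[OF nPQ nPQ nPQ] by auto
  \<comment> \<open>Three flexes on y = 0 and two sides left: two of them share a side, and y
    therefore reduces to it.\<close>
  then have "j1 = j2 \<or> j1 = j3 \<or> j2 = j3" using j123(1,3,5) i(1) by linarith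
  then have "\<exists>v w j. dot Ly v = 0 \<and> dot Ly w = 0 \<and> j < 3 \<and> j \<noteq> i \<and> T j v \<and> T j w \<and> nonprop v w"
    using j123 dQ nQ c(4-6) \<open>j1 \<noteq> i\<close> \<open>j2 \<noteq> i\<close> by blast
  then obtain v w j where j: "dot Ly v = 0" "dot Ly w = 0" "j < 3" "T j v" "T j w" "nonprop v w" and ji: "j \<noteq> i" by blast
  obtain ky uy where ky: "ky \<noteq> 0" "uy \<noteq> 0" "mat_all (\<lambda>a. a \<in> V) (scal ky Ly)" "rotv j (vmap \<rho> (scal ky Ly)) = (uy, 0, 0)"
    using rowE[OF Lnz(2) j] by blast
  have TQ: "T j (Q c1)" "T j (Q c2)" "T j (Q c3)" using line_type[OF ky j(3)] fQ dQ by blast+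
  have notj: "\<not> T j v" if "nonprop (Q c1) v" "nonprop (Q c2) v" "nonprop (Q c3) v" for v
    by (rule T4[OF j(3) TQ nQ[OF c(4)] nQ[OF c(5)] nQ[OF c(6)] that])
  obtain l1 l2 where l12: "l1 < 3" "T l1 (R h1)" "l2 < 3" "T l2 (R h2)" using T1[OF fR(1)] T1[OF fR(2)] by blast
  have li: "l1 \<noteq> i" "l2 \<noteq> i" "l1 \<noteq> j" "l2 \<noteq> j"
    using l12 noti[OF nPR nPR nPR] notj[OF nQR nQR nQR] by auto
  then have "l2 = l1" using l12(1,3) i(1) j(3) ji by linarith
  then obtain kz uz where kz: "kz \<noteq> 0" "uz \<noteq> 0" "mat_all (\<lambda>a. a \<in> V) (scal kz Lz)" "rotv l1 (vmap \<rho> (scal kz Lz)) = (uz, 0, 0)"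
    using rowE[OF Lnz(3) dR dR l12(1,2) _ nR[OF h(3)]] l12(4) by blast
  \<comment> \<open>The coordinate forms of the diagonal cubic, scaled to be integral. They reduce
    to three different sides, which makes the matrix monomial modulo the maximal ideal.\<close>
  define A where "A = (scal kx Lx, scal ky Ly, scal kz Lz)"
  have vA: "vmono A" unfolding vmono_def
  proof
    show "VM A" unfolding A_def VM_simp using kx ky kz by blast
    obtain x1 x2 x3 y1 y2 y3 z1 z2 z3 where v: "vmap \<rho> (scal kx Lx) = (x1, x2, x3)" "vmap \<rho> (scal ky Ly) = (y1, y2, y3)"
      "vmap \<rho> (scal kz Lz) = (z1, z2, z3)" by (meson prod_cases3)
    have i': "i = 0 \<or> i = Suc 0 \<or> i = 2" "j = 0 \<or> j = Suc 0 \<or> j = 2" "l1 = 0 \<or> l1 = Suc 0 \<or> l1 = 2"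
      using i(1) j(3) l12(1) by auto
    show "monomial_mat (rmat A)" unfolding A_def rmat_simp v
      using i' kx(2,4) ky(2,4) kz(2,4) ji li(1,3) unfolding v by (elim disjE) (auto intro: monomial_matI)
  qed
  note mA = vmono_minv[OF vA]
  define E1 E2 E3 m where "E1 = e1 / kx^3" and "E2 = e2 / ky^3" and "E3 = e3 / kz^3" and "m = mu / (kx * ky * kz)"
  have E0: "E1 \<noteq> 0" "E2 \<noteq> 0" "E3 \<noteq> 0" unfolding E1_def E2_def E3_def using e kx ky kz by simp_all
  have FD: "F = subst3 A (diag_cubic E1 E2 E3 m)"
  proof (rule eval3_eqI)
    fix x y z
    have ke: "E1 * kx^3 = e1" "E2 * ky^3 = e2" "E3 * kz^3 = e3" "m * (kx * ky * kz) = mu"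
      unfolding E1_def E2_def E3_def m_def using kx ky kz by simp_all
    have "eval3 F (x, y, z) = eval3 (subst3 M' (subst3 M F)) (x, y, z)" by (simp only: subst_subst[OF lininv_sym[OF M(1)]])
    also have "\<dots> = eval3 (diag_cubic e1 e2 e3 mu) (dot Lx (x, y, z), dot Ly (x, y, z), dot Lz (x, y, z))"
      unfolding M(2) eval3_subst M' app.simps ..
    also have "\<dots> = eval3 (diag_cubic E1 E2 E3 m) (kx * dot Lx (x, y, z), ky * dot Ly (x, y, z), kz * dot Lz (x, y, z))"
      unfolding eval3_diag ke[symmetric] by (simp add: power_mult_distrib mult_ac)
    finally show "eval3 F (x, y, z) = eval3 (subst3 A (diag_cubic E1 E2 E3 m)) (x, y, z)"
      unfolding eval3_subst A_def app.simps dot_scal_left .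
  qed
  then have D: "subst3 (minv A) F = diag_cubic E1 E2 E3 m" by (simp only: subst_subst[OF lininv_sym[OF mA(1)]])
  have VF: "VG F" "red F = mono3 (\<rho> e) 1 1 1"
    using VG_cub[of "t*f1" "t*f2" "t*f3" "t*f4" e "t*f6" "t*f7" "t*f8" "t*f9" "t*f10"] t fV unfolding F_def by (simp_all add: cub_mono3)
  have mm: "monomial_mat (rmat (minv A))" "VM (minv A)" using mA(2) by (simp_all add: vmono_def)
  obtain ee where ee: "ee \<noteq> 0" "subst3 (rmat (minv A)) (mono3 1 1 1 1) = mono3 ee 1 1 1" using monomial_xyz[OF mm(1)] .
  have VD: "VG (diag_cubic E1 E2 E3 m)" "red (diag_cubic E1 E2 E3 m) = subst3 (rmat (minv A)) (mono3 (\<rho> e) 1 1 1)"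
    using VG_subst[OF fF VF(1) mm(2)] unfolding D VF(2) by simp_all
  have "mono3 (\<rho> e) 1 1 1 = const3 (\<rho> e) * mono3 1 1 1 1" by (rule eval3_eqI) simp
  then have "red (diag_cubic E1 E2 E3 m) = const3 (\<rho> e) * mono3 ee 1 1 1" unfolding VD(2) by (simp only: subst_mult subst_const3 ee(2))
  also have "\<dots> = mono3 (\<rho> e * ee) 1 1 1" by (rule eval3_eqI) simp
  finally have rD: "red (diag_cubic E1 E2 E3 m) = mono3 (\<rho> e * ee) 1 1 1" .
  have EV: "E1 \<in> V" "m \<in> V" using VD(1)[unfolded VG_def diag_cubic_def, rule_format, of 3 0 0]
      VD(1)[unfolded VG_def diag_cubic_def, rule_format, of 1 1 1] by simp_all
  have rE: "\<rho> E1 = 0" "\<rho> m \<noteq> 0" using arg_cong[OF rD, of "\<lambda>G. coeff3 G 3 0 0"] arg_cong[OF rD, of "\<lambda>G. coeff3 G 1 1 1"] fu(1) ee(1)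
    by (simp_all add: diag_cubic_def)
  \<comment> \<open>A flex reduces to the interior of its side, so forms that reduce to the other
    two sides take unit values there.\<close>
  have unit: "\<exists>k. k \<noteq> 0 \<and> dot (scal kl L) (scal k v) \<in> V \<and> \<rho> (dot (scal kl L) (scal k v)) \<noteq> 0 \<and> dot (scal kl' L') (scal k v) \<in> V \<and> \<rho> (dot (scal kl' L') (scal k v)) \<noteq> 0"
    if hyp: "T n v" "n < 3" "mat_all (\<lambda>a. a \<in> V) (scal kl L)" "rotv r (vmap \<rho> (scal kl L)) = (u, 0, 0)" "u \<noteq> 0" "r < 3" "r \<noteq> n"
      "mat_all (\<lambda>a. a \<in> V) (scal kl' L')" "rotv r' (vmap \<rho> (scal kl' L')) = (u', 0, 0)" "u' \<noteq> 0" "r' < 3" "r' \<noteq> n"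
    for n v kl L r u kl' L' r' u'
  proof -
    obtain a where a: "a \<noteq> 0" "red_pt (rotv n v) (0, a, 1)" using T2[OF hyp(2,1)] by blast
    then obtain k where k: "k \<noteq> 0" "mat_all (\<lambda>a. a \<in> V) (scal k (rotv n v))" "vmap \<rho> (scal k (rotv n v)) = (0, a, 1)" unfolding red_pt_def by blast
    have kv: "mat_all (\<lambda>a. a \<in> V) (scal k v)" "rotv n (vmap \<rho> (scal k v)) = (0, a, 1)"
      using k unfolding rotv_scal[symmetric] mat_all_rotv vmap_rotv by simp_all
    obtain x y z where xyz: "vmap \<rho> (scal k v) = (x, y, z)" by (cases "vmap \<rho> (scal k v)")
    have *: "dot L (scal k v) \<in> V \<and> \<rho> (dot L (scal k v)) \<noteq> 0"
      if L: "mat_all (\<lambda>a. a \<in> V) L" "rotv r (vmap \<rho> L) = (u, 0, 0)" "u \<noteq> 0" "r < 3" "r \<noteq> n" for L r u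
    proof -
      obtain a1 a2 a3 where v: "vmap \<rho> L = (a1, a2, a3)" by (cases "vmap \<rho> L")
      have "dot (a1, a2, a3) (x, y, z) \<noteq> 0"
        using L(2-5) kv(2) a(1) \<open>n < 3\<close> unfolding v xyz less3_cases by (elim disjE) auto
      then show ?thesis using r_dot[OF L(1) kv(1)] unfolding v xyz by simp
    qed
    show ?thesis using k(1) *[OF hyp(3-7)] *[OF hyp(8-12)] by blast
  qed
  have evF: "eval3 F (scal k v) = 0" if "flex F v" for k v
    using eval3_scal[OF fF, of k v] flex_zero[OF that] by simp
  have dk: "dot (scal kl L) (scal k v) = 0" if "dot L v = 0" for kl L k and v :: "'k geom vec" using that by (simp add: dot_scal dot_scal_left)
  have evD: "E1 * x^3 + E2 * y^3 + E3 * z^3 + m * x * y * z = 0"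
    if "eval3 F v = 0" "x = dot (scal kx Lx) v" "y = dot (scal ky Ly) v" "z = dot (scal kz Lz) v" for x y z v
    using that(1) unfolding FD eval3_subst A_def app.simps that(2-4)[symmetric] eval3_diag .
  obtain k where k: "dot (scal kx Lx) (scal k (Q c1)) \<in> V" "\<rho> (dot (scal kx Lx) (scal k (Q c1))) \<noteq> 0"
    "dot (scal kz Lz) (scal k (Q c1)) \<in> V" "\<rho> (dot (scal kz Lz) (scal k (Q c1))) \<noteq> 0"
    using unit[OF TQ(1) j(3) kx(3,4,2) i(1) ji[symmetric] kz(3,4,2) l12(1) li(3)] by blast
  \<comment> \<open>At a flex with y = 0 the equation is E1 x^3 + E3 z^3 = 0, so -z / x is a cube
    root of E1 / E3, and it is a unit by the preceding observation; \<open>d2\<close> arises in the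
    same way from a flex with z = 0.\<close>
  define d3 where "d3 = - dot (scal kz Lz) (scal k (Q c1)) / dot (scal kx Lx) (scal k (Q c1))"
  obtain k' where k': "dot (scal kx Lx) (scal k' (R h1)) \<in> V" "\<rho> (dot (scal kx Lx) (scal k' (R h1))) \<noteq> 0"
    "dot (scal ky Ly) (scal k' (R h1)) \<in> V" "\<rho> (dot (scal ky Ly) (scal k' (R h1))) \<noteq> 0"
    using unit[OF l12(2,1) kx(3,4,2) i(1) li(1)[symmetric] ky(3,4,2) j(3) li(3)[symmetric]] by blast
  define d2 where "d2 = - dot (scal ky Ly) (scal k' (R h1)) / dot (scal kx Lx) (scal k' (R h1))"
  have dV: "d2 \<in> V" "d3 \<in> V" "\<rho> d2 \<noteq> 0" "\<rho> d3 \<noteq> 0" unfolding d2_def d3_def using k k' by simp_all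
  have E3: "E3 * d3^3 = E1"
  proof -
    define x z where "x = dot (scal kx Lx) (scal k (Q c1))" and "z = dot (scal kz Lz) (scal k (Q c1))"
    have "E1 * x^3 + E2 * 0^3 + E3 * z^3 + m * x * 0 * z = 0"
      by (rule evD[OF evF[OF fQ(1)] x_def dk[OF dQ, symmetric] z_def])
    then have "E3 * z^3 = - (E1 * x^3)" by (simp add: add_eq_0_iff)
    moreover have "x \<noteq> 0" using k(2) unfolding x_def[symmetric] by auto
    ultimately show ?thesis unfolding d3_def x_def[symmetric] z_def[symmetric] by (simp add: field_simps)
  qed
  have E2: "E2 * d2^3 = E1"
  proof -
    define x y where "x = dot (scal kx Lx) (scal k' (R h1))" and "y = dot (scal ky Ly) (scal k' (R h1))"
    have "E1 * x^3 + E2 * y^3 + E3 * 0^3 + m * x * y * 0 = 0"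
      by (rule evD[OF evF[OF fR(1)] x_def y_def dk[OF dR, symmetric]])
    then have "E2 * y^3 = - (E1 * x^3)" by (simp add: add_eq_0_iff)
    moreover have "x \<noteq> 0" using k'(2) unfolding x_def[symmetric] by auto
    ultimately show ?thesis unfolding d2_def x_def[symmetric] y_def[symmetric] by (simp add: field_simps)
  qed
  let ?B = "((1, 0, 0), (0, d2, 0), (0, 0, d3))"
  have vB: "vmono ?B" unfolding vmono_def using dV by (simp add: monomial_matI)
  define n where "n = m * d2 * d3"
  have n: "n \<in> V" "\<rho> n \<noteq> 0" unfolding n_def using EV dV rE by simp_all
  then have n0: "n \<noteq> 0" by auto
  have "subst3 ?B (diag_cubic E1 E2 E3 m) = const3 n * hesse (E1 / n)"
  proof (rule eval3_eqI)
    fix x y z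
    have "eval3 (subst3 ?B (diag_cubic E1 E2 E3 m)) (x, y, z) = E1 * x^3 + (E2 * d2^3) * y^3 + (E3 * d3^3) * z^3 + n * x * y * z"
      by (simp add: eval3_diag n_def power_mult_distrib mult_ac del: subst3.simps)
    also have "\<dots> = n * ((E1 / n) * (x^3 + y^3 + z^3) + x * y * z)" unfolding E2 E3 using n0 by (simp add: field_simps)
    finally show "eval3 (subst3 ?B (diag_cubic E1 E2 E3 m)) (x, y, z) = eval3 (const3 n * hesse (E1 / n)) (x, y, z)"
      unfolding eval3_mult eval3_const3 eval3_hesse .
  qed
  then have eq: "subst3 ?B (subst3 (minv A) F) = const3 n * hesse (E1 / n)" unfolding D .
  have sV: "E1 / n \<in> V" "\<rho> (E1 / n) = 0" "E1 / n \<noteq> 0" using EV rE n E0 n0 by simp_all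
  show ?thesis by (rule that[OF mA(2) vB sV n0 eq])
qed

theorem triangle_limits: "card {C \<in> max_tangent_cubics F. has_lmd D C} = weight D 27 162 45"
proof -
  obtain A B s k where r: "vmono A" "vmono B" "s \<in> V" "\<rho> s = 0" "s \<noteq> 0" "k \<noteq> 0" "subst3 B (subst3 A F) = const3 k * hesse s"
    using hesse_reduction .
  interpret hesse_place V \<rho> s by unfold_locales (use r in simp_all)
  have "card {C \<in> max_tangent_cubics F. has_lmd D C} = card {C \<in> max_tangent_cubics (const3 k * hesse s). has_lmd D C}"
    unfolding r(7)[symmetric] mtc_lmd_transport[OF r(2)] mtc_lmd_transport[OF r(1)] ..
  then show ?thesis unfolding max_tangent_scale[OF r(6)] hesse_limits .
qed

end

theorem mainTheorem6:
  fixes F :: "'k::{alg_closed_field, field_char_0} poly poly poly poly"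
    and U :: "'k set"
    and V :: "'k geom set" and \<rho> :: "'k geom \<Rightarrow> 'k"
  assumes "toric_degeneration F U"
    and "place_over_0 V \<rho>"
  shows "card (max_tangent_cubics (generic_fibre F)) = 234 \<and>
    card {C \<in> max_tangent_cubics (generic_fibre F). limiting_multidegree V \<rho> C {#1, 1, 1#}} = 27 \<and>
    card {C \<in> max_tangent_cubics (generic_fibre F). limiting_multidegree V \<rho> C {#2, 1, 0#}} = 162 \<and>
    card {C \<in> max_tangent_cubics (generic_fibre F). limiting_multidegree V \<rho> C {#3, 0, 0#}} = 45"
proof -
  interpret place V \<rho> using assms(2) by unfold_locales
  have F: "form3 3 F" "smooth_total_space F U" "0 \<in> U" "curve (fibre F 0) = toric_cycle 1 1 1"
    using assms(1) by (simp_all add: toric_degeneration_def)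
  have cG: "coeff3 (generic_fibre F) i j k = embed (coeff3 F i j k)" for i j k
    by (simp add: generic_fibre_def coeff3_def coeff_map_poly)
  have cf: "coeff3 (fibre G 0) i j k = poly (coeff3 G i j k) 0" for G :: "'k poly poly poly poly" and i j k
    by (simp add: fibre_def coeff3_def coeff_map_poly)
  have cd: "coeff3 (diff_t F) i j k = pderiv (coeff3 F i j k)" for i j k
    by (simp add: diff_t_def coeff3_def coeff_map_poly)
  obtain c where c: "c \<noteq> 0" "fibre F 0 = const3 c * mono3 1 1 1 1"
    using F(4) unfolding toric_cycle_def toric_mono3 curve_eq_iff by blast
  have cm: "const3 c * mono3 1 1 1 1 = mono3 c 1 1 1" by (rule eval3_eqI) simp
  have p0: "poly (coeff3 F i j k) 0 = (if i = 1 \<and> j = 1 \<and> k = 1 then c else 0)" for i j k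
    using cf[of F i j k] unfolding c(2) cm by auto
  \<comment> \<open>The central fibre is a multiple of x y z, so every other coefficient of the
    family is divisible by t.\<close>
  have "\<exists>q. (i, j, k) \<noteq> (1, 1, 1) \<longrightarrow> coeff3 F i j k = [:0, 1:] * q" for i j k
  proof (cases "coeff3 F i j k")
    case (pCons a q)
    then show ?thesis using p0[of i j k] by (intro exI[of _ q]) auto
  qed
  then obtain q where q: "\<And>i j k. (i, j, k) \<noteq> (1, 1, 1) \<Longrightarrow> coeff3 F i j k = [:0, 1:] * q i j k" by metis
  define t where "t = embed ([:0, 1:] :: 'k poly)"
  have t: "t \<in> V" "\<rho> t = 0" "t \<noteq> 0" using embed_inj[of "[:0, 1:]" 0] by (simp_all add: t_def)
  have cq: "coeff3 (generic_fibre F) i j k = t * embed (q i j k)" if "(i, j, k) \<noteq> (1, 1, 1)" for i j k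
    unfolding cG q[OF that] embed_mult t_def ..
  have fG: "form3 3 (generic_fibre F)" "form3 3 (fibre (diff_t F) 0)"
    using F(1) unfolding form3_def cG cf cd by (metis embed_0, metis pderiv_0 poly_0)
  \<comment> \<open>At a vertex all derivatives of the central fibre in x, y, z vanish, so the
    Jacobian criterion requires a nonzero t-derivative; its value is the coefficient of the
    corresponding cube, divided by t, at t = 0.\<close>
  have tot: "poly (q 3 0 0) 0 \<noteq> 0 \<and> poly (q 0 3 0) 0 \<noteq> 0 \<and> poly (q 0 0 3) 0 \<noteq> 0"
  proof -
    have d: "diff_x (mono3 c 1 1 1) = mono3 c 0 1 1" "diff_y (mono3 c 1 1 1) = mono3 c 1 0 1" "diff_z (mono3 c 1 1 1) = mono3 c 1 1 0"
      by (simp_all add: diff_x_def diff_y_def diff_z_def mono3_def pderiv_monom map_poly_monom)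
    have s: "eval3 (fibre (diff_t F) 0) v \<noteq> 0" if "v \<in> {(1, 0, 0), (0, 1, 0), (0, 0, 1)}" for v
    proof -
      have "singular_at (fibre F 0) v" unfolding singular_at_def c(2) cm d using that by auto
      then show ?thesis using F(2,3) that unfolding smooth_total_space_def by auto
    qed
    have e: "coeff3 (fibre (diff_t F) 0) i j k = poly (q i j k) 0" if "(i, j, k) \<noteq> (1, 1, 1)" for i j k
      unfolding cf cd q[OF that] by (simp add: pderiv_mult pderiv_pCons)
    obtain a1 a2 a3 a4 a5 a6 a7 a8 a9 a10 where H: "fibre (diff_t F) 0 = cub a1 a2 a3 a4 a5 a6 a7 a8 a9 a10" using form3_3E[OF fG(2)] .
    have "a1 = poly (q 3 0 0) 0" "a7 = poly (q 0 3 0) 0" "a10 = poly (q 0 0 3) 0"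
      using e[of 3 0 0] e[of 0 3 0] e[of 0 0 3] unfolding H by simp_all
    then show ?thesis using s[of "(1, 0, 0)"] s[of "(0, 1, 0)"] s[of "(0, 0, 1)"] unfolding H by simp
  qed
  interpret triangle_cubic V \<rho> t "embed (q 3 0 0)" "embed (q 2 1 0)" "embed (q 2 0 1)" "embed (q 1 2 0)" "embed (coeff3 F 1 1 1)"
    "embed (q 1 0 2)" "embed (q 0 3 0)" "embed (q 0 2 1)" "embed (q 0 1 2)" "embed (q 0 0 3)"
    using t tot p0[of 1 1 1] c(1) by unfold_locales simp_all
  have cqs: "coeff3 (generic_fibre F) 3 0 0 = t * embed (q 3 0 0)"
    "coeff3 (generic_fibre F) 2 1 0 = t * embed (q 2 1 0)"
    "coeff3 (generic_fibre F) 2 0 1 = t * embed (q 2 0 1)"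
    "coeff3 (generic_fibre F) 1 2 0 = t * embed (q 1 2 0)"
    "coeff3 (generic_fibre F) 1 0 2 = t * embed (q 1 0 2)"
    "coeff3 (generic_fibre F) 0 3 0 = t * embed (q 0 3 0)"
    "coeff3 (generic_fibre F) 0 2 1 = t * embed (q 0 2 1)"
    "coeff3 (generic_fibre F) 0 1 2 = t * embed (q 0 1 2)"
    "coeff3 (generic_fibre F) 0 0 3 = t * embed (q 0 0 3)"
    by (rule cq, simp)+
  have "generic_fibre F = cub (t * embed (q 3 0 0)) (t * embed (q 2 1 0)) (t * embed (q 2 0 1)) (t * embed (q 1 2 0))
      (embed (coeff3 F 1 1 1)) (t * embed (q 1 0 2)) (t * embed (q 0 3 0)) (t * embed (q 0 2 1)) (t * embed (q 0 1 2)) (t * embed (q 0 0 3))"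
    using form3_3_eq_cub[OF fG(1)] unfolding cqs unfolding cG .
  note this[folded F_def]
  then have count: "card {C \<in> max_tangent_cubics (generic_fibre F). has_lmd D C} = weight D 27 162 45" for D
    using triangle_limits by simp
  show ?thesis
    using count[of None] count[of "Some {#1, 1, 1#}"] count[of "Some {#2, 1, 0#}"] count[of "Some {#3, 0, 0#}"]
      multidegree_distinct multidegree_distinct[symmetric]
    unfolding has_lmd_def weight_def option.case by simp
qed

end
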